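(* Let $\gamma_1,\gamma_2>0$, $\beta>0$, $\alpha_1,\alpha_2>0$, $0<q_1,q_2<4$, and let $p=\frac{n_1}{n_2}$ be a positive rational number with $n_2$ odd and $0<p<4$. Then for every $(r,l,m)\in(0,\infty)^3$ there exists a solution $$(\sigma_{1r},\sigma_{2l},c_m,\phi_r,\phi_l,w_m)\in(0,\infty)^2\times\mathbb R\times H^1_{\mathbb C}\times H^1_{\mathbb C}\times H^1_{\mathbb R}$$ of the system (with $(\sigma_1,\sigma_2,c,\phi_1,\phi_2,w)=(\sigma_{1r},\sigma_{2l},c_m,\phi_r,\phi_l,w_m)$) $$\begin{cases}-\phi_1''+\sigma_1\phi_1=\gamma_1|\phi_1|^{q_1}\phi_1+\alpha_1\phi_1w,\\ -\phi_2''+\sigma_2\phi_2=\gamma_2|\phi_2|^{q_2}\phi_2+\alpha_2\phi_2w,\\ -w''+cw=\frac{\beta}{p+1}w^{p+1}+\frac{\alpha_1}{2}|\phi_1|^2+\frac{\alpha_2}{2}|\phi_2|^2\end{cases}$$ on $\mathbb R$, satisfying $$\|\phi_r\|_{L^2}^2=r,\quad\|\phi_l\|_{L^2}^2=l,\quad\|w_m\|_{L^2}^2=m,$$ with $\sigma_{1r},\sigma_{2l},c_m$ being the Lagrange multipliers (associated with these three constraints in the problem of minimizing the functional $E$ given in the context). Moreover, $w_m(x)>0$ for all $x\in\mathbb R$, and there exist $(\zeta_j,R_j)\in S^1\times H^1_+(\mathbb R)$, $j=1,2$, such that $$\phi_r(x)=\zeta_1R_1(x)\quad\text{and}\quad\phi_l(x)=\zeta_2R_2(x)\quad\text{for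 all }x\in\mathbb R.$$ In particular, $(\sigma_{1r},\sigma_{2l},c_m,R_1,R_2,w_m)$ is a real-valued positive solution of the system $$\begin{cases}-R_1''+\sigma_{1r}R_1=\gamma_1|R_1|^{q_1}R_1+\alpha_1R_1w_m,\\ -R_2''+\sigma_{2l}R_2=\gamma_2|R_2|^{q_2}R_2+\alpha_2R_2w_m,\\ -w_m''+c_mw_m=\frac{\beta}{p+1}w_m^{p+1}+\frac{\alpha_1}{2}|R_1|^2+\frac{\alpha_2}{2}|R_2|^2.\end{cases}$$
   Context: $H^1_{\mathbb C}$ and $H^1_{\mathbb R}$ are the Sobolev spaces $H^1(\mathbb R)$ of complex-valued and real-valued functions, $H^1_+(\mathbb R)$ is the set of $f\in H^1_{\mathbb R}$ with $f(x)>0$ for all $x\in\mathbb R$, and $S^1=\{z\in\mathbb C:|z|=1\}$. For real $s$ and $p=n_1/n_2$ with $n_2$ odd, powers such as $s^{p+1}$ are defined using the real odd root. The functional $E$ on $H^1_{\mathbb C}\times H^1_{\mathbb C}\times H^1_{\mathbb R}$ is $$E(f_1,f_2,g)=\int_{-\infty}^\infty\Big(\sum_{j=1}^2\big(|f_j'|^2-\tau_j|f_j|^{q_j+2}-\alpha_j|f_j|^2g\big)+|g'|^2-\tau g^{p+2}\Big)dx,\quad \tau_j=\frac{2\gamma_j}{q_j+2},\ \tau=\frac{2\beta}{(p+1)(p+2)},$$ and it is minimized over all $(f_1,f_2,g)$ with $\|f_1\|_{L^2}^2=r$, $\|f_2\|_{L^2}^2=l$, $\|g\|_{L^2}^2=m$.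 *)

theory Defs
  imports "HOL-Analysis.Analysis"
begin

definition L2 :: "(real \<Rightarrow> 'a::euclidean_space) set" where
  "L2 = {f. f \<in> borel_measurable lborel \<and> integrable lborel (\<lambda>x. (norm (f x))\<^sup>2)}"

definition L2_norm :: "(real \<Rightarrow> 'a::euclidean_space) \<Rightarrow> real" where
  "L2_norm f = sqrt (LINT x|lborel. (norm (f x))\<^sup>2)"

definition test_function :: "(real \<Rightarrow> real) \<Rightarrow> bool" where
  "test_function \<eta> \<longleftrightarrow>
     (\<forall>k x. ((deriv ^^ k) \<eta>) field_differentiable (at x)) \<and>
     compact (closure {x. \<eta> x \<noteq> 0})"

definition is_weak_deriv :: "(real \<Rightarrow> 'a::euclidean_space) \<Rightarrow> (real \<Rightarrow> 'a) \<Rightarrow> bool" where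
  "is_weak_deriv f g \<longleftrightarrow>
     (\<forall>\<eta>. test_function \<eta> \<longrightarrow>
        (LINT x|lborel. deriv \<eta> x *\<^sub>R f x) = - (LINT x|lborel. \<eta> x *\<^sub>R g x))"

(* Every class in the Sobolev space on the line has exactly one continuous representative.
   Elements of H1 are these representatives, so that pointwise assertions are meaningful.
   The codomain is complex or real for the two spaces of the text. *)
definition H1 :: "(real \<Rightarrow> 'a::euclidean_space) set" where
  "H1 = {f. continuous_on UNIV f \<and> f \<in> L2 \<and> (\<exists>g\<in>L2. is_weak_deriv f g)}"

definition H1_pos :: "(real \<Rightarrow> real) set" where
  "H1_pos = {f \<in> H1. \<forall>x. f x > 0}"

(* A choice of weak derivative; it is determined only up to null sets and meant for f in H1. *)
definition weak_deriv :: "(real \<Rightarrow> 'a::euclidean_space) \<Rightarrow> (real \<Rightarrow> 'a)" where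
  "weak_deriv f = (SOME g. g \<in> L2 \<and> is_weak_deriv f g)"

(* s to the power a/n for odd n and any real s. Here root is the real odd root, so
   root n (- s) = - root n s. The value depends only on the fraction a/n, as long as n is odd. *)
definition odd_pow :: "nat \<Rightarrow> nat \<Rightarrow> real \<Rightarrow> real" where
  "odd_pow a n s = (root n s) ^ a"

(* With p = n1/n2: p + 1 = (n1 + n2)/n2 and p + 2 = (n1 + 2 n2)/n2. *)
definition energy ::
  "real \<Rightarrow> real \<Rightarrow> real \<Rightarrow> real \<Rightarrow> real \<Rightarrow> real \<Rightarrow> real \<Rightarrow> nat \<Rightarrow> nat \<Rightarrow>
   (real \<Rightarrow> complex) \<Rightarrow> (real \<Rightarrow> complex) \<Rightarrow> (real \<Rightarrow> real) \<Rightarrow> real" where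
  "energy \<gamma>1 \<gamma>2 \<beta> \<alpha>1 \<alpha>2 q1 q2 n1 n2 f1 f2 g =
     (let p = real n1 / real n2;
          \<tau>1 = 2 * \<gamma>1 / (q1 + 2);
          \<tau>2 = 2 * \<gamma>2 / (q2 + 2);
          \<tau> = 2 * \<beta> / ((p + 1) * (p + 2))
      in LINT x|lborel.
           ((cmod (weak_deriv f1 x))\<^sup>2 - \<tau>1 * cmod (f1 x) powr (q1 + 2) - \<alpha>1 * (cmod (f1 x))\<^sup>2 * g x)
         + ((cmod (weak_deriv f2 x))\<^sup>2 - \<tau>2 * cmod (f2 x) powr (q2 + 2) - \<alpha>2 * (cmod (f2 x))\<^sup>2 * g x)
         + (weak_deriv g x)\<^sup>2 - \<tau> * odd_pow (n1 + 2 * n2) n2 (g x))"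

definition admissible ::
  "real \<Rightarrow> real \<Rightarrow> real \<Rightarrow> (real \<Rightarrow> complex) \<Rightarrow> (real \<Rightarrow> complex) \<Rightarrow> (real \<Rightarrow> real) \<Rightarrow> bool" where
  "admissible r l m f1 f2 g \<longleftrightarrow>
     f1 \<in> H1 \<and> f2 \<in> H1 \<and> g \<in> H1 \<and>
     (L2_norm f1)\<^sup>2 = r \<and> (L2_norm f2)\<^sup>2 = l \<and> (L2_norm g)\<^sup>2 = m"

definition is_constrained_minimizer ::
  "((real \<Rightarrow> complex) \<Rightarrow> (real \<Rightarrow> complex) \<Rightarrow> (real \<Rightarrow> real) \<Rightarrow> real) \<Rightarrow> real \<Rightarrow> real \<Rightarrow> real \<Rightarrow>
   (real \<Rightarrow> complex) \<Rightarrow> (real \<Rightarrow> complex) \<Rightarrow> (real \<Rightarrow> real) \<Rightarrow> bool" where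
  "is_constrained_minimizer E r l m f1 f2 g \<longleftrightarrow>
     admissible r l m f1 f2 g \<and>
     (\<forall>h1 h2 k. admissible r l m h1 h2 k \<longrightarrow> E f1 f2 g \<le> E h1 h2 k)"

(* The point (f1, f2, g) is stationary for the Lagrangian
   E + s1 |f1|^2 + s2 |f2|^2 + c |g|^2 (squared L2 norms): its first variation vanishes in every
   H1 direction. With this sign convention the Euler-Lagrange equations are nls_system below. *)
definition lagrange_multipliers ::
  "((real \<Rightarrow> complex) \<Rightarrow> (real \<Rightarrow> complex) \<Rightarrow> (real \<Rightarrow> real) \<Rightarrow> real) \<Rightarrow>
   (real \<Rightarrow> complex) \<Rightarrow> (real \<Rightarrow> complex) \<Rightarrow> (real \<Rightarrow> real) \<Rightarrow> real \<Rightarrow> real \<Rightarrow> real \<Rightarrow> bool" where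
  "lagrange_multipliers E f1 f2 g \<sigma>1 \<sigma>2 c \<longleftrightarrow>
     (\<forall>h1\<in>H1. \<forall>h2\<in>H1. \<forall>k\<in>H1.
        ((\<lambda>t. let u1 = (\<lambda>x. f1 x + t *\<^sub>R h1 x);
                   u2 = (\<lambda>x. f2 x + t *\<^sub>R h2 x);
                   v = (\<lambda>x. g x + t * k x)
               in E u1 u2 v + \<sigma>1 * (L2_norm u1)\<^sup>2 + \<sigma>2 * (L2_norm u2)\<^sup>2 + c * (L2_norm v)\<^sup>2)
          has_real_derivative 0) (at 0))"

definition has_second_deriv :: "(real \<Rightarrow> 'a::real_normed_vector) \<Rightarrow> (real \<Rightarrow> 'a) \<Rightarrow> bool" where
  "has_second_deriv f f'' \<longleftrightarrow>
     (\<exists>f'. \<forall>x. (f has_vector_derivative f' x) (at x) \<and> (f' has_vector_derivative f'' x) (at x))"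

(* Classical (pointwise) solutions. For continuous f1, f2, w this is equivalent to solving the
   system in the sense of distributions. 'a is complex or real. *)
definition nls_system ::
  "real \<Rightarrow> real \<Rightarrow> real \<Rightarrow> real \<Rightarrow> real \<Rightarrow> real \<Rightarrow> real \<Rightarrow> nat \<Rightarrow> nat \<Rightarrow> real \<Rightarrow> real \<Rightarrow> real \<Rightarrow>
   (real \<Rightarrow> 'a::euclidean_space) \<Rightarrow> (real \<Rightarrow> 'a) \<Rightarrow> (real \<Rightarrow> real) \<Rightarrow> bool" where
  "nls_system \<gamma>1 \<gamma>2 \<beta> \<alpha>1 \<alpha>2 q1 q2 n1 n2 \<sigma>1 \<sigma>2 c f1 f2 w \<longleftrightarrow>
     (let p = real n1 / real n2 in
      \<exists>f1'' f2'' w''.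
        has_second_deriv f1 f1'' \<and> has_second_deriv f2 f2'' \<and> has_second_deriv w w'' \<and>
        (\<forall>x. - f1'' x + \<sigma>1 *\<^sub>R f1 x = (\<gamma>1 * norm (f1 x) powr q1) *\<^sub>R f1 x + (\<alpha>1 * w x) *\<^sub>R f1 x) \<and>
        (\<forall>x. - f2'' x + \<sigma>2 *\<^sub>R f2 x = (\<gamma>2 * norm (f2 x) powr q2) *\<^sub>R f2 x + (\<alpha>2 * w x) *\<^sub>R f2 x) \<and>
        (\<forall>x. - w'' x + c * w x =
              \<beta> / (p + 1) * odd_pow (n1 + n2) n2 (w x)
              + \<alpha>1 / 2 * (norm (f1 x))\<^sup>2 + \<alpha>2 / 2 * (norm (f2 x))\<^sup>2))"

end

theory Submission
  imports Defs
begin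

text \<open>The constraints are relaxed to upper bounds on the three masses and the problem is discretised on a
  lattice of spacing \<open>1/n\<close>. There a minimiser exists by compactness, it may be taken nonnegative, and
  among the nonnegative minimisers the one with least second moment is unimodal with peak at \<open>0\<close>:
  reflecting about a half-integer and moving the larger values to the side of the origin does not
  increase the energy, but decreases the moment. Unimodality yields the decay \<open>U(x)\<^sup>2 \<le> M / \<bar>x\<bar>\<close>
  uniformly in \<open>n\<close>, which replaces concentration compactness: the potential terms pass to the limit
  by dominated convergence, the Dirichlet terms by Fatou, and the discrete Euler-Lagrange equations
  become the differential equations. Hence the limit is smooth and minimises the energy under the
  relaxed constraints. No component vanishes, because a spread-out bump of small amplitude has
  negative energy. The components are then positive, and the multipliers are positive since a
  positive concave function on the line does not vanish at infinity. Finally, by the first variation,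
  enlarging a component with a positive multiplier lowers the energy, so all masses are attained.\<close>

subsection \<open>The lattice problem\<close>

text \<open>On the line, rearrangement means symmetrisation inequalities for Sobolev functions; on a
  lattice a reflection merely sorts two values per component, and the comparison becomes a two-point
  inequality. The coupling is compatible with this since x^2 z is supermodular for nonnegative
  arguments and \<alpha>1, \<alpha>2 > 0. The bounds q1, q2, p < 4 say that the potential energy is
  controlled by powers below 1 of the Dirichlet energy, so the lattice minimisers are bounded
  independently of the spacing; positivity of the exponents is what turns the decay rate |x|^(-1/2)
  into an integrable majorant. The constraints are upper bounds because mass is only lower
  semicontinuous in the limit: equality could be lost, an upper bound cannot. Complex values and
  negative values of the third component are dealt with in the comparison: moduli have no larger
  increments and no smaller potential energy, even with the odd power, so the nonnegative problem
  governs all competitors.\<close>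

lemma compact_pointwise:
  fixes S :: "'a \<Rightarrow> 'b::topological_space set"
  assumes "\<And>i. compact (S i)"
  shows "compact {f. \<forall>i. f i \<in> S i}"
proof -
  have "compactin (product_topology (\<lambda>i. euclidean) UNIV) (PiE UNIV S)"
    using assms by (simp add: compactin_PiE)
  moreover have "PiE UNIV S = {f. \<forall>i. f i \<in> S i}" by auto
  ultimately show ?thesis by (simp add: euclidean_product_topology)
qed

lemma power2_norm_vec: "(norm (x :: real^'k))\<^sup>2 = (\<Sum>k\<in>UNIV. (x$k)\<^sup>2)"
  unfolding power2_norm_eq_inner inner_vec_def by (simp add: power2_eq_square)

text \<open>The reflection of i to 2*j+1-i about the half-integer j + 1/2 has no fixed site, so a
  symmetric window splits into pairs.\<close>

lemma sum_reflect:
  fixes F :: "int \<Rightarrow> 'a::comm_monoid_add"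
  assumes "L \<ge> 0"
  shows "(\<Sum>i\<in>{j-L..j+1+L}. F i) = (\<Sum>i\<in>{j-L..j}. F i + F (2*j+1-i))"
proof -
  have "(\<Sum>i\<in>{j-L..j+1+L}. F i) = (\<Sum>i\<in>{j-L..j} \<union> {j+1..j+1+L}. F i)"
    by (rule sum.cong) (use assms in auto)
  also have "\<dots> = (\<Sum>i\<in>{j-L..j}. F i) + (\<Sum>i\<in>{j+1..j+1+L}. F i)"
    by (rule sum.union_disjoint) auto
  also have "(\<Sum>i\<in>{j+1..j+1+L}. F i) = (\<Sum>i\<in>{j-L..j}. F (2*j+1-i))"
    by (rule sum.reindex_bij_witness[of _ "\<lambda>i. 2*j+1-i" "\<lambda>i. 2*j+1-i"]) auto
  finally show ?thesis by (simp add: sum.distrib)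
qed

text \<open>Meant for edges, labelled by their left endpoints. The reflection about j + 1/2 takes
  the edge i to the edge 2*j-i and maps the edge from j to j+1 to itself; that edge stands alone in
  front of the paired sum.\<close>

lemma sum_reflect_centre:
  fixes F :: "int \<Rightarrow> 'a::comm_monoid_add"
  assumes "L \<ge> 0"
  shows "(\<Sum>i\<in>{j-L..j+L}. F i) = F j + (\<Sum>i\<in>{j-L..j-1}. F i + F (2*j-i))"
proof -
  have "(\<Sum>i\<in>{j-L..j+L}. F i) = (\<Sum>i\<in>insert j ({j-L..j-1} \<union> {j+1..j+L}). F i)"
    by (rule sum.cong) (use assms in auto)
  also have "\<dots> = F j + ((\<Sum>i\<in>{j-L..j-1}. F i) + (\<Sum>i\<in>{j+1..j+L}. F i))"
    by (subst sum.insert, simp, simp) (rule arg_cong[where f="\<lambda>x. F j + x"], rule sum.union_disjoint, auto)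
  also have "(\<Sum>i\<in>{j+1..j+L}. F i) = (\<Sum>i\<in>{j-L..j-1}. F (2*j-i))"
    by (rule sum.reindex_bij_witness[of _ "\<lambda>i. 2*j-i" "\<lambda>i. 2*j-i"]) auto
  finally show ?thesis by (simp add: sum.distrib)
qed

lemma sum_int_widen:
  fixes F :: "int \<Rightarrow> 'a::comm_monoid_add"
  assumes "\<And>i. i \<notin> A \<Longrightarrow> F i = 0" "finite B" "A \<subseteq> B"
  shows "sum F A = sum F B"
  using assms by (intro sum.mono_neutral_left) auto

text \<open>If the two pairs are ordered alike, sorting changes nothing. Otherwise the sides differ
  by twice the product of the two gaps |c-a| and |b-d|.\<close>

lemma max_min_dist_le:
  fixes a b c d :: real
  shows "(max a c - max b d)\<^sup>2 + (min a c - min b d)\<^sup>2 \<le> (a-b)\<^sup>2 + (c-d)\<^sup>2"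
proof (cases "a \<le> c"; cases "b \<le> d")
  assume h: "a \<le> c" "\<not> b \<le> d"
  have "(c-a)*(b-d) \<ge> 0" using h by (intro mult_nonneg_nonneg) auto
  thus ?thesis using h by (simp add: max_def min_def power2_eq_square algebra_simps)
next
  assume h: "\<not> a \<le> c" "b \<le> d"
  have "(a-c)*(d-b) \<ge> 0" using h by (intro mult_nonneg_nonneg) auto
  thus ?thesis using h by (simp add: max_def min_def power2_eq_square algebra_simps)
qed (auto simp: max_def min_def)

text \<open>\<open>G\<close> is the gradient of the potential \<open>V\<close>. \<open>V_abs\<close>
  and the supermodularity \<open>V_super\<close> are what absolute values and polarisation consume.
  In \<open>V_growth\<close>, \<open>a > 0\<close> makes the decay of unimodal profiles integrable
  and \<open>b < 4\<close> subordinates the potential energy to the Dirichlet energy.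
  \<open>G_lin\<close> controls the multipliers and the right-hand side of the equation.\<close>

locale coupled_energy =
  fixes V :: "real^'k \<Rightarrow> real" and G :: "real^'k \<Rightarrow> real^'k" and M :: "'k \<Rightarrow> real" and K a b :: real
  assumes V_deriv: "\<And>x. (V has_derivative (\<lambda>h. G x \<bullet> h)) (at x)"
    and G_cont: "continuous_on UNIV G"
    and V_abs: "\<And>x. V x \<le> V (\<chi> k. \<bar>x$k\<bar>)"
    and V_super: "\<And>x y. (\<forall>k. 0 \<le> x$k \<and> 0 \<le> y$k) \<Longrightarrow>
          V x + V y \<le> V (\<chi> k. max (x$k) (y$k)) + V (\<chi> k. min (x$k) (y$k))"
    and V_growth: "\<And>x. \<bar>V x\<bar> \<le> K * (norm x)\<^sup>2 * (norm x powr a + norm x powr b)"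
    and a_pos: "0 < a" and a_le_b: "a \<le> b" and b_less: "b < 4"
    and G_lin: "\<And>B. \<exists>C. \<forall>x. norm x \<le> B \<longrightarrow> norm (G x) \<le> C * norm x"
    and M_pos: "\<And>k. 0 < M k"
begin

lemma V_zero [simp]: "V 0 = 0"
  using V_growth[of 0] by simp

lemma V_cont: "continuous_on UNIV V"
  using V_deriv by (meson continuous_at_imp_continuous_on has_derivative_continuous)

text \<open>The index starts at -N-1 so that the jumps to the value 0 at both ends of the window are
  counted. For \<open>u\<close> supported in the window this is the full sum over all edges, so
  larger windows give the same value.\<close>

definition grid_dirichlet :: "nat \<Rightarrow> (int \<Rightarrow> real^'k) \<Rightarrow> real" where
  "grid_dirichlet N u = (\<Sum>i\<in>{-int N - 1..int N}. (norm (u (i+1) - u i))\<^sup>2)"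

text \<open>At spacing 1/n a difference quotient is n times an increment and a cell has length 1/n;
  together they leave the factor n in front of the Dirichlet sum.\<close>

definition grid_energy :: "nat \<Rightarrow> nat \<Rightarrow> (int \<Rightarrow> real^'k) \<Rightarrow> real" where
  "grid_energy n N u = real n * grid_dirichlet N u - (\<Sum>i\<in>{-int N..int N}. V (u i)) / real n"

definition grid_mass :: "nat \<Rightarrow> nat \<Rightarrow> (int \<Rightarrow> real^'k) \<Rightarrow> 'k \<Rightarrow> real" where
  "grid_mass n N u k = (\<Sum>i\<in>{-int N..int N}. (u i $ k)\<^sup>2) / real n"

definition feasible :: "nat \<Rightarrow> nat \<Rightarrow> (int \<Rightarrow> real^'k) set" where
  "feasible n N = {u. (\<forall>i. \<bar>i\<bar> > int N \<longrightarrow> u i = 0) \<and> (\<forall>k. grid_mass n N u k \<le> M k)}"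

lemma continuous_grid_dirichlet: "continuous_on UNIV (grid_dirichlet N)"
  unfolding grid_dirichlet_def[abs_def] by (intro continuous_intros continuous_on_product_coordinates)

lemma continuous_grid_energy: "continuous_on UNIV (grid_energy n N)"
  unfolding grid_energy_def[abs_def]
  by (cases "n = 0")
    (auto intro!: continuous_intros continuous_grid_dirichlet continuous_on_compose2[OF V_cont] continuous_on_product_coordinates)

lemma continuous_grid_mass: "continuous_on UNIV (\<lambda>u. grid_mass n N u k)"
  unfolding grid_mass_def by (cases "n = 0") (auto intro!: continuous_intros continuous_on_product_coordinates)

text \<open>A bound on the sum of squares bounds each entry, so the feasible set is a closed part of
  a product of balls and single points.\<close>

lemma compact_feasible:
  assumes "n > 0" shows "compact (feasible n N)"
proof -
  define B where "B = real n * (\<Sum>k\<in>UNIV. M k)"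
  define S where "S = (\<lambda>i. if \<bar>i\<bar> > int N then {0::real^'k} else cball 0 (sqrt B))"
  have "compact {u. \<forall>i. u i \<in> S i}"
    by (rule compact_pointwise) (auto simp: S_def)
  moreover have "closed {u. \<forall>k. grid_mass n N u k \<le> M k}"
    by (intro closed_Collect_all closed_Collect_le continuous_grid_mass continuous_on_const)
  moreover have "feasible n N = {u. \<forall>i. u i \<in> S i} \<inter> {u. \<forall>k. grid_mass n N u k \<le> M k}"
  proof -
    have "u i \<in> cball 0 (sqrt B)" if u: "\<forall>k. grid_mass n N u k \<le> M k" and i: "\<bar>i\<bar> \<le> int N" for u i
    proof -
      have "(u i $ k)\<^sup>2 \<le> real n * M k" for k
      proof -
        have "(u i $ k)\<^sup>2 \<le> (\<Sum>i\<in>{-int N..int N}. (u i $ k)\<^sup>2)"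
          by (rule member_le_sum) (use i in auto)
        also have "\<dots> \<le> real n * M k" using u[rule_format, of k] \<open>n > 0\<close> unfolding grid_mass_def
          by (simp add: field_simps)
        finally show ?thesis .
      qed
      then have "(norm (u i))\<^sup>2 \<le> B" unfolding power2_norm_vec B_def sum_distrib_left
        by (intro sum_mono)
      then show ?thesis by (simp add: real_le_rsqrt)
    qed
    then show ?thesis unfolding feasible_def S_def by (fastforce split: if_splits)
  qed
  ultimately show ?thesis by (simp add: compact_Int_closed)
qed

lemma zero_feasible: "(\<lambda>_. 0) \<in> feasible n N"
  using M_pos by (auto simp: feasible_def grid_mass_def intro: less_imp_le)

section \<open>Absolute values and two-point rearrangement on the lattice\<close>

definition grid_abs :: "(int \<Rightarrow> real^'k) \<Rightarrow> int \<Rightarrow> real^'k" where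
  "grid_abs u i = (\<chi> k. \<bar>u i $ k\<bar>)"

lemma grid_abs_feasible: "u \<in> feasible n N \<Longrightarrow> grid_abs u \<in> feasible n N"
  by (auto simp: feasible_def grid_mass_def grid_abs_def vec_eq_iff)

lemma norm_abs_diff_le: "norm ((\<chi> k. \<bar>x$k\<bar>) - (\<chi> k. \<bar>y$k\<bar>) :: real^'k) \<le> norm (x - y)"
  by (rule norm_le_componentwise_cart) (auto simp: abs_if)

lemma grid_abs_energy: "grid_energy n N (grid_abs u) \<le> grid_energy n N u"
proof -
  have "grid_dirichlet N (grid_abs u) \<le> grid_dirichlet N u"
    unfolding grid_dirichlet_def grid_abs_def by (intro sum_mono power_mono norm_abs_diff_le) auto
  moreover have "(\<Sum>i\<in>{-int N..int N}. V (u i)) \<le> (\<Sum>i\<in>{-int N..int N}. V (grid_abs u i))"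
    unfolding grid_abs_def by (intro sum_mono V_abs)
  ultimately show ?thesis unfolding grid_energy_def
    by (intro diff_mono mult_left_mono divide_right_mono) auto
qed

text \<open>Two-point rearrangement about j + 1/2 in each component separately. The larger value
  goes to the half-line i \<le> j, which contains the origin when j \<ge> 0.\<close>

definition polarise :: "int \<Rightarrow> (int \<Rightarrow> real^'k) \<Rightarrow> int \<Rightarrow> real^'k" where
  "polarise j u i = (if i \<le> j then (\<chi> k. max (u i $ k) (u (2*j+1-i) $ k))
                     else (\<chi> k. min (u i $ k) (u (2*j+1-i) $ k)))"

lemma polarise_low: "i \<le> j \<Longrightarrow> polarise j u i = (\<chi> k. max (u i $ k) (u (2*j+1-i) $ k))"
  by (simp add: polarise_def)

lemma polarise_high: "i \<le> j \<Longrightarrow> polarise j u (2*j+1-i) = (\<chi> k. min (u i $ k) (u (2*j+1-i) $ k))"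
  by (simp add: polarise_def min.commute)

text \<open>The condition j \<ge> 0 keeps the window: a site outside it with i \<le> j has its
  mirror image outside as well, and for i > j the minimum of the value 0 at \<open>i\<close> and a
  nonnegative value is 0.\<close>

lemma polarise_support:
  assumes "\<forall>i. \<bar>i\<bar> > int N \<longrightarrow> u i = 0" "\<forall>i k. 0 \<le> u i $ k" "j \<ge> 0" "\<bar>i\<bar> > int N"
  shows "polarise j u i = 0"
proof (cases "i \<le> j")
  case True
  then have "u i = 0 \<and> u (2*j+1-i) = 0" using assms by auto
  then show ?thesis using True by (simp add: polarise_low vec_eq_iff)
next
  case False
  then show ?thesis using assms by (simp add: polarise_def vec_eq_iff min_def)
qed

lemma sum_grid_reflect:
  fixes F :: "int \<Rightarrow> 'b::comm_monoid_add"
  assumes "\<And>i. \<bar>i\<bar> > int N \<Longrightarrow> F i = 0" "j \<ge> 0"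
  shows "(\<Sum>i\<in>{-int N..int N}. F i) = (\<Sum>i\<in>{j-(int N+j)..j}. F i + F (2*j+1-i))"
proof -
  have "(\<Sum>i\<in>{-int N..int N}. F i) = (\<Sum>i\<in>{j-(int N+j)..j+1+(int N+j)}. F i)"
    by (rule sum_int_widen) (use assms in auto)
  then show ?thesis using sum_reflect[of "int N+j" F j] assms by simp
qed

text \<open>The middle edge keeps its squared length, since in each component its end values are at
  most interchanged. The other edges come in mirror pairs, and \<open>max_min_dist_le\<close>
  settles each pair in each component.\<close>

lemma polarise_dirichlet:
  assumes s: "\<forall>i. \<bar>i\<bar> > int N \<longrightarrow> u i = 0" and p: "\<forall>i k. 0 \<le> u i $ k" and j: "j \<ge> 0"
  shows "grid_dirichlet N (polarise j u) \<le> grid_dirichlet N u"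
proof -
  \<comment> \<open>The radius N + j + 1 about j reaches down exactly to -N-1, the first edge that
    meets the window, and far enough to the right.\<close>
  let ?L = "int N + j + 1" and ?v = "polarise j u"
  have 1: "grid_dirichlet N w = (norm (w (j+1) - w j))\<^sup>2 +
      (\<Sum>i\<in>{j-?L..j-1}. (norm (w (i+1) - w i))\<^sup>2 + (norm (w (2*j-i+1) - w (2*j-i)))\<^sup>2)"
    if "\<forall>i. \<bar>i\<bar> > int N \<longrightarrow> w i = 0" for w :: "int \<Rightarrow> real^'k"
  proof -
    have "grid_dirichlet N w = (\<Sum>i\<in>{j-?L..j+?L}. (norm (w (i+1) - w i))\<^sup>2)"
      unfolding grid_dirichlet_def by (rule sum_int_widen) (use that j in auto)
    also have "\<dots> = (norm (w (j+1) - w j))\<^sup>2 +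
      (\<Sum>i\<in>{j-?L..j-1}. (norm (w (i+1) - w i))\<^sup>2 + (norm (w (2*j-i+1) - w (2*j-i)))\<^sup>2)"
      by (subst sum_reflect_centre) (use j in auto)
    finally show ?thesis .
  qed
  have c: "(norm (?v (j+1) - ?v j))\<^sup>2 = (norm (u (j+1) - u j))\<^sup>2"
  proof -
    have "(?v (j+1) $ k - ?v j $ k)\<^sup>2 = (u (j+1) $ k - u j $ k)\<^sup>2" for k
      by (auto simp: polarise_def max_def min_def power2_commute)
    then show ?thesis by (simp add: power2_norm_vec)
  qed
  have e: "(norm (?v (i+1) - ?v i))\<^sup>2 + (norm (?v (2*j-i+1) - ?v (2*j-i)))\<^sup>2
     \<le> (norm (u (i+1) - u i))\<^sup>2 + (norm (u (2*j-i+1) - u (2*j-i)))\<^sup>2" if i: "i \<le> j-1" for i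
  proof -
    have eq: "2*j-i+1 = 2*j+1-i" "2*j-i = 2*j+1-(i+1)" by (simp_all add: algebra_simps)
    have "(?v (i+1) $ k - ?v i $ k)\<^sup>2 + (?v (2*j-i+1) $ k - ?v (2*j-i) $ k)\<^sup>2
       \<le> (u (i+1) $ k - u i $ k)\<^sup>2 + (u (2*j-i+1) $ k - u (2*j-i) $ k)\<^sup>2" for k
    proof -
      have 1: "i \<le> j" "i+1 \<le> j" using i by auto
      show ?thesis unfolding eq(1) unfolding eq(2) polarise_low[OF 1(1)] polarise_low[OF 1(2)] polarise_high[OF 1(1)] polarise_high[OF 1(2)]
        using max_min_dist_le[of "u (i+1) $ k" "u (2*j+1-(i+1)) $ k" "u i $ k" "u (2*j+1-i) $ k"]
        by (simp add: power2_commute)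
    qed
    then show ?thesis unfolding power2_norm_vec sum.distrib[symmetric] by (intro sum_mono) simp
  qed
  have 2: "\<forall>i. \<bar>i\<bar> > int N \<longrightarrow> ?v i = 0" using polarise_support[OF s p j] by auto
  show ?thesis unfolding 1[OF s] 1[OF 2] c
    using e by (intro add_left_mono sum_mono) auto
qed

lemma polarise_mass:
  assumes s: "\<forall>i. \<bar>i\<bar> > int N \<longrightarrow> u i = 0" and p: "\<forall>i k. 0 \<le> u i $ k" and j: "j \<ge> 0"
  shows "grid_mass n N (polarise j u) k = grid_mass n N u k"
proof -
  have "(\<Sum>i\<in>{-int N..int N}. (polarise j u i $ k)\<^sup>2) = (\<Sum>i\<in>{-int N..int N}. (u i $ k)\<^sup>2)"
    apply (subst sum_grid_reflect[OF _ j], use polarise_support[OF s p j] in simp)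
    apply (subst sum_grid_reflect[OF _ j], use s in simp)
    by (rule sum.cong) (auto simp: polarise_low polarise_high max_def min_def)
  then show ?thesis by (simp add: grid_mass_def)
qed

lemma polarise_feasible:
  assumes "u \<in> feasible n N" and p: "\<forall>i k. 0 \<le> u i $ k" and j: "j \<ge> 0"
  shows "polarise j u \<in> feasible n N"
  using assms polarise_mass[OF _ p j] polarise_support[OF _ p j] unfolding feasible_def by auto

lemma polarise_energy:
  assumes s: "\<forall>i. \<bar>i\<bar> > int N \<longrightarrow> u i = 0" and p: "\<forall>i k. 0 \<le> u i $ k" and j: "j \<ge> 0"
  shows "grid_energy n N (polarise j u) \<le> grid_energy n N u"
proof -
  have "(\<Sum>i\<in>{-int N..int N}. V (u i)) \<le> (\<Sum>i\<in>{-int N..int N}. V (polarise j u i))"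
    apply (subst sum_grid_reflect[OF _ j], use s in simp)
    apply (subst sum_grid_reflect[OF _ j], use polarise_support[OF s p j] in simp)
    using V_super p by (intro sum_mono) (auto simp: polarise_low polarise_high)
  then show ?thesis unfolding grid_energy_def using polarise_dirichlet[OF s p j]
    by (intro diff_mono mult_left_mono divide_right_mono) auto
qed

text \<open>Minimising this moment among the minimisers of the energy selects a unimodal one.\<close>

definition moment :: "nat \<Rightarrow> (int \<Rightarrow> real^'k) \<Rightarrow> real" where
  "moment N u = (\<Sum>i\<in>{-int N..int N}. (real_of_int i)\<^sup>2 * (norm (u i))\<^sup>2)"

text \<open>In a mirror pair with i \<le> j the moment drops by the difference of the weights times
  the excess of the outer square over the inner one. The weights differ by (2j+1)(2j+1-2i) > 0, and
  for i = j the component \<open>k\<close> has a positive excess.\<close>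

lemma polarise_moment:
  assumes s: "\<forall>i. \<bar>i\<bar> > int N \<longrightarrow> u i = 0" and p: "\<forall>i k. 0 \<le> u i $ k" and j: "j \<ge> 0"
    and less: "u j $ k < u (j+1) $ k"
  shows "moment N (polarise j u) < moment N u"
proof -
  let ?v = "polarise j u"
  have eq: "(real_of_int i)\<^sup>2 * (norm (u i))\<^sup>2 + (real_of_int (2*j+1-i))\<^sup>2 * (norm (u (2*j+1-i)))\<^sup>2
     - ((real_of_int i)\<^sup>2 * (norm (?v i))\<^sup>2 + (real_of_int (2*j+1-i))\<^sup>2 * (norm (?v (2*j+1-i)))\<^sup>2)
     = (\<Sum>k\<in>UNIV. ((real_of_int (2*j+1-i))\<^sup>2 - (real_of_int i)\<^sup>2) * (max 0 ((u (2*j+1-i) $ k)\<^sup>2 - (u i $ k)\<^sup>2)))"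
    if i: "i \<le> j" for i
  proof -
    have 1: "x * A + y * B - (x * (max A' B')\<^sup>2 + y * (min A' B')\<^sup>2) = (y - x) * max 0 (B - A)"
      if "A = A'\<^sup>2" "B = B'\<^sup>2" "0 \<le> A'" "0 \<le> B'" for x y A B A' B' :: real
      using that by (cases "A' \<le> B'") (auto simp: max_def min_def algebra_simps power2_eq_square intro: mult_mono dest!: antisym[OF mult_mono, rotated -1] split: if_splits)
    show ?thesis unfolding power2_norm_vec polarise_low[OF i] polarise_high[OF i] sum_distrib_left
       sum.distrib[symmetric] sum_subtractf[symmetric] vec_lambda_beta
      by (intro sum.cong refl 1) (use p in auto)
  qed
  have w: "(real_of_int (2*j+1-i))\<^sup>2 - (real_of_int i)\<^sup>2 > 0" if "i \<le> j" for i
  proof -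
    have "(real_of_int (2*j+1-i))\<^sup>2 - (real_of_int i)\<^sup>2 = real_of_int (2*j+1) * real_of_int (2*j+1-2*i)"
      by (simp add: power2_eq_square algebra_simps)
    also have "\<dots> > 0" using j that by (intro mult_pos_pos) auto
    finally show ?thesis .
  qed
  have jN: "j \<le> int N"
  proof (rule ccontr)
    assume "\<not> j \<le> int N"
    then have "u (j+1) = 0" using s by auto
    then show False using less p by (simp add: not_less[symmetric])
  qed
  show ?thesis unfolding moment_def
    apply (subst sum_grid_reflect[OF _ j], use polarise_support[OF s p j] in simp)
    apply (subst sum_grid_reflect[OF _ j], use s in simp)
  proof (rule sum_strict_mono_ex1)
    show "\<forall>i\<in>{j - (int N + j)..j}. (real_of_int i)\<^sup>2 * (norm (?v i))\<^sup>2 + (real_of_int (2*j+1-i))\<^sup>2 * (norm (?v (2*j+1-i)))\<^sup>2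
       \<le> (real_of_int i)\<^sup>2 * (norm (u i))\<^sup>2 + (real_of_int (2*j+1-i))\<^sup>2 * (norm (u (2*j+1-i)))\<^sup>2"
    proof
      fix i assume "i \<in> {j - (int N + j)..j}"
      then have i: "i \<le> j" by simp
      have "(\<Sum>k\<in>UNIV. ((real_of_int (2*j+1-i))\<^sup>2 - (real_of_int i)\<^sup>2) * (max 0 ((u (2*j+1-i) $ k)\<^sup>2 - (u i $ k)\<^sup>2))) \<ge> 0"
        using w[OF i] by (intro sum_nonneg mult_nonneg_nonneg) auto
      then show "(real_of_int i)\<^sup>2 * (norm (?v i))\<^sup>2 + (real_of_int (2*j+1-i))\<^sup>2 * (norm (?v (2*j+1-i)))\<^sup>2
       \<le> (real_of_int i)\<^sup>2 * (norm (u i))\<^sup>2 + (real_of_int (2*j+1-i))\<^sup>2 * (norm (u (2*j+1-i)))\<^sup>2"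
        using eq[OF i] by linarith
    qed
    have "0 < ((real_of_int (2*j+1-j))\<^sup>2 - (real_of_int j)\<^sup>2) * (max 0 ((u (2*j+1-j) $ k)\<^sup>2 - (u j $ k)\<^sup>2))"
    proof (intro mult_pos_pos w)
      have "(u j $ k)\<^sup>2 < (u (j+1) $ k)\<^sup>2" using less p by (intro power_strict_mono) auto
      then show "0 < max 0 ((u (2*j+1-j) $ k)\<^sup>2 - (u j $ k)\<^sup>2)" by (simp add: algebra_simps)
    qed simp
    also have "\<dots> \<le> (\<Sum>k\<in>UNIV. ((real_of_int (2*j+1-j))\<^sup>2 - (real_of_int j)\<^sup>2) * (max 0 ((u (2*j+1-j) $ k)\<^sup>2 - (u j $ k)\<^sup>2)))"
      using w[of j] by (intro member_le_sum) auto
    finally show "\<exists>i\<in>{j - (int N + j)..j}. (real_of_int i)\<^sup>2 * (norm (?v i))\<^sup>2 + (real_of_int (2*j+1-i))\<^sup>2 * (norm (?v (2*j+1-i)))\<^sup>2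
       < (real_of_int i)\<^sup>2 * (norm (u i))\<^sup>2 + (real_of_int (2*j+1-i))\<^sup>2 * (norm (u (2*j+1-i)))\<^sup>2"
      using eq[of j] j by (intro bexI[of _ j]) auto
  qed simp
qed

lemma sum_grid_uminus: "(\<Sum>i\<in>{-int N..int N}. F (-i)) = (\<Sum>i\<in>{-int N..int N}. F i)"
  by (rule sum.reindex_bij_witness[of _ uminus uminus]) auto

text \<open>Under i to -i the edge with left endpoint i becomes the edge with left endpoint
  -i-1.\<close>

lemma mirror_dirichlet: "grid_dirichlet N (\<lambda>i. u (-i)) = grid_dirichlet N u"
  unfolding grid_dirichlet_def
  by (rule sum.reindex_bij_witness[of _ "\<lambda>i. -i-1" "\<lambda>i. -i-1"]) (auto simp: norm_minus_commute)

lemma mirror: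
  "grid_energy n N (\<lambda>i. u (-i)) = grid_energy n N u"
  "grid_mass n N (\<lambda>i. u (-i)) = grid_mass n N u"
  "moment N (\<lambda>i. u (-i)) = moment N u"
  "u \<in> feasible n N \<Longrightarrow> (\<lambda>i. u (-i)) \<in> feasible n N"
proof -
  show *: "grid_mass n N (\<lambda>i. u (-i)) = grid_mass n N u"
    unfolding grid_mass_def using sum_grid_uminus[of "\<lambda>i. (u i $ _)\<^sup>2" N] by auto
  show "grid_energy n N (\<lambda>i. u (-i)) = grid_energy n N u"
    unfolding grid_energy_def mirror_dirichlet using sum_grid_uminus[of "\<lambda>i. V (u i)" N] by simp
  show "moment N (\<lambda>i. u (-i)) = moment N u"
    unfolding moment_def using sum_grid_uminus[of "\<lambda>i. (real_of_int i)\<^sup>2 * (norm (u i))\<^sup>2" N] by simp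
  show "u \<in> feasible n N \<Longrightarrow> (\<lambda>i. u (-i)) \<in> feasible n N"
    using * by (auto simp: feasible_def)
qed

lemma grid_minimiser_exists:
  assumes "n > 0"
  obtains u where "u \<in> feasible n N" "\<forall>i k. 0 \<le> u i $ k"
    "\<forall>v\<in>feasible n N. grid_energy n N u \<le> grid_energy n N v"
    "\<forall>j\<ge>0. \<forall>k. u (j+1) $ k \<le> u j $ k" "\<forall>j\<le>0. \<forall>k. u (j-1) $ k \<le> u j $ k"
proof -
  obtain u0 where u0: "u0 \<in> feasible n N" "\<forall>v\<in>feasible n N. grid_energy n N u0 \<le> grid_energy n N v"
    using continuous_attains_inf[OF compact_feasible[OF assms, of N], of "grid_energy n N"]
      zero_feasible continuous_on_subset[OF continuous_grid_energy] by blast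
  \<comment> \<open>Minimality is expressed by an inequality against the minimum, so A is the
    compact feasible set cut by closed conditions, and every rearrangement that does not raise the
    energy stays in it.\<close>
  define A where "A = feasible n N \<inter> ({u. \<forall>i k. 0 \<le> u i $ k} \<inter> {u. grid_energy n N u \<le> grid_energy n N u0})"
  have "compact A" unfolding A_def
    by (intro compact_Int_closed compact_feasible assms closed_Int closed_Collect_all closed_Collect_le
        continuous_grid_energy continuous_on_const continuous_on_component continuous_on_product_coordinates)
  moreover have "grid_abs u0 \<in> A"
    using grid_abs_feasible[OF u0(1)] grid_abs_energy[of n N u0] by (auto simp: A_def grid_abs_def)
  moreover have "continuous_on A (moment N)"
    unfolding moment_def[abs_def]
    by (rule continuous_on_subset[OF _ subset_UNIV]) (intro continuous_intros continuous_on_product_coordinates)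
  ultimately obtain u where u: "u \<in> A" "\<forall>v\<in>A. moment N u \<le> moment N v"
    using continuous_attains_inf[of A "moment N"] by blast
  \<comment> \<open>Stated for an arbitrary moment minimiser \<open>w\<close> of A because it is
    applied to u and also to the mirror image of u; the latter gives monotonicity on the
    left.\<close>
  have mono: "w (j+1) $ k \<le> w j $ k" if w: "w \<in> A" "\<forall>v\<in>A. moment N w \<le> moment N v" and j: "j \<ge> 0" for w j k
  proof (rule ccontr)
    assume "\<not> w (j+1) $ k \<le> w j $ k"
    then have less: "w j $ k < w (j+1) $ k" by simp
    have s: "\<forall>i. \<bar>i\<bar> > int N \<longrightarrow> w i = 0" and p: "\<forall>i k. 0 \<le> w i $ k" using w by (auto simp: A_def feasible_def)
    have "polarise j w \<in> A"
      using w polarise_feasible[OF _ p j, of n N] polarise_energy[OF s p j, of n] p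
      by (auto simp: A_def polarise_def le_max_iff_disj intro: order_trans)
    with polarise_moment[OF s p j less] w(2) show False by (auto simp: not_le[symmetric])
  qed
  have m: "(\<lambda>i. u (-i)) \<in> A" using u(1) mirror by (auto simp: A_def)
  show thesis
  proof
    show "\<forall>j\<ge>0. \<forall>k. u (j+1) $ k \<le> u j $ k" using mono[OF u] by blast
    show "\<forall>j\<le>0. \<forall>k. u (j-1) $ k \<le> u j $ k"
    proof (intro allI impI)
      fix j :: int and k assume "j \<le> 0"
      then show "u (j-1) $ k \<le> u j $ k" using mono[OF m, of "-j" k] u(2) mirror(3)[of N u] by simp
    qed
    show "u \<in> feasible n N" "\<forall>i k. 0 \<le> u i $ k" using u by (auto simp: A_def)
    show "\<forall>v\<in>feasible n N. grid_energy n N u \<le> grid_energy n N v"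
      using u(1) u0(2) by (auto simp: A_def intro: order_trans)
  qed
qed

end

subsection \<open>Stationarity and uniform bounds on the lattice\<close>

context coupled_energy begin

text \<open>Summation by parts. Since \<open>h\<close> vanishes outside the window there are no
  boundary terms, and \<open>h\<close> is paired with minus the second difference of
  \<open>w\<close>.\<close>

lemma sum_edges:
  fixes h w :: "int \<Rightarrow> real^'k"
  assumes "\<forall>i. \<bar>i\<bar> > int N \<longrightarrow> h i = 0"
  shows "(\<Sum>i\<in>{-int N - 1..int N}. (w (i+1) - w i) \<bullet> (h (i+1) - h i)) =
         (\<Sum>i\<in>{-int N..int N}. h i \<bullet> (2 *\<^sub>R w i - w (i+1) - w (i-1)))"
proof -
  have 1: "(\<Sum>i\<in>{-int N - 1..int N}. (w (i+1) - w i) \<bullet> h (i+1)) = (\<Sum>i\<in>{-int N..int N+1}. (w i - w (i-1)) \<bullet> h i)"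
    by (rule sum.reindex_bij_witness[of _ "\<lambda>i. i-1" "\<lambda>i. i+1"]) auto
  have 2: "(\<Sum>i\<in>{-int N..int N}. (w i - w (i-1)) \<bullet> h i) = (\<Sum>i\<in>{-int N..int N+1}. (w i - w (i-1)) \<bullet> h i)"
    by (rule sum.mono_neutral_left) (use assms in auto)
  have 3: "(\<Sum>i\<in>{-int N..int N}. (w (i+1) - w i) \<bullet> h i) = (\<Sum>i\<in>{-int N-1..int N}. (w (i+1) - w i) \<bullet> h i)"
    by (rule sum.mono_neutral_left) (use assms in auto)
  show ?thesis
    unfolding inner_diff_right[of "w (_ + 1) - w _"] sum_subtractf[of "\<lambda>i. (w (i+1) - w i) \<bullet> h (i+1)"]
      1 2[symmetric] 3[symmetric] sum_subtractf[symmetric]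
    by (rule sum.cong) (simp_all add: inner_diff_left inner_diff_right inner_commute)
qed

text \<open>The partial gradient of \<open>grid_energy\<close> with respect to the value at the site
  \<open>i\<close>.\<close>

definition grid_gradient :: "nat \<Rightarrow> (int \<Rightarrow> real^'k) \<Rightarrow> int \<Rightarrow> real^'k" where
  "grid_gradient n u i = (2 * real n) *\<^sub>R (2 *\<^sub>R u i - u (i+1) - u (i-1)) - (1 / real n) *\<^sub>R G (u i)"

text \<open>Formulated for curves rather than lines, since the mass-preserving variations below are
  rotations.\<close>

lemma grid_energy_has_derivative:
  fixes c :: "real \<Rightarrow> int \<Rightarrow> real^'k"
  assumes d: "\<And>i. ((\<lambda>t. c t i) has_vector_derivative h i) (at 0)"
    and h: "\<forall>i. \<bar>i\<bar> > int N \<longrightarrow> h i = 0"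
  shows "((\<lambda>t. grid_energy n N (c t)) has_real_derivative
           (\<Sum>i\<in>{-int N..int N}. h i \<bullet> grid_gradient n (c 0) i)) (at 0)"
proof -
  have e: "((\<lambda>t. (norm (c t (i+1) - c t i))\<^sup>2) has_real_derivative 2 * ((c 0 (i+1) - c 0 i) \<bullet> (h (i+1) - h i))) (at 0)" for i
  proof -
    have "((\<lambda>t. c t (i+1) - c t i) has_vector_derivative h (i+1) - h i) (at 0)"
      by (intro derivative_intros d)
    then have "((\<lambda>t. (c t (i+1) - c t i) \<bullet> (c t (i+1) - c t i)) has_derivative
        (\<lambda>t. (c 0 (i+1) - c 0 i) \<bullet> (t *\<^sub>R (h (i+1) - h i)) + (t *\<^sub>R (h (i+1) - h i)) \<bullet> (c 0 (i+1) - c 0 i))) (at 0)"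
      unfolding has_vector_derivative_def
      using has_derivative_inner[of "\<lambda>t. c t (i+1) - c t i" _ 0 UNIV "\<lambda>t. c t (i+1) - c t i"] by blast
    then show ?thesis unfolding power2_norm_eq_inner has_field_derivative_def
      by (rule has_derivative_eq_rhs) (auto simp: fun_eq_iff inner_commute)
  qed
  have v: "((\<lambda>t. V (c t i)) has_real_derivative G (c 0 i) \<bullet> h i) (at 0)" for i
  proof -
    have "((\<lambda>t. V (c t i)) has_derivative (\<lambda>t. G (c 0 i) \<bullet> (t *\<^sub>R h i))) (at 0)"
      using has_derivative_compose[OF d[of i, unfolded has_vector_derivative_def] V_deriv] by simp
    then show ?thesis unfolding has_field_derivative_def
      by (rule has_derivative_eq_rhs) (auto simp: fun_eq_iff)
  qed
  have "((\<lambda>t. grid_energy n N (c t)) has_real_derivative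
     real n * (\<Sum>i\<in>{-int N - 1..int N}. 2 * ((c 0 (i+1) - c 0 i) \<bullet> (h (i+1) - h i))) -
     (\<Sum>i\<in>{-int N..int N}. G (c 0 i) \<bullet> h i) / real n) (at 0)"
    unfolding grid_energy_def grid_dirichlet_def
    by (intro DERIV_diff DERIV_cmult DERIV_cdivide DERIV_sum e v)
  moreover have "real n * (\<Sum>i\<in>{-int N - 1..int N}. 2 * ((c 0 (i+1) - c 0 i) \<bullet> (h (i+1) - h i))) -
     (\<Sum>i\<in>{-int N..int N}. G (c 0 i) \<bullet> h i) / real n = (\<Sum>i\<in>{-int N..int N}. h i \<bullet> grid_gradient n (c 0) i)"
    unfolding sum_distrib_left[symmetric] sum_edges[OF h]
    unfolding sum_distrib_left sum_divide_distrib sum_subtractf[symmetric] grid_gradient_def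
    by (rule sum.cong) (auto simp: inner_diff_right inner_commute algebra_simps)
  ultimately show ?thesis by simp
qed

text \<open>A slack constraint leaves room to move the single entry in both directions, so its
  partial derivative vanishes.\<close>

lemma grid_stationary_free:
  assumes n: "n > 0" and u: "u \<in> feasible n N" and min: "\<forall>v\<in>feasible n N. grid_energy n N u \<le> grid_energy n N v"
    and m: "grid_mass n N u k < M k" and p: "\<bar>p\<bar> \<le> int N"
  shows "grid_gradient n u p $ k = 0"
proof -
  define c where "c t i = u i + (if i = p then t else 0) *\<^sub>R axis k (1::real)" for t i
  define h where "h i = (if i = p then 1 else 0) *\<^sub>R (axis k 1 :: real^'k)" for i
  have d: "((\<lambda>t. c t i) has_vector_derivative h i) (at 0)" for i
    unfolding c_def h_def by (auto intro!: derivative_eq_intros)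
  have "\<forall>i. \<bar>i\<bar> > int N \<longrightarrow> h i = 0" using p by (auto simp: h_def)
  note D = grid_energy_has_derivative[OF d this, of n]
  have c0: "c 0 = u" by (auto simp: c_def fun_eq_iff)
  have "((\<lambda>t. c t i $ k) \<longlongrightarrow> c 0 i $ k) (at 0)" for i
    by (cases "i = p") (auto simp: c_def intro!: tendsto_eq_intros)
  then have "((\<lambda>t. grid_mass n N (c t) k) \<longlongrightarrow> grid_mass n N (c 0) k) (at 0)"
    unfolding grid_mass_def using n by (intro tendsto_divide tendsto_sum tendsto_power) auto
  then have "\<forall>\<^sub>F t in at 0. grid_mass n N (c t) k < M k"
    using m unfolding c0 by (rule order_tendstoD)
  then obtain e where e: "e > 0" "\<And>t. t \<noteq> 0 \<Longrightarrow> \<bar>t\<bar> < e \<Longrightarrow> grid_mass n N (c t) k < M k"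
    unfolding eventually_at by (auto simp: dist_real_def)
  have feas: "c t \<in> feasible n N" if t: "\<bar>t\<bar> < e" for t
  proof -
    have "grid_mass n N (c t) k' \<le> M k'" for k'
    proof (cases "k' = k")
      case True then show ?thesis using e(2)[of t] t m c0 by (cases "t = 0") auto
    next
      case False
      then have "c t i $ k' = u i $ k'" for i by (auto simp: c_def axis_def)
      then show ?thesis using u by (simp add: feasible_def grid_mass_def)
    qed
    then show ?thesis using u p by (auto simp: feasible_def c_def)
  qed
  have "(\<Sum>i\<in>{-int N..int N}. h i \<bullet> grid_gradient n (c 0) i) = 0"
    by (rule DERIV_local_min[OF D e(1)]) (use feas min c0 in auto)
  moreover have "(\<Sum>i\<in>{-int N..int N}. h i \<bullet> grid_gradient n (c 0) i)
       = (\<Sum>i\<in>{-int N..int N}. if i = p then grid_gradient n (c 0) i $ k else 0)"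
    by (rule sum.cong) (auto simp: h_def inner_axis')
  ultimately show ?thesis using p unfolding c0 by (auto split: if_splits)
qed

text \<open>Rotating two entries of a component preserves its mass exactly, so no multiplier rule is needed.\<close>

lemma grid_stationary_rotation:
  assumes n: "n > 0" and u: "u \<in> feasible n N" and min: "\<forall>v\<in>feasible n N. grid_energy n N u \<le> grid_energy n N v"
    and p: "\<bar>p\<bar> \<le> int N" "\<bar>q\<bar> \<le> int N"
  shows "grid_gradient n u p $ k * u q $ k = grid_gradient n u q $ k * u p $ k"
proof (cases "p = q")
  case False
  define \<phi> where "\<phi> t i = (if i = p then cos t * u p $ k - sin t * u q $ k
     else if i = q then sin t * u p $ k + cos t * u q $ k else u i $ k)" for t i
  define c where "c t i = u i + (\<phi> t i - u i $ k) *\<^sub>R axis k (1::real)" for t i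
  define h where "h i = (if i = p then - u q $ k else if i = q then u p $ k else 0) *\<^sub>R (axis k 1 :: real^'k)" for i
  have d: "((\<lambda>t. c t i) has_vector_derivative h i) (at 0)" for i
  proof -
    have "((\<lambda>t. \<phi> t i - u i $ k) has_vector_derivative (if i = p then - u q $ k else if i = q then u p $ k else 0)) (at 0)"
      unfolding \<phi>_def has_real_derivative_iff_has_vector_derivative[symmetric]
      by (auto intro!: derivative_eq_intros)
    from has_vector_derivative_scaleR[OF this[unfolded has_real_derivative_iff_has_vector_derivative[symmetric]] has_vector_derivative_const[of "axis k 1 :: real^'k"]]
    have "((\<lambda>t. (\<phi> t i - u i $ k) *\<^sub>R (axis k 1 :: real^'k)) has_vector_derivative h i) (at 0)"
      by (simp add: h_def)
    from has_vector_derivative_add[OF has_vector_derivative_const[of "u i"] this]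
    show ?thesis by (simp add: c_def)
  qed
  have "\<forall>i. \<bar>i\<bar> > int N \<longrightarrow> h i = 0" using p by (auto simp: h_def)
  note D = grid_energy_has_derivative[OF d this, of n]
  have c0: "c 0 = u" by (auto simp: c_def \<phi>_def fun_eq_iff)
  have feas: "c t \<in> feasible n N" for t
  proof -
    have "grid_mass n N (c t) k' \<le> M k'" for k'
    proof (cases "k' = k")
      case True
      have *: "c t i $ k = \<phi> t i" for i by (simp add: c_def axis_def)
      let ?S = "{-int N..int N} - {p} - {q}"
      have "(\<phi> t p)\<^sup>2 + (\<phi> t q)\<^sup>2 = (u p $ k)\<^sup>2 + (u q $ k)\<^sup>2"
      proof -
        have "(\<phi> t p)\<^sup>2 + (\<phi> t q)\<^sup>2 = ((cos t)\<^sup>2 + (sin t)\<^sup>2) * ((u p $ k)\<^sup>2 + (u q $ k)\<^sup>2)"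
          using False unfolding \<phi>_def by (simp add: power2_eq_square algebra_simps del: sin_cos_squared_add sin_cos_squared_add2 sin_cos_squared_add3)
        then show ?thesis by simp
      qed
      moreover have "(\<Sum>i\<in>?S. (\<phi> t i)\<^sup>2) = (\<Sum>i\<in>?S. (u i $ k)\<^sup>2)" by (rule sum.cong) (auto simp: \<phi>_def)
      moreover have "sum F {-int N..int N} = F p + F q + sum F ?S" for F :: "int \<Rightarrow> real"
      proof -
        have "p \<in> {-int N..int N}" "q \<in> {-int N..int N} - {p}" using p False by auto
        then show ?thesis using sum.remove[of "{-int N..int N}" p F] sum.remove[of "{-int N..int N} - {p}" q F]
          by (simp add: add.assoc)
      qed
      ultimately have "(\<Sum>i\<in>{-int N..int N}. (\<phi> t i)\<^sup>2) = (\<Sum>i\<in>{-int N..int N}. (u i $ k)\<^sup>2)"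
        by simp
      then show ?thesis using u unfolding True by (simp add: feasible_def grid_mass_def *)
    next
      case False
      then have "c t i $ k' = u i $ k'" for i by (auto simp: c_def axis_def)
      then show ?thesis using u by (simp add: feasible_def grid_mass_def)
    qed
    moreover have "c t i = 0" if "\<bar>i\<bar> > int N" for i
    proof -
      have "\<phi> t i = u i $ k" using that p by (auto simp: \<phi>_def)
      then show ?thesis using that u by (simp add: c_def feasible_def)
    qed
    ultimately show ?thesis by (simp add: feasible_def)
  qed
  have "(\<Sum>i\<in>{-int N..int N}. h i \<bullet> grid_gradient n (c 0) i) = 0"
    by (rule DERIV_local_min[OF D zero_less_one]) (use feas min c0 in auto)
  moreover have "(\<Sum>i\<in>{-int N..int N}. h i \<bullet> grid_gradient n (c 0) i)
       = (\<Sum>i\<in>{-int N..int N}. (if i = p then - u q $ k * grid_gradient n (c 0) i $ k else 0)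
           + (if i = q then u p $ k * grid_gradient n (c 0) i $ k else 0))"
    by (rule sum.cong) (use False in \<open>auto simp: h_def inner_axis'\<close>)
  ultimately show ?thesis using p unfolding c0 by (auto simp: sum.distrib mult.commute split: if_splits)
qed simp

text \<open>Multiplying the rotation identity by \<open>u q $ k\<close> and summing over
  \<open>q\<close> turns the proportionality of gradient and component into an explicit formula for
  the multiplier, which can then be estimated. The factor 2 in \<open>2 * M k\<close> comes from
  scaling the gradient by n/2 to bring the equation to its final form. For a slack constraint the
  multiplier is 0.\<close>

lemma grid_euler_lagrange:
  assumes n: "n > 0" and u: "u \<in> feasible n N" and min: "\<forall>v\<in>feasible n N. grid_energy n N u \<le> grid_energy n N v"
  obtains lam :: "real^'k" where
    "\<And>i. \<bar>i\<bar> \<le> int N \<Longrightarrow> (real n)\<^sup>2 *\<^sub>R (u (i+1) - 2 *\<^sub>R u i + u (i-1)) = (\<chi> k. lam $ k * u i $ k) - (1/2) *\<^sub>R G (u i)"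
    "\<And>k. lam $ k = 0 \<or> (grid_mass n N u k = M k \<and>
        2 * M k * lam $ k = - (\<Sum>i\<in>{-int N..int N}. grid_gradient n u i $ k * u i $ k))"
proof -
  define S where "S k = (\<Sum>i\<in>{-int N..int N}. grid_gradient n u i $ k * u i $ k)" for k
  define lam :: "real^'k" where "lam = (\<chi> k. if grid_mass n N u k < M k then 0 else - S k / (2 * M k))"
  have g: "grid_gradient n u p $ k = - (2 / real n) * lam $ k * u p $ k" if p: "\<bar>p\<bar> \<le> int N" for p k
  proof (cases "grid_mass n N u k < M k")
    case True then show ?thesis using grid_stationary_free[OF n u min True p] by (simp add: lam_def)
  next
    case False
    then have m: "grid_mass n N u k = M k" using u by (auto simp: feasible_def intro: antisym)
    have "grid_gradient n u p $ k * (real n * M k) = (\<Sum>q\<in>{-int N..int N}. grid_gradient n u p $ k * (u q $ k)\<^sup>2)"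
    proof -
      have "real n * M k = (\<Sum>q\<in>{-int N..int N}. (u q $ k)\<^sup>2)"
        using m n by (simp add: grid_mass_def field_simps)
      then show ?thesis by (simp add: sum_distrib_left)
    qed
    also have "\<dots> = (\<Sum>q\<in>{-int N..int N}. grid_gradient n u q $ k * u q $ k * u p $ k)"
      by (rule sum.cong) (use grid_stationary_rotation[OF n u min p, of _ k] in \<open>auto simp: power2_eq_square algebra_simps\<close>)
    also have "\<dots> = S k * u p $ k" by (simp add: S_def sum_distrib_right)
    finally show ?thesis using False n M_pos[of k] by (simp add: lam_def field_simps)
  qed
  show thesis
  proof (rule that)
    fix i assume i: "\<bar>i\<bar> \<le> int N"
    have "((real n)\<^sup>2 *\<^sub>R (u (i+1) - 2 *\<^sub>R u i + u (i-1))) $ k = ((\<chi> k. lam $ k * u i $ k) - (1/2) *\<^sub>R G (u i)) $ k" for k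
    proof -
      have "(real n / 2) * grid_gradient n u i $ k = - (lam $ k * u i $ k)" using g[OF i, of k] n by simp
      moreover have "(real n / 2) * grid_gradient n u i $ k = (real n)\<^sup>2 * (2 * u i $ k - u (i+1) $ k - u (i-1) $ k) - (1/2) * G (u i) $ k"
        using n by (simp add: grid_gradient_def right_diff_distrib power2_eq_square)
      ultimately show ?thesis by (simp add: algebra_simps)
    qed
    then show "(real n)\<^sup>2 *\<^sub>R (u (i+1) - 2 *\<^sub>R u i + u (i-1)) = (\<chi> k. lam $ k * u i $ k) - (1/2) *\<^sub>R G (u i)"
      by (simp add: vec_eq_iff)
  next
    fix k
    show "lam $ k = 0 \<or> (grid_mass n N u k = M k \<and>
        2 * M k * lam $ k = - (\<Sum>i\<in>{-int N..int N}. grid_gradient n u i $ k * u i $ k))"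
      using u M_pos[of k] unfolding lam_def S_def feasible_def
      by (auto simp: field_simps not_less intro!: antisym)
  qed
qed

section \<open>Bounds uniform in the lattice spacing\<close>

lemma K_nonneg: "0 \<le> K"
proof -
  define x :: "real^'k" where "x = axis undefined 1"
  have "norm x = 1" unfolding x_def by (rule norm_axis_1)
  then show ?thesis using V_growth[of x] by simp
qed

definition total_mass :: real where "total_mass = (\<Sum>k\<in>UNIV. M k)"

lemma total_mass_pos: "total_mass > 0"
  unfolding total_mass_def by (intro sum_pos M_pos) auto

lemma sum_norm_le_mass:
  assumes "n > 0" "u \<in> feasible n N"
  shows "(\<Sum>i\<in>{-int N..int N}. (norm (u i))\<^sup>2) \<le> real n * total_mass"
proof -
  have "(\<Sum>i\<in>{-int N..int N}. (norm (u i))\<^sup>2) = (\<Sum>k\<in>UNIV. (\<Sum>i\<in>{-int N..int N}. (u i $ k)\<^sup>2))"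
    unfolding power2_norm_vec by (rule sum.swap)
  also have "\<dots> \<le> (\<Sum>k\<in>UNIV. real n * M k)"
    using assms by (intro sum_mono) (auto simp: feasible_def grid_mass_def field_simps)
  finally show ?thesis by (simp add: total_mass_def sum_distrib_left)
qed

text \<open>Discrete counterpart of the bound of sup |u|^2 by the product of the L2 norms of u and
  u': telescope the squared norm from \<open>i\<close> to the end of the window and apply
  Cauchy-Schwarz. When it is used, the powers of n in the two factors cancel.\<close>

lemma grid_sup_bound:
  assumes s: "\<forall>i. \<bar>i\<bar> > int N \<longrightarrow> u i = 0"
  shows "(norm (u i))\<^sup>2 \<le> 2 * sqrt (grid_dirichlet N u) * sqrt (\<Sum>i\<in>{-int N..int N}. (norm (u i))\<^sup>2)"
proof -
  let ?S = "\<Sum>i\<in>{-int N..int N}. (norm (u i))\<^sup>2"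
  define g where "g j = norm (u (j+1) - u j) * (norm (u j) + norm (u (j+1)))" for j
  have g: "(norm (u j))\<^sup>2 - (norm (u (j+1)))\<^sup>2 \<le> g j" for j
  proof -
    have "(norm (u j))\<^sup>2 - (norm (u (j+1)))\<^sup>2 = (norm (u j) - norm (u (j+1))) * (norm (u j) + norm (u (j+1)))"
      by (simp add: power2_eq_square algebra_simps)
    also have "\<dots> \<le> g j" unfolding g_def
      by (intro mult_right_mono) (use norm_triangle_ineq2[of "u j" "u (j+1)"] in \<open>auto simp: norm_minus_commute\<close>)
    finally show ?thesis .
  qed
  have g0: "g j \<ge> 0" for j by (simp add: g_def)
  \<comment> \<open>Downward induction from N + 1, where \<open>u\<close> vanishes and the sum is
    empty.\<close>
  have tele: "(norm (u j))\<^sup>2 \<le> (\<Sum>l\<in>{j..int N}. g l)" if "j \<le> int N + 1" for j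
    using that
  proof (induction j rule: int_le_induct)
    case base then show ?case using s by simp
  next
    case (step j)
    have "{j-1..int N} = insert (j-1) {j..int N}" using step by auto
    then show ?case using step g[of "j-1"] by simp
  qed
  have "(norm (u i))\<^sup>2 \<le> (\<Sum>l\<in>{-int N-1..int N}. g l)"
  proof (cases "\<bar>i\<bar> \<le> int N")
    case True
    then have "(norm (u i))\<^sup>2 \<le> (\<Sum>l\<in>{i..int N}. g l)" by (intro tele) auto
    also have "\<dots> \<le> (\<Sum>l\<in>{-int N-1..int N}. g l)" using True g0 by (intro sum_mono2) auto
    finally show ?thesis .
  next
    case False then show ?thesis using s g0 by (simp add: sum_nonneg)
  qed
  also have "\<dots> \<le> sqrt (grid_dirichlet N u) * sqrt (4 * ?S)"
  proof -
    have 1: "(\<Sum>l\<in>{-int N-1..int N}. (norm (u l))\<^sup>2) = ?S"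
      by (rule sum.mono_neutral_right) (use s in auto)
    have 2: "(\<Sum>l\<in>{-int N-1..int N}. (norm (u (l+1)))\<^sup>2) = ?S"
    proof -
      have "(\<Sum>l\<in>{-int N-1..int N}. (norm (u (l+1)))\<^sup>2) = (\<Sum>l\<in>{-int N..int N+1}. (norm (u l))\<^sup>2)"
        by (rule sum.reindex_bij_witness[of _ "\<lambda>i. i-1" "\<lambda>i. i+1"]) auto
      also have "\<dots> = ?S" by (rule sum.mono_neutral_right) (use s in auto)
      finally show ?thesis .
    qed
    have "(\<Sum>l\<in>{-int N-1..int N}. (norm (u l) + norm (u (l+1)))\<^sup>2) \<le> (\<Sum>l\<in>{-int N-1..int N}. 2 * (norm (u l))\<^sup>2 + 2 * (norm (u (l+1)))\<^sup>2)"
    proof (intro sum_mono)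
      fix l
      have "0 \<le> (norm (u l) - norm (u (l+1)))\<^sup>2" by simp
      then show "(norm (u l) + norm (u (l+1)))\<^sup>2 \<le> 2 * (norm (u l))\<^sup>2 + 2 * (norm (u (l+1)))\<^sup>2"
        by (simp add: power2_eq_square algebra_simps)
    qed
    also have "\<dots> = 4 * ?S" by (simp add: sum.distrib sum_distrib_left[symmetric] 1 2)
    finally have 3: "(\<Sum>l\<in>{-int N-1..int N}. (norm (u l) + norm (u (l+1)))\<^sup>2) \<le> 4 * ?S" .
    have "(\<Sum>l\<in>{-int N-1..int N}. g l)\<^sup>2 \<le> grid_dirichlet N u * (\<Sum>l\<in>{-int N-1..int N}. (norm (u l) + norm (u (l+1)))\<^sup>2)"
      unfolding g_def grid_dirichlet_def by (rule Cauchy_Schwarz_ineq_sum)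
    also have "\<dots> \<le> grid_dirichlet N u * (4 * ?S)"
      by (intro mult_left_mono 3) (auto simp: grid_dirichlet_def sum_nonneg)
    finally show ?thesis by (simp add: real_le_rsqrt real_sqrt_mult[symmetric])
  qed
  also have "\<dots> = 2 * sqrt (grid_dirichlet N u) * sqrt ?S" by (simp add: real_sqrt_mult)
  finally show ?thesis .
qed

text \<open>The nested root is the sup bound of \<open>grid_sup_bound\<close> in terms of the
  rescaled Dirichlet energy D, so the right-hand side grows like D^(a/4) + D^(b/4). Both exponents
  are below 1 because b < 4, hence D cannot be large.\<close>

lemma sublinear_bound:
  obtains C where "\<And>D. D \<ge> 0 \<Longrightarrow> D \<le> K * total_mass * (sqrt (2 * sqrt (D * total_mass)) powr a + sqrt (2 * sqrt (D * total_mass)) powr b) \<Longrightarrow> D \<le> C"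
proof -
  have e: "sqrt (2 * sqrt (D * total_mass)) powr s = (4 * total_mass) powr (s/4) * D powr (s/4)" if "D > 0" for D s
  proof -
    have "2 * sqrt (D * total_mass) = sqrt (4 * (D * total_mass))" by (simp add: real_sqrt_mult)
    moreover have "sqrt (sqrt y) powr s = y powr (s/4)" if "y > 0" for y :: real
    proof -
      have "sqrt (sqrt y) = (y powr (1/2)) powr (1/2)" using that powr_half_sqrt[of y] powr_half_sqrt[of "sqrt y"] by (metis less_imp_le real_sqrt_ge_zero)
      then show ?thesis by (simp add: powr_powr)
    qed
    ultimately have "sqrt (2 * sqrt (D * total_mass)) powr s = (4 * (D * total_mass)) powr (s/4)"
      using that total_mass_pos by simp
    also have "4 * (D * total_mass) = (4 * total_mass) * D" by simp
    also have "\<dots> powr (s/4) = (4 * total_mass) powr (s/4) * D powr (s/4)"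
      by (rule powr_mult)
    finally show ?thesis .
  qed
  have t: "((\<lambda>D. D powr (s/4) / D) \<longlongrightarrow> 0) at_top" if "s < 4" for s :: real
  proof -
    have "((\<lambda>D. D powr (s/4 - 1)) \<longlongrightarrow> 0) at_top"
      by (rule tendsto_neg_powr) (use that in \<open>auto intro: filterlim_ident\<close>)
    moreover have "\<forall>\<^sub>F D in at_top. D powr (s/4 - 1) = D powr (s/4) / D"
      using eventually_gt_at_top[of 0] by eventually_elim (simp add: powr_diff)
    ultimately show ?thesis by (rule Lim_transform_eventually)
  qed
  have "((\<lambda>D. K * total_mass * ((4 * total_mass) powr (a/4) * (D powr (a/4) / D) + (4 * total_mass) powr (b/4) * (D powr (b/4) / D))) \<longlongrightarrow>
    K * total_mass * ((4 * total_mass) powr (a/4) * 0 + (4 * total_mass) powr (b/4) * 0)) at_top"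
    using a_le_b b_less by (intro tendsto_intros t) auto
  then have "\<forall>\<^sub>F D in at_top. K * total_mass * ((4 * total_mass) powr (a/4) * (D powr (a/4) / D) + (4 * total_mass) powr (b/4) * (D powr (b/4) / D)) < 1"
    by (rule order_tendstoD) simp
  then obtain C where C: "\<And>D. D \<ge> C \<Longrightarrow> K * total_mass * ((4 * total_mass) powr (a/4) * (D powr (a/4) / D) + (4 * total_mass) powr (b/4) * (D powr (b/4) / D)) < 1"
    unfolding eventually_at_top_linorder by blast
  show thesis
  proof (rule that[of "max C 1"], rule ccontr)
    fix D :: real assume "D \<ge> 0" and D: "D \<le> K * total_mass * (sqrt (2 * sqrt (D * total_mass)) powr a + sqrt (2 * sqrt (D * total_mass)) powr b)" "\<not> D \<le> max C 1"
    then have "D > 0" "D \<ge> C" by auto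
    have "K * total_mass * ((4 * total_mass) powr (a/4) * D powr (a/4) + (4 * total_mass) powr (b/4) * D powr (b/4)) / D < 1"
      using C[OF \<open>D \<ge> C\<close>] by (simp add: add_divide_distrib[symmetric])
    then have "K * total_mass * ((4 * total_mass) powr (a/4) * D powr (a/4) + (4 * total_mass) powr (b/4) * D powr (b/4)) < D"
      using \<open>D > 0\<close> by simp
    with D(1) show False unfolding e[OF \<open>D > 0\<close>] by simp
  qed
qed

text \<open>The zero function is feasible with energy 0, so a minimiser has Dirichlet energy at most
  its potential energy, and \<open>sublinear_bound\<close> closes the estimate. The constant depends
  neither on \<open>n\<close> nor on \<open>N\<close>.\<close>

lemma grid_bounds:
  obtains C where "C > 0"
    "\<And>n N u. n > 0 \<Longrightarrow> u \<in> feasible n N \<Longrightarrow> \<forall>v\<in>feasible n N. grid_energy n N u \<le> grid_energy n N v \<Longrightarrow>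
       real n * grid_dirichlet N u \<le> C \<and> (\<forall>i. norm (u i) \<le> C)"
proof -
  obtain C0 where C0: "\<And>D. D \<ge> 0 \<Longrightarrow> D \<le> K * total_mass * (sqrt (2 * sqrt (D * total_mass)) powr a + sqrt (2 * sqrt (D * total_mass)) powr b) \<Longrightarrow> D \<le> C0"
    using sublinear_bound by blast
  define C where "C = max 1 (max C0 (sqrt (2 * sqrt (C0 * total_mass))))"
  show thesis
  proof (rule that[of C])
    fix n N :: nat and u assume n: "n > 0" and u: "u \<in> feasible n N" and min: "\<forall>v\<in>feasible n N. grid_energy n N u \<le> grid_energy n N v"
    define D where "D = real n * grid_dirichlet N u"
    have D0: "D \<ge> 0" by (simp add: D_def grid_dirichlet_def sum_nonneg)
    define s where "s = sqrt (2 * sqrt (D * total_mass))"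
    have sup: "norm (u i) \<le> s" for i
    proof -
      have "(norm (u i))\<^sup>2 \<le> 2 * sqrt (grid_dirichlet N u) * sqrt (\<Sum>i\<in>{-int N..int N}. (norm (u i))\<^sup>2)"
        using u by (intro grid_sup_bound) (auto simp: feasible_def)
      also have "\<dots> \<le> 2 * sqrt (grid_dirichlet N u) * sqrt (real n * total_mass)"
        using sum_norm_le_mass[OF n u] by (intro mult_left_mono) (auto simp: grid_dirichlet_def sum_nonneg)
      also have "\<dots> = 2 * sqrt (D * total_mass)" by (simp add: D_def real_sqrt_mult)
      finally show ?thesis unfolding s_def by (rule real_le_rsqrt)
    qed
    have "grid_energy n N u \<le> grid_energy n N (\<lambda>_. 0)" using min zero_feasible by blast
    also have "\<dots> = 0" by (simp add: grid_energy_def grid_dirichlet_def)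
    finally have "D \<le> (\<Sum>i\<in>{-int N..int N}. V (u i)) / real n" by (simp add: grid_energy_def D_def)
    also have "\<dots> \<le> (\<Sum>i\<in>{-int N..int N}. K * (norm (u i))\<^sup>2 * (s powr a + s powr b)) / real n"
    proof (intro divide_right_mono sum_mono)
      fix i
      have "V (u i) \<le> K * (norm (u i))\<^sup>2 * (norm (u i) powr a + norm (u i) powr b)"
        using V_growth[of "u i"] by simp
      also have "\<dots> \<le> K * (norm (u i))\<^sup>2 * (s powr a + s powr b)"
        using sup[of i] a_pos a_le_b K_nonneg by (intro mult_left_mono add_mono powr_mono2) auto
      finally show "V (u i) \<le> K * (norm (u i))\<^sup>2 * (s powr a + s powr b)" .
    qed simp
    also have "\<dots> = (K * (s powr a + s powr b) / real n) * (\<Sum>i\<in>{-int N..int N}. (norm (u i))\<^sup>2)"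
      by (simp add: sum_distrib_left sum_divide_distrib mult_ac)
    also have "\<dots> \<le> (K * (s powr a + s powr b) / real n) * (real n * total_mass)"
      by (intro mult_left_mono sum_norm_le_mass n u) (auto simp: K_nonneg)
    also have "\<dots> = K * total_mass * (s powr a + s powr b)" using n by simp
    finally have "D \<le> C0" using C0[OF D0] by (simp add: s_def)
    moreover from this have "s \<le> sqrt (2 * sqrt (C0 * total_mass))" using total_mass_pos
      by (simp add: s_def mult_right_mono)
    ultimately show "real n * grid_dirichlet N u \<le> C \<and> (\<forall>i. norm (u i) \<le> C)"
      using sup by (auto simp: C_def D_def[symmetric] le_max_iff_disj intro: order_trans)
  qed (simp add: C_def)
qed

text \<open>Pairing the gradient with the component itself gives twice the Dirichlet energy of that
  component minus the integral of its product with the same component of G(u). Both are under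
  control, and a nonzero multiplier is this quantity, up to sign, divided by the fixed number
  \<open>2 * M k\<close>.\<close>

lemma grid_multiplier_bound:
  assumes "C > 0"
  obtains L where "\<And>n N u lam. n > 0 \<Longrightarrow> u \<in> feasible n N \<Longrightarrow> real n * grid_dirichlet N u \<le> C \<Longrightarrow> \<forall>i. norm (u i) \<le> C \<Longrightarrow>
     \<forall>k. lam $ k = 0 \<or> 2 * M k * lam $ k = - (\<Sum>i\<in>{-int N..int N}. grid_gradient n u i $ k * u i $ k) \<Longrightarrow> norm (lam :: real^'k) \<le> L"
proof -
  obtain c where c: "\<And>x. norm x \<le> C \<Longrightarrow> norm (G x) \<le> c * norm x" using G_lin[of C] by blast
  define B where "B k = (2 * C + \<bar>c\<bar> * total_mass) / (2 * M k)" for k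
  have Bp: "B k \<ge> 0" for k using assms total_mass_pos M_pos[of k] by (auto simp: B_def intro!: divide_nonneg_pos add_nonneg_nonneg)
  show thesis
  proof (rule that[of "\<Sum>k\<in>UNIV. B k"])
    fix n N :: nat and u and lam :: "real^'k"
    assume n: "n > 0" and u: "u \<in> feasible n N" and D: "real n * grid_dirichlet N u \<le> C" and sup: "\<forall>i. norm (u i) \<le> C"
      and lam: "\<forall>k. lam $ k = 0 \<or> 2 * M k * lam $ k = - (\<Sum>i\<in>{-int N..int N}. grid_gradient n u i $ k * u i $ k)"
    have "\<bar>lam $ k\<bar> \<le> B k" for k
    proof (cases "lam $ k = 0")
      case True then show ?thesis using Bp by simp
    next
      case False
      define h where "h i = (u i $ k) *\<^sub>R (axis k 1 :: real^'k)" for i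
      have s: "\<forall>i. \<bar>i\<bar> > int N \<longrightarrow> h i = 0" using u by (auto simp: h_def feasible_def)
      have "(\<Sum>i\<in>{-int N..int N}. grid_gradient n u i $ k * u i $ k) =
         2 * real n * (\<Sum>i\<in>{-int N..int N}. h i \<bullet> (2 *\<^sub>R u i - u (i+1) - u (i-1))) - (1 / real n) * (\<Sum>i\<in>{-int N..int N}. G (u i) $ k * u i $ k)"
        unfolding sum_distrib_left sum_subtractf[symmetric]
        by (rule sum.cong) (auto simp: grid_gradient_def h_def inner_axis' algebra_simps)
      also have "(\<Sum>i\<in>{-int N..int N}. h i \<bullet> (2 *\<^sub>R u i - u (i+1) - u (i-1))) = (\<Sum>i\<in>{-int N - 1..int N}. (u (i+1) $ k - u i $ k)\<^sup>2)"
        unfolding sum_edges[OF s, symmetric]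
        by (rule sum.cong) (auto simp: h_def inner_axis inner_diff_right power2_eq_square algebra_simps)
      finally have e: "(\<Sum>i\<in>{-int N..int N}. grid_gradient n u i $ k * u i $ k) =
         2 * real n * (\<Sum>i\<in>{-int N - 1..int N}. (u (i+1) $ k - u i $ k)\<^sup>2) - (1 / real n) * (\<Sum>i\<in>{-int N..int N}. G (u i) $ k * u i $ k)" .
      have 1: "0 \<le> (\<Sum>i\<in>{-int N - 1..int N}. (u (i+1) $ k - u i $ k)\<^sup>2)" by (intro sum_nonneg) auto
      have "(\<Sum>i\<in>{-int N - 1..int N}. (u (i+1) $ k - u i $ k)\<^sup>2) \<le> grid_dirichlet N u"
        unfolding grid_dirichlet_def power2_norm_vec vector_minus_component
        by (intro sum_mono member_le_sum) auto
      then have 2: "real n * (\<Sum>i\<in>{-int N - 1..int N}. (u (i+1) $ k - u i $ k)\<^sup>2) \<le> C"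
        using D by (meson mult_left_mono of_nat_0_le_iff order_trans)
      have 3: "\<bar>(1 / real n) * (\<Sum>i\<in>{-int N..int N}. G (u i) $ k * u i $ k)\<bar> \<le> \<bar>c\<bar> * total_mass"
      proof -
        have "\<bar>\<Sum>i\<in>{-int N..int N}. G (u i) $ k * u i $ k\<bar> \<le> (\<Sum>i\<in>{-int N..int N}. \<bar>c\<bar> * (norm (u i))\<^sup>2)"
        proof (rule sum_abs[THEN order_trans], rule sum_mono)
          fix i
          have "\<bar>G (u i) $ k * u i $ k\<bar> \<le> norm (G (u i)) * norm (u i)"
            unfolding abs_mult by (intro mult_mono component_le_norm_cart) auto
          also have "\<dots> \<le> (c * norm (u i)) * norm (u i)" using c sup by (intro mult_right_mono) auto
          also have "\<dots> \<le> (\<bar>c\<bar> * norm (u i)) * norm (u i)" by (intro mult_right_mono) auto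
          finally show "\<bar>G (u i) $ k * u i $ k\<bar> \<le> \<bar>c\<bar> * (norm (u i))\<^sup>2" by (simp add: power2_eq_square)
        qed
        also have "\<dots> \<le> \<bar>c\<bar> * (real n * total_mass)" unfolding sum_distrib_left[symmetric]
          by (intro mult_left_mono sum_norm_le_mass n u) auto
        finally show ?thesis using n by (simp add: abs_mult field_simps)
      qed
      have 4: "0 \<le> real n * (\<Sum>i\<in>{-int N - 1..int N}. (u (i+1) $ k - u i $ k)\<^sup>2)"
        by (intro mult_nonneg_nonneg 1) simp
      have "2 * M k * lam $ k = - (2 * (real n * (\<Sum>i\<in>{-int N - 1..int N}. (u (i+1) $ k - u i $ k)\<^sup>2)) - (1 / real n) * (\<Sum>i\<in>{-int N..int N}. G (u i) $ k * u i $ k))"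
        using lam[rule_format, of k] False e by simp
      then have "\<bar>2 * M k * lam $ k\<bar> \<le> 2 * C + \<bar>c\<bar> * total_mass"
        using 2 3 4 by linarith
      then show ?thesis using M_pos[of k] by (simp add: B_def abs_mult field_simps)
    qed
    then show "norm lam \<le> (\<Sum>k\<in>UNIV. B k)"
      by (intro order_trans[OF norm_le_l1_cart] sum_mono)
  qed
qed

end

subsection \<open>Passage to the limit\<close>

lemma step_integral:
  fixes f :: "int \<Rightarrow> 'b::{banach,second_countable_topology}"
  assumes n: "n > 0"
  shows "has_bochner_integral lborel
     (\<lambda>x. indicator {real_of_int i / real n..<real_of_int j / real n} x *\<^sub>R f \<lfloor>real n * x\<rfloor>)
     ((\<Sum>l\<in>{i..<j}. f l) /\<^sub>R real n)"
proof -
  \<comment> \<open>The half-open cells of length 1/n partition the line, and x lies in the cell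
    with index \<open>\<lfloor>real n * x\<rfloor>\<close>.\<close>
  have ind: "indicator {real_of_int l / real n..<real_of_int (l+1) / real n} x = (if l = \<lfloor>real n * x\<rfloor> then 1 else (0::real))" for l x
  proof -
    have "x \<in> {real_of_int l / real n..<real_of_int (l+1) / real n} \<longleftrightarrow> of_int l \<le> real n * x \<and> real n * x < of_int l + 1"
      using n by (auto simp: field_simps)
    also have "\<dots> \<longleftrightarrow> l = \<lfloor>real n * x\<rfloor>" by linarith
    finally show ?thesis by (auto simp: indicator_def)
  qed
  have mem: "x \<in> {real_of_int i / real n..<real_of_int j / real n} \<longleftrightarrow> \<lfloor>real n * x\<rfloor> \<in> {i..<j}" for x
    using n by (auto simp: field_simps le_floor_iff floor_less_iff)
  have "(\<lambda>x. indicator {real_of_int i / real n..<real_of_int j / real n} x *\<^sub>R f \<lfloor>real n * x\<rfloor>) =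
     (\<lambda>x. \<Sum>l\<in>{i..<j}. indicator {real_of_int l / real n..<real_of_int (l+1) / real n} x *\<^sub>R f l)"
  proof
    fix x
    have "(\<Sum>l\<in>{i..<j}. indicator {real_of_int l / real n..<real_of_int (l+1) / real n} x *\<^sub>R f l)
       = (\<Sum>l\<in>{i..<j}. if l = \<lfloor>real n * x\<rfloor> then f l else 0)"
      unfolding ind by (rule sum.cong) auto
    also have "\<dots> = (if \<lfloor>real n * x\<rfloor> \<in> {i..<j} then f \<lfloor>real n * x\<rfloor> else 0)"
      by (subst sum.delta) auto
    also have "\<dots> = indicator {real_of_int i / real n..<real_of_int j / real n} x *\<^sub>R f \<lfloor>real n * x\<rfloor>"
      using mem[of x] by (auto simp: indicator_def)
    finally show "indicator {real_of_int i / real n..<real_of_int j / real n} x *\<^sub>R f \<lfloor>real n * x\<rfloor> =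
      (\<Sum>l\<in>{i..<j}. indicator {real_of_int l / real n..<real_of_int (l+1) / real n} x *\<^sub>R f l)" ..
  qed
  moreover have "has_bochner_integral lborel
     (\<lambda>x. \<Sum>l\<in>{i..<j}. indicator {real_of_int l / real n..<real_of_int (l+1) / real n} x *\<^sub>R f l)
     (\<Sum>l\<in>{i..<j}. (1 / real n) *\<^sub>R f l)"
  proof (rule has_bochner_integral_sum)
    fix l
    have "has_bochner_integral lborel (\<lambda>x. indicator {real_of_int l / real n..<real_of_int (l+1) / real n} x *\<^sub>R f l)
       (measure lborel {real_of_int l / real n..<real_of_int (l+1) / real n} *\<^sub>R f l)"
      by (rule has_bochner_integral_indicator) (use n in \<open>auto simp: divide_right_mono\<close>)
    then show "has_bochner_integral lborel (\<lambda>x. indicator {real_of_int l / real n..<real_of_int (l+1) / real n} x *\<^sub>R f l)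
       ((1 / real n) *\<^sub>R f l)"
      using n by (simp add: divide_right_mono diff_divide_distrib[symmetric])
  qed
  ultimately show ?thesis by (simp add: scaleR_sum_right inverse_eq_divide)
qed

lemma step_integral_UNIV:
  fixes f :: "int \<Rightarrow> 'b::{banach,second_countable_topology}"
  assumes n: "n > 0" and f: "\<And>l. l \<notin> {i..<j} \<Longrightarrow> f l = 0"
  shows "has_bochner_integral lborel (\<lambda>x. f \<lfloor>real n * x\<rfloor>) ((\<Sum>l\<in>{i..<j}. f l) /\<^sub>R real n)"
proof -
  have "indicator {real_of_int i / real n..<real_of_int j / real n} x *\<^sub>R f \<lfloor>real n * x\<rfloor> = f \<lfloor>real n * x\<rfloor>" for x
  proof (cases "\<lfloor>real n * x\<rfloor> \<in> {i..<j}")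
    case True
    then have "x \<in> {real_of_int i / real n..<real_of_int j / real n}"
      using n by (auto simp: field_simps le_floor_iff floor_less_iff)
    then show ?thesis by simp
  next
    case False then show ?thesis using f by simp
  qed
  then show ?thesis using step_integral[OF n, of i j f] by simp
qed

lemma measurable_step [measurable]:
  fixes f :: "int \<Rightarrow> 'b::{second_countable_topology,topological_space}"
  shows "(\<lambda>x::real. f \<lfloor>real n * x\<rfloor>) \<in> borel_measurable lborel"
proof -
  have "(\<lambda>x::real. f \<lfloor>real n * x\<rfloor>) \<in> borel_measurable borel"
    by (rule measurable_compose[where N="count_space UNIV"]) auto
  then show ?thesis by simp
qed

text \<open>The endpoints are rounded to the lattice and therefore move with n. Off the two limit
  endpoints, a null set, the indicators converge; the margin 1 on both sides keeps the moving
  interval where the bound is available.\<close>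

lemma tendsto_step_integral:
  fixes f :: "nat \<Rightarrow> real \<Rightarrow> 'b::{banach,second_countable_topology}"
  assumes p: "p \<longlonglongrightarrow> x" and q: "q \<longlonglongrightarrow> y" and xy: "x \<le> y"
    and m: "\<And>n. f n \<in> borel_measurable lborel" "g \<in> borel_measurable lborel"
    and lim: "\<And>s. x - 1 \<le> s \<Longrightarrow> s \<le> y + 1 \<Longrightarrow> (\<lambda>n. f n s) \<longlonglongrightarrow> g s"
    and bd: "\<forall>\<^sub>F n in sequentially. \<forall>s. x - 1 \<le> s \<longrightarrow> s \<le> y + 1 \<longrightarrow> norm (f n s) \<le> B"
  shows "(\<lambda>n. LINT s|lborel. indicator {p n..<q n} s *\<^sub>R f n s) \<longlonglongrightarrow> (LINT s|lborel. indicator {x..<y} s *\<^sub>R g s)"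
    "integrable lborel (\<lambda>s. indicator {x..<y} s *\<^sub>R g s)"
proof -
  have ev: "\<forall>\<^sub>F n in sequentially. p n > x - 1 \<and> q n < y + 1 \<and> (\<forall>s. x - 1 \<le> s \<longrightarrow> s \<le> y + 1 \<longrightarrow> norm (f n s) \<le> B)"
    using order_tendstoD(1)[OF p, of "x - 1"] order_tendstoD(2)[OF q, of "y + 1"] bd by (simp add: eventually_conj_iff)
  \<comment> \<open>Dominated convergence wants the bound for every index, so the sequence is
    started at \<open>n0\<close> and the shift is undone at the end.\<close>
  then obtain n0 where n0: "\<And>n. n \<ge> n0 \<Longrightarrow> p n > x - 1 \<and> q n < y + 1 \<and> (\<forall>s. x - 1 \<le> s \<longrightarrow> s \<le> y + 1 \<longrightarrow> norm (f n s) \<le> B)"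
    unfolding eventually_sequentially by blast
  let ?w = "\<lambda>s::real. \<bar>B\<bar> * indicator {x-1..y+1} s"
  have w: "integrable lborel ?w"
    by (intro integrable_mult_right integrable_real_indicator) (auto simp: emeasure_lborel_Icc_eq)
  have AE: "AE s in lborel. s \<noteq> x \<and> s \<noteq> y"
    by (intro AE_conjI AE_lborel_singleton)
  have l: "AE s in lborel. (\<lambda>n. indicator {p (n+n0)..<q (n+n0)} s *\<^sub>R f (n+n0) s) \<longlonglongrightarrow> indicator {x..<y} s *\<^sub>R g s"
    using AE
  proof eventually_elim
    case (elim s)
    have p': "(\<lambda>n. p (n+n0)) \<longlonglongrightarrow> x" and q': "(\<lambda>n. q (n+n0)) \<longlonglongrightarrow> y" using p q by (auto intro: LIMSEQ_ignore_initial_segment)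
    show ?case
    proof (cases "x < s \<and> s < y")
      case True
      then have "\<forall>\<^sub>F n in sequentially. p (n+n0) < s \<and> s < q (n+n0)"
        using order_tendstoD(2)[OF p'] order_tendstoD(1)[OF q'] by (simp add: eventually_conj_iff)
      then have "\<forall>\<^sub>F n in sequentially. f (n+n0) s = indicator {p (n+n0)..<q (n+n0)} s *\<^sub>R f (n+n0) s"
        by eventually_elim (simp add: indicator_def)
      moreover have "(\<lambda>n. f (n+n0) s) \<longlonglongrightarrow> g s" using lim[of s] True by (intro LIMSEQ_ignore_initial_segment) auto
      ultimately have "(\<lambda>n. indicator {p (n+n0)..<q (n+n0)} s *\<^sub>R f (n+n0) s) \<longlonglongrightarrow> g s"
        by (rule Lim_transform_eventually[rotated])
      then show ?thesis using True by (simp add: indicator_def)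
    next
      case False
      then have "s < x \<or> y < s" using elim by auto
      then have "\<forall>\<^sub>F n in sequentially. s < p (n+n0) \<or> q (n+n0) < s"
        using order_tendstoD(1)[OF p', of s] order_tendstoD(2)[OF q', of s] by (auto elim: eventually_mono)
      then have "\<forall>\<^sub>F n in sequentially. indicator {p (n+n0)..<q (n+n0)} s *\<^sub>R f (n+n0) s = 0"
        by eventually_elim (auto simp: indicator_def)
      moreover have "s \<notin> {x..<y}" using False elim by auto
      ultimately show ?thesis by (simp add: tendsto_eventually)
    qed
  qed
  have b: "AE s in lborel. norm (indicator {p (n+n0)..<q (n+n0)} s *\<^sub>R f (n+n0) s) \<le> ?w s" for n
  proof (rule AE_I2)
    fix s
    show "norm (indicator {p (n+n0)..<q (n+n0)} s *\<^sub>R f (n+n0) s) \<le> ?w s"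
      using n0[of "n+n0"] by (cases "s \<in> {p (n+n0)..<q (n+n0)}") (auto intro!: order_trans[OF _ abs_ge_self])
  qed
  have mm: "(\<lambda>s. indicator {p n..<q n} s *\<^sub>R f n s) \<in> borel_measurable lborel"
    "(\<lambda>s. indicator {x..<y} s *\<^sub>R g s) \<in> borel_measurable lborel" for n
    using m by (auto intro!: borel_measurable_scaleR borel_measurable_indicator)
  have "(\<lambda>n. LINT s|lborel. indicator {p (n+n0)..<q (n+n0)} s *\<^sub>R f (n+n0) s) \<longlonglongrightarrow> (LINT s|lborel. indicator {x..<y} s *\<^sub>R g s)"
    by (rule integral_dominated_convergence[OF mm(2) mm(1) w l b])
  then show "(\<lambda>n. LINT s|lborel. indicator {p n..<q n} s *\<^sub>R f n s) \<longlonglongrightarrow> (LINT s|lborel. indicator {x..<y} s *\<^sub>R g s)"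
    by (rule LIMSEQ_offset)
  show "integrable lborel (\<lambda>s. indicator {x..<y} s *\<^sub>R g s)"
    by (rule integrable_dominated_convergence[OF mm(2) mm(1) w l b])
qed

text \<open>Turns the integrated limit equations into differential ones. The base point x - 1 makes
  x an interior point of the interval on which the fundamental theorem is applied.\<close>

lemma integral_has_vector_derivative_UNIV:
  fixes f g :: "real \<Rightarrow> 'b::euclidean_space"
  assumes c: "continuous_on UNIV g"
    and eq: "\<And>x y. x \<le> y \<Longrightarrow> f y - f x = (LINT s|lborel. indicator {x..<y} s *\<^sub>R g s)"
  shows "(f has_vector_derivative g x) (at x)"
proof -
  have e: "f y = f (x-1) + integral {x-1..y} g" if "y \<in> {x-1..x+1}" for y
  proof -
    have int: "set_integrable lborel {x-1..y} g"
      using borel_integrable_compact[of "{x-1..y}" g] continuous_on_subset[OF c] by (simp add: set_integrable_def)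
    have "f y - f (x-1) = (LINT s|lborel. indicator {x-1..<y} s *\<^sub>R g s)" using that by (intro eq) auto
    also have "\<dots> = (LINT s|lborel. indicator {x-1..y} s *\<^sub>R g s)"
    proof (rule integral_cong_AE)
      have g: "g \<in> borel_measurable lborel" using borel_measurable_continuous_onI[OF c] by simp
      show "(\<lambda>s. indicator {x-1..<y} s *\<^sub>R g s) \<in> borel_measurable lborel" "(\<lambda>s. indicator {x-1..y} s *\<^sub>R g s) \<in> borel_measurable lborel"
        using g by (auto intro!: borel_measurable_scaleR borel_measurable_indicator)
      have "AE s in lborel. s \<noteq> y" by (rule AE_lborel_singleton)
      then show "AE s in lborel. indicator {x-1..<y} s *\<^sub>R g s = indicator {x-1..y} s *\<^sub>R g s"
        by eventually_elim (auto simp: indicator_def)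
    qed
    also have "\<dots> = integral {x-1..y} g" using set_borel_integral_eq_integral(2)[OF int] by (simp add: set_lebesgue_integral_def)
    finally show ?thesis by (simp add: diff_eq_eq add.commute)
  qed
  have "((\<lambda>y. integral {x-1..y} g) has_vector_derivative g x) (at x within {x-1..x+1})"
    by (rule integral_has_vector_derivative) (auto intro: continuous_on_subset[OF c])
  then have "((\<lambda>y. f (x-1) + integral {x-1..y} g) has_vector_derivative g x) (at x within {x-1..x+1})"
    by (auto intro!: derivative_eq_intros)
  from has_vector_derivative_transform[OF _ e this]
  have "(f has_vector_derivative g x) (at x within {x-1..x+1})" by simp
  then show ?thesis by (simp add: at_within_Icc_at)
qed

text \<open>The majorant for the potential terms; the cut-off at 1 removes the singularity at the
  origin.\<close>

lemma integrable_min_powr: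
  fixes s :: real
  assumes s: "s > 1"
  shows "integrable lborel (\<lambda>x::real. min 1 (\<bar>x\<bar> powr (-s)))"
proof -
  have "has_bochner_integral lborel (\<lambda>x::real. indicator {1..} x *\<^sub>R (x powr (-s))) (1 / (s - 1))"
  proof (rule has_bochner_integral_nn_integral)
    have "((\<lambda>x. x powr (-s)) has_integral -(1 powr (-s+1)) / (-s+1)) {1..}"
      by (rule has_integral_powr_to_inf) (use s in auto)
    also have "-(1 powr (-s+1)) / (-s+1) = 1 / (s - 1)" by (simp add: minus_divide_right)
    finally have "((\<lambda>x. x powr (-s)) has_integral 1 / (s - 1)) {1..}" .
    from nn_integral_has_integral_lebesgue[OF _ this]
    have "integral\<^sup>N lborel (\<lambda>x. ennreal (indicator {1..} x * x powr (-s))) = ennreal (1 / (s-1))" by simp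
    then show "integral\<^sup>N lborel (\<lambda>x. ennreal (indicator {1..} x *\<^sub>R x powr (-s))) = ennreal (1 / (s-1))" by simp
  qed (use s in auto)
  then have 1: "integrable lborel (\<lambda>x::real. indicator {1..} x *\<^sub>R (x powr (-s)))" by (simp add: has_bochner_integral_iff)
  from lborel_integrable_real_affine[OF this, of "-1" 0]
  have 2: "integrable lborel (\<lambda>x::real. indicator {1..} (-x) *\<^sub>R ((-x) powr (-s)))" by simp
  have 3: "integrable lborel (indicator {-1..1} :: real \<Rightarrow> real)" by (rule integrable_real_indicator) auto
  have "integrable lborel (\<lambda>x::real. indicator {-1..1} x + (indicator {1..} x *\<^sub>R (x powr (-s)) + indicator {1..} (-x) *\<^sub>R ((-x) powr (-s))))"
    by (intro Bochner_Integration.integrable_add 1 2 3)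
  then show ?thesis
    by (rule Bochner_Integration.integrable_bound) (auto simp: indicator_def min_def)
qed

lemma sum_telescope_int:
  fixes f :: "int \<Rightarrow> 'b::ab_group_add"
  assumes "i \<le> j" shows "(\<Sum>l\<in>{i..<j}. f (l+1) - f l) = f j - f i"
  using assms
proof (induction j rule: int_ge_induct)
  case (step j)
  have "{i..<j+1} = insert j {i..<j}" using step by auto
  then show ?case using step by simp
qed simp

text \<open>Serves the masses and the Dirichlet energy, for which only an inequality survives in the
  limit. The bounds \<open>e n\<close> may vary because the discrete Dirichlet energies merely
  converge.\<close>

lemma fatou_limit:
  fixes f :: "nat \<Rightarrow> real \<Rightarrow> real"
  assumes m: "\<And>n. f n \<in> borel_measurable lborel" and i: "\<And>n. integrable lborel (f n)"
    and nn: "\<And>n x. 0 \<le> f n x" and lim: "\<And>x. (\<lambda>n. f n x) \<longlonglongrightarrow> g x"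
    and e: "\<And>n. (LINT x|lborel. f n x) \<le> e n" "e \<longlonglongrightarrow> c"
  shows "integrable lborel g" "(LINT x|lborel. g x) \<le> c"
proof -
  have g0: "0 \<le> g x" for x using lim[of x] nn by (intro LIMSEQ_le_const) auto
  have gm: "g \<in> borel_measurable lborel" by (rule borel_measurable_LIMSEQ_real[OF lim m])
  have c0: "0 \<le> c"
  proof (rule LIMSEQ_le_const[OF e(2)], intro exI allI impI)
    show "0 \<le> e n" for n using order_trans[OF Bochner_Integration.integral_nonneg e(1)] nn by blast
  qed
  have "(\<integral>\<^sup>+x. ennreal (g x) \<partial>lborel) = (\<integral>\<^sup>+x. liminf (\<lambda>n. ennreal (f n x)) \<partial>lborel)"
    by (rule nn_integral_cong) (use lim in \<open>auto intro!: lim_imp_Liminf[symmetric] tendsto_ennrealI\<close>)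
  also have "\<dots> \<le> liminf (\<lambda>n. \<integral>\<^sup>+x. ennreal (f n x) \<partial>lborel)"
    by (rule nn_integral_liminf) (use m in auto)
  also have "\<dots> \<le> liminf (\<lambda>n. ennreal (e n))"
    by (rule Liminf_mono, rule always_eventually) (use e(1) nn i in \<open>auto simp: nn_integral_eq_integral intro!: ennreal_leI\<close>)
  also have "\<dots> = ennreal c" using e(2) by (intro lim_imp_Liminf tendsto_ennrealI) auto
  finally have le: "(\<integral>\<^sup>+x. ennreal (g x) \<partial>lborel) \<le> ennreal c" .
  show "integrable lborel g"
    by (rule integrableI_nonneg) (use gm g0 le in \<open>auto intro: le_less_trans\<close>)
  show "(LINT x|lborel. g x) \<le> c" by (rule integral_real_bounded[OF c0 le])
qed

context coupled_energy begin

text \<open>Right-hand side of the limit equation U'' = lam U - G(U)/2. The half is there because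
  the Dirichlet term of the energy carries no factor 1/2.\<close>

definition force :: "real^'k \<Rightarrow> real^'k \<Rightarrow> real^'k" where
  "force lam x = (\<chi> k. lam $ k * x $ k) - (1/2) *\<^sub>R G x"

lemma tendsto_force:
  assumes "(f \<longlongrightarrow> lam) F" "(g \<longlongrightarrow> x) F"
  shows "((\<lambda>t. force (f t) (g t)) \<longlongrightarrow> force lam x) F"
proof -
  have "isCont G x" using G_cont by (simp add: continuous_on_eq_continuous_at)
  then have "((\<lambda>t. G (g t)) \<longlongrightarrow> G x) F" using assms(2) by (rule isCont_tendsto_compose)
  then show ?thesis unfolding force_def using assms by (intro tendsto_intros)
qed

lemma continuous_force: "continuous_on UNIV f \<Longrightarrow> continuous_on UNIV (\<lambda>x. force lam (f x))"
  unfolding continuous_on by (auto intro!: tendsto_force)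

lemma norm_scaled_le: "norm ((\<chi> k. lam $ k * x $ k) :: real^'k) \<le> norm lam * norm x"
proof -
  have "norm ((\<chi> k. lam $ k * x $ k) :: real^'k) \<le> norm (norm lam *\<^sub>R x)"
    by (rule norm_le_componentwise_cart) (auto simp: abs_mult intro!: mult_right_mono component_le_norm_cart)
  then show ?thesis by simp
qed

end

text \<open>What the limit passage uses of one lattice minimiser for each spacing 1/n. With n*n
  sites on either side the window is [-n, n] in real coordinates and exhausts the line. Minimality
  itself is not recorded: it has gone into the bounds and the equation, and it returns as a separate
  hypothesis in \<open>compact_competitor\<close>.\<close>

locale grid_sequence = coupled_energy V G M K a b
  for V :: "real^'k \<Rightarrow> real" and G :: "real^'k \<Rightarrow> real^'k" and M :: "'k \<Rightarrow> real" and K a b :: real +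
  fixes u :: "nat \<Rightarrow> int \<Rightarrow> real^'k" and lam :: "nat \<Rightarrow> real^'k" and C L :: real
  assumes feas: "n > 0 \<Longrightarrow> u n \<in> feasible n (n*n)"
    and u_nonneg: "n > 0 \<Longrightarrow> 0 \<le> u n i $ k"
    and mono_right: "n > 0 \<Longrightarrow> j \<ge> 0 \<Longrightarrow> u n (j+1) $ k \<le> u n j $ k"
    and mono_left: "n > 0 \<Longrightarrow> j \<le> 0 \<Longrightarrow> u n (j-1) $ k \<le> u n j $ k"
    and dir_le: "n > 0 \<Longrightarrow> real n * grid_dirichlet (n*n) (u n) \<le> C"
    and sup_le: "n > 0 \<Longrightarrow> norm (u n i) \<le> C"
    and lam_le: "n > 0 \<Longrightarrow> norm (lam n) \<le> L"
    and EL: "n > 0 \<Longrightarrow> \<bar>i\<bar> \<le> int (n*n) \<Longrightarrow>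
       (real n)\<^sup>2 *\<^sub>R (u n (i+1) - 2 *\<^sub>R u n i + u n (i-1)) = force (lam n) (u n i)"
begin

definition Uf :: "nat \<Rightarrow> real \<Rightarrow> real^'k" where "Uf n x = u n \<lfloor>real n * x\<rfloor>"
definition d :: "nat \<Rightarrow> int \<Rightarrow> real^'k" where "d n i = real n *\<^sub>R (u n (i+1) - u n i)"
definition Df :: "nat \<Rightarrow> real \<Rightarrow> real^'k" where "Df n x = d n \<lfloor>real n * x\<rfloor>"

section \<open>Equicontinuity, decay and discrete slopes\<close>

lemma C_nonneg: "0 \<le> C" using sup_le[of 1 0] norm_ge_zero order_trans zero_less_one by blast

lemma u_support: "n > 0 \<Longrightarrow> \<bar>i\<bar> > int (n*n) \<Longrightarrow> u n i = 0"
  using feas[of n] by (auto simp: feasible_def)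

lemma measurable_Uf: "Uf n \<in> borel_measurable lborel" "Df n \<in> borel_measurable lborel"
  unfolding Uf_def[abs_def] Df_def[abs_def] by (rule measurable_step)+

text \<open>Discrete Morrey estimate: Cauchy-Schwarz over the j - i edges between the two sites.
  Edges beyond the window join two values 0 and contribute nothing.\<close>

lemma u_hoelder:
  assumes n: "n > 0" and ij: "i \<le> j"
  shows "(norm (u n j - u n i))\<^sup>2 \<le> C * (real_of_int (j - i) / real n)"
proof -
  let ?A = "{-int (n*n) - 1..int (n*n)}" and ?e = "\<lambda>l. norm (u n (l+1) - u n l)"
  have "norm (u n j - u n i) \<le> (\<Sum>l\<in>{i..<j}. ?e l)"
    unfolding sum_telescope_int[OF ij, of "u n", symmetric] by (rule norm_sum)
  then have "(norm (u n j - u n i))\<^sup>2 \<le> (\<Sum>l\<in>{i..<j}. 1 * ?e l)\<^sup>2" by (intro power_mono) auto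
  also have "\<dots> \<le> (\<Sum>l\<in>{i..<j}. 1\<^sup>2) * (\<Sum>l\<in>{i..<j}. (?e l)\<^sup>2)" by (rule Cauchy_Schwarz_ineq_sum)
  also have "\<dots> = real_of_int (j - i) * (\<Sum>l\<in>{i..<j}. (?e l)\<^sup>2)" using ij by simp
  also have "(\<Sum>l\<in>{i..<j}. (?e l)\<^sup>2) \<le> (\<Sum>l\<in>{i..<j} \<union> ?A. (?e l)\<^sup>2)" by (rule sum_mono2) auto
  also have "\<dots> = grid_dirichlet (n*n) (u n)" unfolding grid_dirichlet_def
    by (rule sum.mono_neutral_right) (use u_support[OF n] in auto)
  also have "\<dots> \<le> C / real n" using dir_le[OF n] n by (simp add: field_simps)
  finally have "(norm (u n j - u n i))\<^sup>2 \<le> real_of_int (j - i) * (C / real n)"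
    using ij by (simp add: mult_left_mono)
  then show ?thesis by (simp add: mult.commute)
qed

text \<open>Rounding changes the distance of the two arguments by at most one cell, whence the
  summand 1/n, which disappears in the limit.\<close>

lemma Uf_hoelder:
  assumes n: "n > 0"
  shows "(norm (Uf n y - Uf n x))\<^sup>2 \<le> C * (\<bar>y - x\<bar> + 1 / real n)"
proof -
  have *: "(norm (Uf n y - Uf n x))\<^sup>2 \<le> C * (y - x + 1 / real n)" if "x \<le> y" for x y
  proof -
    have l: "\<lfloor>real n * x\<rfloor> \<le> \<lfloor>real n * y\<rfloor>" using that by (intro floor_mono mult_left_mono) auto
    have "real_of_int (\<lfloor>real n * y\<rfloor> - \<lfloor>real n * x\<rfloor>) \<le> real n * (y - x) + 1"
      unfolding right_diff_distrib by linarith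
    then have "real_of_int (\<lfloor>real n * y\<rfloor> - \<lfloor>real n * x\<rfloor>) / real n \<le> y - x + 1 / real n"
          proof -
      have "real n * (y - x) + 1 = (y - x + 1 / real n) * real n" using n by (simp add: distrib_right)
      with \<open>real_of_int (\<lfloor>real n * y\<rfloor> - \<lfloor>real n * x\<rfloor>) \<le> real n * (y - x) + 1\<close> show ?thesis
        using n by (simp only: pos_divide_le_eq of_nat_0_less_iff)
    qed
    then show ?thesis unfolding Uf_def
      by (intro order_trans[OF u_hoelder[OF n l]] mult_left_mono C_nonneg)
  qed
  show ?thesis using *[of x y] *[of y x] by (cases "x \<le> y") (auto simp: norm_minus_commute)
qed

lemma u_mono_right: "n > 0 \<Longrightarrow> 0 \<le> i \<Longrightarrow> i \<le> j \<Longrightarrow> u n j $ k \<le> u n i $ k"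
proof (rotate_tac 2, induction j rule: int_ge_induct)
  case (step j) then show ?case using mono_right[of n j k] by simp
qed auto

lemma u_mono_left: "n > 0 \<Longrightarrow> i \<le> 0 \<Longrightarrow> j \<le> i \<Longrightarrow> u n j $ k \<le> u n i $ k"
proof (rotate_tac 2, induction j rule: int_le_induct)
  case (step j) then show ?case using mono_left[of n j k] by simp
qed auto

lemma sum_component_le:
  assumes n: "n > 0" and fin: "finite A"
  shows "(\<Sum>l\<in>A. (u n l $ k)\<^sup>2) \<le> real n * M k"
proof -
  have "(\<Sum>l\<in>A. (u n l $ k)\<^sup>2) \<le> (\<Sum>l\<in>A \<union> {-int (n*n)..int (n*n)}. (u n l $ k)\<^sup>2)"
    by (rule sum_mono2) (use fin in auto)
  also have "\<dots> = (\<Sum>l\<in>{-int (n*n)..int (n*n)}. (u n l $ k)\<^sup>2)"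
    by (rule sum.mono_neutral_right) (use u_support[OF n] fin in auto)
  also have "\<dots> \<le> real n * M k"
    using feas[OF n] n unfolding feasible_def grid_mass_def by (auto simp: field_simps)
  finally show ?thesis .
qed

text \<open>By unimodality all sites between 0 and the one of x carry at least the value at x, and
  there are at least n|x| of them; the mass bound limits the value. Being uniform in n, this is the
  tightness needed for the potential terms.\<close>

lemma Uf_decay:
  assumes n: "n > 0"
  shows "\<bar>x\<bar> * (Uf n x $ k)\<^sup>2 \<le> M k"
proof -
  let ?i = "\<lfloor>real n * x\<rfloor>"
  have c: "real (card A) * (u n ?i $ k)\<^sup>2 \<le> real n * M k"
    if "finite A" "\<And>l. l \<in> A \<Longrightarrow> u n ?i $ k \<le> u n l $ k" for A
  proof -
    have "real (card A) * (u n ?i $ k)\<^sup>2 = (\<Sum>l\<in>A. (u n ?i $ k)\<^sup>2)" by simp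
    also have "\<dots> \<le> (\<Sum>l\<in>A. (u n l $ k)\<^sup>2)" using that u_nonneg[OF n] by (intro sum_mono power_mono) auto
    finally show ?thesis using sum_component_le[OF n that(1), of k] by simp
  qed
  have "(real n * \<bar>x\<bar>) * (u n ?i $ k)\<^sup>2 \<le> real n * M k"
  proof (cases "x \<ge> 0")
    case True
    then have i: "?i \<ge> 0" by simp
    have "real n * \<bar>x\<bar> \<le> real_of_int (?i + 1)" using True by simp
    also have "\<dots> = real (card {0..?i})" using i by simp
    finally have "(real n * \<bar>x\<bar>) * (u n ?i $ k)\<^sup>2 \<le> real (card {0..?i}) * (u n ?i $ k)\<^sup>2" by (intro mult_right_mono) auto
    also have "\<dots> \<le> real n * M k" by (rule c) (auto intro: u_mono_right[OF n])
    finally show ?thesis .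
  next
    case False
    then have "real n * x < 0" using n by (simp add: mult_pos_neg)
    then have i: "?i < 0" by simp
    have "real n * \<bar>x\<bar> \<le> real_of_int (- ?i)" using False by simp
    also have "\<dots> \<le> real (card {?i..0})" using i by simp
    finally have "(real n * \<bar>x\<bar>) * (u n ?i $ k)\<^sup>2 \<le> real (card {?i..0}) * (u n ?i $ k)\<^sup>2" by (intro mult_right_mono) auto
    also have "\<dots> \<le> real n * M k" by (rule c) (auto intro: u_mono_left[OF n])
    finally show ?thesis .
  qed
  then show ?thesis using n by (simp add: Uf_def mult.assoc)
qed

lemma force_bound:
  obtains F where "F \<ge> 0" "\<And>n i. n > 0 \<Longrightarrow> norm (force (lam n) (u n i)) \<le> F"
proof -
  obtain c where c: "\<And>x. norm x \<le> C \<Longrightarrow> norm (G x) \<le> c * norm x" using G_lin[of C] by blast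
  have L0: "0 \<le> L" using lam_le[of 1] norm_ge_zero order_trans zero_less_one by blast
  show thesis
  proof (rule that[of "L * C + \<bar>c\<bar> * C"])
    fix n i assume n: "(n::nat) > 0"
    have "norm (force (lam n) (u n i)) \<le> norm (lam n) * norm (u n i) + (1/2) * norm (G (u n i))"
      unfolding force_def by (rule order_trans[OF norm_triangle_ineq4]) (simp add: norm_scaled_le)
    also have "norm (lam n) * norm (u n i) \<le> L * C" using lam_le[OF n] sup_le[OF n, of i] L0 by (intro mult_mono) auto
    also have "(1/2) * norm (G (u n i)) \<le> \<bar>c\<bar> * C"
    proof -
      have "norm (G (u n i)) \<le> c * norm (u n i)" using c sup_le[OF n] by blast
      also have "\<dots> \<le> \<bar>c\<bar> * C" using sup_le[OF n, of i] by (intro mult_mono) auto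
      finally show ?thesis using norm_ge_zero[of "G (u n i)"] by linarith
    qed
    finally show "norm (force (lam n) (u n i)) \<le> L * C + \<bar>c\<bar> * C" by simp
  qed (use L0 C_nonneg in simp)
qed

text \<open>The second difference at the site l+1 is the increment of the forward slope from l to
  l+1; this is the origin of the shifted argument here and in \<open>Df_diff\<close>.\<close>

lemma d_step:
  assumes n: "n > 0" and i: "\<bar>l + 1\<bar> \<le> int (n*n)"
  shows "d n (l+1) - d n l = (1 / real n) *\<^sub>R force (lam n) (u n (l+1))"
proof -
  have "(1 / real n) *\<^sub>R force (lam n) (u n (l+1)) = (1 / real n) *\<^sub>R ((real n)\<^sup>2 *\<^sub>R (u n (l+1+1) - 2 *\<^sub>R u n (l+1) + u n l))"
    using EL[OF n i] by simp
  also have "\<dots> = d n (l+1) - d n l"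
    using n by (simp add: d_def power2_eq_square algebra_simps scaleR_2)
  finally show ?thesis ..
qed

lemma d_diff:
  assumes n: "n > 0" and ij: "i \<le> j" and r: "- int (n*n) \<le> i + 1" "j \<le> int (n*n)"
  shows "d n j - d n i = (\<Sum>l\<in>{i..<j}. force (lam n) (u n (l+1))) /\<^sub>R real n"
proof -
  have "d n j - d n i = (\<Sum>l\<in>{i..<j}. (1 / real n) *\<^sub>R force (lam n) (u n (l+1)))"
    unfolding sum_telescope_int[OF ij, of "d n", symmetric]
    by (rule sum.cong[OF refl], rule d_step[OF n]) (use r in auto)
  then show ?thesis by (simp add: scaleR_sum_right inverse_eq_divide)
qed

lemma Df_diff:
  assumes n: "n > 0" and xy: "x \<le> y" and r: "- int (n*n) \<le> \<lfloor>real n * x\<rfloor> + 1" "\<lfloor>real n * y\<rfloor> \<le> int (n*n)"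
  shows "Df n y - Df n x = (LINT s|lborel. indicator {real_of_int \<lfloor>real n * x\<rfloor> / real n..<real_of_int \<lfloor>real n * y\<rfloor> / real n} s
            *\<^sub>R force (lam n) (Uf n (s + 1 / real n)))"
proof -
  have l: "\<lfloor>real n * x\<rfloor> \<le> \<lfloor>real n * y\<rfloor>" using xy by (intro floor_mono mult_left_mono) auto
  have "Uf n (s + 1 / real n) = u n (\<lfloor>real n * s\<rfloor> + 1)" for s
    using n by (simp add: Uf_def distrib_left)
  then show ?thesis unfolding Df_def d_diff[OF n l r]
    using has_bochner_integral_integral_eq[OF step_integral[OF n, of "\<lfloor>real n * x\<rfloor>" "\<lfloor>real n * y\<rfloor>" "\<lambda>l. force (lam n) (u n (l+1))"]]
    by simp
qed

lemma Uf_diff: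
  assumes n: "n > 0" and xy: "x \<le> y"
  shows "Uf n y - Uf n x = (LINT s|lborel. indicator {real_of_int \<lfloor>real n * x\<rfloor> / real n..<real_of_int \<lfloor>real n * y\<rfloor> / real n} s
            *\<^sub>R Df n s)"
proof -
  have l: "\<lfloor>real n * x\<rfloor> \<le> \<lfloor>real n * y\<rfloor>" using xy by (intro floor_mono mult_left_mono) auto
  have "(\<Sum>l\<in>{\<lfloor>real n * x\<rfloor>..<\<lfloor>real n * y\<rfloor>}. d n l) = (\<Sum>l\<in>{\<lfloor>real n * x\<rfloor>..<\<lfloor>real n * y\<rfloor>}. real n *\<^sub>R u n (l+1) - real n *\<^sub>R u n l)"
    by (simp add: d_def scaleR_diff_right)
  also have "\<dots> = real n *\<^sub>R u n \<lfloor>real n * y\<rfloor> - real n *\<^sub>R u n \<lfloor>real n * x\<rfloor>"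
    by (rule sum_telescope_int[OF l, of "\<lambda>l. real n *\<^sub>R u n l"])
  finally have "(\<Sum>l\<in>{\<lfloor>real n * x\<rfloor>..<\<lfloor>real n * y\<rfloor>}. d n l) /\<^sub>R real n = Uf n y - Uf n x"
    using n by (simp add: Uf_def scaleR_diff_right[symmetric])
  then show ?thesis unfolding Df_def
    using has_bochner_integral_integral_eq[OF step_integral[OF n, of "\<lfloor>real n * x\<rfloor>" "\<lfloor>real n * y\<rfloor>" "d n"]] by simp
qed

text \<open>The slope at 0 is compared with the mean slope over [0, 1], which is the difference of
  two values and hence at most 2C: by the equation the slopes there differ from the one at 0 by at
  most F. The same bound on increments carries the estimate from 0 to [-R, R], and R + 2 \<le> n
  keeps the sites where the equation holds.\<close>

lemma Df_bound:
  obtains B where "\<And>n. n > 0 \<Longrightarrow> norm (Df n 0) \<le> B"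
    "\<And>n R x. n > 0 \<Longrightarrow> R \<ge> 0 \<Longrightarrow> \<bar>x\<bar> \<le> R \<Longrightarrow> R + 2 \<le> real n \<Longrightarrow> norm (Df n x) \<le> B * (R + 2)"
proof -
  obtain F where F: "F \<ge> 0" "\<And>n i. n > 0 \<Longrightarrow> norm (force (lam n) (u n i)) \<le> F" using force_bound by blast
  have diff: "norm (d n j - d n i) \<le> F * (real_of_int (j - i) / real n)"
    if n: "n > 0" and "i \<le> j" "- int (n*n) \<le> i + 1" "j \<le> int (n*n)" for n i j
  proof -
    have "norm (d n j - d n i) \<le> (\<Sum>l\<in>{i..<j}. norm (force (lam n) (u n (l+1)))) / real n"
      using that by (simp add: d_diff norm_sum divide_right_mono inverse_eq_divide)
    also have "\<dots> \<le> (\<Sum>l\<in>{i..<j}. F) / real n" by (intro divide_right_mono sum_mono F(2) n) simp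
    finally show ?thesis using that by (simp add: mult.commute)
  qed
  have 0: "norm (d n 0) \<le> F + 2 * C" if n: "n > 0" for n
  proof -
    have s: "(\<Sum>l\<in>{0..<int n}. d n l) = real n *\<^sub>R (u n (int n) - u n 0)"
    proof -
      have "(\<Sum>l\<in>{0..<int n}. d n l) = (\<Sum>l\<in>{0..<int n}. real n *\<^sub>R u n (l+1) - real n *\<^sub>R u n l)"
        by (simp add: d_def scaleR_diff_right)
      also have "\<dots> = real n *\<^sub>R u n (int n) - real n *\<^sub>R u n 0"
        by (rule sum_telescope_int[of 0 "int n" "\<lambda>l. real n *\<^sub>R u n l"]) simp
      finally show ?thesis by (simp add: scaleR_diff_right)
    qed
    have "real n *\<^sub>R d n 0 = (\<Sum>l\<in>{0..<int n}. d n l) - (\<Sum>l\<in>{0..<int n}. d n l - d n 0)"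
      unfolding sum_subtractf sum_constant_scaleR by simp
    then have "real n * norm (d n 0) \<le> norm (real n *\<^sub>R (u n (int n) - u n 0)) + norm (\<Sum>l\<in>{0..<int n}. d n l - d n 0)"
      unfolding s by (metis abs_of_nat norm_scaleR norm_triangle_ineq4)
    also have "norm (\<Sum>l\<in>{0..<int n}. d n l - d n 0) \<le> (\<Sum>l\<in>{0..<int n}. F)"
    proof (rule order_trans[OF norm_sum], rule sum_mono)
      fix l assume l: "l \<in> {0..<int n}"
      have sq: "int n \<le> int (n*n)" unfolding of_nat_le_iff by (rule le_square)
      have "0 \<le> l" "l < int n" using l by auto
      with sq have "- int (n*n) \<le> 0 + 1" "l \<le> int (n*n)" "0 \<le> l" by linarith+
      then have "norm (d n l - d n 0) \<le> F * (real_of_int (l - 0) / real n)" by (intro diff[OF n])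
      also have "\<dots> \<le> F * 1" using l n F(1) by (intro mult_left_mono) auto
      finally show "norm (d n l - d n 0) \<le> F" by simp
    qed
    also have "norm (real n *\<^sub>R (u n (int n) - u n 0)) \<le> real n * (2 * C)"
    proof -
      have "norm (u n (int n) - u n 0) \<le> 2 * C"
        using norm_triangle_ineq4[of "u n (int n)" "u n 0"] sup_le[OF n, of "int n"] sup_le[OF n, of 0] by linarith
      then show ?thesis by (simp add: mult_left_mono)
    qed
    finally have "real n * norm (d n 0) \<le> real n * (F + 2 * C)" by (simp add: algebra_simps)
    then show ?thesis using n by simp
  qed
  show thesis
  proof (rule that[of "F + 2 * C"])
    fix n :: nat assume "n > 0" then show "norm (Df n 0) \<le> F + 2 * C" using 0 by (simp add: Df_def)
  next
    fix n :: nat and R x :: real assume n: "n > 0" and R: "R \<ge> 0" "\<bar>x\<bar> \<le> R" "R + 2 \<le> real n"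
    let ?i = "\<lfloor>real n * x\<rfloor>"
    have nx: "real n * \<bar>x\<bar> \<le> real n * R" using R by (intro mult_left_mono) auto
    have "real n * (R + 2) \<le> real n * real n" using R by (intro mult_left_mono) auto
    then have nn: "real n * R + 2 \<le> real (n*n)" using n by (simp add: algebra_simps)
    have ax: "- (real n * R) \<le> real n * x" "real n * x \<le> real n * R"
      using nx by (auto simp: abs_mult[of "real n" x, simplified, symmetric] abs_le_iff)
    have i1: "real_of_int ?i \<le> real (n*n)" "- real (n*n) \<le> real_of_int ?i + 1" using ax nn by linarith+
    have i2: "?i \<le> int (n*n)" "- int (n*n) \<le> ?i + 1"
      using i1 by (metis of_int_le_iff of_int_of_nat_eq, metis (mono_tags) of_int_le_iff of_int_of_nat_eq of_int_minus of_int_add of_int_1)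
    have "norm (d n ?i - d n 0) \<le> F * (R + 1)"
    proof (cases "?i \<ge> 0")
      case True
      then have "norm (d n ?i - d n 0) \<le> F * (real_of_int (?i - 0) / real n)" using i2 n by (intro diff) auto
      also have "real_of_int (?i - 0) / real n \<le> R + 1"
      proof -
        have "real_of_int (?i - 0) \<le> real n * R" using order_trans[OF of_int_floor_le ax(2)] by simp
        also have "\<dots> \<le> real n * (R + 1)" by (simp add: algebra_simps)
        finally show ?thesis using n by (simp add: field_simps)
      qed
      finally show ?thesis using F by (simp add: mult_left_mono)
    next
      case False
      then have "norm (d n 0 - d n ?i) \<le> F * (real_of_int (0 - ?i) / real n)" using i2 n by (intro diff) auto
      also have "real_of_int (0 - ?i) / real n \<le> R + 1"
      proof -
        have "real_of_int (0 - ?i) \<le> real n * R + 1" using ax by simp linarith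
        also have "\<dots> \<le> real n * (R + 1)" using n by (simp add: algebra_simps)
        finally show ?thesis using n by (simp add: field_simps)
      qed
      finally show ?thesis using F by (simp add: mult_left_mono norm_minus_commute)
    qed
    then have "norm (d n ?i) \<le> F * (R + 1) + (F + 2 * C)" using 0[OF n] norm_triangle_sub[of "d n ?i" "d n 0"] by linarith
    also have "\<dots> \<le> (F + 2 * C) * (R + 2)" using F C_nonneg R by (simp add: algebra_simps)
    finally show "norm (Df n x) \<le> (F + 2 * C) * (R + 2)" by (simp add: Df_def)
  qed
qed

text \<open>There is no discretisation error: the integral of the step function is the lattice sum
  itself, so limits of discrete energies are limits of integrals.\<close>

lemma integral_Df:
  assumes n: "n > 0"
  shows "has_bochner_integral lborel (\<lambda>x. (norm (Df n x))\<^sup>2) (real n * grid_dirichlet (n*n) (u n))"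
proof -
  have "has_bochner_integral lborel (\<lambda>x. (norm (Df n x))\<^sup>2) ((\<Sum>l\<in>{-int (n*n) - 1..<int (n*n) + 1}. (norm (d n l))\<^sup>2) /\<^sub>R real n)"
    unfolding Df_def by (rule step_integral_UNIV[OF n]) (use u_support[OF n] in \<open>auto simp: d_def\<close>)
  also have "{-int (n*n) - 1..<int (n*n) + 1} = {-int (n*n) - 1..int (n*n)}" by auto
  also have "(\<Sum>l\<in>{-int (n*n) - 1..int (n*n)}. (norm (d n l))\<^sup>2) /\<^sub>R real n = real n * grid_dirichlet (n*n) (u n)"
    using n by (simp add: d_def grid_dirichlet_def power_mult_distrib sum_distrib_left[symmetric] power2_eq_square[of "real n"])
  finally show ?thesis .
qed

lemma integral_Uf:
  fixes g :: "real^'k \<Rightarrow> real"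
  assumes n: "n > 0" and g: "g 0 = 0"
  shows "has_bochner_integral lborel (\<lambda>x. g (Uf n x)) ((\<Sum>i\<in>{-int (n*n)..int (n*n)}. g (u n i)) / real n)"
proof -
  have "has_bochner_integral lborel (\<lambda>x. g (Uf n x)) ((\<Sum>l\<in>{-int (n*n)..<int (n*n) + 1}. g (u n l)) /\<^sub>R real n)"
    unfolding Uf_def by (rule step_integral_UNIV[OF n, of _ _ "\<lambda>l. g (u n l)"]) (use u_support[OF n] g in auto)
  also have "{-int (n*n)..<int (n*n) + 1} = {-int (n*n)..int (n*n)}" by auto
  finally show ?thesis by (simp add: divide_inverse mult.commute)
qed

end

section \<open>Extraction of the limit profile\<close>

lemma tendsto_floor_scaled:
  fixes r :: "nat \<Rightarrow> nat"
  assumes r: "filterlim r at_top sequentially"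
  shows "(\<lambda>k. real_of_int \<lfloor>real (r k) * x\<rfloor> / real (r k)) \<longlonglongrightarrow> x"
proof -
  have r0: "\<forall>\<^sub>F k in sequentially. r k > 0" using r[unfolded filterlim_at_top, rule_format, of 1] by (simp add: Suc_le_eq)
  have inv: "(\<lambda>k. 1 / real (r k)) \<longlonglongrightarrow> 0"
    by (rule tendsto_divide_0[OF tendsto_const filterlim_at_top_imp_at_infinity[OF filterlim_compose[OF filterlim_real_sequentially r]]])
  have "(\<lambda>k. x - 1 / real (r k)) \<longlonglongrightarrow> x - 0" by (intro tendsto_intros inv)
  moreover have "\<forall>\<^sub>F k in sequentially. x - 1 / real (r k) \<le> real_of_int \<lfloor>real (r k) * x\<rfloor> / real (r k)"
    using r0
  proof eventually_elim
    case (elim k)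
    have "real (r k) * x - 1 \<le> real_of_int \<lfloor>real (r k) * x\<rfloor>" by linarith
    then have "(real (r k) * x - 1) / real (r k) \<le> real_of_int \<lfloor>real (r k) * x\<rfloor> / real (r k)"
      by (rule divide_right_mono) simp
    then show ?case using elim by (simp add: diff_divide_distrib)
  qed
  moreover have "\<forall>\<^sub>F k in sequentially. real_of_int \<lfloor>real (r k) * x\<rfloor> / real (r k) \<le> x"
    using r0
  proof eventually_elim
    case (elim k)
    have "real_of_int \<lfloor>real (r k) * x\<rfloor> \<le> real (r k) * x" by linarith
    then show ?case using elim by (simp add: field_simps)
  qed
  ultimately show ?thesis using tendsto_const[of x] by (auto intro: tendsto_sandwich)
qed

context grid_sequence begin

text \<open>The initial slope is made to converge as well: with it the discrete equations determine the limit slope.\<close>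

lemma subsequence_exists:
  obtains r lam0 d0 E s0 where "strict_mono r" "\<And>k. r k > 0" "(\<lambda>k. lam (r k)) \<longlonglongrightarrow> lam0"
    "(\<lambda>k. Df (r k) 0) \<longlonglongrightarrow> d0" "(\<lambda>k. real (r k) * grid_dirichlet (r k * r k) (u (r k))) \<longlonglongrightarrow> E"
    "\<And>q::rat. (\<lambda>k. Uf (r k) (of_rat q)) \<longlonglongrightarrow> s0 q"
proof -
  obtain B where B: "\<And>n. n > 0 \<Longrightarrow> norm (Df n 0) \<le> B" using Df_bound by metis
  \<comment> \<open>Only values at rational points are recorded: over a countable index set the
    product is metrisable, and one use of compactness for the whole tuple replaces a diagonal
    argument.\<close>
  define S where "S = {s :: rat \<Rightarrow> real^'k. \<forall>q. s q \<in> cball 0 C} \<times> cball (0::real^'k) L \<times> cball (0::real^'k) B \<times> {0..C}"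
  \<comment> \<open>The index is \<open>Suc n\<close> because all estimates concern positive
    n.\<close>
  define z where "z n = ((\<lambda>q. Uf (Suc n) (real_of_rat q)), lam (Suc n), Df (Suc n) 0, real (Suc n) * grid_dirichlet (Suc n * Suc n) (u (Suc n)))" for n
  have "compact S" unfolding S_def by (intro compact_Times compact_cball compact_Icc compact_pointwise)
  then have "seq_compact S" by (simp add: compact_eq_seq_compact_metric)
  moreover have "z n \<in> S" for n
    unfolding z_def S_def using B[of "Suc n"] sup_le[of "Suc n"] lam_le[of "Suc n"] dir_le[of "Suc n"]
    by (auto simp: Uf_def grid_dirichlet_def intro!: mult_nonneg_nonneg sum_nonneg simp del: of_nat_Suc mult_Suc mult_Suc_right)
  ultimately obtain t l where t: "strict_mono t" "(z \<circ> t) \<longlonglongrightarrow> l" unfolding seq_compact_def by metis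
  obtain s0 lam0 d0 E where l: "l = (s0, lam0, d0, E)" by (cases l) auto
  have f: "(\<lambda>k. fst (z (t k))) \<longlonglongrightarrow> s0" using tendsto_fst[OF t(2)] by (simp add: l o_def)
  have sn: "(\<lambda>k. snd (z (t k))) \<longlonglongrightarrow> (lam0, d0, E)" using tendsto_snd[OF t(2)] by (simp add: l o_def)
  have sn2: "(\<lambda>k. snd (snd (z (t k)))) \<longlonglongrightarrow> (d0, E)" using tendsto_snd[OF sn] by simp
  show thesis
  proof (rule that[of "\<lambda>k. Suc (t k)" lam0 d0 E s0])
    show "strict_mono (\<lambda>k. Suc (t k))" using t(1) by (simp add: strict_mono_def)
    show "(\<lambda>k. lam (Suc (t k))) \<longlonglongrightarrow> lam0" using tendsto_fst[OF sn] by (simp add: z_def)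
    show "(\<lambda>k. Df (Suc (t k)) 0) \<longlonglongrightarrow> d0" using tendsto_fst[OF sn2] by (simp add: z_def)
    show "(\<lambda>k. real (Suc (t k)) * grid_dirichlet (Suc (t k) * Suc (t k)) (u (Suc (t k)))) \<longlonglongrightarrow> E"
      using tendsto_snd[OF sn2] by (simp add: z_def)
    fix q
    have "isCont (\<lambda>s::rat \<Rightarrow> real^'k. s q) s0"
      by (rule continuous_on_eq_continuous_at[OF open_UNIV, THEN iffD1, OF continuous_on_product_coordinates, rule_format]) simp
    from isCont_tendsto_compose[OF this f] show "(\<lambda>k. Uf (Suc (t k)) (of_rat q)) \<longlonglongrightarrow> s0 q" by (simp add: z_def)
  qed simp
qed

text \<open>The integrated identities \<open>Uf_diff\<close> and \<open>Df_diff\<close> pass to the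
  limit, so W is obtained as a classical solution without regularity theory. The limit E of the
  Dirichlet energies may exceed the Dirichlet energy of W; the potential energies converge.\<close>

lemma limit_exists:
  obtains r W W' lam0 E where "strict_mono r" "\<And>k. r k > 0"
    "\<And>x. (W has_vector_derivative W' x) (at x)"
    "\<And>x. (W' has_vector_derivative force lam0 (W x)) (at x)"
    "\<And>x k. 0 \<le> W x $ k" "\<And>x. norm (W x) \<le> C" "\<And>x k. \<bar>x\<bar> * (W x $ k)\<^sup>2 \<le> M k"
    "\<And>k. integrable lborel (\<lambda>x. (W x $ k)\<^sup>2)" "\<And>k. (LINT x|lborel. (W x $ k)\<^sup>2) \<le> M k"
    "integrable lborel (\<lambda>x. (norm (W' x))\<^sup>2)" "(LINT x|lborel. (norm (W' x))\<^sup>2) \<le> E"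
    "integrable lborel (\<lambda>x. V (W x))"
    "(\<lambda>k. grid_energy (r k) (r k * r k) (u (r k))) \<longlonglongrightarrow> E - (LINT x|lborel. V (W x))"
proof -
  obtain r lam0 d0 E s0 where r: "strict_mono r" "\<And>k. r k > 0" "(\<lambda>k. lam (r k)) \<longlonglongrightarrow> lam0"
    "(\<lambda>k. Df (r k) 0) \<longlonglongrightarrow> d0" "(\<lambda>k. real (r k) * grid_dirichlet (r k * r k) (u (r k))) \<longlonglongrightarrow> E"
    "\<And>q::rat. (\<lambda>k. Uf (r k) (of_rat q)) \<longlonglongrightarrow> s0 q" by (rule subsequence_exists) (rule that)
  have rlim: "filterlim r at_top sequentially" using r(1) by (rule filterlim_subseq)
  have inv: "(\<lambda>k. 1 / real (r k)) \<longlonglongrightarrow> 0"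
    by (rule tendsto_divide_0[OF tendsto_const filterlim_at_top_imp_at_infinity[OF filterlim_compose[OF filterlim_real_sequentially rlim]]])
  have rlarge: "\<forall>\<^sub>F k in sequentially. x \<le> real (r k)" for x
    using filterlim_compose[OF filterlim_real_sequentially rlim] by (simp add: filterlim_at_top)

  \<comment> \<open>Convergence at rational points spreads to every x by the common modulus of
    continuity. \<eta> is such that a rational within \<eta>, together with a rounding error below
    \<eta>, costs less than e/3 in \<open>Uf_hoelder\<close>.\<close>
  have "convergent (\<lambda>k. Uf (r k) x)" for x
  proof (rule Cauchy_convergent, rule metric_CauchyI)
    fix e :: real assume e: "e > 0"
    define \<eta> where "\<eta> = (e/3)\<^sup>2 / (2 * (C + 1))"
    have \<eta>: "\<eta> > 0" using e C_nonneg by (simp add: \<eta>_def)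
    obtain q where q: "x < real_of_rat q" "real_of_rat q < x + \<eta>" using of_rat_dense[of x "x + \<eta>"] \<eta> by auto
    obtain k1 where k1: "\<And>k. k \<ge> k1 \<Longrightarrow> 1 / real (r k) < \<eta>"
      using order_tendstoD(2)[OF inv \<eta>] unfolding eventually_sequentially by blast
    have near: "norm (Uf (r k) x - Uf (r k) (of_rat q)) < e / 3" if "k \<ge> k1" for k
    proof -
      have "(norm (Uf (r k) x - Uf (r k) (of_rat q)))\<^sup>2 \<le> C * (\<bar>x - of_rat q\<bar> + 1 / real (r k))"
        by (rule Uf_hoelder[OF r(2)])
      also have "\<dots> \<le> C * (2 * \<eta>)" using q k1[OF that] C_nonneg by (intro mult_left_mono) auto
      also have "\<dots> < (C + 1) * (2 * \<eta>)" using \<eta> by (intro mult_strict_right_mono) auto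
      also have "\<dots> = (e/3)\<^sup>2" using C_nonneg by (simp add: \<eta>_def field_simps)
      finally show ?thesis by (rule power2_less_imp_less) (use e in simp)
    qed
    have "Cauchy (\<lambda>k. Uf (r k) (of_rat q))" using r(6) by (rule LIMSEQ_imp_Cauchy)
    then obtain k2 where k2: "\<And>m n. m \<ge> k2 \<Longrightarrow> n \<ge> k2 \<Longrightarrow> dist (Uf (r m) (of_rat q)) (Uf (r n) (of_rat q)) < e / 3"
      unfolding Cauchy_def using e by (meson divide_pos_pos zero_less_numeral)
    show "\<exists>M. \<forall>m\<ge>M. \<forall>n\<ge>M. dist (Uf (r m) x) (Uf (r n) x) < e"
    proof (intro exI[of _ "max k1 k2"] allI impI)
      fix m n assume mn: "m \<ge> max k1 k2" "n \<ge> max k1 k2"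
      have "dist (Uf (r m) x) (Uf (r m) (of_rat q)) < e / 3" "dist (Uf (r n) x) (Uf (r n) (of_rat q)) < e / 3"
        using near mn by (auto simp: dist_norm)
      moreover have "dist (Uf (r m) (of_rat q)) (Uf (r n) (of_rat q)) < e / 3" using k2 mn by auto
      ultimately show "dist (Uf (r m) x) (Uf (r n) x) < e"
        using dist_triangle[of "Uf (r m) x" "Uf (r n) x" "Uf (r m) (of_rat q)"]
          dist_triangle2[of "Uf (r m) (of_rat q)" "Uf (r n) x" "Uf (r n) (of_rat q)"]
        by linarith
    qed
  qed
  then obtain W where W: "\<And>x. (\<lambda>k. Uf (r k) x) \<longlonglongrightarrow> W x" unfolding convergent_def by metis
  have Wk: "(\<lambda>k. Uf (r k) x $ j) \<longlonglongrightarrow> W x $ j" for x j using W by (intro tendsto_intros)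
  have W0: "0 \<le> W x $ j" for x j
    by (rule LIMSEQ_le_const[OF Wk]) (use u_nonneg[OF r(2)] in \<open>auto simp: Uf_def\<close>)
  have Wsup: "norm (W x) \<le> C" for x
    by (rule LIMSEQ_le_const2[OF tendsto_norm[OF W]]) (use sup_le[OF r(2)] in \<open>auto simp: Uf_def\<close>)
  have Wdec: "\<bar>x\<bar> * (W x $ j)\<^sup>2 \<le> M j" for x j
    by (rule LIMSEQ_le_const2[OF tendsto_mult[OF tendsto_const tendsto_power[OF Wk]]]) (use Uf_decay[OF r(2)] in auto)
  have Whol: "(norm (W y - W x))\<^sup>2 \<le> C * \<bar>y - x\<bar>" for x y
  proof (rule LIMSEQ_le[OF tendsto_power[OF tendsto_norm[OF tendsto_diff[OF W W]]]])
    show "(\<lambda>k. C * (\<bar>y - x\<bar> + 1 / real (r k))) \<longlonglongrightarrow> C * \<bar>y - x\<bar>"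
      using tendsto_mult[OF tendsto_const tendsto_add[OF tendsto_const inv], of C "\<bar>y - x\<bar>"] by simp
  qed (use Uf_hoelder[OF r(2)] in auto)
  have Wcont: "continuous_on UNIV W"
  proof (rule continuous_at_imp_continuous_on, rule ballI)
    fix x
    have "((\<lambda>y. sqrt (C * \<bar>y - x\<bar>)) \<longlongrightarrow> 0) (at x)"
      by (auto intro!: tendsto_eq_intros)
    then have "((\<lambda>y. norm (W y - W x)) \<longlongrightarrow> 0) (at x)"
      by (rule Lim_null_comparison[rotated]) (use Whol in \<open>auto intro!: always_eventually real_le_rsqrt\<close>)
    then show "isCont W x" unfolding isCont_def using tendsto_norm_zero_iff LIM_zero_iff by blast
  qed
  \<comment> \<open>The shift by one cell in the discrete equation is harmless in the limit.\<close>
  have Wshift: "(\<lambda>k. Uf (r k) (x + 1 / real (r k))) \<longlonglongrightarrow> W x" for x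
  proof -
    have b: "norm (Uf (r k) (x + 1 / real (r k)) - Uf (r k) x) \<le> sqrt (C * (1 / real (r k) + 1 / real (r k)))" for k
      by (rule real_le_rsqrt) (use Uf_hoelder[OF r(2)[of k], of "x + 1 / real (r k)" x] in simp)
    have "(\<lambda>k. sqrt (C * (1 / real (r k) + 1 / real (r k)))) \<longlonglongrightarrow> sqrt (C * (0 + 0))"
      by (intro tendsto_intros inv)
    then have "(\<lambda>k. sqrt (C * (1 / real (r k) + 1 / real (r k)))) \<longlonglongrightarrow> 0" by simp
    then have "(\<lambda>k. norm (Uf (r k) (x + 1 / real (r k)) - Uf (r k) x)) \<longlonglongrightarrow> 0"
      by (rule Lim_null_comparison[rotated]) (use b in simp)
    then have "(\<lambda>k. Uf (r k) (x + 1 / real (r k)) - Uf (r k) x) \<longlonglongrightarrow> 0" by (rule tendsto_norm_zero_cancel)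
    from tendsto_add[OF this W[of x]] show ?thesis by simp
  qed
  define \<Phi> where "\<Phi> = (\<lambda>x. force lam0 (W x))"
  define \<Phi>n where "\<Phi>n k s = force (lam (r k)) (Uf (r k) (s + 1 / real (r k)))" for k s
  have \<Phi>lim: "(\<lambda>k. \<Phi>n k s) \<longlonglongrightarrow> \<Phi> s" for s unfolding \<Phi>_def \<Phi>n_def by (intro tendsto_force r Wshift)
  obtain F where F: "F \<ge> 0" "\<And>n i. n > 0 \<Longrightarrow> norm (force (lam n) (u n i)) \<le> F" using force_bound by blast
  have \<Phi>bd: "norm (\<Phi>n k s) \<le> F" for k s unfolding \<Phi>n_def Uf_def using F(2) r(2) by blast
  have \<Phi>cont: "continuous_on UNIV \<Phi>" unfolding \<Phi>_def by (rule continuous_force[OF Wcont])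
  have \<Phi>m: "\<Phi> \<in> borel_measurable lborel" using borel_measurable_continuous_onI[OF \<Phi>cont] by simp
  have \<Phi>nm: "\<Phi>n k \<in> borel_measurable lborel" for k
  proof -
    have "\<Phi>n k = (\<lambda>s. force (lam (r k)) (u (r k) (\<lfloor>real (r k) * s\<rfloor> + 1)))"
      using r(2)[of k] by (auto simp: \<Phi>n_def Uf_def distrib_left fun_eq_iff)
    also have "\<dots> \<in> borel_measurable lborel"
      using measurable_step[of "\<lambda>i. force (lam (r k)) (u (r k) (i + 1))" "r k"] .
    finally show ?thesis .
  qed
  have region: "\<forall>\<^sub>F k in sequentially. - int (r k * r k) \<le> \<lfloor>real (r k) * x\<rfloor> + 1 \<and> \<lfloor>real (r k) * x\<rfloor> \<le> int (r k * r k)" for x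
    using rlarge[of "\<bar>x\<bar> + 1"]
  proof eventually_elim
    case (elim k)
    have rk: "real (r k) \<ge> 1" using elim by linarith
    have "real (r k) * (\<bar>x\<bar> + 1) \<le> real (r k) * real (r k)" using elim by (intro mult_left_mono) auto
    then have b: "real (r k) * \<bar>x\<bar> + 1 \<le> real (r k * r k)" using rk by (simp add: algebra_simps)
    have "\<bar>real (r k) * x\<bar> = real (r k) * \<bar>x\<bar>" by (simp add: abs_mult)
    then have "real (r k) * x \<le> real (r k * r k)" "- real (r k * r k) \<le> real (r k) * x" using b by linarith+
    then have "real_of_int \<lfloor>real (r k) * x\<rfloor> \<le> real_of_int (int (r k * r k))" "real_of_int (- int (r k * r k)) \<le> real_of_int (\<lfloor>real (r k) * x\<rfloor> + 1)"
      unfolding of_int_minus of_int_of_nat_eq of_int_add of_int_1 by linarith+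
    then show ?case by (simp only: of_int_le_iff simp_thms)
  qed
  have fl: "(\<lambda>k. real_of_int \<lfloor>real (r k) * x\<rfloor> / real (r k)) \<longlonglongrightarrow> x" for x by (rule tendsto_floor_scaled[OF rlim])
  have Dlim: "(\<lambda>k. Df (r k) y - Df (r k) x) \<longlonglongrightarrow> (LINT s|lborel. indicator {x..<y} s *\<^sub>R \<Phi> s)" if xy: "x \<le> y" for x y
  proof -
    have "(\<lambda>k. LINT s|lborel. indicator {real_of_int \<lfloor>real (r k) * x\<rfloor> / real (r k)..<real_of_int \<lfloor>real (r k) * y\<rfloor> / real (r k)} s *\<^sub>R \<Phi>n k s)
        \<longlonglongrightarrow> (LINT s|lborel. indicator {x..<y} s *\<^sub>R \<Phi> s)"
      by (rule tendsto_step_integral(1)[OF fl fl xy \<Phi>nm \<Phi>m \<Phi>lim always_eventually]) (use \<Phi>bd in blast)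
    moreover have "\<forall>\<^sub>F k in sequentially. (LINT s|lborel. indicator {real_of_int \<lfloor>real (r k) * x\<rfloor> / real (r k)..<real_of_int \<lfloor>real (r k) * y\<rfloor> / real (r k)} s *\<^sub>R \<Phi>n k s)
        = Df (r k) y - Df (r k) x"
      using region[of x] region[of y]
      by eventually_elim (use Df_diff[OF r(2) xy] in \<open>auto simp: \<Phi>n_def\<close>)
    ultimately show ?thesis by (rule Lim_transform_eventually)
  qed
  have "convergent (\<lambda>k. Df (r k) x)" for x
  proof (cases "0 \<le> x")
    case True
    from tendsto_add[OF Dlim[OF True] r(4)] show ?thesis by (auto simp: convergent_def)
  next
    case False
    then have "x \<le> 0" by simp
    from tendsto_diff[OF r(4) Dlim[OF this]] show ?thesis by (auto simp: convergent_def)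
  qed
  then obtain W' where W': "\<And>x. (\<lambda>k. Df (r k) x) \<longlonglongrightarrow> W' x" unfolding convergent_def by metis
  have W'eq: "W' y - W' x = (LINT s|lborel. indicator {x..<y} s *\<^sub>R \<Phi> s)" if "x \<le> y" for x y
    using tendsto_diff[OF W'[of y] W'[of x]] Dlim[OF that] by (rule LIMSEQ_unique)
  have W'd: "(W' has_vector_derivative \<Phi> x) (at x)" for x
    by (rule integral_has_vector_derivative_UNIV[OF \<Phi>cont W'eq])
  then have W'cont: "continuous_on UNIV W'"
    by (intro continuous_at_imp_continuous_on ballI has_vector_derivative_continuous) 
  have W'm: "W' \<in> borel_measurable lborel" using borel_measurable_continuous_onI[OF W'cont] by simp
  obtain B where B: "\<And>n R x. n > 0 \<Longrightarrow> R \<ge> 0 \<Longrightarrow> \<bar>x\<bar> \<le> R \<Longrightarrow> R + 2 \<le> real n \<Longrightarrow> norm (Df n x) \<le> B * (R + 2)"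
    using Df_bound by metis
  have Weq: "W y - W x = (LINT s|lborel. indicator {x..<y} s *\<^sub>R W' s)" if xy: "x \<le> y" for x y
  proof -
    define R where "R = \<bar>x\<bar> + \<bar>y\<bar> + 1"
    have "(\<lambda>k. LINT s|lborel. indicator {real_of_int \<lfloor>real (r k) * x\<rfloor> / real (r k)..<real_of_int \<lfloor>real (r k) * y\<rfloor> / real (r k)} s *\<^sub>R Df (r k) s)
        \<longlonglongrightarrow> (LINT s|lborel. indicator {x..<y} s *\<^sub>R W' s)"
    proof (rule tendsto_step_integral(1)[OF fl fl xy measurable_Uf(2) W'm W'])
      show "\<forall>\<^sub>F k in sequentially. \<forall>s. x - 1 \<le> s \<longrightarrow> s \<le> y + 1 \<longrightarrow> norm (Df (r k) s) \<le> B * (R + 2)"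
        using rlarge[of "R + 2"]
      proof eventually_elim
        case (elim k)
        show ?case
        proof (intro allI impI)
          fix s assume "x - 1 \<le> s" "s \<le> y + 1"
          then have "\<bar>s\<bar> \<le> R" unfolding R_def by linarith
          then show "norm (Df (r k) s) \<le> B * (R + 2)" using elim by (intro B[OF r(2)]) (auto simp: R_def)
        qed
      qed
    qed
    then have "(\<lambda>k. Uf (r k) y - Uf (r k) x) \<longlonglongrightarrow> (LINT s|lborel. indicator {x..<y} s *\<^sub>R W' s)"
      unfolding Uf_diff[OF r(2) xy] .
    with tendsto_diff[OF W[of y] W[of x]] show ?thesis by (rule LIMSEQ_unique)
  qed
  have Wd: "(W has_vector_derivative W' x) (at x)" for x
    by (rule integral_has_vector_derivative_UNIV[OF W'cont Weq])
  have mass: "integrable lborel (\<lambda>x. (W x $ j)\<^sup>2)" "(LINT x|lborel. (W x $ j)\<^sup>2) \<le> M j" for j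
  proof -
    have i: "has_bochner_integral lborel (\<lambda>x. (Uf (r k) x $ j)\<^sup>2) (grid_mass (r k) (r k * r k) (u (r k)) j)" for k
      using integral_Uf[OF r(2)[of k], of "\<lambda>z. (z $ j)\<^sup>2"] by (simp add: grid_mass_def)
    have e: "(LINT x|lborel. (Uf (r k) x $ j)\<^sup>2) \<le> M j" for k
      using has_bochner_integral_integral_eq[OF i[of k]] feas[OF r(2)[of k]] by (simp add: feasible_def)
    have m: "(\<lambda>x. (Uf (r k) x $ j)\<^sup>2) \<in> borel_measurable lborel" for k
      using has_bochner_integral_iff i borel_measurable_integrable by blast
    show "integrable lborel (\<lambda>x. (W x $ j)\<^sup>2)" "(LINT x|lborel. (W x $ j)\<^sup>2) \<le> M j"
      using fatou_limit[OF m _ _ tendsto_power[OF Wk] e tendsto_const] i by (auto simp: has_bochner_integral_iff)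
  qed
  have dir: "integrable lborel (\<lambda>x. (norm (W' x))\<^sup>2)" "(LINT x|lborel. (norm (W' x))\<^sup>2) \<le> E"
  proof -
    note i = integral_Df[OF r(2)]
    have m: "(\<lambda>x. (norm (Df (r k) x))\<^sup>2) \<in> borel_measurable lborel" for k
      using has_bochner_integral_iff i borel_measurable_integrable by blast
    have e: "(LINT x|lborel. (norm (Df (r k) x))\<^sup>2) \<le> real (r k) * grid_dirichlet (r k * r k) (u (r k))" for k
      using has_bochner_integral_integral_eq[OF i[of k]] by simp
    show "integrable lborel (\<lambda>x. (norm (W' x))\<^sup>2)" "(LINT x|lborel. (norm (W' x))\<^sup>2) \<le> E"
      using fatou_limit[OF m _ _ tendsto_power[OF tendsto_norm[OF W']] e r(5)] i by (auto simp: has_bochner_integral_iff)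
  qed
  \<comment> \<open>If t is the norm at x, then V is at most a constant times t^(2+a) =
    (t^2)^\<sigma>, and the decay of t^2 like 1/|x| turns this into |x|^(-\<sigma>) with \<sigma> >
    1. Near the origin t \<le> C is used instead; Q covers both cases.\<close>
  define \<sigma> where "\<sigma> = 1 + a / 2"
  define Q where "Q = K * (1 + C powr (b - a)) * ((C\<^sup>2) powr \<sigma> + total_mass powr \<sigma>)"
  have Vbd: "\<bar>V (Uf n x)\<bar> \<le> Q * min 1 (\<bar>x\<bar> powr (-\<sigma>))" if n: "n > 0" and x: "x \<noteq> 0" for n x
  proof -
    define t where "t = norm (Uf n x)"
    have t0: "0 \<le> t" and tC: "t \<le> C" using sup_le[OF n] by (auto simp: t_def Uf_def)
    have "\<bar>x\<bar> * t\<^sup>2 = (\<Sum>k\<in>UNIV. \<bar>x\<bar> * (Uf n x $ k)\<^sup>2)" unfolding t_def power2_norm_vec sum_distrib_left ..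
    also have "\<dots> \<le> total_mass" unfolding total_mass_def by (intro sum_mono Uf_decay n)
    finally have tx: "t\<^sup>2 \<le> total_mass / \<bar>x\<bar>" using x by (simp add: field_simps)
    have s: "(t\<^sup>2) powr \<sigma> = t\<^sup>2 * t powr a"
    proof (cases "t = 0")
      case False
      then show ?thesis using t0 by (simp add: \<sigma>_def powr_add powr_powr powr_numeral[symmetric] del: powr_numeral)
    qed simp
    have \<sigma>0: "\<sigma> \<ge> 0" using a_pos by (simp add: \<sigma>_def)
    have 1: "(t\<^sup>2) powr \<sigma> \<le> (C\<^sup>2) powr \<sigma>" using t0 tC \<sigma>0 by (intro powr_mono2 power_mono) auto
    have 2: "(t\<^sup>2) powr \<sigma> \<le> total_mass powr \<sigma> * \<bar>x\<bar> powr (-\<sigma>)"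
    proof -
      have "(t\<^sup>2) powr \<sigma> \<le> (total_mass / \<bar>x\<bar>) powr \<sigma>" using tx \<sigma>0 by (intro powr_mono2) auto
      also have "\<dots> = total_mass powr \<sigma> * \<bar>x\<bar> powr (-\<sigma>)" using total_mass_pos by (simp add: powr_divide powr_minus_divide)
      finally show ?thesis .
    qed
    have 3: "(t\<^sup>2) powr \<sigma> \<le> ((C\<^sup>2) powr \<sigma> + total_mass powr \<sigma>) * min 1 (\<bar>x\<bar> powr (-\<sigma>))"
    proof (cases "1 \<le> \<bar>x\<bar> powr (-\<sigma>)")
      case True
      then show ?thesis using 1 by (simp add: min_absorb1) (smt (verit) powr_ge_zero)
    next
      case False
      have "0 \<le> (C\<^sup>2) powr \<sigma> * \<bar>x\<bar> powr (-\<sigma>)" by simp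
      then show ?thesis using 2 False by (simp add: min_absorb2 distrib_right add_increasing)
    qed
    have "\<bar>V (Uf n x)\<bar> \<le> K * t\<^sup>2 * (t powr a + t powr b)" using V_growth[of "Uf n x"] by (simp add: t_def)
    also have "t powr b = t powr a * t powr (b - a)" by (simp add: powr_add[symmetric])
    also have "K * t\<^sup>2 * (t powr a + t powr a * t powr (b - a)) = K * (1 + t powr (b - a)) * (t\<^sup>2) powr \<sigma>"
      unfolding s by (simp add: algebra_simps)
    also have "\<dots> \<le> K * (1 + C powr (b - a)) * (((C\<^sup>2) powr \<sigma> + total_mass powr \<sigma>) * min 1 (\<bar>x\<bar> powr (-\<sigma>)))"
      using K_nonneg a_le_b t0 tC by (intro mult_mono 3 mult_left_mono add_left_mono powr_mono2 mult_nonneg_nonneg) auto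
    finally show ?thesis by (simp add: Q_def mult.assoc)
  qed
  have Vm: "V \<in> borel_measurable borel" by (rule borel_measurable_continuous_onI[OF V_cont])
  have Wm: "W \<in> borel_measurable lborel" using borel_measurable_continuous_onI[OF Wcont] by simp
  have m1: "(\<lambda>x. V (Uf (r k) x)) \<in> borel_measurable lborel" for k using measurable_compose[OF measurable_Uf(1) Vm] .
  have m2: "(\<lambda>x. V (W x)) \<in> borel_measurable lborel" using measurable_compose[OF Wm Vm] .
  have w: "integrable lborel (\<lambda>x. Q * min 1 (\<bar>x\<bar> powr (-\<sigma>)))"
    using a_pos by (intro integrable_mult_right integrable_min_powr) (simp add: \<sigma>_def)
  have l: "AE x in lborel. (\<lambda>k. V (Uf (r k) x)) \<longlonglongrightarrow> V (W x)"
  proof (rule AE_I2)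
    fix x
    have "isCont V (W x)" using V_cont by (simp add: continuous_on_eq_continuous_at)
    then show "(\<lambda>k. V (Uf (r k) x)) \<longlonglongrightarrow> V (W x)" by (rule isCont_tendsto_compose[OF _ W])
  qed
  have bd: "AE x in lborel. norm (V (Uf (r k) x)) \<le> Q * min 1 (\<bar>x\<bar> powr (-\<sigma>))" for k
    using AE_lborel_singleton[of 0] by eventually_elim (use Vbd[OF r(2)] in auto)
  have Vint: "integrable lborel (\<lambda>x. V (W x))" by (rule integrable_dominated_convergence[OF m2 m1 w l bd])
  have "(\<lambda>k. LINT x|lborel. V (Uf (r k) x)) \<longlonglongrightarrow> (LINT x|lborel. V (W x))"
    by (rule integral_dominated_convergence[OF m2 m1 w l bd])
  then have Vlim: "(\<lambda>k. (\<Sum>i\<in>{-int (r k * r k)..int (r k * r k)}. V (u (r k) i)) / real (r k)) \<longlonglongrightarrow> (LINT x|lborel. V (W x))"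
    using has_bochner_integral_integral_eq[OF integral_Uf[OF r(2), of V]] by simp
  have Elim: "(\<lambda>k. grid_energy (r k) (r k * r k) (u (r k))) \<longlonglongrightarrow> E - (LINT x|lborel. V (W x))"
    unfolding grid_energy_def by (intro tendsto_diff r(5) Vlim)
  show thesis
    by (rule that[OF r(1,2) Wd W'd[unfolded \<Phi>_def] W0 Wsup Wdec mass dir Vint Elim])
qed

end

subsection \<open>Comparison with arbitrary competitors\<close>

lemma vanishing_imp_bounded:
  fixes v :: "real \<Rightarrow> 'b::real_normed_vector"
  assumes c: "continuous_on UNIV v" and lim: "(v \<longlongrightarrow> 0) at_infinity"
  obtains B where "B > 0" "\<And>x. norm (v x) \<le> B"
proof -
  obtain R where R: "\<And>x. \<bar>x\<bar> \<ge> R \<Longrightarrow> norm (v x) < 1"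
    using tendstoD[OF lim zero_less_one] unfolding eventually_at_infinity by auto
  have "compact (v ` {-R..R})" by (rule compact_continuous_image[OF continuous_on_subset[OF c]]) auto
  then obtain B where B: "B > 0" "\<And>y. y \<in> v ` {-R..R} \<Longrightarrow> norm y \<le> B"
    using compact_imp_bounded bounded_pos by metis
  show thesis
  proof (rule that[of "max B 1"])
    fix x show "norm (v x) \<le> max B 1"
    proof (cases "\<bar>x\<bar> \<ge> R")
      case True
      then show ?thesis using R[of x] by simp
    next
      case False
      then have "v x \<in> v ` {-R..R}" by (intro imageI) auto
      then show ?thesis using B(2) by (simp add: le_max_iff_disj)
    qed
  qed simp
qed

lemma less_abs_divide: "0 < n \<Longrightarrow> n * n < \<bar>z\<bar> \<Longrightarrow> n < \<bar>z / n\<bar>" for n z :: real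
  by (simp add: abs_divide pos_less_divide_eq)

context coupled_energy begin

text \<open>Riemann sums, written as integrals of step functions so that dominated convergence
  applies. The index is shifted by \<open>n0\<close> so that the window [-n, n] contains the
  support, whose radius is enlarged by 1 since rounding moves a point by at most 1.\<close>

lemma tendsto_grid_sum:
  fixes g :: "real^'k \<Rightarrow> real" and v :: "real \<Rightarrow> real^'k"
  assumes g: "continuous_on UNIV g" "g 0 = 0" and v: "continuous_on UNIV v" "\<And>x. \<bar>x\<bar> > R \<Longrightarrow> v x = 0"
  shows "(\<lambda>n. (\<Sum>i\<in>{-int (n*n)..int (n*n)}. g (v (real_of_int i / real n))) / real n) \<longlonglongrightarrow> (LINT x|lborel. g (v x))"
proof -
  define R' where "R' = \<bar>R\<bar> + 1"
  have R'0: "R' \<ge> 1" by (simp add: R'_def)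
  have gv: "continuous_on UNIV (\<lambda>x. g (v x))" by (rule continuous_on_compose2[OF g(1) v(1)]) auto
  have "((\<lambda>x. g (v x)) \<longlongrightarrow> 0) at_infinity"
    by (rule tendsto_eventually) (use v(2) g(2) in \<open>auto simp: eventually_at_infinity intro!: exI[of _ "R+1"]\<close>)
  then obtain B where B: "\<And>x. norm (g (v x)) \<le> B" using vanishing_imp_bounded[OF gv] by metis
  have fl: "(\<lambda>n. real_of_int \<lfloor>real n * x\<rfloor> / real n) \<longlonglongrightarrow> x" for x
    using tendsto_floor_scaled[OF filterlim_ident] .
  obtain n0 where n0: "real n0 > R'" using reals_Archimedean2 by blast
  let ?s = "\<lambda>n x. g (v (real_of_int \<lfloor>real (n+n0) * x\<rfloor> / real (n+n0)))"
  have m: "?s n \<in> borel_measurable lborel" for n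
    using measurable_step[of "\<lambda>i. g (v (real_of_int i / real (n+n0)))" "n+n0"] .
  have m0: "(\<lambda>x. g (v x)) \<in> borel_measurable lborel" using borel_measurable_continuous_onI[OF gv] by simp
  have w: "integrable lborel (\<lambda>x. B * indicator {-R'..R'} x)"
    by (intro integrable_mult_right integrable_real_indicator) (auto simp: emeasure_lborel_Icc_eq)
  have l: "(\<lambda>n. ?s n x) \<longlonglongrightarrow> g (v x)" for x
  proof -
    have "isCont (\<lambda>x. g (v x)) x" using gv by (simp add: continuous_on_eq_continuous_at)
    from isCont_tendsto_compose[OF this fl[of x]]
    show ?thesis by (rule LIMSEQ_ignore_initial_segment)
  qed
  have bd: "norm (?s n x) \<le> B * indicator {-R'..R'} x" for n x
  proof (cases "x \<in> {-R'..R'}")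
    case True then show ?thesis using B by simp
  next
    case False
    let ?n = "n + n0"
    have n: "real ?n > R'" using n0 by simp
    then have np: "real ?n \<ge> 1" using R'0 by linarith
    have "\<bar>real_of_int \<lfloor>real ?n * x\<rfloor> / real ?n - x\<bar> \<le> 1"
    proof -
      have "real_of_int \<lfloor>real ?n * x\<rfloor> / real ?n - x = (real_of_int \<lfloor>real ?n * x\<rfloor> - real ?n * x) / real ?n"
        using np by (simp add: diff_divide_distrib)
      also have "\<bar>\<dots>\<bar> \<le> 1 / real ?n" unfolding abs_divide by (intro frac_le) (use np in \<open>linarith+\<close>)
      also have "\<dots> \<le> 1" using np by simp
      finally show ?thesis .
    qed
    moreover have "\<bar>x\<bar> > R'" using False by auto
    ultimately have "\<bar>real_of_int \<lfloor>real ?n * x\<rfloor> / real ?n\<bar> > R" unfolding R'_def by linarith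
    then show ?thesis using False v(2) g(2) by simp
  qed
  have lim: "(\<lambda>n. LINT x|lborel. ?s n x) \<longlonglongrightarrow> (LINT x|lborel. g (v x))"
    by (rule integral_dominated_convergence[OF m0 m w]) (use l bd in auto)
  have eq: "(LINT x|lborel. ?s n x) =
      (\<Sum>i\<in>{-int ((n+n0)*(n+n0))..int ((n+n0)*(n+n0))}. g (v (real_of_int i / real (n+n0)))) / real (n+n0)" for n
  proof -
    let ?n = "n + n0"
    have n: "real ?n > R'" using n0 by simp
    then have np: "?n > 0" using R'0 by (metis gr0I less_eq_real_def not_less of_nat_0 zero_less_one order_trans)
    have z: "g (v (real_of_int l / real ?n)) = 0" if "l \<notin> {-int (?n*?n)..<int (?n*?n) + 1}" for l
    proof -
      have "\<bar>l\<bar> > int (?n*?n)" using that by auto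
      then have "\<bar>real_of_int l\<bar> > real (?n*?n)" by linarith
      then have "\<bar>real_of_int l / real ?n\<bar> > real ?n" using np by (intro less_abs_divide) auto
      then have "\<bar>real_of_int l / real ?n\<bar> > R" using n unfolding R'_def by linarith
      then show ?thesis using v(2) g(2) by simp
    qed
    have "(LINT x|lborel. ?s n x) = (\<Sum>i\<in>{-int (?n*?n)..<int (?n*?n) + 1}. g (v (real_of_int i / real ?n))) /\<^sub>R real ?n"
      by (rule has_bochner_integral_integral_eq[OF step_integral_UNIV[OF np z]])
    also have "{-int (?n*?n)..<int (?n*?n) + 1} = {-int (?n*?n)..int (?n*?n)}" by auto
    finally show ?thesis by (simp add: divide_inverse mult.commute)
  qed
  show ?thesis using lim unfolding eq by (rule LIMSEQ_offset)
qed

text \<open>\<open>dd\<close> plays the part of the squared derivative but is tied to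
  \<open>v\<close> only through an estimate of increments. So \<open>v\<close> may be made of moduli
  and truncations, which do not increase increments, and these never have to be differentiated. On
  each cell the estimate bounds the sampled term, and the cells are disjoint.\<close>

lemma sampled_dirichlet_le:
  fixes v :: "real \<Rightarrow> real^'k"
  assumes n: "n > 0" and dd: "integrable lborel dd" "\<And>x. 0 \<le> dd x"
    and hol: "\<And>x y. x \<le> y \<Longrightarrow> (norm (v y - v x))\<^sup>2 \<le> (y - x) * (LINT s|lborel. indicator {x..<y} s * dd s)"
  shows "real n * grid_dirichlet N (\<lambda>i. v (real_of_int i / real n)) \<le> (LINT x|lborel. dd x)"
proof -
  let ?A = "{-int N - 1..int N}" and ?I = "\<lambda>i::int. {real_of_int i / real n..<real_of_int (i+1) / real n}"
  have int: "integrable lborel (\<lambda>s. indicator (?I i) s * dd s)" for i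
    using integrable_mult_indicator[OF _ dd(1), of "?I i"] by simp
  have "real n * grid_dirichlet N (\<lambda>i. v (real_of_int i / real n)) \<le> (\<Sum>i\<in>?A. LINT s|lborel. indicator (?I i) s * dd s)"
    unfolding grid_dirichlet_def sum_distrib_left
  proof (rule sum_mono)
    fix i
    have "(norm (v (real_of_int (i+1) / real n) - v (real_of_int i / real n)))\<^sup>2
        \<le> (real_of_int (i+1) / real n - real_of_int i / real n) * (LINT s|lborel. indicator (?I i) s * dd s)"
      by (rule hol) (simp add: divide_right_mono)
    then show "real n * (norm (v (real_of_int (i+1) / real n) - v (real_of_int i / real n)))\<^sup>2 \<le> (LINT s|lborel. indicator (?I i) s * dd s)"
      using n by (simp add: diff_divide_distrib[symmetric] field_simps)
  qed
  also have "\<dots> = (LINT s|lborel. (\<Sum>i\<in>?A. indicator (?I i) s * dd s))"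
    by (rule Bochner_Integration.integral_sum[symmetric]) (rule int)
  also have "\<dots> \<le> (LINT s|lborel. dd s)"
  proof (rule integral_mono[OF Bochner_Integration.integrable_sum[OF int] dd(1)])
    fix s
    have ind: "indicator (?I l) s = (if l = \<lfloor>real n * s\<rfloor> then 1 else (0::real))" for l
    proof -
      have "s \<in> ?I l \<longleftrightarrow> of_int l \<le> real n * s \<and> real n * s < of_int l + 1"
        using n by (auto simp: field_simps)
      also have "\<dots> \<longleftrightarrow> l = \<lfloor>real n * s\<rfloor>" by linarith
      finally show ?thesis by (auto simp: indicator_def)
    qed
    have "(\<Sum>i\<in>?A. indicator (?I i) s * dd s) = (\<Sum>i\<in>?A. if i = \<lfloor>real n * s\<rfloor> then dd s else 0)"
      unfolding ind by (rule sum.cong) auto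
    also have "\<dots> \<le> dd s" using dd(2)[of s] by (subst sum.delta) auto
    finally show "(\<Sum>i\<in>?A. indicator (?I i) s * dd s) \<le> dd s" .
  qed
  finally show ?thesis .
qed

text \<open>The masses of the samples merely converge to those of \<open>v\<close>; strict
  inequality makes the samples feasible for large n, and compact support places them inside the
  window.\<close>

lemma compact_competitor:
  fixes v :: "real \<Rightarrow> real^'k" and r :: "nat \<Rightarrow> nat"
  assumes min: "\<And>n w. n > 0 \<Longrightarrow> w \<in> feasible n (n*n) \<Longrightarrow> e n \<le> grid_energy n (n*n) w"
    and r: "strict_mono r" "(\<lambda>k. e (r k)) \<longlonglongrightarrow> E0"
    and v: "continuous_on UNIV v" "\<And>x. \<bar>x\<bar> > R \<Longrightarrow> v x = 0"
    and dd: "integrable lborel dd" "\<And>x. 0 \<le> dd x"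
    and hol: "\<And>x y. x \<le> y \<Longrightarrow> (norm (v y - v x))\<^sup>2 \<le> (y - x) * (LINT s|lborel. indicator {x..<y} s * dd s)"
    and mass: "\<And>k. (LINT x|lborel. (v x $ k)\<^sup>2) < M k"
  shows "E0 \<le> (LINT x|lborel. dd x) - (LINT x|lborel. V (v x))"
proof -
  define w where "w n i = v (real_of_int i / real n)" for n i
  have ml: "(\<lambda>n. grid_mass n (n*n) (w n) k) \<longlonglongrightarrow> (LINT x|lborel. (v x $ k)\<^sup>2)" for k
    unfolding grid_mass_def w_def
    using tendsto_grid_sum[of "\<lambda>z. (z $ k)\<^sup>2", OF _ _ v] by (simp add: continuous_intros)
  have Vl: "(\<lambda>n. (\<Sum>i\<in>{-int (n*n)..int (n*n)}. V (w n i)) / real n) \<longlonglongrightarrow> (LINT x|lborel. V (v x))"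
    unfolding w_def by (rule tendsto_grid_sum[OF V_cont V_zero v])
  have "\<forall>\<^sub>F n in sequentially. \<forall>k. grid_mass n (n*n) (w n) k < M k"
    by (intro eventually_all_finite order_tendstoD(2)[OF ml mass])
  moreover have "\<forall>\<^sub>F n in sequentially. real n > R"
    using filterlim_real_sequentially by (simp add: filterlim_at_top_dense)
  ultimately have "\<forall>\<^sub>F n in sequentially. e n \<le> (LINT x|lborel. dd x) - (\<Sum>i\<in>{-int (n*n)..int (n*n)}. V (w n i)) / real n"
    using eventually_gt_at_top[of 0]
  proof eventually_elim
    case (elim n)
    have "w n i = 0" if "\<bar>i\<bar> > int (n*n)" for i
    proof -
      have "\<bar>real_of_int i\<bar> > real (n*n)" using that by linarith
      then have "\<bar>real_of_int i / real n\<bar> > real n" using elim by (intro less_abs_divide) auto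
      then show ?thesis using v(2) elim unfolding w_def by simp
    qed
    then have "w n \<in> feasible n (n*n)" using elim by (auto simp: feasible_def less_imp_le)
    then have "e n \<le> grid_energy n (n*n) (w n)" using min elim by blast
    also have "\<dots> \<le> (LINT x|lborel. dd x) - (\<Sum>i\<in>{-int (n*n)..int (n*n)}. V (w n i)) / real n"
      unfolding grid_energy_def w_def
      by (intro diff_right_mono sampled_dirichlet_le[OF _ dd hol]) (use elim in auto)
    finally show ?case .
  qed
  then have "\<forall>\<^sub>F k in sequentially. e (r k) \<le> (LINT x|lborel. dd x) - (\<Sum>i\<in>{-int (r k * r k)..int (r k * r k)}. V (w (r k) i)) / real (r k)"
    by (rule eventually_subseq[OF r(1)])
  moreover have "(\<lambda>k. (LINT x|lborel. dd x) - (\<Sum>i\<in>{-int (r k * r k)..int (r k * r k)}. V (w (r k) i)) / real (r k))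
     \<longlonglongrightarrow> (LINT x|lborel. dd x) - (LINT x|lborel. V (v x))"
    using LIMSEQ_subseq_LIMSEQ[OF Vl r(1)] by (intro tendsto_intros) (simp add: o_def)
  ultimately show ?thesis using r(2) by (intro tendsto_le[OF sequentially_bot])
qed

text \<open>Shrinking the components of a competitor by \<open>v \<mapsto> (1 - \<epsilon>) max 0 (v - \<epsilon>)\<close> makes the support
  compact and the mass constraint strict without increasing increments.\<close>

definition shrink :: "real \<Rightarrow> real^'k \<Rightarrow> real^'k" where
  "shrink \<epsilon> x = (\<chi> k. (1 - \<epsilon>) * max 0 (x $ k - \<epsilon>))"

lemma shrink_diff_le:
  assumes "0 < \<epsilon>" "\<epsilon> < 1" shows "norm (shrink \<epsilon> x - shrink \<epsilon> y) \<le> norm (x - y)"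
proof (rule norm_le_componentwise_cart)
  fix k
  have "\<bar>(1 - \<epsilon>) * (max 0 (x $ k - \<epsilon>) - max 0 (y $ k - \<epsilon>))\<bar> \<le> 1 * \<bar>x $ k - y $ k\<bar>"
    unfolding abs_mult using assms by (intro mult_mono) auto
  then show "norm ((shrink \<epsilon> x - shrink \<epsilon> y) $ k) \<le> norm ((x - y) $ k)"
    by (simp add: shrink_def right_diff_distrib)
qed

lemma shrink_component:
  assumes "0 < \<epsilon>" "\<epsilon> < 1" "0 \<le> x $ k" shows "0 \<le> shrink \<epsilon> x $ k" "shrink \<epsilon> x $ k \<le> (1 - \<epsilon>) * x $ k"
proof -
  have "max 0 (x $ k - \<epsilon>) \<le> x $ k" "0 \<le> 1 - \<epsilon>" using assms by auto
  then show "0 \<le> shrink \<epsilon> x $ k" "shrink \<epsilon> x $ k \<le> (1 - \<epsilon>) * x $ k"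
    by (auto simp: shrink_def intro: mult_left_mono)
qed

lemma norm_shrink_le:
  assumes "0 < \<epsilon>" "\<epsilon> < 1" "\<And>k. 0 \<le> x $ k" shows "norm (shrink \<epsilon> x) \<le> norm x"
proof (rule norm_le_componentwise_cart)
  fix k
  have "shrink \<epsilon> x $ k \<le> 1 * x $ k" using shrink_component[OF assms(1,2) assms(3)[of k]] assms(3)[of k] assms(1)
    by (meson diff_ge_0_iff_ge less_imp_le mult_right_mono order_trans diff_le_self le_add_same_cancel1 diff_le_eq)
  then show "norm (shrink \<epsilon> x $ k) \<le> norm (x $ k)" using shrink_component[OF assms(1,2) assms(3)[of k]] assms(3)[of k] by simp
qed

text \<open>Shrinking makes \<open>compact_competitor\<close> applicable with the same
  \<open>dd\<close>. Only the potential energy then depends on \<epsilon>, and it converges by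
  dominated convergence.\<close>

lemma competitor:
  fixes v :: "real \<Rightarrow> real^'k" and r :: "nat \<Rightarrow> nat"
  assumes min: "\<And>n w. n > 0 \<Longrightarrow> w \<in> feasible n (n*n) \<Longrightarrow> e n \<le> grid_energy n (n*n) w"
    and r: "strict_mono r" "(\<lambda>k. e (r k)) \<longlonglongrightarrow> E0"
    and v: "continuous_on UNIV v" "(v \<longlongrightarrow> 0) at_infinity" "\<And>x k. 0 \<le> v x $ k"
    and dd: "integrable lborel dd" "\<And>x. 0 \<le> dd x"
    and hol: "\<And>x y. x \<le> y \<Longrightarrow> (norm (v y - v x))\<^sup>2 \<le> (y - x) * (LINT s|lborel. indicator {x..<y} s * dd s)"
    and int: "\<And>k. integrable lborel (\<lambda>x. (v x $ k)\<^sup>2)"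
    and mass: "\<And>k. (LINT x|lborel. (v x $ k)\<^sup>2) \<le> M k"
  shows "E0 \<le> (LINT x|lborel. dd x) - (LINT x|lborel. V (v x))"
proof -
  obtain B where B: "B > 0" "\<And>x. norm (v x) \<le> B" using vanishing_imp_bounded[OF v(1,2)] by metis
  have cs: "continuous_on UNIV (shrink \<epsilon>)" for \<epsilon>
    unfolding shrink_def[abs_def] by (intro continuous_on_vec_lambda continuous_intros)
  have cv: "continuous_on UNIV (\<lambda>x. shrink \<epsilon> (v x))" for \<epsilon> by (rule continuous_on_compose2[OF cs v(1)]) auto
  have le: "E0 \<le> (LINT x|lborel. dd x) - (LINT x|lborel. V (shrink \<epsilon> (v x)))" if \<epsilon>: "0 < \<epsilon>" "\<epsilon> < 1" for \<epsilon>
  proof -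
    obtain R where R: "\<And>x. \<bar>x\<bar> \<ge> R \<Longrightarrow> norm (v x) < \<epsilon>"
      using tendstoD[OF v(2) \<epsilon>(1)] unfolding eventually_at_infinity by auto
    have supp: "shrink \<epsilon> (v x) = 0" if "\<bar>x\<bar> > R" for x
    proof -
      have "v x $ k \<le> \<epsilon>" for k using R[of x] that component_le_norm_cart[of "v x" k] by auto
      then show ?thesis by (simp add: shrink_def vec_eq_iff max_absorb1)
    qed
    have h: "(norm (shrink \<epsilon> (v y) - shrink \<epsilon> (v x)))\<^sup>2 \<le> (y - x) * (LINT s|lborel. indicator {x..<y} s * dd s)" if "x \<le> y" for x y
      by (rule order_trans[OF power_mono[OF shrink_diff_le[OF \<epsilon>]] hol[OF that]]) simp
    have m: "(LINT x|lborel. (shrink \<epsilon> (v x) $ k)\<^sup>2) < M k" for k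
    proof -
      have p: "(shrink \<epsilon> (v x) $ k)\<^sup>2 \<le> (1 - \<epsilon>)\<^sup>2 * (v x $ k)\<^sup>2" for x
        unfolding power_mult_distrib[symmetric]
        by (rule power_mono[OF shrink_component(2)[OF \<epsilon> v(3)] shrink_component(1)[OF \<epsilon> v(3)]])
      have i2: "integrable lborel (\<lambda>x. (1 - \<epsilon>)\<^sup>2 * (v x $ k)\<^sup>2)" by (intro integrable_mult_right int)
      have "continuous_on UNIV (\<lambda>x. (shrink \<epsilon> (v x) $ k)\<^sup>2)" by (intro continuous_intros cv)
      then have mm: "(\<lambda>x. (shrink \<epsilon> (v x) $ k)\<^sup>2) \<in> borel_measurable lborel" using borel_measurable_continuous_onI by simp
      have i1: "integrable lborel (\<lambda>x. (shrink \<epsilon> (v x) $ k)\<^sup>2)"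
        by (rule Bochner_Integration.integrable_bound[OF i2 mm]) (use p in auto)
      have "(LINT x|lborel. (shrink \<epsilon> (v x) $ k)\<^sup>2) \<le> (LINT x|lborel. (1 - \<epsilon>)\<^sup>2 * (v x $ k)\<^sup>2)"
        by (rule integral_mono[OF i1 i2 p])
      also have "\<dots> \<le> (1 - \<epsilon>)\<^sup>2 * M k" by (simp add: mass mult_left_mono)
      also have "\<dots> < 1 * M k"
        by (rule mult_strict_right_mono[OF _ M_pos]) (use \<epsilon> in \<open>simp add: power_less_one_iff abs_square_less_1\<close>)
      finally show ?thesis by simp
    qed
    show ?thesis by (rule compact_competitor[OF min r cv supp dd h m])
  qed
  \<comment> \<open>The shift by 2 keeps \<epsilon> strictly below 1 from the first index
    on.\<close>
  define \<epsilon> where "\<epsilon> n = 1 / real (n + 2)" for n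
  have \<epsilon>: "0 < \<epsilon> n" "\<epsilon> n < 1" for n by (auto simp: \<epsilon>_def field_simps)
  have \<epsilon>lim: "\<epsilon> \<longlonglongrightarrow> 0" unfolding \<epsilon>_def by (rule LIMSEQ_ignore_initial_segment[OF lim_1_over_n])
  have Vm: "V \<in> borel_measurable borel" by (rule borel_measurable_continuous_onI[OF V_cont])
  have "(\<lambda>n. LINT x|lborel. V (shrink (\<epsilon> n) (v x))) \<longlonglongrightarrow> (LINT x|lborel. V (v x))"
  proof (rule integral_dominated_convergence)
    have "(\<lambda>x. v x) \<in> borel_measurable lborel" using borel_measurable_continuous_onI[OF v(1)] by simp
    then show "(\<lambda>x. V (v x)) \<in> borel_measurable lborel" using measurable_compose[OF _ Vm] by blast
    have "(\<lambda>x. shrink (\<epsilon> n) (v x)) \<in> borel_measurable lborel" for n using borel_measurable_continuous_onI[OF cv] by simp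
    then show "(\<lambda>x. V (shrink (\<epsilon> n) (v x))) \<in> borel_measurable lborel" for n using measurable_compose[OF _ Vm] by blast
    have "integrable lborel (\<lambda>x. K * (B powr a + B powr b) * (\<Sum>k\<in>UNIV. (v x $ k)\<^sup>2))"
      by (intro integrable_mult_right Bochner_Integration.integrable_sum int)
    then show "integrable lborel (\<lambda>x. K * (B powr a + B powr b) * (norm (v x))\<^sup>2)" by (simp add: power2_norm_vec)
    show "AE x in lborel. (\<lambda>n. V (shrink (\<epsilon> n) (v x))) \<longlonglongrightarrow> V (v x)"
    proof (rule AE_I2)
      fix x
      have "(\<lambda>n. shrink (\<epsilon> n) (v x)) \<longlonglongrightarrow> (\<chi> k. (1 - 0) * max 0 (v x $ k - 0))"
        unfolding shrink_def by (intro tendsto_intros \<epsilon>lim)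
      also have "(\<chi> k. (1 - 0) * max 0 (v x $ k - 0)) = v x" using v(3) by (simp add: vec_eq_iff max_def)
      finally have "(\<lambda>n. shrink (\<epsilon> n) (v x)) \<longlonglongrightarrow> v x" .
      moreover have "isCont V (v x)" using V_cont by (simp add: continuous_on_eq_continuous_at)
      ultimately show "(\<lambda>n. V (shrink (\<epsilon> n) (v x))) \<longlonglongrightarrow> V (v x)" by (rule isCont_tendsto_compose[rotated])
    qed
    show "AE x in lborel. norm (V (shrink (\<epsilon> n) (v x))) \<le> K * (B powr a + B powr b) * (norm (v x))\<^sup>2" for n
    proof (rule AE_I2)
      fix x
      let ?z = "shrink (\<epsilon> n) (v x)"
      have z: "norm ?z \<le> norm (v x)" by (rule norm_shrink_le[OF \<epsilon> v(3)])
      then have zB: "norm ?z \<le> B" using B(2)[of x] by linarith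
      have "norm (V ?z) \<le> K * (norm ?z)\<^sup>2 * (norm ?z powr a + norm ?z powr b)" using V_growth[of ?z] by simp
      also have "\<dots> \<le> K * (norm (v x))\<^sup>2 * (B powr a + B powr b)"
        using K_nonneg a_pos a_le_b z zB by (intro mult_mono mult_left_mono add_mono powr_mono2 power_mono) auto
      finally show "norm (V ?z) \<le> K * (B powr a + B powr b) * (norm (v x))\<^sup>2" by (simp add: mult_ac)
    qed
  qed
  then have "(\<lambda>n. (LINT x|lborel. dd x) - (LINT x|lborel. V (shrink (\<epsilon> n) (v x)))) \<longlonglongrightarrow> (LINT x|lborel. dd x) - (LINT x|lborel. V (v x))"
    by (intro tendsto_intros)
  then show ?thesis by (rule LIMSEQ_le_const) (use le[OF \<epsilon>] in auto)
qed

section \<open>Ground states of the abstract energy\<close>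

lemma grid_sequence_exists:
  obtains u lam C L where "grid_sequence V G M K a b u lam C L"
    "\<And>n v. n > 0 \<Longrightarrow> v \<in> feasible n (n*n) \<Longrightarrow> grid_energy n (n*n) (u n) \<le> grid_energy n (n*n) v"
proof -
  obtain C where C: "C > 0" "\<And>n N u. n > 0 \<Longrightarrow> u \<in> feasible n N \<Longrightarrow> \<forall>v\<in>feasible n N. grid_energy n N u \<le> grid_energy n N v \<Longrightarrow>
       real n * grid_dirichlet N u \<le> C \<and> (\<forall>i. norm (u i) \<le> C)" using grid_bounds by blast
  obtain L where L: "\<And>n N u lam. n > 0 \<Longrightarrow> u \<in> feasible n N \<Longrightarrow> real n * grid_dirichlet N u \<le> C \<Longrightarrow> \<forall>i. norm (u i) \<le> C \<Longrightarrow>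
     \<forall>k. lam $ k = 0 \<or> 2 * M k * lam $ k = - (\<Sum>i\<in>{-int N..int N}. grid_gradient n u i $ k * u i $ k) \<Longrightarrow> norm (lam :: real^'k) \<le> L"
    using grid_multiplier_bound[OF C(1)] by blast
  have "\<exists>u lam. n > 0 \<longrightarrow> u \<in> feasible n (n*n) \<and> (\<forall>i k. 0 \<le> u i $ k) \<and>
      (\<forall>v\<in>feasible n (n*n). grid_energy n (n*n) u \<le> grid_energy n (n*n) v) \<and>
      (\<forall>j\<ge>0. \<forall>k. u (j+1) $ k \<le> u j $ k) \<and> (\<forall>j\<le>0. \<forall>k. u (j-1) $ k \<le> u j $ k) \<and> norm lam \<le> L \<and>
      (\<forall>i. \<bar>i\<bar> \<le> int (n*n) \<longrightarrow> (real n)\<^sup>2 *\<^sub>R (u (i+1) - 2 *\<^sub>R u i + u (i-1)) = force lam (u i))" for n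
  proof (cases "n > 0")
    case n: True
    obtain u where u: "u \<in> feasible n (n*n)" "\<forall>i k. 0 \<le> u i $ k"
      "\<forall>v\<in>feasible n (n*n). grid_energy n (n*n) u \<le> grid_energy n (n*n) v"
      "\<forall>j\<ge>0. \<forall>k. u (j+1) $ k \<le> u j $ k" "\<forall>j\<le>0. \<forall>k. u (j-1) $ k \<le> u j $ k"
      by (rule grid_minimiser_exists[OF n])
    obtain lam :: "real^'k" where lam:
      "\<And>i. \<bar>i\<bar> \<le> int (n*n) \<Longrightarrow> (real n)\<^sup>2 *\<^sub>R (u (i+1) - 2 *\<^sub>R u i + u (i-1)) = (\<chi> k. lam $ k * u i $ k) - (1/2) *\<^sub>R G (u i)"
      "\<And>k. lam $ k = 0 \<or> (grid_mass n (n*n) u k = M k \<and>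
        2 * M k * lam $ k = - (\<Sum>i\<in>{-int (n*n)..int (n*n)}. grid_gradient n u i $ k * u i $ k))"
      by (rule grid_euler_lagrange[OF n u(1,3)]) (rule that)
    have "norm lam \<le> L" by (rule L[OF n u(1)]) (use C(2)[OF n u(1,3)] lam(2) in blast)+
    with u lam(1) show ?thesis unfolding force_def by blast
  qed simp
  then obtain u lam where ul: "\<And>n. n > 0 \<Longrightarrow> u n \<in> feasible n (n*n) \<and> (\<forall>i k. 0 \<le> u n i $ k) \<and>
      (\<forall>v\<in>feasible n (n*n). grid_energy n (n*n) (u n) \<le> grid_energy n (n*n) v) \<and>
      (\<forall>j\<ge>0. \<forall>k. u n (j+1) $ k \<le> u n j $ k) \<and> (\<forall>j\<le>0. \<forall>k. u n (j-1) $ k \<le> u n j $ k) \<and> norm (lam n) \<le> L \<and>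
      (\<forall>i. \<bar>i\<bar> \<le> int (n*n) \<longrightarrow> (real n)\<^sup>2 *\<^sub>R (u n (i+1) - 2 *\<^sub>R u n i + u n (i-1)) = force (lam n) (u n i))"
    by metis
  show thesis
  proof (rule that[of u lam C L])
    show "grid_sequence V G M K a b u lam C L"
    proof (intro grid_sequence.intro grid_sequence_axioms.intro coupled_energy_axioms)
      fix n :: nat assume n: "n > 0"
      note h = ul[OF n]
      have f: "u n \<in> feasible n (n*n)" and m: "\<forall>v\<in>feasible n (n*n). grid_energy n (n*n) (u n) \<le> grid_energy n (n*n) v"
        using h by blast+
      show "u n \<in> feasible n (n*n)" by (rule f)
      show "real n * grid_dirichlet (n*n) (u n) \<le> C" using C(2)[OF n f m] by blast
      show "norm (lam n) \<le> L" using h by blast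
      fix i k
      show "norm (u n i) \<le> C" using C(2)[OF n f m] by blast
      show "0 \<le> u n i $ k" using h by blast
      show "u n (i+1) $ k \<le> u n i $ k" if "i \<ge> 0" using h that by blast
      show "u n (i-1) $ k \<le> u n i $ k" if "i \<le> 0" using h that by blast
      show "(real n)\<^sup>2 *\<^sub>R (u n (i+1) - 2 *\<^sub>R u n i + u n (i-1)) = force (lam n) (u n i)" if "\<bar>i\<bar> \<le> int (n*n)"
        using h that by blast
    qed
  qed (use ul in blast)
qed

theorem ground_state_exists:
  obtains W W' lam where
    "\<And>x. (W has_vector_derivative W' x) (at x)"
    "\<And>x. (W' has_vector_derivative force lam (W x)) (at x)"
    "\<And>x k. 0 \<le> W x $ k" "\<And>x k. \<bar>x\<bar> * (W x $ k)\<^sup>2 \<le> M k"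
    "\<And>k. integrable lborel (\<lambda>x. (W x $ k)\<^sup>2)" "\<And>k. (LINT x|lborel. (W x $ k)\<^sup>2) \<le> M k"
    "integrable lborel (\<lambda>x. (norm (W' x))\<^sup>2)" "integrable lborel (\<lambda>x. V (W x))"
    "\<And>v dd. continuous_on UNIV v \<Longrightarrow> (v \<longlongrightarrow> 0) at_infinity \<Longrightarrow> (\<And>x k. 0 \<le> v x $ k) \<Longrightarrow>
       integrable lborel dd \<Longrightarrow> (\<And>x. 0 \<le> dd x) \<Longrightarrow>
       (\<And>x y. x \<le> y \<Longrightarrow> (norm (v y - v x))\<^sup>2 \<le> (y - x) * (LINT s|lborel. indicator {x..<y} s * dd s)) \<Longrightarrow>
       (\<And>k. integrable lborel (\<lambda>x. (v x $ k)\<^sup>2)) \<Longrightarrow> (\<And>k. (LINT x|lborel. (v x $ k)\<^sup>2) \<le> M k) \<Longrightarrow>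
       (LINT x|lborel. (norm (W' x))\<^sup>2) - (LINT x|lborel. V (W x)) \<le> (LINT x|lborel. dd x) - (LINT x|lborel. V (v x))"
proof -
  obtain u lam C L where s: "grid_sequence V G M K a b u lam C L"
    and min: "\<And>n v. n > 0 \<Longrightarrow> v \<in> feasible n (n*n) \<Longrightarrow> grid_energy n (n*n) (u n) \<le> grid_energy n (n*n) v"
    by (rule grid_sequence_exists) (rule that)
  obtain r W W' lam0 E where W: "strict_mono r" "\<And>k. r k > 0"
    "\<And>x. (W has_vector_derivative W' x) (at x)"
    "\<And>x. (W' has_vector_derivative force lam0 (W x)) (at x)"
    "\<And>x k. 0 \<le> W x $ k" "\<And>x. norm (W x) \<le> C" "\<And>x k. \<bar>x\<bar> * (W x $ k)\<^sup>2 \<le> M k"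
    "\<And>k. integrable lborel (\<lambda>x. (W x $ k)\<^sup>2)" "\<And>k. (LINT x|lborel. (W x $ k)\<^sup>2) \<le> M k"
    "integrable lborel (\<lambda>x. (norm (W' x))\<^sup>2)" "(LINT x|lborel. (norm (W' x))\<^sup>2) \<le> E"
    "integrable lborel (\<lambda>x. V (W x))"
    "(\<lambda>k. grid_energy (r k) (r k * r k) (u (r k))) \<longlonglongrightarrow> E - (LINT x|lborel. V (W x))"
    using grid_sequence.limit_exists[OF s] by blast
  show thesis
  proof (rule that[OF W(3,4,5,7,8,9,10,12)])
    fix v dd assume "continuous_on UNIV v" "(v \<longlongrightarrow> 0) at_infinity" "\<And>x k. 0 \<le> v x $ k"
       "integrable lborel dd" "\<And>x. 0 \<le> dd x"
       "\<And>x y. x \<le> y \<Longrightarrow> (norm (v y - v x))\<^sup>2 \<le> (y - x) * (LINT s|lborel. indicator {x..<y} s * dd s)"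
       "\<And>k. integrable lborel (\<lambda>x. (v x $ k)\<^sup>2)" "\<And>k. (LINT x|lborel. (v x $ k)\<^sup>2) \<le> M k"
    from competitor[OF min W(1,13) this]
    have "E - (LINT x|lborel. V (W x)) \<le> (LINT x|lborel. dd x) - (LINT x|lborel. V (v x))" .
    then show "(LINT x|lborel. (norm (W' x))\<^sup>2) - (LINT x|lborel. V (W x)) \<le> (LINT x|lborel. dd x) - (LINT x|lborel. V (v x))"
      \<comment> \<open>Fatou's bound: the Dirichlet energy of W is at most E, so W does no worse
        than the limit of the minimal lattice energies.\<close>
      using W(11) by linarith
  qed
qed

end

subsection \<open>Smooth bump functions\<close>

text \<open>Differentiability to finite order, by recursion on the derivative, so that sums,
  products and affine substitutions are handled by induction on the order. Smoothness is
  \<open>smooth_upto n\<close> for all n.\<close>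

primrec smooth_upto :: "nat \<Rightarrow> (real \<Rightarrow> real) \<Rightarrow> bool" where
  "smooth_upto 0 f \<longleftrightarrow> (\<forall>x. f field_differentiable (at x))"
| "smooth_upto (Suc n) f \<longleftrightarrow> (\<forall>x. f field_differentiable (at x)) \<and> smooth_upto n (deriv f)"

lemma smooth_upto_differentiable: "smooth_upto n f \<Longrightarrow> f field_differentiable (at x)"
  by (cases n) auto

lemma smooth_upto_Suc_imp: "smooth_upto (Suc n) f \<Longrightarrow> smooth_upto n f"
  by (induction n arbitrary: f) auto

lemma smooth_upto_iterate: "(\<And>n. smooth_upto n f) \<Longrightarrow> ((deriv ^^ k) f) field_differentiable (at x)"
proof (induction k arbitrary: f)
  case 0 then show ?case using smooth_upto_differentiable[of 0 f x] by simp
next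
  case (Suc k)
  have "smooth_upto n (deriv f)" for n using Suc.prems[of "Suc n"] by simp
  from Suc.IH[OF this] show ?case by (simp add: funpow_Suc_right del: funpow.simps)
qed

lemma smooth_upto_add: "smooth_upto n f \<Longrightarrow> smooth_upto n g \<Longrightarrow> smooth_upto n (\<lambda>x. f x + g x)"
proof (induction n arbitrary: f g)
  case (Suc n)
  then have "deriv (\<lambda>x. f x + g x) = (\<lambda>x. deriv f x + deriv g x)" by (auto simp: fun_eq_iff)
  then show ?case using Suc by (auto intro!: field_differentiable_add)
qed (auto intro!: field_differentiable_add)

lemma smooth_upto_mult: "smooth_upto n f \<Longrightarrow> smooth_upto n g \<Longrightarrow> smooth_upto n (\<lambda>x. f x * g x)"
proof (induction n arbitrary: f g)
  case (Suc n)
  then have "deriv (\<lambda>x. f x * g x) = (\<lambda>x. f x * deriv g x + deriv f x * g x)" by (auto simp: fun_eq_iff)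
  moreover have "smooth_upto n (\<lambda>x. f x * deriv g x)" "smooth_upto n (\<lambda>x. deriv f x * g x)"
    using Suc.IH[of f "deriv g"] Suc.IH[of "deriv f" g] smooth_upto_Suc_imp[OF Suc.prems(1)]
      smooth_upto_Suc_imp[OF Suc.prems(2)] Suc.prems by simp_all
  ultimately show ?case using Suc.prems by (auto intro!: field_differentiable_mult smooth_upto_add)
qed (auto intro!: field_differentiable_mult)

lemma smooth_upto_affine: "smooth_upto n f \<Longrightarrow> smooth_upto n (\<lambda>x. c * f (p + q * x))"
proof (induction n arbitrary: f c)
  case 0
  then have f: "(f has_field_derivative deriv f y) (at y)" for y
    by (simp add: field_differentiable_derivI)
  have "((\<lambda>x. c * f (p + q * x)) has_field_derivative c * (deriv f (p + q * x) * q)) (at x)" for x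
    by (rule derivative_eq_intros DERIV_chain2[OF f] refl)+ simp
  then show ?case by (auto simp: field_differentiable_def)
next
  case (Suc n)
  have f: "(f has_field_derivative deriv f y) (at y)" for y
    using Suc.prems smooth_upto_differentiable field_differentiable_derivI by blast
  have d: "((\<lambda>x. c * f (p + q * x)) has_field_derivative (c * q) * deriv f (p + q * x)) (at x)" for x
    by (rule derivative_eq_intros DERIV_chain2[OF f] refl)+ (auto simp: algebra_simps)
  then have "deriv (\<lambda>x. c * f (p + q * x)) = (\<lambda>x. (c * q) * deriv f (p + q * x))"
    by (auto simp: fun_eq_iff DERIV_imp_deriv)
  moreover have "smooth_upto n (\<lambda>x. (c * q) * deriv f (p + q * x))" using Suc by auto
  ultimately show ?case using d by (auto simp: field_differentiable_def)
qed

text \<open>The polynomial factor makes this class of flat functions closed under differentiation,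
  so smoothness to all orders follows from a single differentiability proof.\<close>

definition flat_exp :: "real poly \<Rightarrow> real \<Rightarrow> real" where
  "flat_exp P x = (if x \<le> 0 then 0 else poly P (1/x) * exp (-(1/x)))"

lemma flat_exp_tendsto: "((\<lambda>x. flat_exp P x) \<longlongrightarrow> 0) (at 0)"
proof -
  have p: "((\<lambda>y. poly P y * exp (-y)) \<longlongrightarrow> 0) at_top" for P :: "real poly"
  proof -
    have "((\<lambda>y. \<Sum>i\<le>degree P. coeff P i * (y ^ i / exp y)) \<longlongrightarrow> (\<Sum>i\<le>degree P. coeff P i * 0)) at_top"
      by (intro tendsto_sum tendsto_mult tendsto_const tendsto_power_div_exp_0)
    moreover have "(\<lambda>y. \<Sum>i\<le>degree P. coeff P i * (y ^ i / exp y)) = (\<lambda>y. poly P y * exp (-y))"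
      by (auto simp: poly_altdef exp_minus sum_distrib_right divide_inverse fun_eq_iff intro!: sum.cong)
    ultimately show ?thesis by simp
  qed
  have "((\<lambda>x. poly P (inverse x) * exp (-(inverse x))) \<longlongrightarrow> 0) (at_right 0)"
    by (rule filterlim_compose[OF p filterlim_inverse_at_top_right])
  moreover have "\<forall>\<^sub>F x in at_right 0. poly P (inverse x) * exp (-(inverse x)) = flat_exp P x"
    by (auto simp: eventually_at_filter flat_exp_def inverse_eq_divide)
  ultimately have "((\<lambda>x. flat_exp P x) \<longlongrightarrow> 0) (at_right 0)" by (rule Lim_transform_eventually)
  moreover have "((\<lambda>x. flat_exp P x) \<longlongrightarrow> 0) (at_left 0)"
    by (rule tendsto_eventually) (auto simp: eventually_at_filter flat_exp_def)
  ultimately show ?thesis by (simp add: filterlim_split_at)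
qed

text \<open>In the variable y = 1/x the derivative is -y^2 d/dy, which takes P(y) e^(-y) to y^2 (P -
  P')(y) e^(-y); \<open>[:0,0,1:]\<close> is y^2.\<close>

lemma flat_exp_deriv: "(flat_exp P has_real_derivative flat_exp ([:0,0,1:] * (P - pderiv P)) x) (at x)"
proof -
  consider "x < 0" | "x = 0" | "x > 0" by linarith
  then show ?thesis
  proof cases
    case 1
    have "((\<lambda>_. 0) has_real_derivative 0) (at x)" by simp
    moreover have "\<forall>\<^sub>F y in nhds x. 0 = flat_exp P y"
      using eventually_nhds_in_open[of "{..<0}" x] 1 by (auto simp: flat_exp_def elim: eventually_mono)
    ultimately show ?thesis using 1 DERIV_cong_ev[of x x "\<lambda>_. 0" "flat_exp P" 0 0]
      by (simp add: flat_exp_def)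
  next
    case 2
    \<comment> \<open>The difference quotient at 0 is of the same kind, with P multiplied by
      y.\<close>
    have "((\<lambda>h. flat_exp P h / h) \<longlongrightarrow> 0) (at 0)"
      using flat_exp_tendsto[of "[:0,1:] * P"]
      by (rule Lim_transform_eventually) (auto simp: eventually_at_filter flat_exp_def)
    then show ?thesis using 2 by (simp add: DERIV_def flat_exp_def)
  next
    case 3
    have "((\<lambda>y. poly P (1/y) * exp (-(1/y))) has_real_derivative
       poly P (1/x) * (exp (-(1/x)) * (1/x\<^sup>2)) + (poly (pderiv P) (1/x) * (-(1/x\<^sup>2))) * exp (-(1/x))) (at x)"
      using 3 by (auto intro!: derivative_eq_intros DERIV_chain2[OF poly_DERIV] simp: power2_eq_square)
    also have "poly P (1/x) * (exp (-(1/x)) * (1/x\<^sup>2)) + (poly (pderiv P) (1/x) * (-(1/x\<^sup>2))) * exp (-(1/x))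
       = flat_exp ([:0,0,1:] * (P - pderiv P)) x"
      using 3 by (simp add: flat_exp_def power2_eq_square algebra_simps)
    finally have d: "((\<lambda>y. poly P (1/y) * exp (-(1/y))) has_real_derivative flat_exp ([:0,0,1:] * (P - pderiv P)) x) (at x)" .
    have "\<forall>\<^sub>F y in nhds x. poly P (1/y) * exp (-(1/y)) = flat_exp P y"
      using eventually_nhds_in_open[of "{0<..}" x] 3 by (auto simp: flat_exp_def elim: eventually_mono)
    from DERIV_cong_ev[OF refl this refl] d show ?thesis by simp
  qed
qed

lemma smooth_upto_flat_exp: "smooth_upto n (flat_exp P)"
proof (induction n arbitrary: P)
  case 0 show ?case using flat_exp_deriv by (auto simp: field_differentiable_def)
next
  case (Suc n)
  have "deriv (flat_exp P) = flat_exp ([:0,0,1:] * (P - pderiv P))"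
    using flat_exp_deriv by (auto simp: fun_eq_iff DERIV_imp_deriv)
  then show ?case using Suc flat_exp_deriv[of P] by (auto simp: field_differentiable_def)
qed

lemma bump_exists:
  obtains \<rho> :: "real \<Rightarrow> real" where "\<And>n. smooth_upto n \<rho>" "\<And>x. 0 \<le> \<rho> x" "\<And>x. x \<notin> {0<..<1} \<Longrightarrow> \<rho> x = 0"
    "continuous_on UNIV \<rho>" "integrable lborel \<rho>" "(LINT x|lborel. \<rho> x) = 1"
proof -
  define \<beta> where "\<beta> x = flat_exp 1 x * flat_exp 1 (1 - x)" for x
  have s: "smooth_upto n \<beta>" for n
    unfolding \<beta>_def using smooth_upto_affine[OF smooth_upto_flat_exp[of n 1], of 1 1 "-1"]
    by (intro smooth_upto_mult smooth_upto_flat_exp) simp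
  have c: "continuous_on UNIV \<beta>"
    using smooth_upto_differentiable[OF s[of 0]]
    by (intro continuous_at_imp_continuous_on ballI field_differentiable_imp_continuous_at)
  have nn: "0 \<le> \<beta> x" for x by (simp add: \<beta>_def flat_exp_def)
  have z: "\<beta> x = 0" if "x \<notin> {0<..<1}" for x using that by (auto simp: \<beta>_def flat_exp_def)
  have i0: "integral {0..1} \<beta> \<noteq> 0"
  proof
    assume "integral {0..1} \<beta> = 0"
    then have "\<forall>x\<in>{0..1}. \<beta> x = 0"
      using integral_eq_0_iff[of 0 1 \<beta>] nn continuous_on_subset[OF c] by auto
    then have "\<beta> (1/2) = 0" by simp
    then show False by (simp add: \<beta>_def flat_exp_def)
  qed
  define I where "I = integral {0..1} \<beta>"
  have "I \<ge> 0" unfolding I_def by (rule integral_nonneg) (use nn c in \<open>auto intro!: integrable_continuous_interval continuous_on_subset[OF c]\<close>)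
  then have I: "I > 0" using i0 by (simp add: I_def)
  have si: "set_integrable lborel {0..1} \<beta>"
    using borel_integrable_compact[of "{0..1}" \<beta>] continuous_on_subset[OF c] by (simp add: set_integrable_def)
  have ind: "indicator {0..1} x * \<beta> x = \<beta> x" for x by (cases "x \<in> {0<..<1}") (auto simp: z indicator_def)
  have \<beta>i: "integrable lborel \<beta>" using si by (simp add: set_integrable_def ind)
  have "(LINT x|lborel. \<beta> x) = I"
    using set_borel_integral_eq_integral(2)[OF si] by (simp add: set_lebesgue_integral_def ind I_def)
  then have L: "(LINT x|lborel. \<beta> x / I) = 1" using I by simp
  show thesis
  \<comment> \<open>The affine form of the argument matches \<open>smooth_upto_affine\<close>, which
    also provides the normalising factor.\<close>
  proof (rule that[of "\<lambda>x. (1 / I) * \<beta> (0 + 1 * x)"])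
    show "smooth_upto n (\<lambda>x. (1 / I) * \<beta> (0 + 1 * x))" for n by (rule smooth_upto_affine[OF s])
    show "continuous_on UNIV (\<lambda>x. (1 / I) * \<beta> (0 + 1 * x))" using c I by (auto intro!: continuous_intros)
    show "integrable lborel (\<lambda>x. (1 / I) * \<beta> (0 + 1 * x))" using \<beta>i by simp
    show "(LINT x|lborel. (1 / I) * \<beta> (0 + 1 * x)) = 1" using L by simp
  qed (use nn z I in auto)
qed

subsection \<open>Primitives of square integrable functions\<close>

text \<open>Absolute continuity with density \<open>g\<close>. For continuous \<open>f\<close> in L2
  and \<open>g\<close> in L2 it amounts to \<open>is_weak_deriv f g\<close>, by
  \<open>weak_deriv_imp_primitive\<close> and \<open>primitive_imp_weak_deriv\<close>; all estimates
  are made in this form.\<close>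

definition is_primitive :: "(real \<Rightarrow> 'a::euclidean_space) \<Rightarrow> (real \<Rightarrow> 'a) \<Rightarrow> bool" where
  "is_primitive f g \<longleftrightarrow> (\<forall>x y. x \<le> y \<longrightarrow> f y - f x = (LINT s|lborel. indicator {x..<y} s *\<^sub>R g s))"

lemma L2_measurable: "g \<in> L2 \<Longrightarrow> g \<in> borel_measurable lborel"
  and L2_integrable: "g \<in> L2 \<Longrightarrow> integrable lborel (\<lambda>x. (norm (g x))\<^sup>2)"
  by (auto simp: L2_def)

text \<open>Square integrable functions are locally integrable because t \<le> 1 + t^2.\<close>

lemma L2_integrable_compact_weight:
  fixes g :: "real \<Rightarrow> 'a::euclidean_space" and \<eta> :: "real \<Rightarrow> real"
  assumes g: "g \<in> L2" and m: "\<eta> \<in> borel_measurable lborel" and b: "\<And>s. \<bar>\<eta> s\<bar> \<le> B * indicator {x..y} s"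
  shows "integrable lborel (\<lambda>s. \<eta> s *\<^sub>R g s)"
proof (rule Bochner_Integration.integrable_bound)
  show "integrable lborel (\<lambda>s. B * (indicator {x..y} s + (norm (g s))\<^sup>2))"
    by (intro integrable_mult_right Bochner_Integration.integrable_add L2_integrable g integrable_real_indicator)
       (auto simp: emeasure_lborel_Icc_eq)
  show "(\<lambda>s. \<eta> s *\<^sub>R g s) \<in> borel_measurable lborel" using m L2_measurable[OF g] by measurable
  show "AE s in lborel. norm (\<eta> s *\<^sub>R g s) \<le> norm (B * (indicator {x..y} s + (norm (g s))\<^sup>2))"
  proof (rule AE_I2)
    fix s
    have ineq: "t \<le> 1 + t\<^sup>2" for t :: real
    proof -
      have "0 \<le> (t - 1)\<^sup>2 + 1 + t\<^sup>2" by simp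
      then show ?thesis by (simp add: power2_eq_square algebra_simps)
    qed
    show "norm (\<eta> s *\<^sub>R g s) \<le> norm (B * (indicator {x..y} s + (norm (g s))\<^sup>2))"
    proof (cases "s \<in> {x..y}")
      case True
      then have "\<bar>\<eta> s\<bar> \<le> B" using b[of s] by simp
      then have "\<bar>\<eta> s\<bar> * norm (g s) \<le> B * (1 + (norm (g s))\<^sup>2)" using ineq by (intro mult_mono) auto
      then show ?thesis using True by (simp add: abs_le_iff)
    next
      case False then show ?thesis using b[of s] by simp
    qed
  qed
qed

lemma L2_set_integrable:
  fixes g :: "real \<Rightarrow> 'a::euclidean_space"
  assumes "g \<in> L2" shows "integrable lborel (\<lambda>s. indicator {x..<y} s *\<^sub>R g s)"
  by (rule L2_integrable_compact_weight[OF assms, of _ 1 x y]) (auto simp: indicator_def)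

text \<open>Expand the nonnegative integral of (h - m)^2 over the interval, where m is the mean of
  h.\<close>

lemma cauchy_schwarz_interval:
  fixes h :: "real \<Rightarrow> real" and x y :: real
  assumes h: "integrable lborel (\<lambda>s. indicator {x..<y} s * h s)" "integrable lborel (\<lambda>s. indicator {x..<y} s * (h s)\<^sup>2)"
    and xy: "x \<le> y"
  shows "(LINT s|lborel. indicator {x..<y} s * h s)\<^sup>2 \<le> (y - x) * (LINT s|lborel. indicator {x..<y} s * (h s)\<^sup>2)"
proof (cases "x = y")
  case False
  then have p: "y - x > 0" using xy by simp
  define J where "J = (LINT s|lborel. indicator {x..<y} s * h s)"
  define m where "m = J / (y - x)"
  have i: "integrable lborel (indicator {x..<y} :: real \<Rightarrow> real)" by (rule integrable_real_indicator) (auto simp: xy)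
  have v: "(LINT s|lborel. indicator {x..<y} s) = y - x" using xy by simp
  have "0 \<le> (LINT s|lborel. indicator {x..<y} s * (h s - m)\<^sup>2)" by (rule Bochner_Integration.integral_nonneg) auto
  also have "(\<lambda>s. indicator {x..<y} s * (h s - m)\<^sup>2) =
     (\<lambda>s. indicator {x..<y} s * (h s)\<^sup>2 - (2 * m) * (indicator {x..<y} s * h s) + m\<^sup>2 * indicator {x..<y} s)"
    by (auto simp: fun_eq_iff power2_eq_square algebra_simps)
  also have "(LINT s|lborel. indicator {x..<y} s * (h s)\<^sup>2 - (2 * m) * (indicator {x..<y} s * h s) + m\<^sup>2 * indicator {x..<y} s)
     = (LINT s|lborel. indicator {x..<y} s * (h s)\<^sup>2) - (2 * m) * J + m\<^sup>2 * (y - x)"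
    unfolding J_def v[symmetric] using h i by simp
  finally have nn: "0 \<le> (LINT s|lborel. indicator {x..<y} s * (h s)\<^sup>2) - (2 * m) * J + m\<^sup>2 * (y - x)" .
  have mJ: "m * (y - x) = J" using p by (simp add: m_def)
  have "m\<^sup>2 * (y - x) = m * J" unfolding power2_eq_square mult.assoc mJ ..
  then have "m * J \<le> (LINT s|lborel. indicator {x..<y} s * (h s)\<^sup>2)" using nn by linarith
  then have "J\<^sup>2 / (y - x) \<le> (LINT s|lborel. indicator {x..<y} s * (h s)\<^sup>2)"
    by (simp add: m_def power2_eq_square)
  then show ?thesis using p by (simp add: J_def field_simps)
qed simp

lemma L2_interval_norms:
  fixes g :: "real \<Rightarrow> 'a::euclidean_space"
  assumes "g \<in> L2"
  shows "integrable lborel (\<lambda>s. indicator {x..<y} s * norm (g s))" "integrable lborel (\<lambda>s. indicator {x..<y} s * (norm (g s))\<^sup>2)"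
  using integrable_norm[OF L2_set_integrable[OF assms, of x y]]
    integrable_mult_indicator[OF _ L2_integrable[OF assms], of "{x..<y}"]
  by auto

lemma primitive_hoelder:
  fixes f g :: "real \<Rightarrow> 'a::euclidean_space"
  assumes f: "is_primitive f g" and g: "g \<in> L2" and xy: "x \<le> y"
  shows "norm (f y - f x) \<le> (LINT s|lborel. indicator {x..<y} s * norm (g s))"
    "(norm (f y - f x))\<^sup>2 \<le> (y - x) * (LINT s|lborel. indicator {x..<y} s * (norm (g s))\<^sup>2)"
proof -
  have "norm (f y - f x) = norm (LINT s|lborel. indicator {x..<y} s *\<^sub>R g s)" using f xy by (simp add: is_primitive_def)
  also have "\<dots> \<le> (LINT s|lborel. norm (indicator {x..<y} s *\<^sub>R g s))" by (rule integral_norm_bound)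
  also have "(\<lambda>s. norm (indicator {x..<y} s *\<^sub>R g s)) = (\<lambda>s. indicator {x..<y} s * norm (g s))" by auto
  finally show 1: "norm (f y - f x) \<le> (LINT s|lborel. indicator {x..<y} s * norm (g s))" .
  have "(norm (f y - f x))\<^sup>2 \<le> (LINT s|lborel. indicator {x..<y} s * norm (g s))\<^sup>2" by (rule power_mono[OF 1]) simp
  also have "\<dots> \<le> (y - x) * (LINT s|lborel. indicator {x..<y} s * (norm (g s))\<^sup>2)"
    by (rule cauchy_schwarz_interval[OF L2_interval_norms[OF g] xy])
  finally show "(norm (f y - f x))\<^sup>2 \<le> (y - x) * (LINT s|lborel. indicator {x..<y} s * (norm (g s))\<^sup>2)" .
qed

lemma primitive_hoelder_global:
  fixes f g :: "real \<Rightarrow> 'a::euclidean_space"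
  assumes f: "is_primitive f g" and g: "g \<in> L2"
  shows "(norm (f y - f x))\<^sup>2 \<le> \<bar>y - x\<bar> * (LINT s|lborel. (norm (g s))\<^sup>2)"
proof -
  have *: "(norm (f y - f x))\<^sup>2 \<le> \<bar>y - x\<bar> * (LINT s|lborel. (norm (g s))\<^sup>2)" if "x \<le> y" for x y
  proof (rule order_trans[OF primitive_hoelder(2)[OF f g that]])
    have "(LINT s|lborel. indicator {x..<y} s * (norm (g s))\<^sup>2) \<le> (LINT s|lborel. (norm (g s))\<^sup>2)"
      by (rule integral_mono[OF L2_interval_norms(2)[OF g] L2_integrable[OF g]]) (auto simp: indicator_def)
    then show "(y - x) * (LINT s|lborel. indicator {x..<y} s * (norm (g s))\<^sup>2) \<le> \<bar>y - x\<bar> * (LINT s|lborel. (norm (g s))\<^sup>2)"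
      using that by (simp add: mult_left_mono)
  qed
  show ?thesis using *[of x y] *[of y x] by (cases "x \<le> y") (auto simp: norm_minus_commute abs_minus_commute)
qed

lemma hoelder_half_continuous:
  fixes f :: "real \<Rightarrow> 'a::real_normed_vector"
  assumes "\<And>x y. (norm (f y - f x))\<^sup>2 \<le> \<bar>y - x\<bar> * C"
  shows "continuous_on UNIV f"
proof (rule continuous_at_imp_continuous_on, rule ballI)
  fix x
  have "((\<lambda>y. sqrt (\<bar>y - x\<bar> * C)) \<longlongrightarrow> 0) (at x)" by (auto intro!: tendsto_eq_intros)
  then have "((\<lambda>y. norm (f y - f x)) \<longlongrightarrow> 0) (at x)"
    by (rule Lim_null_comparison[rotated]) (use assms in \<open>auto intro!: always_eventually real_le_rsqrt\<close>)
  then show "isCont f x" unfolding isCont_def using tendsto_norm_zero_iff LIM_zero_iff by blast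
qed

text \<open>If |f| were at least \<epsilon> at a far point, the Hoelder estimate would keep it above
  \<epsilon>/2 on an interval of length \<delta>, and the tail of the integral of |f|^2 would be at
  least \<delta> (\<epsilon>/2)^2. But the tails tend to 0.\<close>

lemma primitive_vanishes:
  fixes f g :: "real \<Rightarrow> 'a::euclidean_space"
  assumes f: "is_primitive f g" and g: "g \<in> L2" and f2: "f \<in> L2"
  shows "(f \<longlongrightarrow> 0) at_infinity"
proof (rule tendstoI)
  fix \<epsilon> :: real assume e: "\<epsilon> > 0"
  \<comment> \<open>The summand 1 makes D positive; \<delta> is then a length over which f varies by
    at most \<epsilon>/2.\<close>
  define D where "D = (LINT s|lborel. (norm (g s))\<^sup>2) + 1"
  have D: "D > 0" unfolding D_def by (intro add_nonneg_pos Bochner_Integration.integral_nonneg) auto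
  define \<delta> where "\<delta> = (\<epsilon>/2)\<^sup>2 / D"
  have \<delta>: "\<delta> > 0" using e D by (simp add: \<delta>_def)
  have fi: "integrable lborel (\<lambda>s. (norm (f s))\<^sup>2)" by (rule L2_integrable[OF f2])
  have "(\<lambda>n. LINT s|lborel. indicator {s. \<bar>s\<bar> > real n} s * (norm (f s))\<^sup>2) \<longlonglongrightarrow> (LINT s|(lborel::real measure). 0)"
  proof (rule integral_dominated_convergence[OF _ _ fi])
    show "(\<lambda>s. indicator {s. \<bar>s\<bar> > real n} s * (norm (f s))\<^sup>2) \<in> borel_measurable lborel" for n
      using L2_measurable[OF f2] by measurable
    show "AE s in lborel. (\<lambda>n. indicator {s. \<bar>s\<bar> > real n} s * (norm (f s))\<^sup>2) \<longlonglongrightarrow> 0"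
    proof (rule AE_I2)
      fix s :: real
      have "\<forall>\<^sub>F n in sequentially. \<bar>s\<bar> \<le> real n"
        using filterlim_real_sequentially by (simp add: filterlim_at_top)
      then have "\<forall>\<^sub>F n in sequentially. indicator {s. \<bar>s\<bar> > real n} s * (norm (f s))\<^sup>2 = 0"
        by eventually_elim (simp add: indicator_def)
      then show "(\<lambda>n. indicator {s. \<bar>s\<bar> > real n} s * (norm (f s))\<^sup>2) \<longlonglongrightarrow> 0" by (rule tendsto_eventually)
    qed
  qed (auto simp: indicator_def)
  then have "\<forall>\<^sub>F n in sequentially. (LINT s|lborel. indicator {s. \<bar>s\<bar> > real n} s * (norm (f s))\<^sup>2) < \<delta> * (\<epsilon>/2)\<^sup>2"
    by (rule order_tendstoD) (use \<delta> e in simp)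
  then obtain n where n: "(LINT s|lborel. indicator {s. \<bar>s\<bar> > real n} s * (norm (f s))\<^sup>2) < \<delta> * (\<epsilon>/2)\<^sup>2"
    unfolding eventually_sequentially by blast
  have "norm (f x) < \<epsilon>" if x: "\<bar>x\<bar> \<ge> real n + \<delta> + 1" for x
  proof (rule ccontr)
    assume "\<not> norm (f x) < \<epsilon>"
    have low: "(\<epsilon>/2)\<^sup>2 \<le> (norm (f s))\<^sup>2" if s: "s \<in> {x..<x+\<delta>}" for s
    proof -
      have "(norm (f s - f x))\<^sup>2 \<le> \<bar>s - x\<bar> * (LINT s|lborel. (norm (g s))\<^sup>2)" by (rule primitive_hoelder_global[OF f g])
      also have "\<dots> \<le> \<delta> * D" using s by (intro mult_mono) (auto simp: D_def)
      also have "\<dots> = (\<epsilon>/2)\<^sup>2" using D by (simp add: \<delta>_def)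
      finally have "norm (f s - f x) \<le> \<epsilon>/2" by (rule power2_le_imp_le) (use e in simp)
      then have "norm (f s) \<ge> \<epsilon>/2" using \<open>\<not> norm (f x) < \<epsilon>\<close> norm_triangle_ineq2[of "f x" "f s"] by (simp add: norm_minus_commute)
      then show ?thesis using e by (intro power_mono) auto
    qed
    have "\<delta> * (\<epsilon>/2)\<^sup>2 = (LINT s|lborel. indicator {x..<x+\<delta>} s * (\<epsilon>/2)\<^sup>2)" using \<delta> by simp
    also have "\<dots> \<le> (LINT s|lborel. indicator {s. \<bar>s\<bar> > real n} s * (norm (f s))\<^sup>2)"
    proof (rule integral_mono)
      show "integrable lborel (\<lambda>s. indicator {x..<x+\<delta>} s * (\<epsilon>/2)\<^sup>2)"
        by (intro integrable_mult_left integrable_real_indicator) (use \<delta> in auto)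
      show "integrable lborel (\<lambda>s. indicator {s. \<bar>s\<bar> > real n} s * (norm (f s))\<^sup>2)"
        using integrable_mult_indicator[OF _ fi, of "{s. \<bar>s\<bar> > real n}"] by simp
      fix s
      show "indicator {x..<x+\<delta>} s * (\<epsilon>/2)\<^sup>2 \<le> indicator {s. \<bar>s\<bar> > real n} s * (norm (f s))\<^sup>2"
      proof (cases "s \<in> {x..<x+\<delta>}")
        case True
        then have "\<bar>s\<bar> > real n" using x by auto
        then show ?thesis using True low by simp
      qed simp
    qed
    finally show False using n by simp
  qed
  then show "\<forall>\<^sub>F x in at_infinity. dist (f x) 0 < \<epsilon>" unfolding eventually_at_infinity by (auto intro!: exI[of _ "real n + \<delta> + 1"])
qed

text \<open>The test function is a smoothed indicator of [a, b], the difference of two rescaled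
  copies of the primitive P of a bump. Its derivative is a difference of approximate identities at a
  and b, which single out f a - f b by continuity, while the other side tends to minus the integral
  of g over the interval.\<close>

lemma weak_deriv_imp_primitive:
  fixes f g :: "real \<Rightarrow> 'a::euclidean_space"
  assumes fc: "continuous_on UNIV f" and f2: "f \<in> L2" and g2: "g \<in> L2" and wd: "is_weak_deriv f g"
  shows "is_primitive f g"
  unfolding is_primitive_def
proof (intro allI impI)
  fix a b :: real assume ab: "a \<le> b"
  obtain \<rho> :: "real \<Rightarrow> real" where \<rho>: "\<And>n. smooth_upto n \<rho>" "\<And>x. 0 \<le> \<rho> x" "\<And>x. x \<notin> {0<..<1} \<Longrightarrow> \<rho> x = 0"
    "continuous_on UNIV \<rho>" "integrable lborel \<rho>" "(LINT x|lborel. \<rho> x) = 1" by (rule bump_exists) (rule that)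
  have \<rho>m: "\<rho> \<in> borel_measurable borel" by (rule borel_measurable_continuous_onI[OF \<rho>(4)])
  have "compact (\<rho> ` {0..1})" by (rule compact_continuous_image[OF continuous_on_subset[OF \<rho>(4)]]) auto
  then obtain B where B: "B > 0" "\<And>y. y \<in> \<rho> ` {0..1} \<Longrightarrow> norm y \<le> B" using compact_imp_bounded bounded_pos by metis
  have \<rho>B: "\<bar>\<rho> y\<bar> \<le> B * indicator {0..1} y" for y
    using B(2)[of "\<rho> y"] \<rho>(3)[of y] by (auto simp: indicator_def)
  define P where "P y = (LINT s|lborel. indicator {..<y} s *\<^sub>R \<rho> s)" for y
  have Pi: "integrable lborel (\<lambda>s. indicator {..<y} s *\<^sub>R \<rho> s)" for y
    by (rule integrable_mult_indicator[OF _ \<rho>(5)]) simp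
  have "P y - P x = (LINT s|lborel. indicator {x..<y} s *\<^sub>R \<rho> s)" if "x \<le> y" for x y
    unfolding P_def Bochner_Integration.integral_diff[OF Pi Pi, symmetric]
    by (rule Bochner_Integration.integral_cong) (use that in \<open>auto simp: indicator_def\<close>)
  from integral_has_vector_derivative_UNIV[OF \<rho>(4) this]
  have Pd: "(P has_real_derivative \<rho> x) (at x)" for x by (simp add: has_real_derivative_iff_has_vector_derivative)
  have Psm: "smooth_upto n P" for n
  proof (cases n)
    case 0 then show ?thesis using Pd by (auto simp: field_differentiable_def)
  next
    case (Suc m)
    have "deriv P = \<rho>" using Pd by (auto simp: fun_eq_iff DERIV_imp_deriv)
    then show ?thesis using Suc Pd \<rho>(1) by (auto simp: field_differentiable_def)
  qed
  have P0: "P y = 0" if "y \<le> 0" for y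
  proof -
    have "indicator {..<y} s *\<^sub>R \<rho> s = 0" for s using that \<rho>(3)[of s] by (auto simp: indicator_def)
    then have "(\<lambda>s. indicator {..<y} s *\<^sub>R \<rho> s) = (\<lambda>_. 0)" by (rule ext)
    then show ?thesis unfolding P_def by (simp only: Bochner_Integration.integral_zero)
  qed
  have P1: "P y = 1" if "y \<ge> 1" for y
  proof -
    have "indicator {..<y} s *\<^sub>R \<rho> s = \<rho> s" for s using that \<rho>(3)[of s] by (auto simp: indicator_def)
    then have "(\<lambda>s. indicator {..<y} s *\<^sub>R \<rho> s) = \<rho>" by (rule ext)
    then show ?thesis using \<rho>(6) unfolding P_def by (simp only:)
  qed
  have P01: "0 \<le> P y" "P y \<le> 1" for y
  proof -
    show "0 \<le> P y" unfolding P_def using \<rho>(2) by (intro Bochner_Integration.integral_nonneg) auto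
    have "P y \<le> (LINT s|lborel. \<rho> s)" unfolding P_def
      by (rule integral_mono[OF Pi \<rho>(5)]) (use \<rho>(2) in \<open>auto simp: indicator_def\<close>)
    then show "P y \<le> 1" using \<rho>(6) by simp
  qed
  define \<epsilon> where "\<epsilon> n = 1 / real (Suc n)" for n
  have \<epsilon>: "0 < \<epsilon> n" "\<epsilon> n \<le> 1" for n by (auto simp: \<epsilon>_def field_simps)
  have \<epsilon>lim: "\<epsilon> \<longlonglongrightarrow> 0" unfolding \<epsilon>_def by (rule LIMSEQ_Suc[OF lim_1_over_n])
  define \<eta> where "\<eta> n x = P ((x - a) / \<epsilon> n) - P ((x - b) / \<epsilon> n)" for n x
  have \<eta>sm: "smooth_upto k (\<eta> n)" for k n
  proof -
    have "smooth_upto k (\<lambda>x. 1 * P (- a / \<epsilon> n + (1 / \<epsilon> n) * x) + (- 1) * P (- b / \<epsilon> n + (1 / \<epsilon> n) * x))"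
      by (intro smooth_upto_add smooth_upto_affine Psm)
    also have "(\<lambda>x. 1 * P (- a / \<epsilon> n + (1 / \<epsilon> n) * x) + (- 1) * P (- b / \<epsilon> n + (1 / \<epsilon> n) * x)) = \<eta> n"
      by (auto simp: \<eta>_def diff_divide_distrib fun_eq_iff)
    finally show ?thesis .
  qed
  have \<eta>d: "deriv (\<eta> n) x = (1 / \<epsilon> n) * \<rho> ((x - a) / \<epsilon> n) - (1 / \<epsilon> n) * \<rho> ((x - b) / \<epsilon> n)" for n x
  proof -
    have "(\<eta> n has_real_derivative \<rho> ((x - a) / \<epsilon> n) * (1 / \<epsilon> n) - \<rho> ((x - b) / \<epsilon> n) * (1 / \<epsilon> n)) (at x)"
      unfolding \<eta>_def using \<epsilon>(1)[of n] by (intro DERIV_diff DERIV_chain2[OF Pd]) (auto intro!: derivative_eq_intros)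
    then show ?thesis by (simp add: DERIV_imp_deriv)
  qed
  have \<eta>0: "\<eta> n x = 0" if x: "x \<notin> {a..b+1}" for n x
  proof -
    consider "x < a" | "x > b + 1" using x by force
    then show ?thesis
    proof cases
      case 1
      then have "(x - a) / \<epsilon> n \<le> 0" "(x - b) / \<epsilon> n \<le> 0" using \<epsilon>(1)[of n] ab by (auto intro!: divide_nonpos_pos)
      then show ?thesis by (simp add: \<eta>_def P0)
    next
      case 2
      then have "(x - a) / \<epsilon> n \<ge> 1" "(x - b) / \<epsilon> n \<ge> 1" using \<epsilon>[of n] ab by (simp_all add: pos_le_divide_eq)
      then show ?thesis by (simp add: \<eta>_def P1)
    qed
  qed
  have \<eta>b: "\<bar>\<eta> n x\<bar> \<le> 1 * indicator {a..b+1} x" for n x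
    using \<eta>0[of x n] P01[of "(x - a) / \<epsilon> n"] P01[of "(x - b) / \<epsilon> n"]
    by (cases "x \<in> {a..b+1}") (simp_all add: \<eta>_def abs_le_iff)
  have \<eta>t: "test_function (\<eta> n)" for n
  proof -
    have "{x. \<eta> n x \<noteq> 0} \<subseteq> {a..b+1}" using \<eta>0 by blast
    then have "bounded {x. \<eta> n x \<noteq> 0}" using bounded_subset bounded_closed_interval by blast
    then show ?thesis unfolding test_function_def using smooth_upto_iterate[OF \<eta>sm] by (simp add: compact_closure)
  qed
  have eq: "(LINT x|lborel. deriv (\<eta> n) x *\<^sub>R f x) = - (LINT x|lborel. \<eta> n x *\<^sub>R g x)" for n
    using wd \<eta>t unfolding is_weak_deriv_def by blast
  \<comment> \<open>Substituting x = c + \<epsilon> n * y moves the concentration from the bump to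
    the argument of f, where continuity can be used.\<close>
  have piece: "integrable lborel (\<lambda>x. ((1 / \<epsilon> n) * \<rho> ((x - c) / \<epsilon> n)) *\<^sub>R f x)"
    "(LINT x|lborel. ((1 / \<epsilon> n) * \<rho> ((x - c) / \<epsilon> n)) *\<^sub>R f x) = (LINT y|lborel. \<rho> y *\<^sub>R f (c + \<epsilon> n * y))" for n c
  proof -
    have "\<bar>(1 / \<epsilon> n) * \<rho> ((x - c) / \<epsilon> n)\<bar> \<le> (B / \<epsilon> n) * indicator {c..c+\<epsilon> n} x" for x
    proof -
      have i: "indicator {0..1} ((x - c) / \<epsilon> n) = (indicator {c..c+\<epsilon> n} x :: real)"
        using \<epsilon>(1)[of n] by (auto simp: indicator_def field_simps)
      show ?thesis using \<rho>B[of "(x - c) / \<epsilon> n"] \<epsilon>(1)[of n] unfolding i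
        by (simp add: abs_mult divide_right_mono)
    qed
    moreover have "(\<lambda>x. (1 / \<epsilon> n) * \<rho> ((x - c) / \<epsilon> n)) \<in> borel_measurable lborel" using \<rho>m by measurable
    ultimately show "integrable lborel (\<lambda>x. ((1 / \<epsilon> n) * \<rho> ((x - c) / \<epsilon> n)) *\<^sub>R f x)"
      by (intro L2_integrable_compact_weight[OF f2])
    show "(LINT x|lborel. ((1 / \<epsilon> n) * \<rho> ((x - c) / \<epsilon> n)) *\<^sub>R f x) = (LINT y|lborel. \<rho> y *\<^sub>R f (c + \<epsilon> n * y))"
      using \<epsilon>(1)[of n] by (subst lborel_integral_real_affine[where c="\<epsilon> n" and t=c]) (auto simp flip: integral_scaleR_right)
  qed
  have lim1: "(\<lambda>n. LINT y|lborel. \<rho> y *\<^sub>R f (c + \<epsilon> n * y)) \<longlonglongrightarrow> f c" for c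
  proof -
    have "compact (f ` {c..c+1})" by (rule compact_continuous_image[OF continuous_on_subset[OF fc]]) auto
    then obtain C where C: "C > 0" "\<And>y. y \<in> f ` {c..c+1} \<Longrightarrow> norm y \<le> C" using compact_imp_bounded bounded_pos by metis
    have "(\<lambda>n. LINT y|lborel. \<rho> y *\<^sub>R f (c + \<epsilon> n * y)) \<longlonglongrightarrow> (LINT y|lborel. \<rho> y *\<^sub>R f c)"
    proof (rule integral_dominated_convergence)
      have fm: "f \<in> borel_measurable borel" by (rule borel_measurable_continuous_onI[OF fc])
      show "(\<lambda>y. \<rho> y *\<^sub>R f c) \<in> borel_measurable lborel" using \<rho>m by measurable
      show "(\<lambda>y. \<rho> y *\<^sub>R f (c + \<epsilon> n * y)) \<in> borel_measurable lborel" for n using \<rho>m fm by measurable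
      show "integrable lborel (\<lambda>y. \<rho> y * C)" using \<rho>(5) by simp
      show "AE y in lborel. (\<lambda>n. \<rho> y *\<^sub>R f (c + \<epsilon> n * y)) \<longlonglongrightarrow> \<rho> y *\<^sub>R f c"
      proof (rule AE_I2)
        fix y
        have "(\<lambda>n. c + \<epsilon> n * y) \<longlonglongrightarrow> c + 0 * y" by (intro tendsto_intros \<epsilon>lim)
        then have "(\<lambda>n. c + \<epsilon> n * y) \<longlonglongrightarrow> c" by simp
        moreover have "isCont f c" using fc by (simp add: continuous_on_eq_continuous_at)
        ultimately have "(\<lambda>n. f (c + \<epsilon> n * y)) \<longlonglongrightarrow> f c" by (rule isCont_tendsto_compose[rotated])
        then show "(\<lambda>n. \<rho> y *\<^sub>R f (c + \<epsilon> n * y)) \<longlonglongrightarrow> \<rho> y *\<^sub>R f c" by (intro tendsto_intros)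
      qed
      show "AE y in lborel. norm (\<rho> y *\<^sub>R f (c + \<epsilon> n * y)) \<le> \<rho> y * C" for n
      proof (rule AE_I2)
        fix y
        show "norm (\<rho> y *\<^sub>R f (c + \<epsilon> n * y)) \<le> \<rho> y * C"
        proof (cases "y \<in> {0<..<1}")
          case True
          then have "\<epsilon> n * y \<le> 1" "0 \<le> \<epsilon> n * y" using \<epsilon>[of n] by (auto intro!: mult_le_one)
          then have "f (c + \<epsilon> n * y) \<in> f ` {c..c+1}" by (intro imageI) auto
          then have "norm (f (c + \<epsilon> n * y)) \<le> C" by (rule C(2))
          from mult_left_mono[OF this \<rho>(2)[of y]] show ?thesis using \<rho>(2)[of y] by simp
        next
          case False then show ?thesis using \<rho>(3) by simp
        qed
      qed
    qed
    also have "(LINT y|lborel. \<rho> y *\<^sub>R f c) = f c" using \<rho>(5,6) by simp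
    finally show ?thesis .
  qed
  have "(\<lambda>n. LINT x|lborel. deriv (\<eta> n) x *\<^sub>R f x) \<longlonglongrightarrow> f a - f b"
  proof -
    have "(LINT x|lborel. deriv (\<eta> n) x *\<^sub>R f x) = (LINT y|lborel. \<rho> y *\<^sub>R f (a + \<epsilon> n * y)) - (LINT y|lborel. \<rho> y *\<^sub>R f (b + \<epsilon> n * y))" for n
      unfolding \<eta>d scaleR_diff_left Bochner_Integration.integral_diff[OF piece(1) piece(1)] piece(2) ..
    then show ?thesis using tendsto_diff[OF lim1[of a] lim1[of b]] by simp
  qed
  moreover have "(\<lambda>n. - (LINT x|lborel. \<eta> n x *\<^sub>R g x)) \<longlonglongrightarrow> - (LINT x|lborel. indicator {a..<b} x *\<^sub>R g x)"
  proof (rule tendsto_minus, rule integral_dominated_convergence)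
    have gm: "g \<in> borel_measurable borel" using L2_measurable[OF g2] by simp
    show "(\<lambda>x. indicator {a..<b} x *\<^sub>R g x) \<in> borel_measurable lborel" using gm by measurable
    have "\<eta> n \<in> borel_measurable borel" for n
      using smooth_upto_differentiable[OF \<eta>sm[of 0 n]]
      by (intro borel_measurable_continuous_onI continuous_at_imp_continuous_on ballI field_differentiable_imp_continuous_at)
    then show "(\<lambda>x. \<eta> n x *\<^sub>R g x) \<in> borel_measurable lborel" for n using gm by measurable
    show "integrable lborel (\<lambda>x. norm (indicator {a..b+1} x *\<^sub>R g x))"
      by (intro integrable_norm L2_integrable_compact_weight[OF g2, of _ 1 a "b+1"]) (auto simp: indicator_def)
    show "AE x in lborel. norm (\<eta> n x *\<^sub>R g x) \<le> norm (indicator {a..b+1} x *\<^sub>R g x)" for n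
      using \<eta>b[of n] by (intro AE_I2) (auto simp: intro!: mult_right_mono)
    have step: "(\<lambda>n. P ((x - c) / \<epsilon> n)) \<longlonglongrightarrow> (if x < c then 0 else 1)" if "x \<noteq> c" for x c
    proof (cases "x < c")
      case True
      then have "P ((x - c) / \<epsilon> n) = 0" for n using \<epsilon>(1)[of n] by (intro P0) (simp add: divide_nonpos_pos)
      then show ?thesis using True by simp
    next
      case False
      then have p: "x - c > 0" using that by simp
      have "\<forall>\<^sub>F n in sequentially. \<epsilon> n < x - c" by (rule order_tendstoD(2)[OF \<epsilon>lim p])
      then have "\<forall>\<^sub>F n in sequentially. P ((x - c) / \<epsilon> n) = 1"
        by eventually_elim (use \<epsilon>(1) in \<open>auto intro!: P1 simp: pos_le_divide_eq\<close>)
      then show ?thesis using False by (simp add: tendsto_eventually)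
    qed
    have "AE x in lborel. x \<noteq> a \<and> x \<noteq> b" by (intro AE_conjI AE_lborel_singleton)
    then show "AE x in lborel. (\<lambda>n. \<eta> n x *\<^sub>R g x) \<longlonglongrightarrow> indicator {a..<b} x *\<^sub>R g x"
    proof eventually_elim
      case (elim x)
      have "(\<lambda>n. \<eta> n x) \<longlonglongrightarrow> (if x < a then 0 else 1) - (if x < b then 0 else 1)"
        unfolding \<eta>_def by (intro tendsto_diff step) (use elim in auto)
      also have "(if x < a then 0 else 1) - (if x < b then 0 else 1) = (indicator {a..<b} x :: real)"
        using elim ab by (auto simp: indicator_def)
      finally show ?case by (intro tendsto_intros)
    qed
  qed
  ultimately have "f a - f b = - (LINT x|lborel. indicator {a..<b} x *\<^sub>R g x)"
    unfolding eq by (rule LIMSEQ_unique)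
  then show "f b - f a = (LINT x|lborel. indicator {a..<b} x *\<^sub>R g x)" by (metis minus_diff_eq minus_equation_iff)
qed

text \<open>Over N equal pieces the total increment is at most N times a multiple of (1/N)^(3/2),
  which tends to 0.\<close>

lemma three_halves_constant:
  fixes D :: "real \<Rightarrow> 'a::real_normed_vector"
  assumes ab: "a \<le> b" and D: "\<And>x y. a \<le> x \<Longrightarrow> x \<le> y \<Longrightarrow> y \<le> b \<Longrightarrow> norm (D y - D x) \<le> C * (y - x) * sqrt (y - x)"
  shows "D b = D a"
proof -
  have bd: "norm (D b - D a) \<le> C * (b - a) * sqrt ((b - a) * (1 / real (Suc n)))" for n
  proof -
    define N where "N = Suc n"
    define p where "p i = a + real i * ((b - a) / real N)" for i
    have ps: "p (Suc i) - p i = (b - a) / real N" for i 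
    proof -
      have "real (Suc i) * c - real i * c = c" for c :: real by (simp add: distrib_right)
      from this[of "(b - a) / real N"] show ?thesis unfolding p_def by linarith
    qed
    have "D b - D a = (\<Sum>i<N. D (p (Suc i)) - D (p i))"
      by (subst sum_lessThan_telescope) (simp add: p_def N_def)
    then have "norm (D b - D a) \<le> (\<Sum>i<N. norm (D (p (Suc i)) - D (p i)))" by (simp add: norm_sum)
    also have "\<dots> \<le> (\<Sum>i<N. C * ((b - a) / real N) * sqrt ((b - a) / real N))"
    proof (rule sum_mono)
      fix i assume i: "i \<in> {..<N}"
      have 0: "0 \<le> (b - a) / real N" using ab by simp
      have "real (Suc i) * ((b - a) / real N) \<le> real N * ((b - a) / real N)" using i 0 by (intro mult_right_mono) auto
      then have "p (Suc i) \<le> b" unfolding p_def N_def by simp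
      moreover have "a \<le> p i" unfolding p_def using mult_nonneg_nonneg[OF of_nat_0_le_iff 0, of i] by linarith
      moreover have "p i \<le> p (Suc i)" using ps[of i] 0 by linarith
      ultimately show "norm (D (p (Suc i)) - D (p i)) \<le> C * ((b - a) / real N) * sqrt ((b - a) / real N)"
        using D[of "p i" "p (Suc i)"] unfolding ps by simp
    qed
    also have "\<dots> = C * (b - a) * sqrt ((b - a) * (1 / real N))" by (simp add: N_def)
    finally show ?thesis by (simp add: N_def)
  qed
  have "(\<lambda>n. C * (b - a) * sqrt ((b - a) * (1 / real (Suc n)))) \<longlonglongrightarrow> C * (b - a) * sqrt ((b - a) * 0)"
    by (intro tendsto_intros LIMSEQ_Suc[OF lim_1_over_n])
  then have "norm (D b - D a) \<le> C * (b - a) * sqrt ((b - a) * 0)"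
    by (rule LIMSEQ_le_const) (use bd in auto)
  then show ?thesis by simp
qed

text \<open>The defect of the formula over \<open>[x, y]\<close> is \<open>O((y - x) powr (3/2))\<close> by Cauchy-Schwarz, hence zero.\<close>

lemma primitive_by_parts:
  fixes f g :: "real \<Rightarrow> 'a::euclidean_space" and \<eta> \<eta>' :: "real \<Rightarrow> real"
  assumes f: "is_primitive f g" and g: "g \<in> L2"
    and d: "\<And>x. (\<eta> has_real_derivative \<eta>' x) (at x)" and c: "continuous_on UNIV \<eta>'" and ab: "a \<le> b"
  shows "integrable lborel (\<lambda>s. indicator {a..<b} s *\<^sub>R (\<eta>' s *\<^sub>R f s))"
    "integrable lborel (\<lambda>s. indicator {a..<b} s *\<^sub>R (\<eta> s *\<^sub>R g s))"
    "\<eta> b *\<^sub>R f b - \<eta> a *\<^sub>R f a =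
      (LINT s|lborel. indicator {a..<b} s *\<^sub>R (\<eta>' s *\<^sub>R f s)) + (LINT s|lborel. indicator {a..<b} s *\<^sub>R (\<eta> s *\<^sub>R g s))"
proof -
  have fc: "continuous_on UNIV f" by (rule hoelder_half_continuous[OF primitive_hoelder_global[OF f g]])
  have \<eta>c: "continuous_on UNIV \<eta>" using d by (intro continuous_at_imp_continuous_on ballI DERIV_isCont) 
  have ci: "integrable lborel (\<lambda>s. indicator {x..<y} s *\<^sub>R k s)" if "continuous_on UNIV k" for k :: "real \<Rightarrow> 'b::euclidean_space" and x y
  proof -
    have "integrable lborel (\<lambda>s. indicator {x..y} s *\<^sub>R k s)"
      by (rule borel_integrable_compact) (auto intro: continuous_on_subset[OF that])
    then have "integrable lborel (\<lambda>s. indicator {x..<y} s *\<^sub>R (indicator {x..y} s *\<^sub>R k s))"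
      by (rule integrable_mult_indicator[rotated]) simp
    then show ?thesis
      by (rule Bochner_Integration.integrable_cong[THEN iffD1, rotated 2]) (auto simp: indicator_def)
  qed
  have wi: "integrable lborel (\<lambda>s. indicator {x..<y} s *\<^sub>R (k s *\<^sub>R g s))" if "continuous_on UNIV k" for k :: "real \<Rightarrow> real" and x y
  proof -
    have "compact (k ` {x..y})" by (rule compact_continuous_image[OF continuous_on_subset[OF that]]) auto
    then obtain B where B: "B > 0" "\<And>z. z \<in> k ` {x..y} \<Longrightarrow> norm z \<le> B" using compact_imp_bounded bounded_pos by metis
    have "integrable lborel (\<lambda>s. (indicator {x..<y} s * k s) *\<^sub>R g s)"
    proof (rule L2_integrable_compact_weight[OF g])
      show "(\<lambda>s. indicator {x..<y} s * k s) \<in> borel_measurable lborel"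
        using borel_measurable_continuous_onI[OF that] by measurable
      show "\<bar>indicator {x..<y} s * k s\<bar> \<le> B * indicator {x..y} s" for s
        using B by (auto simp: indicator_def)
    qed
    then show ?thesis by simp
  qed
  have i1: "integrable lborel (\<lambda>s. indicator {x..<y} s *\<^sub>R (\<eta>' s *\<^sub>R f s))" for x y by (intro ci continuous_intros c fc)
  have i2: "integrable lborel (\<lambda>s. indicator {x..<y} s *\<^sub>R (\<eta> s *\<^sub>R g s))" for x y by (rule wi[OF \<eta>c])
  show "integrable lborel (\<lambda>s. indicator {a..<b} s *\<^sub>R (\<eta>' s *\<^sub>R f s))"
    "integrable lborel (\<lambda>s. indicator {a..<b} s *\<^sub>R (\<eta> s *\<^sub>R g s))" by (rule i1, rule i2)
  define H where "H x y = (LINT s|lborel. indicator {x..<y} s *\<^sub>R (\<eta>' s *\<^sub>R f s)) + (LINT s|lborel. indicator {x..<y} s *\<^sub>R (\<eta> s *\<^sub>R g s))" for x y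
  have Hadd: "H a y = H a x + H x y" if "a \<le> x" "x \<le> y" for x y
  proof -
    have s: "indicator {a..<y} s *\<^sub>R v = indicator {a..<x} s *\<^sub>R v + indicator {x..<y} s *\<^sub>R v" for s and v :: 'a
      using that by (auto simp: indicator_def)
    show ?thesis unfolding H_def s[of _ "\<eta>' _ *\<^sub>R f _"] s[of _ "\<eta> _ *\<^sub>R g _"]
      using i1 i2 by simp
  qed
  have "compact (\<eta>' ` {a..b})" by (rule compact_continuous_image[OF continuous_on_subset[OF c]]) auto
  then obtain L where L: "L > 0" "\<And>z. z \<in> \<eta>' ` {a..b} \<Longrightarrow> norm z \<le> L" using compact_imp_bounded bounded_pos by metis
  define N where "N = (LINT s|lborel. (norm (g s))\<^sup>2)"
  have N0: "N \<ge> 0" unfolding N_def by (rule Bochner_Integration.integral_nonneg) simp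
  define D where "D y = \<eta> y *\<^sub>R f y - H a y" for y
  have key: "norm (D y - D x) \<le> (2 * L * sqrt N) * (y - x) * sqrt (y - x)" if xy: "a \<le> x" "x \<le> y" "y \<le> b" for x y
  proof -
    have lip: "\<bar>\<eta> y - \<eta> s\<bar> \<le> L * (y - x)" if s: "s \<in> {x..<y}" for s
    proof -
      have "\<exists>z>s. z < y \<and> \<eta> y - \<eta> s = (y - s) * \<eta>' z" by (rule MVT2) (use d s in auto)
      then obtain z where z: "s < z" "z < y" "\<eta> y - \<eta> s = (y - s) * \<eta>' z" by blast
      have "\<bar>\<eta>' z\<bar> \<le> L" using L(2)[of "\<eta>' z"] z s xy by auto
      then have "\<bar>\<eta> y - \<eta> s\<bar> \<le> (y - s) * L" using z s by (simp add: abs_mult mult_left_mono)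
      also have "\<dots> \<le> (y - x) * L" using s L(1) by (intro mult_right_mono) auto
      finally show ?thesis by (simp add: mult.commute)
    qed
    have fl: "norm (f x - f s) \<le> sqrt N * sqrt (y - x)" if "s \<in> {x..<y}" for s
    proof -
      have "(norm (f x - f s))\<^sup>2 \<le> \<bar>x - s\<bar> * N" unfolding N_def by (rule primitive_hoelder_global[OF f g])
      also have "\<dots> \<le> (y - x) * N" using that N0 by (intro mult_right_mono) auto
      finally have "norm (f x - f s) \<le> sqrt ((y - x) * N)" by (rule real_le_rsqrt)
      then show ?thesis by (simp only: real_sqrt_mult mult.commute)
    qed
    have e1: "f y - f x = (LINT s|lborel. indicator {x..<y} s *\<^sub>R g s)" using f xy by (simp add: is_primitive_def)
    have e2: "\<eta> y - \<eta> x = (LINT s|lborel. indicator {x..<y} s *\<^sub>R \<eta>' s)"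
    proof -
      have "(LINT s|lborel. indicator {x..y} s *\<^sub>R \<eta>' s) = \<eta> y - \<eta> x"
        by (rule integral_FTC_atLeastAtMost[OF xy(2)])
           (use d c in \<open>auto simp: has_real_derivative_iff_has_vector_derivative[symmetric] intro: has_field_derivative_at_within continuous_on_subset\<close>)
      moreover have "(LINT s|lborel. indicator {x..y} s *\<^sub>R \<eta>' s) = (LINT s|lborel. indicator {x..<y} s *\<^sub>R \<eta>' s)"
      proof (rule integral_cong_AE)
        have "\<eta>' \<in> borel_measurable borel" by (rule borel_measurable_continuous_onI[OF c])
        then show "(\<lambda>s. indicator {x..y} s *\<^sub>R \<eta>' s) \<in> borel_measurable lborel" "(\<lambda>s. indicator {x..<y} s *\<^sub>R \<eta>' s) \<in> borel_measurable lborel"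
          by measurable
        show "AE s in lborel. indicator {x..y} s *\<^sub>R \<eta>' s = indicator {x..<y} s *\<^sub>R \<eta>' s"
          using AE_lborel_singleton[of y] by eventually_elim (auto simp: indicator_def)
      qed
      ultimately show ?thesis by simp
    qed
    have j1: "integrable lborel (\<lambda>s. \<eta> y *\<^sub>R (indicator {x..<y} s *\<^sub>R g s))"
      by (intro integrable_scaleR_right L2_set_integrable g)
    have j2: "integrable lborel (\<lambda>s. (indicator {x..<y} s *\<^sub>R \<eta>' s) *\<^sub>R f x)"
      by (intro integrable_scaleR_left ci c)
    \<comment> \<open>Splitting the increment of the product with \<eta> taken at y and f taken at x
      leaves (\<eta> y - \<eta> s) g s + \<eta>' s (f x - f s) under one integral. In the first term
      \<eta> gives a factor y - x, in the second f gives the root of y - x.\<close>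
    have "D y - D x = \<eta> y *\<^sub>R (f y - f x) + (\<eta> y - \<eta> x) *\<^sub>R f x - H x y"
      unfolding D_def Hadd[OF xy(1,2)] by (simp add: algebra_simps)
    also have "\<dots> = (LINT s|lborel. \<eta> y *\<^sub>R (indicator {x..<y} s *\<^sub>R g s)) + (LINT s|lborel. (indicator {x..<y} s *\<^sub>R \<eta>' s) *\<^sub>R f x) - H x y"
      unfolding e1 e2 integral_scaleR_right integral_scaleR_left[OF ci[OF c]] ..
    also have "\<dots> = (LINT s|lborel. (\<eta> y *\<^sub>R (indicator {x..<y} s *\<^sub>R g s) + (indicator {x..<y} s *\<^sub>R \<eta>' s) *\<^sub>R f x)
         - (indicator {x..<y} s *\<^sub>R (\<eta>' s *\<^sub>R f s) + indicator {x..<y} s *\<^sub>R (\<eta> s *\<^sub>R g s)))"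
      unfolding H_def using j1 j2 i1 i2 by simp
    finally have "norm (D y - D x) = norm (LINT s|lborel. (\<eta> y *\<^sub>R (indicator {x..<y} s *\<^sub>R g s) + (indicator {x..<y} s *\<^sub>R \<eta>' s) *\<^sub>R f x)
         - (indicator {x..<y} s *\<^sub>R (\<eta>' s *\<^sub>R f s) + indicator {x..<y} s *\<^sub>R (\<eta> s *\<^sub>R g s)))" by (rule arg_cong)
    also have "\<dots> \<le> (LINT s|lborel. L * (y - x) * (indicator {x..<y} s * norm (g s)) + indicator {x..<y} s * (L * (sqrt N * sqrt (y - x))))"
    proof (rule order_trans[OF integral_norm_bound], rule integral_mono[OF integrable_norm])
      show "integrable lborel (\<lambda>s. (\<eta> y *\<^sub>R (indicator {x..<y} s *\<^sub>R g s) + (indicator {x..<y} s *\<^sub>R \<eta>' s) *\<^sub>R f x)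
         - (indicator {x..<y} s *\<^sub>R (\<eta>' s *\<^sub>R f s) + indicator {x..<y} s *\<^sub>R (\<eta> s *\<^sub>R g s)))"
        using j1 j2 i1 i2 by (intro Bochner_Integration.integrable_diff Bochner_Integration.integrable_add)
      show "integrable lborel (\<lambda>s. L * (y - x) * (indicator {x..<y} s * norm (g s)) + indicator {x..<y} s * (L * (sqrt N * sqrt (y - x))))"
        by (intro Bochner_Integration.integrable_add integrable_mult_right L2_interval_norms(1)[OF g] integrable_mult_left integrable_real_indicator)
           (use xy in auto)
      fix s
      show "norm ((\<eta> y *\<^sub>R (indicator {x..<y} s *\<^sub>R g s) + (indicator {x..<y} s *\<^sub>R \<eta>' s) *\<^sub>R f x)
         - (indicator {x..<y} s *\<^sub>R (\<eta>' s *\<^sub>R f s) + indicator {x..<y} s *\<^sub>R (\<eta> s *\<^sub>R g s)))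
        \<le> L * (y - x) * (indicator {x..<y} s * norm (g s)) + indicator {x..<y} s * (L * (sqrt N * sqrt (y - x)))"
      proof (cases "s \<in> {x..<y}")
        case True
        have "norm ((\<eta> y *\<^sub>R g s + \<eta>' s *\<^sub>R f x) - (\<eta>' s *\<^sub>R f s + \<eta> s *\<^sub>R g s)) = norm ((\<eta> y - \<eta> s) *\<^sub>R g s + \<eta>' s *\<^sub>R (f x - f s))"
          by (rule arg_cong[where f=norm]) (simp add: algebra_simps)
        also have "\<dots> \<le> \<bar>\<eta> y - \<eta> s\<bar> * norm (g s) + \<bar>\<eta>' s\<bar> * norm (f x - f s)"
          using norm_triangle_ineq[of "(\<eta> y - \<eta> s) *\<^sub>R g s" "\<eta>' s *\<^sub>R (f x - f s)"] by simp
        also have "\<dots> \<le> L * (y - x) * norm (g s) + L * (sqrt N * sqrt (y - x))"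
          using lip[OF True] fl[OF True] L True xy
          by (intro add_mono mult_mono) auto
        finally show ?thesis using True by simp
      qed simp
    qed
    also have e3: "\<dots> = L * (y - x) * (LINT s|lborel. indicator {x..<y} s * norm (g s)) + (y - x) * (L * (sqrt N * sqrt (y - x)))"
    proof -
      have i: "integrable lborel (indicator {x..<y} :: real \<Rightarrow> real)"
        by (rule integrable_real_indicator) (auto simp: xy(2))
      have v: "(LINT s|lborel. indicator {x..<y} s) = y - x" using xy(2) by simp
      have "(LINT s|lborel. p * (indicator {x..<y} s * norm (g s)) + indicator {x..<y} s * q)
         = p * (LINT s|lborel. indicator {x..<y} s * norm (g s)) + (y - x) * q" for p q :: real
        unfolding Bochner_Integration.integral_add[OF integrable_mult_right[OF L2_interval_norms(1)[OF g]] integrable_mult_left[OF i]]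
          integral_mult_right_zero integral_mult_left_zero v ..
      then show ?thesis .
    qed
    finally have e4: "norm (D y - D x) \<le> L * (y - x) * (LINT s|lborel. indicator {x..<y} s * norm (g s)) + (y - x) * (L * (sqrt N * sqrt (y - x)))" .
    have "(LINT s|lborel. indicator {x..<y} s * norm (g s)) \<le> sqrt N * sqrt (y - x)"
    proof -
      have "(LINT s|lborel. indicator {x..<y} s * norm (g s))\<^sup>2 \<le> (y - x) * (LINT s|lborel. indicator {x..<y} s * (norm (g s))\<^sup>2)"
        by (rule cauchy_schwarz_interval[OF L2_interval_norms[OF g] xy(2)])
      also have "\<dots> \<le> (y - x) * N" unfolding N_def
        by (intro mult_left_mono integral_mono[OF L2_interval_norms(2)[OF g] L2_integrable[OF g]]) (use xy in \<open>auto simp: indicator_def\<close>)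
      finally have "(LINT s|lborel. indicator {x..<y} s * norm (g s)) \<le> sqrt ((y - x) * N)" by (rule real_le_rsqrt)
      then show ?thesis by (simp only: real_sqrt_mult mult.commute)
    qed
    then have "L * (y - x) * (LINT s|lborel. indicator {x..<y} s * norm (g s)) \<le> L * (y - x) * (sqrt N * sqrt (y - x))"
      using L(1) xy by (intro mult_left_mono) auto
    with e4 show ?thesis by (simp add: algebra_simps)
  qed
  have "D b = D a" by (rule three_halves_constant[OF ab key])
  moreover have "H a a = 0" by (simp add: H_def)
  ultimately show "\<eta> b *\<^sub>R f b - \<eta> a *\<^sub>R f a =
      (LINT s|lborel. indicator {a..<b} s *\<^sub>R (\<eta>' s *\<^sub>R f s)) + (LINT s|lborel. indicator {a..<b} s *\<^sub>R (\<eta> s *\<^sub>R g s))"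
    by (simp add: D_def H_def algebra_simps)
qed

subsection \<open>Elements of the Sobolev space as primitives\<close>

text \<open>Integration by parts on an interval that contains the closed support in its interior:
  \<eta> and its derivative vanish at the ends and beyond.\<close>

lemma primitive_imp_weak_deriv:
  fixes f g :: "real \<Rightarrow> 'a::euclidean_space"
  assumes f: "is_primitive f g" and g: "g \<in> L2"
  shows "is_weak_deriv f g"
  unfolding is_weak_deriv_def
proof (intro allI impI)
  fix \<eta> assume \<eta>: "test_function \<eta>"
  have d: "(\<eta> has_real_derivative deriv \<eta> x) (at x)" for x
  proof -
    have "\<eta> field_differentiable (at x)" using \<eta> unfolding test_function_def by (metis funpow_0)
    then show ?thesis by (simp add: field_differentiable_derivI)
  qed
  have c: "continuous_on UNIV (deriv \<eta>)"
  proof (intro continuous_at_imp_continuous_on ballI field_differentiable_imp_continuous_at)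
    fix x
    have "((deriv ^^ 1) \<eta>) field_differentiable (at x)" using \<eta> unfolding test_function_def by blast
    then show "deriv \<eta> field_differentiable (at x)" by simp
  qed
  have "bounded (closure {x. \<eta> x \<noteq> 0})" using \<eta> unfolding test_function_def by (blast intro: compact_imp_bounded)
  then obtain R where R: "\<And>x. x \<in> closure {x. \<eta> x \<noteq> 0} \<Longrightarrow> norm x \<le> R" unfolding bounded_iff by blast
  define b where "b = \<bar>R\<bar> + 1"
  have b: "b > 0" "R < b" by (auto simp: b_def)
  have z: "x \<notin> closure {x. \<eta> x \<noteq> 0}" if "\<bar>x\<bar> \<ge> b" for x using R[of x] that b by auto
  have \<eta>0: "\<eta> x = 0" if "\<bar>x\<bar> \<ge> b" for x using z[OF that] closure_subset[of "{x. \<eta> x \<noteq> 0}"] by auto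
  have \<eta>'0: "deriv \<eta> x = 0" if "\<bar>x\<bar> \<ge> b" for x
  proof -
    have "\<forall>\<^sub>F y in nhds x. y \<in> - closure {x. \<eta> x \<noteq> 0}" using z[OF that] by (intro eventually_nhds_in_open) auto
    then have "\<forall>\<^sub>F y in nhds x. \<eta> y = 0" by eventually_elim (use closure_subset[of "{x. \<eta> x \<noteq> 0}"] in auto)
    then have "deriv \<eta> x = deriv (\<lambda>_. 0) x" by (intro deriv_cong_ev) auto
    then show ?thesis by simp
  qed
  have i1: "indicator {-b..<b} s *\<^sub>R (deriv \<eta> s *\<^sub>R f s) = deriv \<eta> s *\<^sub>R f s" for s
    using \<eta>'0[of s] by (cases "s \<in> {-b..<b}") auto
  have i2: "indicator {-b..<b} s *\<^sub>R (\<eta> s *\<^sub>R g s) = \<eta> s *\<^sub>R g s" for s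
    using \<eta>0[of s] by (cases "s \<in> {-b..<b}") auto
  have "\<eta> b *\<^sub>R f b - \<eta> (-b) *\<^sub>R f (-b) = (LINT s|lborel. deriv \<eta> s *\<^sub>R f s) + (LINT s|lborel. \<eta> s *\<^sub>R g s)"
    using primitive_by_parts(3)[OF f g d c, of "-b" b] b unfolding i1 i2 by simp
  then have "(LINT s|lborel. deriv \<eta> s *\<^sub>R f s) + (LINT s|lborel. \<eta> s *\<^sub>R g s) = 0"
    using \<eta>0[of b] \<eta>0[of "-b"] b by simp
  then show "(LINT x|lborel. deriv \<eta> x *\<^sub>R f x) = - (LINT x|lborel. \<eta> x *\<^sub>R g x)" by (simp add: eq_neg_iff_add_eq_0)
qed

text \<open>The positive and the negative part of h, cut to [-N, N), are densities of finite
  measures that agree on all half-lines; uniqueness of densities makes them equal almost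
  everywhere.\<close>

lemma zero_of_interval_integrals:
  fixes h :: "real \<Rightarrow> real"
  assumes i: "\<And>x y. integrable lborel (\<lambda>s. indicator {x..<y} s * h s)"
    and z: "\<And>x y. x \<le> y \<Longrightarrow> (LINT s|lborel. indicator {x..<y} s * h s) = 0"
    and m: "h \<in> borel_measurable lborel"
  shows "AE s in lborel. h s = 0"
proof -
  have part: "AE s in lborel. s \<in> {-real N..<real N} \<longrightarrow> h s = 0" for N
  proof -
    define p where "p s = indicator {-real N..<real N} s * max 0 (h s)" for s
    define q where "q s = indicator {-real N..<real N} s * max 0 (- h s)" for s
    have pm: "p \<in> borel_measurable lborel" "q \<in> borel_measurable lborel" using m unfolding p_def q_def by measurable
    have e: "(\<integral>\<^sup>+s. ennreal (p s) * indicator {x<..} s \<partial>lborel) = (\<integral>\<^sup>+s. ennreal (q s) * indicator {x<..} s \<partial>lborel)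
         \<and> (\<integral>\<^sup>+s. ennreal (p s) * indicator {x<..} s \<partial>lborel) < \<infinity>" for x
    proof -
      \<comment> \<open>x clipped to [-N, N]: up to the points x and c, the half-line beyond x meets
        [-N, N) in [c, N).\<close>
      define c where "c = min (max x (- real N)) (real N)"
      have cN: "c \<le> real N" "- real N \<le> c" by (auto simp: c_def)
      have AE: "AE s in lborel. s \<noteq> x \<and> s \<noteq> c" by (intro AE_conjI AE_lborel_singleton)
      have ip: "integrable lborel (\<lambda>s. indicator {c..<real N} s * max 0 (h s))"
        "integrable lborel (\<lambda>s. indicator {c..<real N} s * max 0 (- h s))"
        by (rule Bochner_Integration.integrable_bound[OF i[of c "real N"]], use m in measurable,
            auto simp: indicator_def)+
      have "(LINT s|lborel. indicator {c..<real N} s * max 0 (h s)) - (LINT s|lborel. indicator {c..<real N} s * max 0 (- h s))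
         = (LINT s|lborel. indicator {c..<real N} s * h s)"
        unfolding Bochner_Integration.integral_diff[OF ip, symmetric]
        by (rule Bochner_Integration.integral_cong) (auto simp: indicator_def)
      then have eq: "(LINT s|lborel. indicator {c..<real N} s * max 0 (h s)) = (LINT s|lborel. indicator {c..<real N} s * max 0 (- h s))"
        using z[OF cN(1)] by simp
      have set: "s \<in> {-real N..<real N} \<and> s \<in> {x<..} \<longleftrightarrow> s \<in> {c..<real N}" if "s \<noteq> x \<and> s \<noteq> c" for s
        using that by (auto simp: c_def min_def max_def)
      have P: "(\<integral>\<^sup>+s. ennreal (p s) * indicator {x<..} s \<partial>lborel) = ennreal (LINT s|lborel. indicator {c..<real N} s * max 0 (h s))"
      proof -
        have "(\<integral>\<^sup>+s. ennreal (p s) * indicator {x<..} s \<partial>lborel) = (\<integral>\<^sup>+s. ennreal (indicator {c..<real N} s * max 0 (h s)) \<partial>lborel)"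
          by (rule nn_integral_cong_AE) (use AE in \<open>eventually_elim, use set in \<open>auto simp: p_def indicator_def split: if_splits\<close>\<close>)
        also have "\<dots> = ennreal (LINT s|lborel. indicator {c..<real N} s * max 0 (h s))"
          by (rule nn_integral_eq_integral[OF ip(1)]) auto
        finally show ?thesis .
      qed
      have Q: "(\<integral>\<^sup>+s. ennreal (q s) * indicator {x<..} s \<partial>lborel) = ennreal (LINT s|lborel. indicator {c..<real N} s * max 0 (- h s))"
      proof -
        have "(\<integral>\<^sup>+s. ennreal (q s) * indicator {x<..} s \<partial>lborel) = (\<integral>\<^sup>+s. ennreal (indicator {c..<real N} s * max 0 (- h s)) \<partial>lborel)"
          by (rule nn_integral_cong_AE) (use AE in \<open>eventually_elim, use set in \<open>auto simp: q_def indicator_def split: if_splits\<close>\<close>)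
        also have "\<dots> = ennreal (LINT s|lborel. indicator {c..<real N} s * max 0 (- h s))"
          by (rule nn_integral_eq_integral[OF ip(2)]) auto
        finally show ?thesis .
      qed
      show ?thesis unfolding P Q eq by simp
    qed
    have "density lborel (\<lambda>s. ennreal (p s)) = density lborel (\<lambda>s. ennreal (q s))"
    proof (rule measure_eqI_lessThan)
      fix x
      have em: "emeasure (density lborel (\<lambda>s. ennreal (k s))) {x<..} = (\<integral>\<^sup>+s. ennreal (k s) * indicator {x<..} s \<partial>lborel)"
        if "k \<in> borel_measurable lborel" for k :: "real \<Rightarrow> real"
        by (rule emeasure_density) (use that in auto)
      show "emeasure (density lborel (\<lambda>s. ennreal (p s))) {x<..} < \<infinity>"
        unfolding em[OF pm(1)] by (rule conjunct2[OF e])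
      show "emeasure (density lborel (\<lambda>s. ennreal (p s))) {x<..} = emeasure (density lborel (\<lambda>s. ennreal (q s))) {x<..}"
        unfolding em[OF pm(1)] em[OF pm(2)] by (rule conjunct1[OF e])
    qed simp_all
    then have "AE s in lborel. ennreal (p s) = ennreal (q s)"
      by (intro sigma_finite_measure.density_unique[OF sigma_finite_lborel]) (use pm in auto)
    then show ?thesis
    proof eventually_elim
      case (elim s)
      then have "p s = q s" by (subst (asm) ennreal_inj) (auto simp: p_def q_def)
      then show ?case by (auto simp: p_def q_def max_def split: if_splits)
    qed
  qed
  have "AE s in lborel. \<forall>N. s \<in> {-real N..<real N} \<longrightarrow> h s = 0" unfolding AE_all_countable using part by blast
  then show ?thesis
  proof eventually_elim
    case (elim s)
    obtain N where "\<bar>s\<bar> < real N" using reals_Archimedean2 by blast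
    then have "s \<in> {-real N..<real N}" by (auto simp: abs_less_iff)
    then show ?case using elim by blast
  qed
qed

text \<open>Inner products with basis vectors reduce this to real functions.\<close>

lemma primitive_unique:
  fixes f g1 g2 :: "real \<Rightarrow> 'a::euclidean_space"
  assumes f: "is_primitive f g1" "is_primitive f g2" and g: "g1 \<in> L2" "g2 \<in> L2"
  shows "AE x in lborel. g1 x = g2 x"
proof -
  have i: "integrable lborel (\<lambda>s. indicator {x..<y} s *\<^sub>R (g1 s - g2 s))" for x y
    using Bochner_Integration.integrable_diff[OF L2_set_integrable[OF g(1), of x y] L2_set_integrable[OF g(2), of x y]]
    by (simp add: scaleR_diff_right)
  have z: "(LINT s|lborel. indicator {x..<y} s *\<^sub>R (g1 s - g2 s)) = 0" if "x \<le> y" for x y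
  proof -
    have "(LINT s|lborel. indicator {x..<y} s *\<^sub>R (g1 s - g2 s)) =
      (LINT s|lborel. indicator {x..<y} s *\<^sub>R g1 s) - (LINT s|lborel. indicator {x..<y} s *\<^sub>R g2 s)"
      unfolding scaleR_diff_right by (rule Bochner_Integration.integral_diff[OF L2_set_integrable[OF g(1)] L2_set_integrable[OF g(2)]])
    then show ?thesis using f that by (simp add: is_primitive_def)
  qed
  have comp: "AE x in lborel. (g1 x - g2 x) \<bullet> e = 0" for e
  proof (rule zero_of_interval_integrals)
    show "integrable lborel (\<lambda>s. indicator {x..<y} s * ((g1 s - g2 s) \<bullet> e))" for x y
      using integrable_inner_left[OF i[of x y], of e] by simp
    show "(LINT s|lborel. indicator {x..<y} s * ((g1 s - g2 s) \<bullet> e)) = 0" if "x \<le> y" for x y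
      using integral_inner_left[OF i[of x y], of e] z[OF that] by simp
    show "(\<lambda>s. (g1 s - g2 s) \<bullet> e) \<in> borel_measurable lborel"
      using L2_measurable[OF g(1)] L2_measurable[OF g(2)] by measurable
  qed
  have "AE x in lborel. \<forall>e\<in>Basis. (g1 x - g2 x) \<bullet> e = 0" using comp by (intro AE_finite_allI) auto
  then show ?thesis by eventually_elim (auto intro: euclidean_eqI simp: inner_diff_left)
qed

section \<open>Calculus in H1\<close>

lemma H1_L2: "f \<in> H1 \<Longrightarrow> f \<in> L2" and H1_continuous: "f \<in> H1 \<Longrightarrow> continuous_on UNIV f"
  by (auto simp: H1_def)

lemma H1_weak_deriv:
  fixes f :: "real \<Rightarrow> 'a::euclidean_space"
  assumes "f \<in> H1" shows "weak_deriv f \<in> L2" "is_primitive f (weak_deriv f)"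
proof -
  have "\<exists>g. g \<in> L2 \<and> is_weak_deriv f g" using assms by (auto simp: H1_def)
  then have "weak_deriv f \<in> L2 \<and> is_weak_deriv f (weak_deriv f)" unfolding weak_deriv_def by (rule someI_ex)
  then show "weak_deriv f \<in> L2" "is_primitive f (weak_deriv f)"
    using weak_deriv_imp_primitive[OF H1_continuous[OF assms] H1_L2[OF assms]] by auto
qed

text \<open>\<open>weak_deriv\<close> is an arbitrary choice. This is the way to prove membership in
  H1 and to evaluate the chosen derivative up to null sets.\<close>

lemma H1I:
  fixes f :: "real \<Rightarrow> 'a::euclidean_space"
  assumes "f \<in> L2" "g \<in> L2" "is_primitive f g"
  shows "f \<in> H1" "AE x in lborel. weak_deriv f x = g x"
proof -
  have "continuous_on UNIV f" by (rule hoelder_half_continuous[OF primitive_hoelder_global[OF assms(3,2)]])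
  then show f: "f \<in> H1" using assms primitive_imp_weak_deriv by (auto simp: H1_def)
  show "AE x in lborel. weak_deriv f x = g x"
    by (rule primitive_unique[OF H1_weak_deriv(2)[OF f] assms(3) H1_weak_deriv(1)[OF f] assms(2)])
qed

lemma L2_inner_integrable:
  fixes f g :: "real \<Rightarrow> 'a::euclidean_space"
  assumes "f \<in> L2" "g \<in> L2"
  shows "integrable lborel (\<lambda>x. f x \<bullet> g x)"
proof (rule Bochner_Integration.integrable_bound)
  show "integrable lborel (\<lambda>x. (norm (f x))\<^sup>2 + (norm (g x))\<^sup>2)"
    using assms by (intro Bochner_Integration.integrable_add L2_integrable)
  show "(\<lambda>x. f x \<bullet> g x) \<in> borel_measurable lborel"
    using L2_measurable[OF assms(1)] L2_measurable[OF assms(2)] by measurable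
  show "AE x in lborel. norm (f x \<bullet> g x) \<le> norm ((norm (f x))\<^sup>2 + (norm (g x))\<^sup>2)"
  proof (rule AE_I2)
    fix x
    have "0 \<le> (norm (f x) - norm (g x))\<^sup>2" "0 \<le> norm (f x) * norm (g x)" by simp_all
    then have "norm (f x) * norm (g x) \<le> (norm (f x))\<^sup>2 + (norm (g x))\<^sup>2"
      unfolding power2_diff mult.assoc by linarith
    then show "norm (f x \<bullet> g x) \<le> norm ((norm (f x))\<^sup>2 + (norm (g x))\<^sup>2)"
      using Cauchy_Schwarz_ineq2[of "f x" "g x"] by simp
  qed
qed

lemma power2_norm_add_scaleR: "(norm (a + t *\<^sub>R b))\<^sup>2 = (norm a)\<^sup>2 + 2 * t * (a \<bullet> b) + t\<^sup>2 * (norm b)\<^sup>2"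
  for a b :: "'a::real_inner"
  unfolding power2_norm_eq_inner
  by (simp add: inner_add_left inner_add_right inner_commute power2_eq_square[of t] algebra_simps)

lemma L2_add_scaleR:
  fixes f g :: "real \<Rightarrow> 'a::euclidean_space"
  assumes "f \<in> L2" "g \<in> L2"
  shows "(\<lambda>x. f x + t *\<^sub>R g x) \<in> L2"
    "(LINT x|lborel. (norm (f x + t *\<^sub>R g x))\<^sup>2) = (LINT x|lborel. (norm (f x))\<^sup>2) + 2 * t * (LINT x|lborel. f x \<bullet> g x) + t\<^sup>2 * (LINT x|lborel. (norm (g x))\<^sup>2)"
proof -
  note i = L2_integrable[OF assms(1)] L2_integrable[OF assms(2)] L2_inner_integrable[OF assms]
  have "integrable lborel (\<lambda>x. (norm (f x + t *\<^sub>R g x))\<^sup>2)"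
    unfolding power2_norm_add_scaleR using i by (intro Bochner_Integration.integrable_add integrable_mult_right)
  then show "(\<lambda>x. f x + t *\<^sub>R g x) \<in> L2"
    using L2_measurable[OF assms(1)] L2_measurable[OF assms(2)] by (auto simp: L2_def)
  show "(LINT x|lborel. (norm (f x + t *\<^sub>R g x))\<^sup>2) = (LINT x|lborel. (norm (f x))\<^sup>2) + 2 * t * (LINT x|lborel. f x \<bullet> g x) + t\<^sup>2 * (LINT x|lborel. (norm (g x))\<^sup>2)"
    unfolding power2_norm_add_scaleR using i by simp
qed

lemma H1_add_scaleR:
  fixes f g :: "real \<Rightarrow> 'a::euclidean_space"
  assumes "f \<in> H1" "g \<in> H1"
  shows "(\<lambda>x. f x + t *\<^sub>R g x) \<in> H1"
    "AE x in lborel. weak_deriv (\<lambda>x. f x + t *\<^sub>R g x) x = weak_deriv f x + t *\<^sub>R weak_deriv g x"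
proof -
  note f = H1_weak_deriv[OF assms(1)] and g = H1_weak_deriv[OF assms(2)]
  have "is_primitive (\<lambda>x. f x + t *\<^sub>R g x) (\<lambda>x. weak_deriv f x + t *\<^sub>R weak_deriv g x)"
    unfolding is_primitive_def
  proof (intro allI impI)
    fix x y :: real assume xy: "x \<le> y"
    have "(LINT s|lborel. indicator {x..<y} s *\<^sub>R (weak_deriv f s + t *\<^sub>R weak_deriv g s))
       = (LINT s|lborel. indicator {x..<y} s *\<^sub>R weak_deriv f s + t *\<^sub>R (indicator {x..<y} s *\<^sub>R weak_deriv g s))"
      by (simp add: scaleR_add_right mult.commute)
    also have "\<dots> = (LINT s|lborel. indicator {x..<y} s *\<^sub>R weak_deriv f s) + t *\<^sub>R (LINT s|lborel. indicator {x..<y} s *\<^sub>R weak_deriv g s)"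
      unfolding Bochner_Integration.integral_add[OF L2_set_integrable[OF f(1)] integrable_scaleR_right[OF L2_set_integrable[OF g(1)]]] integral_scaleR_right ..
    also have "\<dots> = (f y - f x) + t *\<^sub>R (g y - g x)" using f(2) g(2) xy unfolding is_primitive_def by simp
    finally show "f y + t *\<^sub>R g y - (f x + t *\<^sub>R g x) = (LINT s|lborel. indicator {x..<y} s *\<^sub>R (weak_deriv f s + t *\<^sub>R weak_deriv g s))"
      by (simp add: algebra_simps)
  qed
  from H1I[OF L2_add_scaleR(1)[OF H1_L2[OF assms(1)] H1_L2[OF assms(2)]] L2_add_scaleR(1)[OF f(1) g(1)] this]
  show "(\<lambda>x. f x + t *\<^sub>R g x) \<in> H1"
    "AE x in lborel. weak_deriv (\<lambda>x. f x + t *\<^sub>R g x) x = weak_deriv f x + t *\<^sub>R weak_deriv g x" by auto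
qed

lemma C1_primitive:
  fixes f :: "real \<Rightarrow> 'a::euclidean_space"
  assumes d: "\<And>x. (f has_vector_derivative f' x) (at x)" and c: "continuous_on UNIV f'"
  shows "is_primitive f f'"
  unfolding is_primitive_def
proof (intro allI impI)
  fix x y :: real assume xy: "x \<le> y"
  have "(LINT s|lborel. indicator {x..y} s *\<^sub>R f' s) = f y - f x"
    by (rule integral_FTC_atLeastAtMost[OF xy])
       (use d c in \<open>auto intro: has_vector_derivative_at_within continuous_on_subset\<close>)
  moreover have "(LINT s|lborel. indicator {x..y} s *\<^sub>R f' s) = (LINT s|lborel. indicator {x..<y} s *\<^sub>R f' s)"
  proof (rule integral_cong_AE)
    have "f' \<in> borel_measurable borel" by (rule borel_measurable_continuous_onI[OF c])
    then show "(\<lambda>s. indicator {x..y} s *\<^sub>R f' s) \<in> borel_measurable lborel" "(\<lambda>s. indicator {x..<y} s *\<^sub>R f' s) \<in> borel_measurable lborel"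
      by measurable
    show "AE s in lborel. indicator {x..y} s *\<^sub>R f' s = indicator {x..<y} s *\<^sub>R f' s"
      using AE_lborel_singleton[of y] by eventually_elim (auto simp: indicator_def)
  qed
  ultimately show "f y - f x = (LINT s|lborel. indicator {x..<y} s *\<^sub>R f' s)" by simp
qed

lemma H1_vanishes: "f \<in> H1 \<Longrightarrow> (f \<longlongrightarrow> 0) at_infinity" for f :: "real \<Rightarrow> 'a::euclidean_space"
  using primitive_vanishes[OF H1_weak_deriv(2) H1_weak_deriv(1) H1_L2] .

lemma H1_bounded:
  fixes f :: "real \<Rightarrow> 'a::euclidean_space"
  assumes "f \<in> H1" obtains B where "B > 0" "\<And>x. norm (f x) \<le> B"
  using vanishing_imp_bounded[OF H1_continuous[OF assms] H1_vanishes[OF assms]] by blast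

lemma L2_inner_const:
  fixes f :: "real \<Rightarrow> 'a::euclidean_space"
  assumes "f \<in> L2" shows "(\<lambda>x. f x \<bullet> e) \<in> L2"
proof -
  have m: "(\<lambda>x. f x \<bullet> e) \<in> borel_measurable lborel" using L2_measurable[OF assms] by measurable
  have "integrable lborel (\<lambda>x. (norm (f x \<bullet> e))\<^sup>2)"
  proof (rule Bochner_Integration.integrable_bound)
    show "integrable lborel (\<lambda>x. (norm e)\<^sup>2 * (norm (f x))\<^sup>2)" using L2_integrable[OF assms] by simp
    show "(\<lambda>x. (norm (f x \<bullet> e))\<^sup>2) \<in> borel_measurable lborel" using m by measurable
    have "(norm (f x \<bullet> e))\<^sup>2 \<le> (norm e)\<^sup>2 * (norm (f x))\<^sup>2" for x
      using power_mono[OF Cauchy_Schwarz_ineq2[of "f x" e], of 2] by (simp add: power_mult_distrib mult.commute)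
    then show "AE x in lborel. norm ((norm (f x \<bullet> e))\<^sup>2) \<le> norm ((norm e)\<^sup>2 * (norm (f x))\<^sup>2)" by simp
  qed
  then show ?thesis using m by (simp add: L2_def)
qed

lemma L2_bounded_mult:
  fixes f b :: "real \<Rightarrow> real"
  assumes f: "f \<in> L2" and b: "b \<in> borel_measurable lborel" "\<And>x. \<bar>b x\<bar> \<le> B"
  shows "(\<lambda>x. b x * f x) \<in> L2"
proof -
  have m: "(\<lambda>x. b x * f x) \<in> borel_measurable lborel" using b(1) L2_measurable[OF f] by measurable
  have "integrable lborel (\<lambda>x. (norm (b x * f x))\<^sup>2)"
  proof (rule Bochner_Integration.integrable_bound)
    show "integrable lborel (\<lambda>x. B\<^sup>2 * (norm (f x))\<^sup>2)" using L2_integrable[OF f] by simp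
    show "(\<lambda>x. (norm (b x * f x))\<^sup>2) \<in> borel_measurable lborel" using m by measurable
    have "(b x)\<^sup>2 \<le> B\<^sup>2" for x using power_mono[OF b(2)[of x], of 2] by simp
    then show "AE x in lborel. norm ((norm (b x * f x))\<^sup>2) \<le> norm (B\<^sup>2 * (norm (f x))\<^sup>2)"
      by (simp add: power_mult_distrib mult_right_mono)
  qed
  then show ?thesis using m by (simp add: L2_def)
qed

text \<open>Integrate by parts on [-n, n]; the boundary terms vanish in the limit because both
  factors are in H1. In the applications \<open>e\<close> is 1, which selects the real part of a
  complex direction.\<close>

lemma H1_by_parts:
  fixes h :: "real \<Rightarrow> 'a::euclidean_space" and \<eta> \<eta>' :: "real \<Rightarrow> real"
  assumes h: "h \<in> H1" and d: "\<And>x. (\<eta> has_real_derivative \<eta>' x) (at x)" and c: "continuous_on UNIV \<eta>'"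
    and L: "\<eta> \<in> L2" "\<eta>' \<in> L2"
  shows "(LINT x|lborel. \<eta> x * (weak_deriv h x \<bullet> e)) = - (LINT x|lborel. \<eta>' x * (h x \<bullet> e))"
proof -
  note w = H1_weak_deriv[OF h]
  have \<eta>p: "is_primitive \<eta> \<eta>'"
    by (rule C1_primitive) (use d c in \<open>auto simp: has_real_derivative_iff_has_vector_derivative\<close>)
  have i1: "integrable lborel (\<lambda>x. \<eta>' x * (h x \<bullet> e))" using L2_inner_integrable[OF L(2) L2_inner_const[OF H1_L2[OF h]]] by simp
  have i2: "integrable lborel (\<lambda>x. \<eta> x * (weak_deriv h x \<bullet> e))" using L2_inner_integrable[OF L(1) L2_inner_const[OF w(1)]] by simp
  have part: "(\<eta> b *\<^sub>R h b - \<eta> (-b) *\<^sub>R h (-b)) \<bullet> e =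
     (LINT s|lborel. indicator {-b..<b} s * (\<eta>' s * (h s \<bullet> e))) + (LINT s|lborel. indicator {-b..<b} s * (\<eta> s * (weak_deriv h s \<bullet> e)))"
    if "b \<ge> 0" for b
  proof -
    have "-b \<le> b" using that by simp
    note p = primitive_by_parts[OF w(2,1) d c this]
    show ?thesis unfolding p(3) inner_add_left integral_inner_left[OF p(1), symmetric] integral_inner_left[OF p(2), symmetric]
      by (simp add: mult.assoc)
  qed
  have lim: "(\<lambda>n. LINT s|lborel. indicator {-real n..<real n} s * k s) \<longlonglongrightarrow> (LINT s|lborel. k s)"
    if k: "integrable lborel k" for k :: "real \<Rightarrow> real"
  proof (rule integral_dominated_convergence[OF _ _ integrable_norm[OF k]])
    show "k \<in> borel_measurable lborel" using k by (rule borel_measurable_integrable)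
    then show "(\<lambda>s. indicator {-real n..<real n} s * k s) \<in> borel_measurable lborel" for n by measurable
    show "AE s in lborel. (\<lambda>n. indicator {-real n..<real n} s * k s) \<longlonglongrightarrow> k s"
    proof (rule AE_I2)
      fix s
      have "\<forall>\<^sub>F n in sequentially. \<bar>s\<bar> < real n" using filterlim_real_sequentially by (simp add: filterlim_at_top_dense)
      then have "\<forall>\<^sub>F n in sequentially. indicator {-real n..<real n} s * k s = k s"
        by eventually_elim (auto simp: indicator_def)
      then show "(\<lambda>n. indicator {-real n..<real n} s * k s) \<longlonglongrightarrow> k s" by (rule tendsto_eventually)
    qed
  qed (auto simp: indicator_def)
  have inf: "filterlim (\<lambda>n. real n) at_infinity sequentially" "filterlim (\<lambda>n. - real n) at_infinity sequentially"
    using filterlim_at_top_imp_at_infinity[OF filterlim_real_sequentially]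
    by (auto simp: filterlim_at_infinity_conv_norm_at_top)
  have "\<eta> \<in> H1" by (rule H1I(1)[OF L \<eta>p])
  then have "(\<eta> \<longlongrightarrow> 0) at_infinity" by (rule H1_vanishes)
  note v = filterlim_compose[OF this inf(1)] filterlim_compose[OF this inf(2)]
    filterlim_compose[OF H1_vanishes[OF h] inf(1)] filterlim_compose[OF H1_vanishes[OF h] inf(2)]
  have "(\<lambda>n. (\<eta> (real n) *\<^sub>R h (real n) - \<eta> (- real n) *\<^sub>R h (- real n)) \<bullet> e) \<longlonglongrightarrow> (0 *\<^sub>R 0 - 0 *\<^sub>R 0) \<bullet> e"
    by (intro tendsto_intros v)
  then have "(\<lambda>n. (LINT s|lborel. indicator {-real n..<real n} s * (\<eta>' s * (h s \<bullet> e))) + (LINT s|lborel. indicator {-real n..<real n} s * (\<eta> s * (weak_deriv h s \<bullet> e)))) \<longlonglongrightarrow> 0"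
    by (simp add: part)
  moreover have "(\<lambda>n. (LINT s|lborel. indicator {-real n..<real n} s * (\<eta>' s * (h s \<bullet> e))) + (LINT s|lborel. indicator {-real n..<real n} s * (\<eta> s * (weak_deriv h s \<bullet> e))))
     \<longlonglongrightarrow> (LINT x|lborel. \<eta>' x * (h x \<bullet> e)) + (LINT x|lborel. \<eta> x * (weak_deriv h x \<bullet> e))"
    by (intro tendsto_add lim i1 i2)
  ultimately have "0 = (LINT x|lborel. \<eta>' x * (h x \<bullet> e)) + (LINT x|lborel. \<eta> x * (weak_deriv h x \<bullet> e))"
    by (rule LIMSEQ_unique)
  then show ?thesis by linarith
qed

subsection \<open>The three-component energy\<close>

text \<open>On either side of 0 this is the power rule; at 0 the difference quotient is bounded by
  |h|^(s+1).\<close>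

lemma abs_powr_has_derivative:
  fixes s t :: real
  assumes s: "s > 0"
  shows "((\<lambda>t. \<bar>t\<bar> powr (s+2)) has_real_derivative (s+2) * \<bar>t\<bar> powr s * t) (at t)"
proof -
  have split: "u powr (s+1) = u powr s * u" if "u \<ge> 0" for u
    using that by (simp add: powr_add)
  consider "t > 0" | "t < 0" | "t = 0" by linarith
  then show ?thesis
  proof cases
    case 1
    have "((\<lambda>t. t powr (s+2)) has_real_derivative (s+2) * t powr (s+2-1)) (at t)"
      by (rule has_real_derivative_powr[OF 1])
    also have "(s+2) * t powr (s+2-1) = (s+2) * \<bar>t\<bar> powr s * t" using split[of t] 1 by (simp add: add.commute)
    finally have d: "((\<lambda>t. t powr (s+2)) has_real_derivative (s+2) * \<bar>t\<bar> powr s * t) (at t)" .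
    have "\<forall>\<^sub>F y in nhds t. y powr (s+2) = \<bar>y\<bar> powr (s+2)"
      using eventually_nhds_in_open[of "{0<..}" t] 1 by (auto elim: eventually_mono)
    from DERIV_cong_ev[OF refl this refl] d show ?thesis by simp
  next
    case 2
    have "((\<lambda>t. (-t) powr (s+2)) has_real_derivative ((s+2) * (-t) powr (s+2-1)) * (-1)) (at t)"
      by (rule DERIV_chain2[OF has_real_derivative_powr]) (use 2 in \<open>auto intro!: derivative_eq_intros\<close>)
    also have "((s+2) * (-t) powr (s+2-1)) * (-1) = (s+2) * \<bar>t\<bar> powr s * t" using split[of "-t"] 2 by (simp add: add.commute)
    finally have d: "((\<lambda>t. (-t) powr (s+2)) has_real_derivative (s+2) * \<bar>t\<bar> powr s * t) (at t)" .
    have "\<forall>\<^sub>F y in nhds t. (-y) powr (s+2) = \<bar>y\<bar> powr (s+2)"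
      using eventually_nhds_in_open[of "{..<0}" t] 2 by (auto elim: eventually_mono)
    from DERIV_cong_ev[OF refl this refl] d show ?thesis by simp
  next
    case 3
    have "((\<lambda>h::real. \<bar>h\<bar> powr (s+1)) \<longlongrightarrow> 0 powr (s+1)) (at 0)"
      using s by (intro tendsto_powr' tendsto_eq_intros) auto
    then have "((\<lambda>h::real. \<bar>h\<bar> powr (s+1)) \<longlongrightarrow> 0) (at 0)" using s by simp
    then have "((\<lambda>h. \<bar>h\<bar> powr (s+2) / h) \<longlongrightarrow> 0) (at 0)"
    proof (rule Lim_null_comparison[rotated])
      have "norm (\<bar>h\<bar> powr (s+2) / h) \<le> \<bar>h\<bar> powr (s+1)" for h :: real
      proof (cases "h = 0")
        case False
        have "\<bar>h\<bar> powr (s+2) = \<bar>h\<bar> powr (s+1) * \<bar>h\<bar>" using powr_add[of "\<bar>h\<bar>" "s+1" 1] False by (simp add: add.commute)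
        then show ?thesis using False by (simp add: abs_mult abs_divide)
      qed simp
      then show "\<forall>\<^sub>F h in at 0. norm (\<bar>h\<bar> powr (s+2) / h) \<le> \<bar>h\<bar> powr (s+1)" by simp
    qed
    then show ?thesis using 3 s by (simp add: DERIV_def)
  qed
qed

lemma odd_pow_nonneg: "x \<ge> 0 \<Longrightarrow> n > 0 \<Longrightarrow> a > 0 \<Longrightarrow> odd_pow a n x = x powr (real a / real n)"
  by (cases "x = 0") (simp_all add: odd_pow_def root_powr_inverse powr_realpow[symmetric] powr_powr)

lemma abs_odd_pow: "n > 0 \<Longrightarrow> a > 0 \<Longrightarrow> \<bar>odd_pow a n x\<bar> = \<bar>x\<bar> powr (real a / real n)"
  using odd_pow_nonneg[of "\<bar>x\<bar>" n a] by (simp add: odd_pow_def power_abs real_root_abs)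

lemma odd_pow_continuous: "n > 0 \<Longrightarrow> continuous_on UNIV (odd_pow a n)"
  unfolding odd_pow_def[abs_def] by (intro continuous_intros continuous_on_real_root continuous_on_id) 

section \<open>The concrete potential\<close>

locale nls_parameters =
  fixes \<gamma>1 \<gamma>2 \<beta> \<alpha>1 \<alpha>2 q1 q2 p r l m :: real and n1 n2 :: nat
  assumes pos: "\<gamma>1 > 0" "\<gamma>2 > 0" "\<beta> > 0" "\<alpha>1 > 0" "\<alpha>2 > 0"
    and q: "0 < q1" "q1 < 4" "0 < q2" "q2 < 4"
    and p: "p = real n1 / real n2" "odd n2" "0 < p" "p < 4"
    and mass_pos: "r > 0" "l > 0" "m > 0"
begin

definition \<tau>1 where "\<tau>1 = 2 * \<gamma>1 / (q1 + 2)"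
definition \<tau>2 where "\<tau>2 = 2 * \<gamma>2 / (q2 + 2)"
definition \<tau> where "\<tau> = 2 * \<beta> / ((p + 1) * (p + 2))"

lemma \<tau>_pos: "\<tau>1 > 0" "\<tau>2 > 0" "\<tau> > 0"
  using pos q p(3) by (auto simp: \<tau>1_def \<tau>2_def \<tau>_def)

lemma n_pos: "n1 > 0" "n2 > 0"
proof -
  show "n2 > 0" using p(2) by (rule odd_pos)
  show "n1 > 0" using p(1,3) by (cases "n1 = 0") auto
qed

lemma odd_pow_p2: "x \<ge> 0 \<Longrightarrow> odd_pow (n1 + 2 * n2) n2 x = x powr (p + 2)"
  and abs_odd_pow_p2: "\<bar>odd_pow (n1 + 2 * n2) n2 y\<bar> = \<bar>y\<bar> powr (p + 2)"
  and odd_pow_p1: "x \<ge> 0 \<Longrightarrow> odd_pow (n1 + n2) n2 x = x powr (p + 1)"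
proof -
  have e: "real (n1 + 2 * n2) / real n2 = p + 2" "real (n1 + n2) / real n2 = p + 1"
    using n_pos p(1) by (simp_all add: field_simps)
  show "x \<ge> 0 \<Longrightarrow> odd_pow (n1 + 2 * n2) n2 x = x powr (p + 2)"
    "x \<ge> 0 \<Longrightarrow> odd_pow (n1 + n2) n2 x = x powr (p + 1)" "\<bar>odd_pow (n1 + 2 * n2) n2 y\<bar> = \<bar>y\<bar> powr (p + 2)"
    using odd_pow_nonneg[of x n2 "n1 + 2 * n2"] odd_pow_nonneg[of x n2 "n1 + n2"] abs_odd_pow[of n2 "n1 + 2 * n2" y] n_pos
    unfolding e by auto
qed

text \<open>The odd power of the third component is replaced by a power of its absolute value, so
  that taking absolute values can only increase \<open>pot\<close>. For nonnegative third component
  the two powers agree.\<close>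

definition pot :: "real \<Rightarrow> real \<Rightarrow> real \<Rightarrow> real" where
  "pot x y z = \<tau>1 * \<bar>x\<bar> powr (q1+2) + \<tau>2 * \<bar>y\<bar> powr (q2+2) + \<tau> * \<bar>z\<bar> powr (p+2) + \<alpha>1 * x\<^sup>2 * z + \<alpha>2 * y\<^sup>2 * z"

definition pot_vec :: "real^3 \<Rightarrow> real" where "pot_vec x = pot (x$1) (x$2) (x$3)"

definition pot_grad :: "real^3 \<Rightarrow> real^3" where
  "pot_grad x = (\<chi> k. if k = 1 then \<tau>1 * ((q1+2) * \<bar>x$1\<bar> powr q1 * x$1) + 2 * \<alpha>1 * x$1 * x$3
     else if k = 2 then \<tau>2 * ((q2+2) * \<bar>x$2\<bar> powr q2 * x$2) + 2 * \<alpha>2 * x$2 * x$3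
     else \<tau> * ((p+2) * \<bar>x$3\<bar> powr p * x$3) + \<alpha>1 * (x$1)\<^sup>2 + \<alpha>2 * (x$2)\<^sup>2)"

definition masses :: "3 \<Rightarrow> real" where "masses k = (if k = 1 then r else if k = 2 then l else m)"

text \<open>Exponents are counted in excess of 2; the entry 1 stands for the cubic coupling
  terms.\<close>

definition exponent_min where "exponent_min = min (min q1 q2) (min p 1)"
definition exponent_max where "exponent_max = max (max q1 q2) (max p 1)"
definition growth_const where "growth_const = \<tau>1 + \<tau>2 + \<tau> + \<alpha>1 + \<alpha>2"

text \<open>Supermodularity is the structural point: powers of a single component are only
  redistributed by max and min, and the coupling x^2 z is a product of increasing functions of
  different components on nonnegative arguments.\<close>

lemma coupled_energy: "coupled_energy pot_vec pot_grad masses growth_const exponent_min exponent_max"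
proof
  fix x :: "real^3"
  have c: "((\<lambda>x::real^3. x$k) has_derivative (\<lambda>h. h$k)) (at x)" for k
    by (rule bounded_linear.has_derivative[OF bounded_linear_vec_nth has_derivative_ident])
  have P: "((\<lambda>x::real^3. \<bar>x$k\<bar> powr (s+2)) has_derivative (\<lambda>h. h$k * ((s+2) * \<bar>x$k\<bar> powr s * x$k))) (at x)" if "s > 0" for s k
    by (rule DERIV_compose_FDERIV[OF abs_powr_has_derivative[OF that] c])
  have "(pot_vec has_derivative (\<lambda>h. \<tau>1 * (h$1 * ((q1+2) * \<bar>x$1\<bar> powr q1 * x$1)) + \<tau>2 * (h$2 * ((q2+2) * \<bar>x$2\<bar> powr q2 * x$2))
      + \<tau> * (h$3 * ((p+2) * \<bar>x$3\<bar> powr p * x$3)) + (\<alpha>1 * (2 * h$1 * x$1) * x$3 + \<alpha>1 * (x$1)\<^sup>2 * h$3)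
      + (\<alpha>2 * (2 * h$2 * x$2) * x$3 + \<alpha>2 * (x$2)\<^sup>2 * h$3))) (at x)"
    unfolding pot_vec_def[abs_def] pot_def
    by (rule derivative_eq_intros P c q p refl)+ (auto simp: fun_eq_iff algebra_simps)
  then show "(pot_vec has_derivative (\<lambda>h. pot_grad x \<bullet> h)) (at x)"
    by (rule has_derivative_eq_rhs) (auto simp: fun_eq_iff inner_vec_def sum_3 pot_grad_def algebra_simps)
next
  have P: "continuous_on UNIV (\<lambda>x::real^3. \<bar>x$k\<bar> powr s)" if "s > 0" for s k
    using that by (intro continuous_on_powr' continuous_intros) auto
  have c1: "continuous_on UNIV (\<lambda>x::real^3. \<tau>1 * ((q1+2) * \<bar>x$1\<bar> powr q1 * x$1) + 2 * \<alpha>1 * x$1 * x$3)"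
    "continuous_on UNIV (\<lambda>x::real^3. \<tau>2 * ((q2+2) * \<bar>x$2\<bar> powr q2 * x$2) + 2 * \<alpha>2 * x$2 * x$3)"
    "continuous_on UNIV (\<lambda>x::real^3. \<tau> * ((p+2) * \<bar>x$3\<bar> powr p * x$3) + \<alpha>1 * (x$1)\<^sup>2 + \<alpha>2 * (x$2)\<^sup>2)"
    by (intro continuous_on_add continuous_on_mult continuous_on_power continuous_on_const continuous_on_component continuous_on_id P q p)+
  show "continuous_on UNIV pot_grad"
    unfolding pot_grad_def[abs_def]
  proof (rule continuous_on_vec_lambda)
    fix k :: 3
    show "continuous_on UNIV (\<lambda>x::real^3. if k = 1 then \<tau>1 * ((q1+2) * \<bar>x$1\<bar> powr q1 * x$1) + 2 * \<alpha>1 * x$1 * x$3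
     else if k = 2 then \<tau>2 * ((q2+2) * \<bar>x$2\<bar> powr q2 * x$2) + 2 * \<alpha>2 * x$2 * x$3
     else \<tau> * ((p+2) * \<bar>x$3\<bar> powr p * x$3) + \<alpha>1 * (x$1)\<^sup>2 + \<alpha>2 * (x$2)\<^sup>2)"
      using c1 by (cases "k = 1"; cases "k = 2") simp_all
  qed
next
  fix x :: "real^3"
  show "pot_vec x \<le> pot_vec (\<chi> k. \<bar>x$k\<bar>)"
    using pos unfolding pot_vec_def pot_def by (auto intro!: add_mono mult_left_mono)
next
  fix x y :: "real^3" assume h: "\<forall>k. 0 \<le> x$k \<and> 0 \<le> y$k"
  have P: "T * \<bar>s\<bar> powr e + T * \<bar>t\<bar> powr e = T * \<bar>max s t\<bar> powr e + T * \<bar>min s t\<bar> powr e" for T s t e :: real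
    by (auto simp: max_def min_def)
  \<comment> \<open>For oppositely ordered pairs the gain is |t^2 - s^2| times |u - v|; for pairs
    ordered alike it is 0.\<close>
  have Q: "s\<^sup>2 * u + t\<^sup>2 * v \<le> (max s t)\<^sup>2 * max u v + (min s t)\<^sup>2 * min u v"
    if "0 \<le> s" "0 \<le> t" "0 \<le> u" "0 \<le> v" for s t u v :: real
  proof (cases "s \<le> t"; cases "u \<le> v")
    assume a: "s \<le> t" "\<not> u \<le> v"
    have "0 \<le> (t\<^sup>2 - s\<^sup>2) * (u - v)" using a that by (intro mult_nonneg_nonneg) (auto intro: power_mono)
    then show ?thesis using a by (simp add: max_def min_def algebra_simps)
  next
    assume a: "\<not> s \<le> t" "u \<le> v"
    have "0 \<le> (s\<^sup>2 - t\<^sup>2) * (v - u)" using a that by (intro mult_nonneg_nonneg) (auto intro: power_mono)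
    then show ?thesis using a by (simp add: max_def min_def algebra_simps)
  qed (auto simp: max_def min_def)
  have k: "\<alpha> * s\<^sup>2 * u + \<alpha> * t\<^sup>2 * v \<le> \<alpha> * (max s t)\<^sup>2 * max u v + \<alpha> * (min s t)\<^sup>2 * min u v"
    if "0 \<le> s" "0 \<le> t" "0 \<le> u" "0 \<le> v" "0 < \<alpha>" for s t u v \<alpha> :: real
    using mult_left_mono[OF Q[OF that(1-4)], of \<alpha>] that(5) by (simp add: algebra_simps)
  show "pot_vec x + pot_vec y \<le> pot_vec (\<chi> k. max (x$k) (y$k)) + pot_vec (\<chi> k. min (x$k) (y$k))"
  proof -
    have "\<tau>1 * \<bar>x$1\<bar> powr (q1+2) + \<tau>1 * \<bar>y$1\<bar> powr (q1+2) = \<tau>1 * \<bar>max (x$1) (y$1)\<bar> powr (q1+2) + \<tau>1 * \<bar>min (x$1) (y$1)\<bar> powr (q1+2)"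
      "\<tau>2 * \<bar>x$2\<bar> powr (q2+2) + \<tau>2 * \<bar>y$2\<bar> powr (q2+2) = \<tau>2 * \<bar>max (x$2) (y$2)\<bar> powr (q2+2) + \<tau>2 * \<bar>min (x$2) (y$2)\<bar> powr (q2+2)"
      "\<tau> * \<bar>x$3\<bar> powr (p+2) + \<tau> * \<bar>y$3\<bar> powr (p+2) = \<tau> * \<bar>max (x$3) (y$3)\<bar> powr (p+2) + \<tau> * \<bar>min (x$3) (y$3)\<bar> powr (p+2)"
      by (rule P)+
    moreover have "\<alpha>1 * (x$1)\<^sup>2 * x$3 + \<alpha>1 * (y$1)\<^sup>2 * y$3 \<le> \<alpha>1 * (max (x$1) (y$1))\<^sup>2 * max (x$3) (y$3) + \<alpha>1 * (min (x$1) (y$1))\<^sup>2 * min (x$3) (y$3)"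
      "\<alpha>2 * (x$2)\<^sup>2 * x$3 + \<alpha>2 * (y$2)\<^sup>2 * y$3 \<le> \<alpha>2 * (max (x$2) (y$2))\<^sup>2 * max (x$3) (y$3) + \<alpha>2 * (min (x$2) (y$2))\<^sup>2 * min (x$3) (y$3)"
      by (rule k; use h pos in blast)+
    ultimately show ?thesis unfolding pot_vec_def pot_def vec_lambda_beta by linarith
  qed
next
  fix x :: "real^3"
  define t where "t = norm x"
  have t0: "t \<ge> 0" by (simp add: t_def)
  have xk: "\<bar>x$k\<bar> \<le> t" for k unfolding t_def by (rule component_le_norm_cart)
  let ?T = "t\<^sup>2 * (t powr exponent_min + t powr exponent_max)"
  \<comment> \<open>An intermediate power is dominated by the extreme ones: by the lowest for t
    \<le> 1, by the highest beyond.\<close>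
  have T: "t\<^sup>2 * t powr e \<le> ?T" if e: "exponent_min \<le> e" "e \<le> exponent_max" for e
  proof (intro mult_left_mono)
    show "t powr e \<le> t powr exponent_min + t powr exponent_max"
    proof (cases "t \<le> 1")
      case True
      have "t powr e \<le> t powr exponent_min" using powr_mono'[OF e(1), of t] t0 True by simp
      then show ?thesis by (simp add: add_increasing2)
    next
      case False
      then have "t powr e \<le> t powr exponent_max" using e by (intro powr_mono) auto
      then show ?thesis by (simp add: add_increasing)
    qed
  qed simp
  have split: "t powr (e+2) = t\<^sup>2 * t powr e" for e
    using t0 by (cases "t = 0") (simp_all add: powr_add powr_numeral)
  have pw: "\<bar>x$k\<bar> powr (e+2) \<le> ?T" if "exponent_min \<le> e" "e \<le> exponent_max" "0 < e" for e k
  proof -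
    have "\<bar>x$k\<bar> powr (e+2) \<le> t powr (e+2)" using xk that by (intro powr_mono2) auto
    then show ?thesis using T[OF that(1,2)] split[of e] by simp
  qed
  have cr: "\<bar>(x$k)\<^sup>2 * x$3\<bar> \<le> ?T" for k
  proof -
    have "\<bar>(x$k)\<^sup>2 * x$3\<bar> = \<bar>x$k\<bar> * \<bar>x$k\<bar> * \<bar>x$3\<bar>" by (simp add: abs_mult power2_eq_square)
    also have "\<dots> \<le> t * t * t" using xk t0 by (intro mult_mono) auto
    also have "\<dots> = t\<^sup>2 * t powr 1" using t0 by (simp add: power2_eq_square)
    also have "\<dots> \<le> ?T" by (rule T) (auto simp: exponent_min_def exponent_max_def)
    finally show ?thesis .
  qed
  have "\<bar>pot_vec x\<bar> \<le> \<tau>1 * \<bar>x$1\<bar> powr (q1+2) + \<tau>2 * \<bar>x$2\<bar> powr (q2+2) + \<tau> * \<bar>x$3\<bar> powr (p+2) + \<alpha>1 * \<bar>(x$1)\<^sup>2 * x$3\<bar> + \<alpha>2 * \<bar>(x$2)\<^sup>2 * x$3\<bar>"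
    unfolding pot_vec_def pot_def
  proof -
    have nn: "0 \<le> \<tau>1 * \<bar>x$1\<bar> powr (q1+2)" "0 \<le> \<tau>2 * \<bar>x$2\<bar> powr (q2+2)" "0 \<le> \<tau> * \<bar>x$3\<bar> powr (p+2)" using \<tau>_pos by auto
    have "\<bar>\<alpha>1 * (x$1)\<^sup>2 * x$3\<bar> = \<alpha>1 * \<bar>(x$1)\<^sup>2 * x$3\<bar>" "\<bar>\<alpha>2 * (x$2)\<^sup>2 * x$3\<bar> = \<alpha>2 * \<bar>(x$2)\<^sup>2 * x$3\<bar>"
      using pos by (simp_all add: abs_mult)
    with nn show "\<bar>\<tau>1 * \<bar>x$1\<bar> powr (q1+2) + \<tau>2 * \<bar>x$2\<bar> powr (q2+2) + \<tau> * \<bar>x$3\<bar> powr (p+2) + \<alpha>1 * (x$1)\<^sup>2 * x$3 + \<alpha>2 * (x$2)\<^sup>2 * x$3\<bar>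
      \<le> \<tau>1 * \<bar>x$1\<bar> powr (q1+2) + \<tau>2 * \<bar>x$2\<bar> powr (q2+2) + \<tau> * \<bar>x$3\<bar> powr (p+2) + \<alpha>1 * \<bar>(x$1)\<^sup>2 * x$3\<bar> + \<alpha>2 * \<bar>(x$2)\<^sup>2 * x$3\<bar>" by linarith
  qed
  also have "\<dots> \<le> \<tau>1 * ?T + \<tau>2 * ?T + \<tau> * ?T + \<alpha>1 * ?T + \<alpha>2 * ?T"
    using \<tau>_pos pos q p(3,4) by (intro add_mono mult_left_mono pw cr) (auto simp: exponent_min_def exponent_max_def)
  also have "\<dots> = growth_const * t\<^sup>2 * (t powr exponent_min + t powr exponent_max)"
    by (simp add: growth_const_def algebra_simps)
  finally show "\<bar>pot_vec x\<bar> \<le> growth_const * (norm x)\<^sup>2 * (norm x powr exponent_min + norm x powr exponent_max)"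
    by (simp add: t_def)
next
  show "0 < exponent_min" "exponent_min \<le> exponent_max" "exponent_max < 4"
    using q p(3,4) by (auto simp: exponent_min_def exponent_max_def)
next
  fix B :: real
  let ?C = "(\<tau>1 * (q1+2) * B powr q1 + 2 * \<alpha>1 * B) + (\<tau>2 * (q2+2) * B powr q2 + 2 * \<alpha>2 * B) + (\<tau> * (p+2) * B powr p + \<alpha>1 * B + \<alpha>2 * B)"
  have "norm (pot_grad x) \<le> ?C * norm x" if x: "norm x \<le> B" for x
  proof -
    define t where "t = norm x"
    have t: "0 \<le> t" "t \<le> B" using x by (auto simp: t_def)
    have xk: "\<bar>x$k\<bar> \<le> t" for k unfolding t_def by (rule component_le_norm_cart)
    have xB: "\<bar>x$k\<bar> \<le> B" for k using xk[of k] t by linarith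
    have pw: "\<bar>T * ((e+2) * \<bar>x$k\<bar> powr e * x$k)\<bar> \<le> T * (e+2) * B powr e * t" if "T > 0" "e > 0" for T e k
    proof -
      have "\<bar>x$k\<bar> powr e * \<bar>x$k\<bar> \<le> B powr e * t" using xk xB that t by (intro mult_mono powr_mono2) auto
      from mult_left_mono[OF this, of "T * (e+2)"] show ?thesis using that by (simp add: abs_mult mult_ac)
    qed
    have cr: "\<bar>x$i * x$j\<bar> \<le> B * t" for i j
      unfolding abs_mult using xk xB t by (intro mult_mono) auto
    have cA: "\<bar>2 * A * x$i * x$j\<bar> \<le> 2 * A * B * t" "\<bar>A * (x$i)\<^sup>2\<bar> \<le> A * B * t" if "A > 0" for A i j
    proof -
      have "\<bar>2 * A * x$i * x$j\<bar> = (2 * A) * \<bar>x$i * x$j\<bar>" "\<bar>A * (x$i)\<^sup>2\<bar> = A * \<bar>x$i * x$i\<bar>" using that by (auto simp: abs_mult power2_eq_square)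
      then show "\<bar>2 * A * x$i * x$j\<bar> \<le> 2 * A * B * t" "\<bar>A * (x$i)\<^sup>2\<bar> \<le> A * B * t"
        using mult_left_mono[OF cr[of i j], of "2 * A"] mult_left_mono[OF cr[of i i], of A] that by (auto simp: mult.assoc)
    qed
    have t2: "\<bar>u + v\<bar> \<le> U + W" if "\<bar>u\<bar> \<le> U" "\<bar>v\<bar> \<le> W" for u v U W :: real using that by linarith
    have "norm (pot_grad x) \<le> (\<Sum>k\<in>UNIV. \<bar>pot_grad x $ k\<bar>)" by (rule norm_le_l1_cart)
    also have "\<dots> = \<bar>\<tau>1 * ((q1+2) * \<bar>x$1\<bar> powr q1 * x$1) + 2 * \<alpha>1 * x$1 * x$3\<bar> + \<bar>\<tau>2 * ((q2+2) * \<bar>x$2\<bar> powr q2 * x$2) + 2 * \<alpha>2 * x$2 * x$3\<bar>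
       + \<bar>\<tau> * ((p+2) * \<bar>x$3\<bar> powr p * x$3) + \<alpha>1 * (x$1)\<^sup>2 + \<alpha>2 * (x$2)\<^sup>2\<bar>"
      by (simp add: sum_3 pot_grad_def)
    also have "\<dots> \<le> (\<tau>1 * (q1+2) * B powr q1 * t + 2 * \<alpha>1 * B * t) + (\<tau>2 * (q2+2) * B powr q2 * t + 2 * \<alpha>2 * B * t)
       + (\<tau> * (p+2) * B powr p * t + \<alpha>1 * B * t + \<alpha>2 * B * t)"
      by (intro add_mono t2 pw \<tau>_pos q p cA pos)
    also have "\<dots> = ?C * t" by (simp add: algebra_simps)
    finally show ?thesis by (simp add: t_def)
  qed
  then show "\<exists>C. \<forall>x. norm x \<le> B \<longrightarrow> norm (pot_grad x) \<le> C * norm x" by blast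
next
  show "0 < masses k" for k using mass_pos by (simp add: masses_def)
qed

end

section \<open>From complex competitors to nonnegative profiles\<close>

lemma H1_powr_integrable:
  fixes f :: "real \<Rightarrow> 'a::euclidean_space"
  assumes f: "f \<in> H1" and s: "s \<ge> 0"
  shows "integrable lborel (\<lambda>x. norm (f x) powr (s+2))"
proof -
  obtain B where B: "B > 0" "\<And>x. norm (f x) \<le> B" using H1_bounded[OF f] by blast
  have fm: "f \<in> borel_measurable lborel" by (rule L2_measurable[OF H1_L2[OF f]])
  show ?thesis
  proof (rule Bochner_Integration.integrable_bound)
    show "integrable lborel (\<lambda>x. B powr s * (norm (f x))\<^sup>2)" by (intro integrable_mult_right L2_integrable H1_L2 f)
    show "(\<lambda>x. norm (f x) powr (s+2)) \<in> borel_measurable lborel" using fm by measurable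
    show "AE x in lborel. norm (norm (f x) powr (s+2)) \<le> norm (B powr s * (norm (f x))\<^sup>2)"
    proof (rule AE_I2)
      fix x
      have "norm (f x) powr (s+2) = norm (f x) powr s * (norm (f x))\<^sup>2"
        by (cases "f x = 0") (simp_all add: powr_add powr_numeral)
      also have "\<dots> \<le> B powr s * (norm (f x))\<^sup>2" using B(2)[of x] s by (intro mult_right_mono powr_mono2) auto
      finally show "norm (norm (f x) powr (s+2)) \<le> norm (B powr s * (norm (f x))\<^sup>2)" by simp
    qed
  qed
qed

lemma H1_coupling_integrable:
  fixes f :: "real \<Rightarrow> 'a::euclidean_space" and g :: "real \<Rightarrow> real"
  assumes f: "f \<in> H1" and g: "g \<in> borel_measurable lborel" "\<And>x. \<bar>g x\<bar> \<le> B"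
  shows "integrable lborel (\<lambda>x. (norm (f x))\<^sup>2 * g x)"
proof (rule Bochner_Integration.integrable_bound)
  have fm: "f \<in> borel_measurable lborel" by (rule L2_measurable[OF H1_L2[OF f]])
  show "integrable lborel (\<lambda>x. B * (norm (f x))\<^sup>2)" by (intro integrable_mult_right L2_integrable H1_L2 f)
  show "(\<lambda>x. (norm (f x))\<^sup>2 * g x) \<in> borel_measurable lborel" using fm g(1) by measurable
  show "AE x in lborel. norm ((norm (f x))\<^sup>2 * g x) \<le> norm (B * (norm (f x))\<^sup>2)"
  proof (rule AE_I2)
    fix x
    have "(norm (f x))\<^sup>2 * \<bar>g x\<bar> \<le> (norm (f x))\<^sup>2 * \<bar>B\<bar>" using g(2)[of x] by (intro mult_left_mono) auto
    then show "norm ((norm (f x))\<^sup>2 * g x) \<le> norm (B * (norm (f x))\<^sup>2)" by (simp add: abs_mult mult.commute)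
  qed
qed

text \<open>Embeds a real profile along a fixed vector; with \<open>e = 1\<close> in the complex
  plane the real minimiser becomes an admissible complex function.\<close>

lemma H1_scaleR:
  fixes e :: "'a::euclidean_space"
  assumes f: "f \<in> L2" and d: "d \<in> L2" and p: "is_primitive f d"
  shows "(\<lambda>x. f x *\<^sub>R e) \<in> H1" "AE x in lborel. weak_deriv (\<lambda>x. f x *\<^sub>R e) x = d x *\<^sub>R e"
proof -
  have L: "(\<lambda>x. h x *\<^sub>R e) \<in> L2" if "h \<in> L2" for h :: "real \<Rightarrow> real"
  proof -
    have "(\<lambda>x. (norm (h x *\<^sub>R e))\<^sup>2) = (\<lambda>x. (norm e)\<^sup>2 * (norm (h x))\<^sup>2)" by (simp add: power_mult_distrib mult.commute)
    then show ?thesis using L2_measurable[OF that] L2_integrable[OF that] by (auto simp: L2_def)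
  qed
  have "is_primitive (\<lambda>x. f x *\<^sub>R e) (\<lambda>x. d x *\<^sub>R e)"
    unfolding is_primitive_def
  proof (intro allI impI)
    fix x y :: real assume xy: "x \<le> y"
    have "(LINT s|lborel. indicator {x..<y} s *\<^sub>R (d s *\<^sub>R e)) = (LINT s|lborel. (indicator {x..<y} s *\<^sub>R d s) *\<^sub>R e)" by simp
    also have "\<dots> = (LINT s|lborel. indicator {x..<y} s *\<^sub>R d s) *\<^sub>R e"
      by (rule integral_scaleR_left[OF L2_set_integrable[OF d]])
    also have "\<dots> = (f y - f x) *\<^sub>R e" using p xy unfolding is_primitive_def by simp
    finally show "f y *\<^sub>R e - f x *\<^sub>R e = (LINT s|lborel. indicator {x..<y} s *\<^sub>R (d s *\<^sub>R e))"
      by (simp add: scaleR_diff_left)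
  qed
  from H1I[OF L[OF f] L[OF d] this] show "(\<lambda>x. f x *\<^sub>R e) \<in> H1" "AE x in lborel. weak_deriv (\<lambda>x. f x *\<^sub>R e) x = d x *\<^sub>R e" by auto
qed

text \<open>Exchanges the chosen weak derivative for a known function. Only norms have to agree, so
  the two may live in different spaces.\<close>

lemma H1_dirichlet_cong:
  fixes f :: "real \<Rightarrow> 'a::euclidean_space" and d :: "real \<Rightarrow> 'b::euclidean_space"
  assumes f: "f \<in> H1" and d: "d \<in> borel_measurable lborel" and AE: "AE x in lborel. norm (weak_deriv f x) = norm (d x)"
  shows "(LINT x|lborel. (norm (weak_deriv f x))\<^sup>2) = (LINT x|lborel. (norm (d x))\<^sup>2)"
proof (rule integral_cong_AE)
  show "(\<lambda>x. (norm (weak_deriv f x))\<^sup>2) \<in> borel_measurable lborel" using L2_measurable[OF H1_weak_deriv(1)[OF f]] by measurable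
  show "(\<lambda>x. (norm (d x))\<^sup>2) \<in> borel_measurable lborel" using d by measurable
  show "AE x in lborel. (norm (weak_deriv f x))\<^sup>2 = (norm (d x))\<^sup>2" using AE by eventually_elim simp
qed

context nls_parameters begin

abbreviation E where "E \<equiv> energy \<gamma>1 \<gamma>2 \<beta> \<alpha>1 \<alpha>2 q1 q2 n1 n2"

lemma H1_odd_pow_integrable:
  assumes g: "g \<in> H1" shows "integrable lborel (\<lambda>x. odd_pow (n1 + 2*n2) n2 (g x))"
proof (rule Bochner_Integration.integrable_bound)
  show "integrable lborel (\<lambda>x. norm (g x) powr (p+2))" by (rule H1_powr_integrable[OF g]) (use p(3) in simp)
  have "continuous_on UNIV (\<lambda>x. odd_pow (n1 + 2*n2) n2 (g x))"
    by (rule continuous_on_compose2[OF odd_pow_continuous[OF n_pos(2)] H1_continuous[OF g]]) auto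
  then show "(\<lambda>x. odd_pow (n1 + 2*n2) n2 (g x)) \<in> borel_measurable lborel" using borel_measurable_continuous_onI by simp
  show "AE x in lborel. norm (odd_pow (n1 + 2*n2) n2 (g x)) \<le> norm (norm (g x) powr (p+2))"
    by (simp add: abs_odd_pow_p2)
qed

lemma H1_coupling:
  fixes f :: "real \<Rightarrow> complex"
  assumes f: "f \<in> H1" and g: "g \<in> H1"
  shows "integrable lborel (\<lambda>x. (cmod (f x))\<^sup>2 * g x)" "integrable lborel (\<lambda>x. (cmod (f x))\<^sup>2 * \<bar>g x\<bar>)"
proof -
  obtain B where B: "\<And>x. norm (g x) \<le> B" using H1_bounded[OF g] by blast
  have gm: "g \<in> borel_measurable lborel" by (rule L2_measurable[OF H1_L2[OF g]])
  show "integrable lborel (\<lambda>x. (cmod (f x))\<^sup>2 * g x)" by (rule H1_coupling_integrable[OF f gm, of B]) (use B in simp)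
  show "integrable lborel (\<lambda>x. (cmod (f x))\<^sup>2 * \<bar>g x\<bar>)"
    by (rule H1_coupling_integrable[OF f, of _ B]) (use B gm in \<open>auto intro!: borel_measurable_abs\<close>)
qed

lemma energy_eq:
  assumes f1: "f1 \<in> H1" and f2: "f2 \<in> H1" and g: "g \<in> H1"
  shows "E f1 f2 g = (LINT x|lborel. (cmod (weak_deriv f1 x))\<^sup>2) - \<tau>1 * (LINT x|lborel. cmod (f1 x) powr (q1+2)) - \<alpha>1 * (LINT x|lborel. (cmod (f1 x))\<^sup>2 * g x)
     + ((LINT x|lborel. (cmod (weak_deriv f2 x))\<^sup>2) - \<tau>2 * (LINT x|lborel. cmod (f2 x) powr (q2+2)) - \<alpha>2 * (LINT x|lborel. (cmod (f2 x))\<^sup>2 * g x))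
     + (LINT x|lborel. (norm (weak_deriv g x))\<^sup>2) - \<tau> * (LINT x|lborel. odd_pow (n1 + 2*n2) n2 (g x))"
proof -
  have i: "integrable lborel (\<lambda>x. (norm (weak_deriv h x))\<^sup>2)" if "h \<in> H1" for h :: "real \<Rightarrow> 'a::euclidean_space"
    by (rule L2_integrable[OF H1_weak_deriv(1)[OF that]])
  have q': "q1 \<ge> 0" "q2 \<ge> 0" using q by auto
  note I = i[OF f1] i[OF f2] i[OF g] H1_powr_integrable[OF f1 q'(1)] H1_powr_integrable[OF f2 q'(2)]
    H1_coupling(1)[OF f1 g] H1_coupling(1)[OF f2 g] H1_odd_pow_integrable[OF g]
  have "E f1 f2 g = (LINT x|lborel. ((norm (weak_deriv f1 x))\<^sup>2 - \<tau>1 * norm (f1 x) powr (q1+2) - \<alpha>1 * ((norm (f1 x))\<^sup>2 * g x))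
       + ((norm (weak_deriv f2 x))\<^sup>2 - \<tau>2 * norm (f2 x) powr (q2+2) - \<alpha>2 * ((norm (f2 x))\<^sup>2 * g x))
       + (norm (weak_deriv g x))\<^sup>2 - \<tau> * odd_pow (n1 + 2*n2) n2 (g x))"
    unfolding energy_def Let_def p(1)[symmetric] \<tau>1_def \<tau>2_def \<tau>_def by (simp add: mult.assoc)
  also have "\<dots> = (LINT x|lborel. (norm (weak_deriv f1 x))\<^sup>2) - \<tau>1 * (LINT x|lborel. norm (f1 x) powr (q1+2)) - \<alpha>1 * (LINT x|lborel. (norm (f1 x))\<^sup>2 * g x)
     + ((LINT x|lborel. (norm (weak_deriv f2 x))\<^sup>2) - \<tau>2 * (LINT x|lborel. norm (f2 x) powr (q2+2)) - \<alpha>2 * (LINT x|lborel. (norm (f2 x))\<^sup>2 * g x))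
     + (LINT x|lborel. (norm (weak_deriv g x))\<^sup>2) - \<tau> * (LINT x|lborel. odd_pow (n1 + 2*n2) n2 (g x))"
    using I by (simp del: power2_abs real_norm_def)
  finally show ?thesis .
qed

lemma integral_pot:
  assumes f1: "f1 \<in> H1" and f2: "f2 \<in> H1" and g: "g \<in> H1"
  shows "(LINT x|lborel. pot (cmod (f1 x)) (cmod (f2 x)) \<bar>g x\<bar>) =
     \<tau>1 * (LINT x|lborel. cmod (f1 x) powr (q1+2)) + \<tau>2 * (LINT x|lborel. cmod (f2 x) powr (q2+2))
     + \<tau> * (LINT x|lborel. \<bar>g x\<bar> powr (p+2)) + \<alpha>1 * (LINT x|lborel. (cmod (f1 x))\<^sup>2 * \<bar>g x\<bar>) + \<alpha>2 * (LINT x|lborel. (cmod (f2 x))\<^sup>2 * \<bar>g x\<bar>)"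
proof -
  have q': "q1 \<ge> 0" "q2 \<ge> 0" "p \<ge> 0" using q p(3) by auto
  note I = H1_powr_integrable[OF f1 q'(1)] H1_powr_integrable[OF f2 q'(2)] H1_powr_integrable[OF g q'(3), unfolded real_norm_def]
    H1_coupling(2)[OF f1 g] H1_coupling(2)[OF f2 g]
  have "(LINT x|lborel. pot (cmod (f1 x)) (cmod (f2 x)) \<bar>g x\<bar>) =
    (LINT x|lborel. \<tau>1 * cmod (f1 x) powr (q1+2) + \<tau>2 * cmod (f2 x) powr (q2+2) + \<tau> * \<bar>g x\<bar> powr (p+2)
      + \<alpha>1 * ((cmod (f1 x))\<^sup>2 * \<bar>g x\<bar>) + \<alpha>2 * ((cmod (f2 x))\<^sup>2 * \<bar>g x\<bar>))"
    unfolding pot_def by (simp add: mult.assoc)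
  also have "\<dots> = \<tau>1 * (LINT x|lborel. cmod (f1 x) powr (q1+2)) + \<tau>2 * (LINT x|lborel. cmod (f2 x) powr (q2+2))
     + \<tau> * (LINT x|lborel. \<bar>g x\<bar> powr (p+2)) + \<alpha>1 * (LINT x|lborel. (cmod (f1 x))\<^sup>2 * \<bar>g x\<bar>) + \<alpha>2 * (LINT x|lborel. (cmod (f2 x))\<^sup>2 * \<bar>g x\<bar>)"
    using I by simp
  finally show ?thesis .
qed

text \<open>Replacing g by |g| can only increase the coupling and power terms, which enter the
  energy with a minus sign; for g \<ge> 0 nothing changes. The derivative terms of the original
  functions are kept, so no gradient of a modulus occurs.\<close>

lemma energy_lower_bound:
  assumes f1: "f1 \<in> H1" and f2: "f2 \<in> H1" and g: "g \<in> H1"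
  shows "(LINT x|lborel. (cmod (weak_deriv f1 x))\<^sup>2) + (LINT x|lborel. (cmod (weak_deriv f2 x))\<^sup>2) + (LINT x|lborel. (norm (weak_deriv g x))\<^sup>2)
     - (LINT x|lborel. pot (cmod (f1 x)) (cmod (f2 x)) \<bar>g x\<bar>) \<le> E f1 f2 g"
    "(\<And>x. 0 \<le> g x) \<Longrightarrow> E f1 f2 g = (LINT x|lborel. (cmod (weak_deriv f1 x))\<^sup>2) + (LINT x|lborel. (cmod (weak_deriv f2 x))\<^sup>2) + (LINT x|lborel. (norm (weak_deriv g x))\<^sup>2)
     - (LINT x|lborel. pot (cmod (f1 x)) (cmod (f2 x)) \<bar>g x\<bar>)"
proof -
  have c: "(LINT x|lborel. (cmod (f x))\<^sup>2 * g x) \<le> (LINT x|lborel. (cmod (f x))\<^sup>2 * \<bar>g x\<bar>)" if "f \<in> H1" for f :: "real \<Rightarrow> complex"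
    by (rule integral_mono[OF H1_coupling[OF that g]]) (auto intro: mult_left_mono)
  have pi: "integrable lborel (\<lambda>x. \<bar>g x\<bar> powr (p+2))" using H1_powr_integrable[OF g, of p] p(3) by simp
  have o: "(LINT x|lborel. odd_pow (n1 + 2*n2) n2 (g x)) \<le> (LINT x|lborel. \<bar>g x\<bar> powr (p+2))"
    by (rule integral_mono[OF H1_odd_pow_integrable[OF g] pi]) (metis abs_odd_pow_p2 abs_ge_self)
  have "\<alpha>1 * (LINT x|lborel. (cmod (f1 x))\<^sup>2 * g x) \<le> \<alpha>1 * (LINT x|lborel. (cmod (f1 x))\<^sup>2 * \<bar>g x\<bar>)"
    "\<alpha>2 * (LINT x|lborel. (cmod (f2 x))\<^sup>2 * g x) \<le> \<alpha>2 * (LINT x|lborel. (cmod (f2 x))\<^sup>2 * \<bar>g x\<bar>)"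
    "\<tau> * (LINT x|lborel. odd_pow (n1 + 2*n2) n2 (g x)) \<le> \<tau> * (LINT x|lborel. \<bar>g x\<bar> powr (p+2))"
    using pos \<tau>_pos by (intro mult_left_mono c f1 f2 o; simp)+
  then show "(LINT x|lborel. (cmod (weak_deriv f1 x))\<^sup>2) + (LINT x|lborel. (cmod (weak_deriv f2 x))\<^sup>2) + (LINT x|lborel. (norm (weak_deriv g x))\<^sup>2)
     - (LINT x|lborel. pot (cmod (f1 x)) (cmod (f2 x)) \<bar>g x\<bar>) \<le> E f1 f2 g"
    unfolding energy_eq[OF assms] integral_pot[OF assms] by linarith
  show "E f1 f2 g = (LINT x|lborel. (cmod (weak_deriv f1 x))\<^sup>2) + (LINT x|lborel. (cmod (weak_deriv f2 x))\<^sup>2) + (LINT x|lborel. (norm (weak_deriv g x))\<^sup>2)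
     - (LINT x|lborel. pot (cmod (f1 x)) (cmod (f2 x)) \<bar>g x\<bar>)" if "\<And>x. 0 \<le> g x"
    unfolding energy_eq[OF assms] integral_pot[OF assms] using that by (simp add: odd_pow_p2)
qed

text \<open>First-order form of the real system, with slopes d1, d2, dg and all six functions in L2.
  The odd power is written |g|^p g, which is the same for g \<ge> 0.\<close>

definition stationary :: "real \<Rightarrow> real \<Rightarrow> real \<Rightarrow> (real \<Rightarrow> real) \<Rightarrow> (real \<Rightarrow> real) \<Rightarrow> (real \<Rightarrow> real) \<Rightarrow> (real \<Rightarrow> real) \<Rightarrow> (real \<Rightarrow> real) \<Rightarrow> (real \<Rightarrow> real) \<Rightarrow> bool" where
  "stationary \<sigma>1 \<sigma>2 c f1 f2 g d1 d2 dg \<longleftrightarrow>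
     (\<forall>x. (f1 has_real_derivative d1 x) (at x)) \<and> (\<forall>x. (f2 has_real_derivative d2 x) (at x)) \<and> (\<forall>x. (g has_real_derivative dg x) (at x)) \<and>
     (\<forall>x. (d1 has_real_derivative \<sigma>1 * f1 x - \<gamma>1 * \<bar>f1 x\<bar> powr q1 * f1 x - \<alpha>1 * f1 x * g x) (at x)) \<and>
     (\<forall>x. (d2 has_real_derivative \<sigma>2 * f2 x - \<gamma>2 * \<bar>f2 x\<bar> powr q2 * f2 x - \<alpha>2 * f2 x * g x) (at x)) \<and>
     (\<forall>x. (dg has_real_derivative c * g x - \<beta> / (p+1) * \<bar>g x\<bar> powr p * g x - \<alpha>1 / 2 * (f1 x)\<^sup>2 - \<alpha>2 / 2 * (f2 x)\<^sup>2) (at x)) \<and>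
     f1 \<in> L2 \<and> f2 \<in> L2 \<and> g \<in> L2 \<and> d1 \<in> L2 \<and> d2 \<in> L2 \<and> dg \<in> L2"

lemma relaxed_minimiser_exists:
  obtains \<sigma>1 \<sigma>2 c f1 f2 g d1 d2 dg where "stationary \<sigma>1 \<sigma>2 c f1 f2 g d1 d2 dg"
    "\<And>x. 0 \<le> f1 x" "\<And>x. 0 \<le> f2 x" "\<And>x. 0 \<le> g x"
    "(LINT x|lborel. (f1 x)\<^sup>2) \<le> r" "(LINT x|lborel. (f2 x)\<^sup>2) \<le> l" "(LINT x|lborel. (g x)\<^sup>2) \<le> m"
    "\<And>h1 h2 k. h1 \<in> H1 \<Longrightarrow> h2 \<in> H1 \<Longrightarrow> k \<in> H1 \<Longrightarrow>
       (LINT x|lborel. (cmod (h1 x))\<^sup>2) \<le> r \<Longrightarrow> (LINT x|lborel. (cmod (h2 x))\<^sup>2) \<le> l \<Longrightarrow> (LINT x|lborel. (k x)\<^sup>2) \<le> m \<Longrightarrow>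
       E (\<lambda>x. f1 x *\<^sub>R 1) (\<lambda>x. f2 x *\<^sub>R 1) g \<le> E h1 h2 k"
proof -
  obtain W W' lam where W: "\<And>x. (W has_vector_derivative W' x) (at x)"
    "\<And>x. (W' has_vector_derivative coupled_energy.force pot_grad lam (W x)) (at x)"
    "\<And>x k. 0 \<le> W x $ k" "\<And>x k. \<bar>x\<bar> * (W x $ k)\<^sup>2 \<le> masses k"
    "\<And>k. integrable lborel (\<lambda>x. (W x $ k)\<^sup>2)" "\<And>k. (LINT x|lborel. (W x $ k)\<^sup>2) \<le> masses k"
    "integrable lborel (\<lambda>x. (norm (W' x))\<^sup>2)" "integrable lborel (\<lambda>x. pot_vec (W x))"
    and min: "\<And>v dd. continuous_on UNIV v \<Longrightarrow> (v \<longlongrightarrow> 0) at_infinity \<Longrightarrow> (\<And>x k. 0 \<le> v x $ k) \<Longrightarrow>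
       integrable lborel dd \<Longrightarrow> (\<And>x. 0 \<le> dd x) \<Longrightarrow>
       (\<And>x y. x \<le> y \<Longrightarrow> (norm (v y - v x))\<^sup>2 \<le> (y - x) * (LINT s|lborel. indicator {x..<y} s * dd s)) \<Longrightarrow>
       (\<And>k. integrable lborel (\<lambda>x. (v x $ k)\<^sup>2)) \<Longrightarrow> (\<And>k. (LINT x|lborel. (v x $ k)\<^sup>2) \<le> masses k) \<Longrightarrow>
       (LINT x|lborel. (norm (W' x))\<^sup>2) - (LINT x|lborel. pot_vec (W x)) \<le> (LINT x|lborel. dd x) - (LINT x|lborel. pot_vec (v x))"
    using coupled_energy.ground_state_exists[OF coupled_energy] by blast
  have comp: "((\<lambda>x. W x $ k) has_real_derivative W' x $ k) (at x)" for k x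
    using bounded_linear.has_vector_derivative[OF bounded_linear_vec_nth W(1)] by (simp add: has_real_derivative_iff_has_vector_derivative)
  have comp': "((\<lambda>x. W' x $ k) has_real_derivative coupled_energy.force pot_grad lam (W x) $ k) (at x)" for k x
    using bounded_linear.has_vector_derivative[OF bounded_linear_vec_nth W(2)] by (simp add: has_real_derivative_iff_has_vector_derivative)
  have F1: "coupled_energy.force pot_grad lam (W x) $ 1 = lam$1 * W x $ 1 - \<gamma>1 * \<bar>W x $ 1\<bar> powr q1 * W x $ 1 - \<alpha>1 * W x $ 1 * W x $ 3" for x
    using q unfolding coupled_energy.force_def[OF coupled_energy] pot_grad_def by (simp add: \<tau>1_def field_simps)
  have F2: "coupled_energy.force pot_grad lam (W x) $ 2 = lam$2 * W x $ 2 - \<gamma>2 * \<bar>W x $ 2\<bar> powr q2 * W x $ 2 - \<alpha>2 * W x $ 2 * W x $ 3" for x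
    using q unfolding coupled_energy.force_def[OF coupled_energy] pot_grad_def by (simp add: \<tau>2_def field_simps)
  have F3: "coupled_energy.force pot_grad lam (W x) $ 3 = lam$3 * W x $ 3 - \<beta> / (p+1) * \<bar>W x $ 3\<bar> powr p * W x $ 3 - \<alpha>1 / 2 * (W x $ 1)\<^sup>2 - \<alpha>2 / 2 * (W x $ 2)\<^sup>2" for x
  proof -
    \<comment> \<open>The normalisation of \<tau>: half the gradient of the power term must have the
      coefficient \<beta>/(p+1) of the equation.\<close>
    have t: "\<tau> * (p+2) / 2 = \<beta> / (p+1)" 
    proof -
      have "2 * \<beta> / (P * Q) * Q / 2 = \<beta> / P" if "Q \<noteq> 0" for P Q :: real using that by simp
      from this[of "p+2" "p+1"] show ?thesis using p(3) by (simp add: \<tau>_def)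
    qed
    have "coupled_energy.force pot_grad lam (W x) $ 3 = lam$3 * W x $ 3 - (\<tau> * (p+2) / 2) * \<bar>W x $ 3\<bar> powr p * W x $ 3 - \<alpha>1 / 2 * (W x $ 1)\<^sup>2 - \<alpha>2 / 2 * (W x $ 2)\<^sup>2"
      unfolding coupled_energy.force_def[OF coupled_energy] pot_grad_def by (simp add: field_simps)
    then show ?thesis unfolding t .
  qed
  have mc: "f \<in> borel_measurable lborel" if "\<And>x. (f has_real_derivative f' x) (at x)" for f f' :: "real \<Rightarrow> real"
  proof -
    have "continuous_on UNIV f" using that by (intro continuous_at_imp_continuous_on ballI DERIV_isCont)
    then show ?thesis using borel_measurable_continuous_onI by simp
  qed
  have WL: "(\<lambda>x. W x $ k) \<in> L2" for k using mc[OF comp] W(5) by (simp add: L2_def)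
  have W'i: "integrable lborel (\<lambda>x. (W' x $ k)\<^sup>2)" for k
  proof (rule Bochner_Integration.integrable_bound[OF W(7)])
    show "(\<lambda>x. (W' x $ k)\<^sup>2) \<in> borel_measurable lborel" using mc[OF comp'] by measurable
    have "(W' x $ k)\<^sup>2 \<le> (norm (W' x))\<^sup>2" for x
      using power_mono[OF component_le_norm_cart[of "W' x" k], of 2] by simp
    then show "AE x in lborel. norm ((W' x $ k)\<^sup>2) \<le> norm ((norm (W' x))\<^sup>2)" by simp
  qed
  have W'L: "(\<lambda>x. W' x $ k) \<in> L2" for k using mc[OF comp'] W'i by (simp add: L2_def)
  have st: "stationary (lam$1) (lam$2) (lam$3) (\<lambda>x. W x $ 1) (\<lambda>x. W x $ 2) (\<lambda>x. W x $ 3) (\<lambda>x. W' x $ 1) (\<lambda>x. W' x $ 2) (\<lambda>x. W' x $ 3)"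
    unfolding stationary_def using comp comp'[of 1, unfolded F1] comp'[of 2, unfolded F2] comp'[of 3, unfolded F3] WL W'L by blast
  have prim: "is_primitive (\<lambda>x. W x $ k) (\<lambda>x. W' x $ k)" for k
  proof (rule C1_primitive)
    show "((\<lambda>x. W x $ k) has_vector_derivative W' x $ k) (at x)" for x using comp by (simp add: has_real_derivative_iff_has_vector_derivative)
    show "continuous_on UNIV (\<lambda>x. W' x $ k)" using comp' by (intro continuous_at_imp_continuous_on ballI DERIV_isCont)
  qed
  note S = H1_scaleR[OF WL W'L prim]
  have gH: "(\<lambda>x. W x $ 3) \<in> H1" "AE x in lborel. weak_deriv (\<lambda>x. W x $ 3) x = W' x $ 3"
    using H1I[OF WL W'L prim] by auto
  have e1: "(LINT x|lborel. (cmod (weak_deriv (\<lambda>x. W x $ k *\<^sub>R 1) x))\<^sup>2) = (LINT x|lborel. (W' x $ k)\<^sup>2)" for k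
  proof -
    have "(LINT x|lborel. (norm (weak_deriv (\<lambda>x. W x $ k *\<^sub>R (1::complex)) x))\<^sup>2) = (LINT x|lborel. (norm (W' x $ k))\<^sup>2)"
    proof (rule H1_dirichlet_cong[OF H1_scaleR(1)[OF WL W'L prim] mc[OF comp']])
      show "AE x in lborel. norm (weak_deriv (\<lambda>x. W x $ k *\<^sub>R (1::complex)) x) = norm (W' x $ k)"
        using H1_scaleR(2)[OF WL[of k] W'L[of k] prim[of k], of "1::complex"] by eventually_elim simp
    qed
    then show ?thesis by simp
  qed
  have e3: "(LINT x|lborel. (norm (weak_deriv (\<lambda>x. W x $ 3) x))\<^sup>2) = (LINT x|lborel. (W' x $ 3)\<^sup>2)"
  proof -
    have "(LINT x|lborel. (norm (weak_deriv (\<lambda>x. W x $ 3) x))\<^sup>2) = (LINT x|lborel. (norm (W' x $ 3))\<^sup>2)"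
    proof (rule H1_dirichlet_cong[OF gH(1) mc[OF comp']])
      show "AE x in lborel. norm (weak_deriv (\<lambda>x. W x $ 3) x) = norm (W' x $ 3)" using gH(2) by eventually_elim simp
    qed
    then show ?thesis by simp
  qed
  have EW: "E (\<lambda>x. W x $ 1 *\<^sub>R 1) (\<lambda>x. W x $ 2 *\<^sub>R 1) (\<lambda>x. W x $ 3) = (LINT x|lborel. (norm (W' x))\<^sup>2) - (LINT x|lborel. pot_vec (W x))"
  proof -
    have "(LINT x|lborel. (norm (W' x))\<^sup>2) = (LINT x|lborel. (W' x $ 1)\<^sup>2) + (LINT x|lborel. (W' x $ 2)\<^sup>2) + (LINT x|lborel. (W' x $ 3)\<^sup>2)"
      unfolding power2_norm_vec sum_3 using W'i by simp
    moreover have "(\<lambda>x. pot (cmod (W x $ 1 *\<^sub>R 1)) (cmod (W x $ 2 *\<^sub>R 1)) \<bar>W x $ 3\<bar>) = (\<lambda>x. pot_vec (W x))"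
      using W(3) by (simp add: pot_vec_def)
    ultimately show ?thesis
      unfolding energy_lower_bound(2)[OF S(1) S(1) gH(1) W(3)] e1 e3 by simp
  qed
  show thesis
  proof (rule that[OF st W(3) W(3) W(3)])
    show "(LINT x|lborel. (W x $ 1)\<^sup>2) \<le> r" "(LINT x|lborel. (W x $ 2)\<^sup>2) \<le> l" "(LINT x|lborel. (W x $ 3)\<^sup>2) \<le> m"
      using W(6)[of 1] W(6)[of 2] W(6)[of 3] by (simp_all add: masses_def)
  next
    fix h1 h2 :: "real \<Rightarrow> complex" and k :: "real \<Rightarrow> real"
    assume H: "h1 \<in> H1" "h2 \<in> H1" "k \<in> H1" and M: "(LINT x|lborel. (cmod (h1 x))\<^sup>2) \<le> r" "(LINT x|lborel. (cmod (h2 x))\<^sup>2) \<le> l" "(LINT x|lborel. (k x)\<^sup>2) \<le> m"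
    \<comment> \<open>The competitor is the vector of moduli. By the reverse triangle inequality its
      increments are bounded by those of h1, h2 and k, so \<open>dd\<close> can be the sum of the
      squared weak derivatives of the original functions.\<close>
    define v :: "real \<Rightarrow> real^3" where "v x = (\<chi> i. if i = 1 then cmod (h1 x) else if i = 2 then cmod (h2 x) else \<bar>k x\<bar>)" for x
    have v: "v x $ 1 = cmod (h1 x)" "v x $ 2 = cmod (h2 x)" "v x $ 3 = \<bar>k x\<bar>" for x by (simp_all add: v_def)
    define dd where "dd x = (norm (weak_deriv h1 x))\<^sup>2 + (norm (weak_deriv h2 x))\<^sup>2 + (norm (weak_deriv k x))\<^sup>2" for x
    have all3: "P i" if "P 1" "P 2" "P 3" for P and i :: 3 using that exhaust_3[of i] by auto
    note i = L2_integrable[OF H1_weak_deriv(1)[OF H(1)]] L2_integrable[OF H1_weak_deriv(1)[OF H(2)]] L2_integrable[OF H1_weak_deriv(1)[OF H(3)]]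
    have "(LINT x|lborel. (norm (W' x))\<^sup>2) - (LINT x|lborel. pot_vec (W x)) \<le> (LINT x|lborel. dd x) - (LINT x|lborel. pot_vec (v x))"
    proof (rule min)
      have c: "continuous_on UNIV (\<lambda>x. v x $ i)" for i
        by (rule all3[of "\<lambda>i. continuous_on UNIV (\<lambda>x. v x $ i)"]; unfold v; intro continuous_intros H1_continuous H)
      show "continuous_on UNIV v" using continuous_on_vec_lambda[of UNIV "\<lambda>i x. v x $ i", OF c] by simp
      have t: "((\<lambda>x. v x $ i) \<longlongrightarrow> 0) at_infinity" for i
        by (rule all3[of "\<lambda>i. ((\<lambda>x. v x $ i) \<longlongrightarrow> 0) at_infinity"]; unfold v real_norm_def[symmetric])
           (rule tendsto_norm_zero[OF H1_vanishes[OF H(1)]] tendsto_norm_zero[OF H1_vanishes[OF H(2)]] tendsto_norm_zero[OF H1_vanishes[OF H(3)]])+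
      show "(v \<longlongrightarrow> 0) at_infinity" by (rule vec_tendstoI) (use t in simp)
      show "0 \<le> v x $ i" for x i by (rule all3[of "\<lambda>i. 0 \<le> v x $ i"]) (simp_all add: v)
      show "integrable lborel dd" unfolding dd_def using i by (intro Bochner_Integration.integrable_add)
      show "0 \<le> dd x" for x by (simp add: dd_def)
      show "integrable lborel (\<lambda>x. (v x $ i)\<^sup>2)" for i
        by (rule all3[of "\<lambda>i. integrable lborel (\<lambda>x. (v x $ i)\<^sup>2)"]; unfold v real_norm_def[symmetric])
           (rule L2_integrable[OF H1_L2[OF H(1)]] L2_integrable[OF H1_L2[OF H(2)]] L2_integrable[OF H1_L2[OF H(3)]])+
      show "(LINT x|lborel. (v x $ i)\<^sup>2) \<le> masses i" for i
        by (rule all3[of "\<lambda>i. (LINT x|lborel. (v x $ i)\<^sup>2) \<le> masses i"]) (use M in \<open>simp_all add: v masses_def\<close>)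
      fix x y :: real assume xy: "x \<le> y"
      have hh: "(norm (h y) - norm (h x))\<^sup>2 \<le> (y - x) * (LINT s|lborel. indicator {x..<y} s * (norm (weak_deriv h s))\<^sup>2)"
        if "h \<in> H1" for h :: "real \<Rightarrow> 'b::euclidean_space"
      proof -
        have "\<bar>norm (h y) - norm (h x)\<bar> \<le> norm (h y - h x)" by (rule norm_triangle_ineq3)
        then have "(norm (h y) - norm (h x))\<^sup>2 \<le> (norm (h y - h x))\<^sup>2" using power_mono[of "\<bar>norm (h y) - norm (h x)\<bar>" _ 2] by simp
        also have "\<dots> \<le> (y - x) * (LINT s|lborel. indicator {x..<y} s * (norm (weak_deriv h s))\<^sup>2)"
          by (rule primitive_hoelder(2)[OF H1_weak_deriv(2,1)[OF that] xy])
        finally show ?thesis .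
      qed
      note ii = L2_interval_norms(2)[OF H1_weak_deriv(1)[OF H(1)], of x y] L2_interval_norms(2)[OF H1_weak_deriv(1)[OF H(2)], of x y] L2_interval_norms(2)[OF H1_weak_deriv(1)[OF H(3)], of x y]
      have "(norm (v y - v x))\<^sup>2 = (norm (h1 y) - norm (h1 x))\<^sup>2 + (norm (h2 y) - norm (h2 x))\<^sup>2 + (norm (k y) - norm (k x))\<^sup>2"
        unfolding power2_norm_vec sum_3 vector_minus_component v by simp
      also have "\<dots> \<le> (y - x) * (LINT s|lborel. indicator {x..<y} s * (norm (weak_deriv h1 s))\<^sup>2) + (y - x) * (LINT s|lborel. indicator {x..<y} s * (norm (weak_deriv h2 s))\<^sup>2)
         + (y - x) * (LINT s|lborel. indicator {x..<y} s * (norm (weak_deriv k s))\<^sup>2)"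
        by (intro add_mono hh H)
      also have "\<dots> = (y - x) * (LINT s|lborel. indicator {x..<y} s * dd s)"
        unfolding dd_def distrib_left Bochner_Integration.integral_add[OF Bochner_Integration.integrable_add[OF ii(1,2)] ii(3)]
          Bochner_Integration.integral_add[OF ii(1,2)] ..
      finally show "(norm (v y - v x))\<^sup>2 \<le> (y - x) * (LINT s|lborel. indicator {x..<y} s * dd s)" .
    qed
    also have "(LINT x|lborel. dd x) = (LINT x|lborel. (cmod (weak_deriv h1 x))\<^sup>2) + (LINT x|lborel. (cmod (weak_deriv h2 x))\<^sup>2) + (LINT x|lborel. (norm (weak_deriv k x))\<^sup>2)"
      unfolding dd_def Bochner_Integration.integral_add[OF Bochner_Integration.integrable_add[OF i(1,2)] i(3)]
          Bochner_Integration.integral_add[OF i(1,2)] ..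
    also have "(\<lambda>x. pot_vec (v x)) = (\<lambda>x. pot (cmod (h1 x)) (cmod (h2 x)) \<bar>k x\<bar>)" by (simp add: pot_vec_def v)
    also note energy_lower_bound(1)[OF H]
    finally show "E (\<lambda>x. W x $ 1 *\<^sub>R 1) (\<lambda>x. W x $ 2 *\<^sub>R 1) (\<lambda>x. W x $ 3) \<le> E h1 h2 k" unfolding EW by simp
  qed
qed

end

subsection \<open>First variation\<close>

text \<open>Differentiation under the integral sign, along an arbitrary sequence tending to 0; the
  Lipschitz bound in t makes \<open>w\<close> a majorant of the difference quotients.\<close>

lemma integral_has_derivative_at_0:
  fixes F :: "real \<Rightarrow> real \<Rightarrow> real"
  assumes i: "\<And>t. integrable lborel (F t)"
    and d: "\<And>x. ((\<lambda>t. F t x) has_real_derivative D x) (at 0)"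
    and b: "\<And>t x. \<bar>t\<bar> \<le> 1 \<Longrightarrow> \<bar>F t x - F 0 x\<bar> \<le> \<bar>t\<bar> * w x" and w: "integrable lborel w"
  shows "((\<lambda>t. LINT x|lborel. F t x) has_real_derivative (LINT x|lborel. D x)) (at 0)"
  unfolding DERIV_def tendsto_at_iff_sequentially
proof (intro allI impI)
  fix X :: "nat \<Rightarrow> real" assume X: "\<forall>i. X i \<in> UNIV - {0}" "X \<longlonglongrightarrow> 0"
  have "\<forall>\<^sub>F n in sequentially. \<bar>X n\<bar> < 1" using order_tendstoD(2)[OF tendsto_rabs_zero[OF X(2)], of 1] by simp
  then obtain N where N: "\<And>n. n \<ge> N \<Longrightarrow> \<bar>X n\<bar> < 1" unfolding eventually_sequentially by blast
  have qlim: "(\<lambda>n. (F (X (n + N)) x - F 0 x) / X (n + N)) \<longlonglongrightarrow> D x" for x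
  proof -
    have "((\<lambda>h. (F h x - F 0 x) / h) \<longlongrightarrow> D x) (at 0)" using d[of x] by (simp add: DERIV_def)
    then have "((\<lambda>h. (F h x - F 0 x) / h) \<circ> X) \<longlonglongrightarrow> D x" using X unfolding tendsto_at_iff_sequentially by blast
    then show ?thesis using LIMSEQ_ignore_initial_segment[of "(\<lambda>h. (F h x - F 0 x) / h) \<circ> X" "D x" N] by (simp add: o_def)
  qed
  have m: "(\<lambda>x. (F (X (n + N)) x - F 0 x) / X (n + N)) \<in> borel_measurable lborel" for n
    using borel_measurable_integrable[OF i[of "X (n + N)"]] borel_measurable_integrable[OF i[of 0]] by measurable
  have "(\<lambda>n. LINT x|lborel. (F (X (n + N)) x - F 0 x) / X (n + N)) \<longlonglongrightarrow> (LINT x|lborel. D x)"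
  proof (rule integral_dominated_convergence[OF _ m w])
    show "D \<in> borel_measurable lborel" by (rule borel_measurable_LIMSEQ_real[OF qlim m])
    show "AE x in lborel. (\<lambda>n. (F (X (n + N)) x - F 0 x) / X (n + N)) \<longlonglongrightarrow> D x" using qlim by simp
    show "AE x in lborel. norm ((F (X (n + N)) x - F 0 x) / X (n + N)) \<le> w x" for n
    proof (rule AE_I2)
      fix x
      have "X (n + N) \<noteq> 0" using X(1) by blast
      then show "norm ((F (X (n + N)) x - F 0 x) / X (n + N)) \<le> w x"
        using b[of "X (n + N)" x] N[of "n + N"] by (simp add: abs_divide pos_divide_le_eq mult.commute)
    qed
  qed
  moreover have "(LINT x|lborel. (F (X (n + N)) x - F 0 x) / X (n + N)) = ((\<lambda>h. ((LINT x|lborel. F (0 + h) x) - (LINT x|lborel. F 0 x)) / h) \<circ> X) (n + N)" for n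
    using i by (simp add: o_def)
  ultimately have "(\<lambda>n. ((\<lambda>h. ((LINT x|lborel. F (0 + h) x) - (LINT x|lborel. F 0 x)) / h) \<circ> X) (n + N)) \<longlonglongrightarrow> (LINT x|lborel. D x)"
    by (simp only:)
  then show "((\<lambda>h. ((LINT x|lborel. F (0 + h) x) - (LINT x|lborel. F 0 x)) / h) \<circ> X) \<longlonglongrightarrow> (LINT x|lborel. D x)"
    by (rule LIMSEQ_offset)
qed

text \<open>The shape of the majorants below: u + v bounds the varied function and v the direction,
  and the result is integrable for L2 functions.\<close>

lemma mult_le_sum_squares: "(u + v) * v \<le> u\<^sup>2 + 2 * v\<^sup>2" for u v :: real
proof -
  have "0 \<le> (u - v)\<^sup>2 + u\<^sup>2 + v\<^sup>2" by simp
  then show ?thesis by (simp add: power2_eq_square algebra_simps)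
qed

lemma power2_powr: "0 < u \<Longrightarrow> (u\<^sup>2) powr e = u powr (2 * e)" for u e :: real
  using powr_powr[of u 2 e] by simp

lemma powr_lipschitz:
  fixes s :: real
  assumes s: "s > 0" and xy: "0 \<le> x" "x \<le> M" "0 \<le> y" "y \<le> M"
  shows "\<bar>x powr (s+2) - y powr (s+2)\<bar> \<le> (s+2) * M powr (s+1) * \<bar>x - y\<bar>"
proof -
  have *: "y powr (s+2) - x powr (s+2) \<le> (s+2) * M powr (s+1) * (y - x)" "x powr (s+2) \<le> y powr (s+2)"
    if xy: "0 \<le> x" "x < y" "y \<le> M" for x y
  proof -
    have "\<exists>z>x. z < y \<and> \<bar>y\<bar> powr (s+2) - \<bar>x\<bar> powr (s+2) = (y - x) * ((s+2) * \<bar>z\<bar> powr s * z)"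
      by (rule MVT2[OF xy(2)]) (rule abs_powr_has_derivative[OF s])
    then obtain z where z: "x < z" "z < y" "\<bar>y\<bar> powr (s+2) - \<bar>x\<bar> powr (s+2) = (y - x) * ((s+2) * \<bar>z\<bar> powr s * z)" by blast
    have "\<bar>z\<bar> powr s * z = z powr (s+1)" using z xy by (simp add: powr_add)
    with z(3) have z3: "y powr (s+2) - x powr (s+2) = (y - x) * ((s+2) * z powr (s+1))" using xy by (simp add: mult.assoc)
    have "z powr (s+1) \<le> M powr (s+1)" using z xy s by (intro powr_mono2) auto
    then have "(y - x) * ((s+2) * z powr (s+1)) \<le> (y - x) * ((s+2) * M powr (s+1))"
      using z s by (intro mult_left_mono) auto
    then show "y powr (s+2) - x powr (s+2) \<le> (s+2) * M powr (s+1) * (y - x)" using z3 by (simp add: mult_ac)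
    show "x powr (s+2) \<le> y powr (s+2)" using xy s by (intro powr_mono2) auto
  qed
  consider "x < y" | "y < x" | "x = y" by linarith
  then show ?thesis
  proof cases
    case 1
    have "\<bar>x powr (s+2) - y powr (s+2)\<bar> = y powr (s+2) - x powr (s+2)" "\<bar>x - y\<bar> = y - x"
      using *(2)[of x y] 1 xy by auto
    then show ?thesis using *(1)[of x y] 1 xy by simp
  next
    case 2
    have "\<bar>x powr (s+2) - y powr (s+2)\<bar> = x powr (s+2) - y powr (s+2)" "\<bar>x - y\<bar> = x - y"
      using *(2)[of y x] 2 xy by auto
    then show ?thesis using *(1)[of y x] 2 xy by simp
  qed simp
qed

lemma odd_pow_uminus: "n > 0 \<Longrightarrow> odd_pow a n (- x) = (-1) ^ a * odd_pow a n x"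
  by (simp add: odd_pow_def real_root_minus power_minus[of "root n x"])

text \<open>For equal signs this is \<open>powr_lipschitz\<close>, after a change of sign if both
  arguments are negative. For opposite signs each value is compared with the value 0 at the origin,
  and |x| + |y| = |x - y|.\<close>

lemma odd_pow_lipschitz:
  assumes n: "n > 0" "a > 0" and s: "real a / real n = s + 2" "s > 0" and M: "\<bar>x\<bar> \<le> M" "\<bar>y\<bar> \<le> M"
  shows "\<bar>odd_pow a n x - odd_pow a n y\<bar> \<le> (s+2) * M powr (s+1) * \<bar>x - y\<bar>"
proof -
  have opp: "\<bar>odd_pow a n x - odd_pow a n y\<bar> \<le> (s+2) * M powr (s+1) * \<bar>x - y\<bar>"
    if xy: "x \<le> 0" "0 \<le> y" "\<bar>x\<bar> \<le> M" "\<bar>y\<bar> \<le> M" for x y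
  proof -
    have e: "\<bar>z\<bar> powr (s+2) \<le> (s+2) * M powr (s+1) * \<bar>z\<bar>" if "\<bar>z\<bar> \<le> M" for z
      using powr_lipschitz[OF s(2), of "\<bar>z\<bar>" M 0] that by simp
    have "\<bar>odd_pow a n x - odd_pow a n y\<bar> \<le> \<bar>odd_pow a n x\<bar> + \<bar>odd_pow a n y\<bar>" by linarith
    also have "\<dots> = \<bar>x\<bar> powr (s+2) + \<bar>y\<bar> powr (s+2)" unfolding abs_odd_pow[OF n] s ..
    also have "\<dots> \<le> (s+2) * M powr (s+1) * \<bar>x\<bar> + (s+2) * M powr (s+1) * \<bar>y\<bar>" by (intro add_mono e xy)
    also have "\<dots> = (s+2) * M powr (s+1) * \<bar>x - y\<bar>" using xy by (simp add: algebra_simps)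
    finally show ?thesis .
  qed
  have same: "\<bar>odd_pow a n x - odd_pow a n y\<bar> \<le> (s+2) * M powr (s+1) * \<bar>x - y\<bar>"
    if "0 \<le> x" "0 \<le> y" "\<bar>x\<bar> \<le> M" "\<bar>y\<bar> \<le> M" for x y
    using powr_lipschitz[OF s(2), of x M y] that by (simp add: odd_pow_nonneg[OF _ n] s)
  have neg: "\<bar>odd_pow a n x - odd_pow a n y\<bar> = \<bar>odd_pow a n (-x) - odd_pow a n (-y)\<bar>" for x y
    unfolding odd_pow_uminus[OF n(1)] right_diff_distrib[symmetric] abs_mult by (simp add: power_abs)
  consider "0 \<le> x" "0 \<le> y" | "x \<le> 0" "0 \<le> y" | "0 \<le> x" "y \<le> 0" | "x \<le> 0" "y \<le> 0" by linarith
  then show ?thesis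
  proof cases
    case 1 then show ?thesis using same M by blast
  next
    case 2 then show ?thesis using opp M by blast
  next
    case 3 then show ?thesis using opp[of y x] M by (simp add: abs_minus_commute)
  next
    case 4 then show ?thesis using same[of "-x" "-y"] M unfolding neg[of x y] by (simp add: abs_minus_commute)
  qed
qed

text \<open>The integrand is a power of the squared norm, a quadratic polynomial in t that is
  positive at t = 0 because f > 0. The majorant comes from \<open>powr_lipschitz\<close> and holds
  also where the varied function vanishes.\<close>

lemma powr_integral_derivative:
  fixes f :: "real \<Rightarrow> real" and h :: "real \<Rightarrow> 'a::euclidean_space" and e :: 'a
  assumes f: "(\<lambda>x. f x *\<^sub>R e) \<in> H1" "\<And>x. 0 < f x" and e: "norm e = 1" and h: "h \<in> H1" and s: "s > 0"
  shows "((\<lambda>t. LINT x|lborel. norm (f x *\<^sub>R e + t *\<^sub>R h x) powr (s+2)) has_real_derivative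
      (LINT x|lborel. (s+2) * (f x powr (s+1) * (h x \<bullet> e)))) (at 0)"
proof -
  obtain B1 where B1: "B1 > 0" "\<And>x. norm (f x *\<^sub>R e) \<le> B1" using H1_bounded[OF f(1)] by blast
  obtain B2 where B2: "B2 > 0" "\<And>x. norm (h x) \<le> B2" using H1_bounded[OF h] by blast
  define B where "B = B1 + B2"
  define w where "w x = (s+2) * B powr s * ((norm (f x *\<^sub>R e))\<^sup>2 + 2 * (norm (h x))\<^sup>2)" for x
  show ?thesis
  proof (rule integral_has_derivative_at_0)
    show "integrable lborel (\<lambda>x. norm (f x *\<^sub>R e + t *\<^sub>R h x) powr (s+2))" for t
      by (rule H1_powr_integrable[OF H1_add_scaleR(1)[OF f(1) h]]) (use s in simp)
    show "integrable lborel w" unfolding w_def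
      by (intro integrable_mult_right Bochner_Integration.integrable_add L2_integrable H1_L2 f h)
    show "((\<lambda>t. norm (f x *\<^sub>R e + t *\<^sub>R h x) powr (s+2)) has_real_derivative (s+2) * (f x powr (s+1) * (h x \<bullet> e))) (at 0)" for x
    proof -
      have n: "norm v powr (s+2) = ((norm v)\<^sup>2) powr (s/2+1)" for v :: 'a
      proof (cases "v = 0")
        case False
        have "2 * (s/2+1) = s + 2" by simp
        then show ?thesis using power2_powr[of "norm v" "s/2+1"] False by simp
      qed simp
      have fx: "(norm (f x *\<^sub>R e))\<^sup>2 = (f x)\<^sup>2" using e by simp
      have q: "((\<lambda>t. (f x)\<^sup>2 + 2 * t * (f x *\<^sub>R e \<bullet> h x) + t\<^sup>2 * (norm (h x))\<^sup>2) has_real_derivative 2 * (f x *\<^sub>R e \<bullet> h x)) (at 0)"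
        by (auto intro!: derivative_eq_intros)
      have p: "((\<lambda>y. y powr (s/2+1)) has_real_derivative (s/2+1) * ((f x)\<^sup>2) powr (s/2)) (at ((f x)\<^sup>2 + 2 * 0 * (f x *\<^sub>R e \<bullet> h x) + 0\<^sup>2 * (norm (h x))\<^sup>2))"
        using has_real_derivative_powr[of "(f x)\<^sup>2" "s/2+1"] f(2)[of x] by simp
      have "((\<lambda>t. ((f x)\<^sup>2 + 2 * t * (f x *\<^sub>R e \<bullet> h x) + t\<^sup>2 * (norm (h x))\<^sup>2) powr (s/2+1)) has_real_derivative
         ((s/2+1) * ((f x)\<^sup>2) powr (s/2)) * (2 * (f x *\<^sub>R e \<bullet> h x))) (at 0)"
        by (rule DERIV_chain2[OF p q])
      moreover have "((s/2+1) * ((f x)\<^sup>2) powr (s/2)) * (2 * (f x *\<^sub>R e \<bullet> h x)) = (s+2) * (f x powr (s+1) * (h x \<bullet> e))"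
      proof -
        have "((f x)\<^sup>2) powr (s/2) = f x powr s" using power2_powr[OF f(2)[of x], of "s/2"] by simp
        moreover have "f x powr (s+1) = f x powr s * f x" using f(2)[of x] by (simp add: powr_add)
        ultimately show ?thesis by (simp add: inner_commute algebra_simps)
      qed
      ultimately show ?thesis unfolding n power2_norm_add_scaleR fx by simp
    qed
    fix t x :: real assume t: "\<bar>t\<bar> \<le> 1"
    let ?F = "norm (f x *\<^sub>R e)" and ?H = "norm (h x)" and ?T = "norm (f x *\<^sub>R e + t *\<^sub>R h x)"
    have th: "norm (t *\<^sub>R h x) \<le> ?H" using t by (simp add: mult_left_le_one_le)
    have TM: "?T \<le> ?F + ?H" using norm_triangle_ineq[of "f x *\<^sub>R e" "t *\<^sub>R h x"] th by linarith
    have M: "(?F + ?H) powr (s+1) \<le> B powr s * (?F + ?H)"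
    proof -
      have "(?F + ?H) powr (s+1) = (?F + ?H) powr s * (?F + ?H)" by (cases "?F + ?H = 0") (auto simp: powr_add)
      also have "\<dots> \<le> B powr s * (?F + ?H)"
        using B1(2)[of x] B2(2)[of x] s by (intro mult_right_mono powr_mono2) (auto simp: B_def)
      finally show ?thesis .
    qed
    have "\<bar>?T powr (s+2) - ?F powr (s+2)\<bar> \<le> (s+2) * (?F + ?H) powr (s+1) * \<bar>?T - ?F\<bar>"
      by (rule powr_lipschitz[OF s]) (use TM in auto)
    also have "\<dots> \<le> (s+2) * (B powr s * (?F + ?H)) * (\<bar>t\<bar> * ?H)"
    proof (intro mult_mono mult_left_mono M)
      show "\<bar>?T - ?F\<bar> \<le> \<bar>t\<bar> * ?H" using norm_triangle_ineq3[of "f x *\<^sub>R e + t *\<^sub>R h x" "f x *\<^sub>R e"] by simp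
    qed (use s in auto)
    also have "\<dots> = \<bar>t\<bar> * ((s+2) * B powr s * ((?F + ?H) * ?H))" by (simp add: mult_ac)
    also have "\<dots> \<le> \<bar>t\<bar> * ((s+2) * B powr s * (?F\<^sup>2 + 2 * ?H\<^sup>2))"
      using s by (intro mult_left_mono mult_le_sum_squares) auto
    finally show "\<bar>?T powr (s+2) - norm (f x *\<^sub>R e + 0 *\<^sub>R h x) powr (s+2)\<bar> \<le> \<bar>t\<bar> * w x" by (simp add: w_def)
  qed
qed

text \<open>The integrand is a polynomial in t, so the pointwise derivative is immediate; the work
  lies in the majorant, where t^2 \<le> |t| absorbs the higher orders.\<close>

lemma coupling_integral_derivative:
  fixes \<phi> h :: "real \<Rightarrow> complex" and g k :: "real \<Rightarrow> real"
  assumes H: "\<phi> \<in> H1" "h \<in> H1" "g \<in> H1" "k \<in> H1"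
  shows "((\<lambda>t. LINT x|lborel. (cmod (\<phi> x + t *\<^sub>R h x))\<^sup>2 * (g x + t * k x)) has_real_derivative
      (LINT x|lborel. 2 * ((\<phi> x \<bullet> h x) * g x) + (cmod (\<phi> x))\<^sup>2 * k x)) (at 0)"
proof -
  obtain B1 where B1: "B1 > 0" "\<And>x. norm (g x) \<le> B1" using H1_bounded[OF H(3)] by blast
  obtain B2 where B2: "B2 > 0" "\<And>x. norm (k x) \<le> B2" using H1_bounded[OF H(4)] by blast
  define B where "B = B1 + B2"
  define w where "w x = B * (2 * (norm (\<phi> x))\<^sup>2 + 3 * (norm (h x))\<^sup>2)" for x
  show ?thesis
  proof (rule integral_has_derivative_at_0)
    fix t
    have gk: "(\<lambda>x. g x + t * k x) \<in> H1" using H1_add_scaleR(1)[OF H(3,4), of t] by simp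
    obtain B3 where B3: "\<And>x. norm (g x + t * k x) \<le> B3" using H1_bounded[OF gk] by blast
    show "integrable lborel (\<lambda>x. (cmod (\<phi> x + t *\<^sub>R h x))\<^sup>2 * (g x + t * k x))"
      by (rule H1_coupling_integrable[OF H1_add_scaleR(1)[OF H(1,2)] L2_measurable[OF H1_L2[OF gk]], of B3]) (use B3 in simp)
  next
    show "integrable lborel w" unfolding w_def
      by (intro integrable_mult_right Bochner_Integration.integrable_add L2_integrable H1_L2 H)
    show "((\<lambda>t. (cmod (\<phi> x + t *\<^sub>R h x))\<^sup>2 * (g x + t * k x)) has_real_derivative 2 * ((\<phi> x \<bullet> h x) * g x) + (cmod (\<phi> x))\<^sup>2 * k x) (at 0)" for x
      unfolding power2_norm_add_scaleR by (auto intro!: derivative_eq_intros)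
    fix t x :: real assume t: "\<bar>t\<bar> \<le> 1"
    let ?P = "norm (\<phi> x)" and ?H = "norm (h x)"
    have t2: "t\<^sup>2 \<le> \<bar>t\<bar>" using t power_decreasing[of 1 2 "\<bar>t\<bar>"] by simp
    have e: "(cmod (\<phi> x + t *\<^sub>R h x))\<^sup>2 * (g x + t * k x) - (cmod (\<phi> x + 0 *\<^sub>R h x))\<^sup>2 * (g x + 0 * k x)
       = t * ?P\<^sup>2 * k x + (2 * t * (\<phi> x \<bullet> h x) + t\<^sup>2 * ?H\<^sup>2) * (g x + t * k x)"
      unfolding power2_norm_add_scaleR by (simp add: algebra_simps)
    have gb: "\<bar>g x + t * k x\<bar> \<le> B"
    proof -
      have "\<bar>t * k x\<bar> \<le> \<bar>k x\<bar>" using t by (simp add: abs_mult mult_left_le_one_le)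
      then show ?thesis using B1(2)[of x] B2(2)[of x] unfolding B_def real_norm_def by linarith
    qed
    have kb: "\<bar>k x\<bar> \<le> B" using B1 B2(2)[of x] by (simp add: B_def)
    have "\<bar>(cmod (\<phi> x + t *\<^sub>R h x))\<^sup>2 * (g x + t * k x) - (cmod (\<phi> x + 0 *\<^sub>R h x))\<^sup>2 * (g x + 0 * k x)\<bar>
      \<le> \<bar>t * ?P\<^sup>2 * k x\<bar> + \<bar>(2 * t * (\<phi> x \<bullet> h x) + t\<^sup>2 * ?H\<^sup>2) * (g x + t * k x)\<bar>" unfolding e by (rule abs_triangle_ineq)
    also have "\<bar>t * ?P\<^sup>2 * k x\<bar> \<le> \<bar>t\<bar> * ?P\<^sup>2 * B"
    proof -
      have "\<bar>t * ?P\<^sup>2 * k x\<bar> = \<bar>t\<bar> * ?P\<^sup>2 * \<bar>k x\<bar>" by (simp add: abs_mult)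
      then show ?thesis using kb by (simp add: mult_left_mono)
    qed
    also have "\<bar>(2 * t * (\<phi> x \<bullet> h x) + t\<^sup>2 * ?H\<^sup>2) * (g x + t * k x)\<bar> \<le> (\<bar>t\<bar> * (?P\<^sup>2 + 2 * ?H\<^sup>2)) * B"
      unfolding abs_mult[of "2 * t * (\<phi> x \<bullet> h x) + t\<^sup>2 * ?H\<^sup>2"]
    proof (rule mult_mono[OF _ gb])
      have "\<bar>2 * t * (\<phi> x \<bullet> h x) + t\<^sup>2 * ?H\<^sup>2\<bar> \<le> \<bar>t\<bar> * (2 * \<bar>\<phi> x \<bullet> h x\<bar>) + t\<^sup>2 * ?H\<^sup>2"
        using abs_triangle_ineq[of "2 * t * (\<phi> x \<bullet> h x)" "t\<^sup>2 * ?H\<^sup>2"] by (simp add: abs_mult mult_ac)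
      also have "\<dots> \<le> \<bar>t\<bar> * (?P\<^sup>2 + ?H\<^sup>2) + \<bar>t\<bar> * ?H\<^sup>2"
      proof (intro add_mono mult_left_mono mult_right_mono t2)
        have "0 \<le> (?P - ?H)\<^sup>2" by simp
        then show "2 * \<bar>\<phi> x \<bullet> h x\<bar> \<le> ?P\<^sup>2 + ?H\<^sup>2"
          using Cauchy_Schwarz_ineq2[of "\<phi> x" "h x"] by (simp add: power2_diff)
      qed auto
      finally show "\<bar>2 * t * (\<phi> x \<bullet> h x) + t\<^sup>2 * ?H\<^sup>2\<bar> \<le> \<bar>t\<bar> * (?P\<^sup>2 + 2 * ?H\<^sup>2)" by (simp add: algebra_simps)
    qed auto
    finally have "\<bar>(cmod (\<phi> x + t *\<^sub>R h x))\<^sup>2 * (g x + t * k x) - (cmod (\<phi> x + 0 *\<^sub>R h x))\<^sup>2 * (g x + 0 * k x)\<bar>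
      \<le> \<bar>t\<bar> * ?P\<^sup>2 * B + (\<bar>t\<bar> * (?P\<^sup>2 + 2 * ?H\<^sup>2)) * B" by simp
    also have "\<dots> = \<bar>t\<bar> * (B * (2 * ?P\<^sup>2 + 2 * ?H\<^sup>2))" by (simp add: algebra_simps)
    also have "\<dots> \<le> \<bar>t\<bar> * w x" unfolding w_def using B1(1) B2(1) by (intro mult_left_mono) (auto simp: B_def)
    finally show "\<bar>(cmod (\<phi> x + t *\<^sub>R h x))\<^sup>2 * (g x + t * k x) - (cmod (\<phi> x + 0 *\<^sub>R h x))\<^sup>2 * (g x + 0 * k x)\<bar> \<le> \<bar>t\<bar> * w x" .
  qed
qed

text \<open>Both integrals are quadratic polynomials in t, the first because the chosen weak
  derivative is linear almost everywhere.\<close>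

lemma dirichlet_derivative:
  fixes \<phi> h :: "real \<Rightarrow> 'a::euclidean_space"
  assumes H: "\<phi> \<in> H1" "h \<in> H1"
  shows "((\<lambda>t. LINT x|lborel. (norm (weak_deriv (\<lambda>x. \<phi> x + t *\<^sub>R h x) x))\<^sup>2) has_real_derivative
      2 * (LINT x|lborel. weak_deriv \<phi> x \<bullet> weak_deriv h x)) (at 0)"
    "((\<lambda>t. LINT x|lborel. (norm (\<phi> x + t *\<^sub>R h x))\<^sup>2) has_real_derivative 2 * (LINT x|lborel. \<phi> x \<bullet> h x)) (at 0)"
proof -
  note w = H1_weak_deriv(1)[OF H(1)] H1_weak_deriv(1)[OF H(2)]
  have e: "(LINT x|lborel. (norm (weak_deriv (\<lambda>x. \<phi> x + t *\<^sub>R h x) x))\<^sup>2) =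
     (LINT x|lborel. (norm (weak_deriv \<phi> x))\<^sup>2) + 2 * t * (LINT x|lborel. weak_deriv \<phi> x \<bullet> weak_deriv h x) + t\<^sup>2 * (LINT x|lborel. (norm (weak_deriv h x))\<^sup>2)" for t
    unfolding L2_add_scaleR(2)[OF w, symmetric]
  proof (rule H1_dirichlet_cong[OF H1_add_scaleR(1)[OF H] L2_measurable[OF L2_add_scaleR(1)[OF w]]])
    show "AE x in lborel. norm (weak_deriv (\<lambda>x. \<phi> x + t *\<^sub>R h x) x) = norm (weak_deriv \<phi> x + t *\<^sub>R weak_deriv h x)"
      using H1_add_scaleR(2)[OF H, of t] by eventually_elim simp
  qed
  show "((\<lambda>t. LINT x|lborel. (norm (weak_deriv (\<lambda>x. \<phi> x + t *\<^sub>R h x) x))\<^sup>2) has_real_derivative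
      2 * (LINT x|lborel. weak_deriv \<phi> x \<bullet> weak_deriv h x)) (at 0)"
    unfolding e by (auto intro!: derivative_eq_intros)
  show "((\<lambda>t. LINT x|lborel. (norm (\<phi> x + t *\<^sub>R h x))\<^sup>2) has_real_derivative 2 * (LINT x|lborel. \<phi> x \<bullet> h x)) (at 0)"
    unfolding L2_add_scaleR(2)[OF H1_L2[OF H(1)] H1_L2[OF H(2)]] by (auto intro!: derivative_eq_intros)
qed

context nls_parameters begin

text \<open>For each x the argument stays positive for small t, and there the odd power is an
  ordinary power. How small t must be depends on x; the majorant comes from
  \<open>odd_pow_lipschitz\<close>, which does not depend on signs.\<close>

lemma odd_pow_integral_derivative:
  assumes g: "g \<in> H1" "\<And>x. 0 < g x" and k: "k \<in> H1"
  shows "((\<lambda>t. LINT x|lborel. odd_pow (n1 + 2*n2) n2 (g x + t * k x)) has_real_derivative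
      (LINT x|lborel. (p+2) * (g x powr (p+1) * k x))) (at 0)"
proof -
  obtain B1 where B1: "B1 > 0" "\<And>x. norm (g x) \<le> B1" using H1_bounded[OF g(1)] by blast
  obtain B2 where B2: "B2 > 0" "\<And>x. norm (k x) \<le> B2" using H1_bounded[OF k] by blast
  define B where "B = B1 + B2"
  define w where "w x = (p+2) * B powr p * ((norm (g x))\<^sup>2 + 2 * (norm (k x))\<^sup>2)" for x
  have pn: "real (n1 + 2*n2) / real n2 = p + 2" using n_pos p(1) by (simp add: field_simps)
  have nn: "n1 + 2*n2 > 0" using n_pos by simp
  show ?thesis
  proof (rule integral_has_derivative_at_0)
    show "integrable lborel (\<lambda>x. odd_pow (n1 + 2*n2) n2 (g x + t * k x))" for t
      using H1_odd_pow_integrable[OF H1_add_scaleR(1)[OF g(1) k, of t]] by simp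
    show "integrable lborel w" unfolding w_def
      by (intro integrable_mult_right Bochner_Integration.integrable_add L2_integrable H1_L2 g k)
    show "((\<lambda>t. odd_pow (n1 + 2*n2) n2 (g x + t * k x)) has_real_derivative (p+2) * (g x powr (p+1) * k x)) (at 0)" for x
    proof -
      have q: "((\<lambda>t. g x + t * k x) has_real_derivative k x) (at 0)" by (auto intro!: derivative_eq_intros)
      have "((\<lambda>y. y powr (p+2)) has_real_derivative (p+2) * g x powr (p+1)) (at (g x + 0 * k x))"
        using has_real_derivative_powr[of "g x" "p+2"] g(2)[of x] by (simp add: add.commute)
      from DERIV_chain2[OF this q]
      have d: "((\<lambda>t. (g x + t * k x) powr (p+2)) has_real_derivative (p+2) * (g x powr (p+1) * k x)) (at 0)" by (simp add: mult.assoc)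
      have "((\<lambda>t. g x + t * k x) \<longlongrightarrow> g x + 0 * k x) (nhds 0)"
        using DERIV_isCont[OF q] by (simp add: continuous_at_imp_continuous_at_within isCont_def tendsto_nhds_iff)
      then have "\<forall>\<^sub>F t in nhds 0. 0 < g x + t * k x" by (rule order_tendstoD) (use g(2) in simp)
      then have "\<forall>\<^sub>F t in nhds 0. (g x + t * k x) powr (p+2) = odd_pow (n1 + 2*n2) n2 (g x + t * k x)"
        by eventually_elim (simp add: odd_pow_p2)
      from DERIV_cong_ev[OF refl this refl] d show ?thesis by simp
    qed
    fix t x :: real assume t: "\<bar>t\<bar> \<le> 1"
    let ?M = "\<bar>g x\<bar> + \<bar>k x\<bar>"
    have th: "\<bar>t * k x\<bar> \<le> \<bar>k x\<bar>" using t by (simp add: abs_mult mult_left_le_one_le)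
    have M: "?M powr (p+1) \<le> B powr p * ?M"
    proof -
      have "?M powr (p+1) = ?M powr p * ?M" by (cases "?M = 0") (auto simp: powr_add)
      also have "\<dots> \<le> B powr p * ?M"
        using B1(2)[of x] B2(2)[of x] p(3) by (intro mult_right_mono powr_mono2) (auto simp: B_def)
      finally show ?thesis .
    qed
    have "\<bar>odd_pow (n1 + 2*n2) n2 (g x + t * k x) - odd_pow (n1 + 2*n2) n2 (g x)\<bar> \<le> (p+2) * ?M powr (p+1) * \<bar>(g x + t * k x) - g x\<bar>"
      by (rule odd_pow_lipschitz[OF n_pos(2) nn pn p(3)]) (use th in linarith)+
    also have "\<dots> \<le> (p+2) * (B powr p * ?M) * (\<bar>t\<bar> * \<bar>k x\<bar>)"
      using p(3) by (intro mult_mono mult_left_mono M) (auto simp: abs_mult)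
    also have "\<dots> = \<bar>t\<bar> * ((p+2) * B powr p * (?M * \<bar>k x\<bar>))" by (simp add: mult_ac)
    also have "\<dots> \<le> \<bar>t\<bar> * ((p+2) * B powr p * ((norm (g x))\<^sup>2 + 2 * (norm (k x))\<^sup>2))"
      unfolding real_norm_def using p(3) by (intro mult_left_mono mult_le_sum_squares) auto
    finally show "\<bar>odd_pow (n1 + 2*n2) n2 (g x + t * k x) - odd_pow (n1 + 2*n2) n2 (g x + 0 * k x)\<bar> \<le> \<bar>t\<bar> * w x" by (simp add: w_def)
  qed
qed

end

subsection \<open>Positivity, concavity and spreading profiles\<close>

lemma continuous_measurable_lborel:
  fixes f :: "real \<Rightarrow> 'a::euclidean_space"
  assumes "continuous_on UNIV f" shows "f \<in> borel_measurable lborel"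
  using borel_measurable_continuous_onI[OF assms] by simp

text \<open>An elementary strong maximum principle. With k^2 = |\<kappa>| the function (f' + k f)
  e^(-kx) is nonincreasing, and it starts from 0 since a zero of f \<ge> 0 is a minimum. Hence f'
  \<le> -k f \<le> 0 to the right of x0, and f cannot rise from 0.\<close>

lemma nonneg_zero_right:
  fixes f d D :: "real \<Rightarrow> real"
  assumes f: "\<And>x. (f has_real_derivative d x) (at x)" "\<And>x. (d has_real_derivative D x) (at x)"
    and nn: "\<And>x. 0 \<le> f x" and D: "\<And>x. D x \<le> \<kappa> * f x" and z: "f x0 = 0" and x: "x0 \<le> x"
  shows "f x = 0"
proof -
  define k where "k = sqrt \<bar>\<kappa>\<bar>"
  have k: "k \<ge> 0" "k * k = \<bar>\<kappa>\<bar>" by (auto simp: k_def)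
  have d0: "d x0 = 0"
    by (rule DERIV_local_min[OF f(1) zero_less_one]) (use nn z in auto)
  have Pd: "((\<lambda>x. (d x + k * f x) * exp (- k * x)) has_real_derivative (D x - k * k * f x) * exp (- k * x)) (at x)" for x
    by (rule derivative_eq_intros f refl)+ (simp add: algebra_simps)
  have neg: "d y + k * f y \<le> 0" if "x0 \<le> y" for y
  proof -
    have "(d y + k * f y) * exp (- k * y) \<le> (d x0 + k * f x0) * exp (- k * x0)"
    proof (rule DERIV_nonpos_imp_nonincreasing[OF that])
      fix t
      have "D t \<le> k * k * f t" unfolding k(2) using D[of t] mult_right_mono[OF abs_ge_self nn[of t], of \<kappa>] by linarith
      then show "\<exists>y. ((\<lambda>x. (d x + k * f x) * exp (- k * x)) has_real_derivative y) (at t) \<and> y \<le> 0"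
        using Pd[of t] by (intro exI conjI) (auto intro: mult_nonpos_nonneg)
    qed
    then show ?thesis using d0 z by (simp add: mult_le_0_iff)
  qed
  have "f x \<le> f x0"
  proof (rule DERIV_nonpos_imp_nonincreasing[OF x])
    fix t assume "x0 \<le> t"
    then have "d t \<le> 0" using neg[of t] nn[of t] k(1) mult_nonneg_nonneg[of k "f t"] by linarith
    then show "\<exists>y. (f has_real_derivative y) (at t) \<and> y \<le> 0" using f(1) by blast
  qed
  then show ?thesis using nn[of x] z by simp
qed

text \<open>A zero propagates to the right by \<open>nonneg_zero_right\<close> and to the left by
  reflection.\<close>

lemma nonneg_dichotomy:
  fixes f d D :: "real \<Rightarrow> real"
  assumes f: "\<And>x. (f has_real_derivative d x) (at x)" "\<And>x. (d has_real_derivative D x) (at x)"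
    and nn: "\<And>x. 0 \<le> f x" and D: "\<And>x. D x \<le> \<kappa> * f x"
  shows "(\<forall>x. f x = 0) \<or> (\<forall>x. 0 < f x)"
proof (rule ccontr)
  assume c: "\<not> ?thesis"
  then obtain x0 where "\<not> 0 < f x0" by blast
  then have z: "f x0 = 0" using nn[of x0] by simp
  have "f x = 0" for x
  proof (cases "x0 \<le> x")
    case True then show ?thesis by (rule nonneg_zero_right[OF f nn D z])
  next
    case False
    have m: "((\<lambda>x. f (-x)) has_real_derivative - d (-x)) (at x)" "((\<lambda>x. - d (-x)) has_real_derivative D (-x)) (at x)" for x
      using DERIV_mirror[THEN iffD1, OF f(1)] DERIV_minus[OF DERIV_mirror[THEN iffD1, OF f(2)]] by simp_all
    have "f (- (-x)) = 0"
      by (rule nonneg_zero_right[OF m, of \<kappa> "-x0"]) (use nn D z False in auto)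
    then show ?thesis by simp
  qed
  then show False using c by blast
qed

text \<open>A concave function lies below its tangents, so a nonzero slope would make it negative
  somewhere. It is therefore constant, and the constant is its limit 0.\<close>

lemma concave_vanishing:
  fixes f d D :: "real \<Rightarrow> real"
  assumes f: "\<And>x. (f has_real_derivative d x) (at x)" "\<And>x. (d has_real_derivative D x) (at x)"
    and nn: "\<And>x. 0 \<le> f x" and D: "\<And>x. D x \<le> 0" and lim: "(f \<longlongrightarrow> 0) at_infinity"
  shows "f x = 0"
proof -
  have dec: "d y \<le> d x" if "x \<le> y" for x y
    by (rule DERIV_nonpos_imp_nonincreasing[OF that]) (use f(2) D in blast)
  have tangent: "f y \<le> f x + d x * (y - x)" for x y
  proof -
    consider "x < y" | "y < x" | "x = y" by linarith
    then show ?thesis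
    proof cases
      case 1
      have "\<exists>z>x. z < y \<and> f y - f x = (y - x) * d z" by (rule MVT2[OF 1]) (rule f(1))
      then obtain z where z: "x < z" "f y - f x = (y - x) * d z" by blast
      have "(y - x) * d z \<le> (y - x) * d x" using dec[of x z] z 1 by (intro mult_left_mono) auto
      then show ?thesis using z(2) by (simp add: mult.commute)
    next
      case 2
      have "\<exists>z>y. z < x \<and> f x - f y = (x - y) * d z" by (rule MVT2[OF 2]) (rule f(1))
      then obtain z where z: "z < x" "f x - f y = (x - y) * d z" by blast
      have "(x - y) * d x \<le> (x - y) * d z" using dec[of z x] z 2 by (intro mult_left_mono) auto
      then show ?thesis using z(2) by (simp add: algebra_simps)
    qed simp
  qed
  have d0: "d x = 0" for x
  proof (rule ccontr)
    assume n: "d x \<noteq> 0"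
    \<comment> \<open>At this point the tangent at x takes the value -1.\<close>
    have "f (x - (f x + 1) / d x) \<le> f x + d x * (x - (f x + 1) / d x - x)" by (rule tangent)
    also have "\<dots> = -1" using n by simp
    finally show False using nn[of "x - (f x + 1) / d x"] by simp
  qed
  have "f y = f x" for y using tangent[of y x] tangent[of x y] by (simp add: d0)
  then have "f = (\<lambda>_. f x)" by auto
  then have "((\<lambda>_::real. f x) \<longlongrightarrow> 0) at_infinity" using lim by simp
  then show ?thesis by (rule tendsto_unique[OF trivial_limit_at_infinity tendsto_const])
qed

lemma integral_square_pos:
  fixes f :: "real \<Rightarrow> real"
  assumes f: "f \<in> L2" "\<And>x. 0 < f x"
  shows "0 < (LINT x|lborel. (f x)\<^sup>2)"
proof -
  have i: "integrable lborel (\<lambda>x. (f x)\<^sup>2)" using L2_integrable[OF f(1)] by simp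
  have "(LINT x|lborel. (f x)\<^sup>2) \<noteq> 0"
  proof
    assume "(LINT x|lborel. (f x)\<^sup>2) = 0"
    then have "AE x in lborel. (f x)\<^sup>2 = 0" using integral_nonneg_eq_0_iff_AE[OF i] by simp
    then have "AE x in (lborel::real measure). False" by eventually_elim (use f(2) in \<open>metis less_irrefl power_eq_0_iff\<close>)
    then show False by (simp add: eventually_False ae_filter_eq_bot_iff)
  qed
  moreover have "0 \<le> (LINT x|lborel. (f x)\<^sup>2)" by (rule Bochner_Integration.integral_nonneg) simp
  ultimately show ?thesis by linarith
qed

text \<open>The profile \<open>a \<phi>(\<epsilon> x)\<close> with \<open>a\<^sup>2 = R \<epsilon> / (M0 + 1)\<close> has mass at most \<open>R\<close>; as \<open>\<epsilon> \<rightarrow> 0\<close> its Dirichlet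
  energy is of order \<open>\<epsilon>\<^sup>2\<close> and its potential energy of order \<open>\<epsilon> powr (s/2)\<close>, which dominates since \<open>s < 4\<close>.\<close>

lemma spread_profile_exists:
  fixes s T R :: real
  assumes s: "0 < s" "s < 4" and T: "T > 0" and R: "R > 0"
  obtains h d :: "real \<Rightarrow> real" where "h \<in> L2" "d \<in> L2" "is_primitive h d" "\<And>x. 0 \<le> h x"
    "(LINT x|lborel. (h x)\<^sup>2) \<le> R"
    "(LINT x|lborel. (d x)\<^sup>2) - T * (LINT x|lborel. \<bar>h x\<bar> powr (s+2)) < 0"
proof -
  \<comment> \<open>This profile is at most 1 and dominates its own derivative, so that all
    integrals needed are controlled by the single integrable function \<phi>.\<close>
  define \<phi> :: "real \<Rightarrow> real" where "\<phi> x = 1 / (1 + x\<^sup>2)" for x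
  define \<psi> :: "real \<Rightarrow> real" where "\<psi> x = - 2 * x / (1 + x\<^sup>2)\<^sup>2" for x
  have one: "0 < 1 + x\<^sup>2" for x :: real by (simp add: add_pos_nonneg)
  have \<phi>0: "0 < \<phi> x" "\<phi> x \<le> 1" for x using one[of x] by (simp_all add: \<phi>_def)
  have \<phi>c: "continuous_on UNIV \<phi>" unfolding \<phi>_def[abs_def] using one by (intro continuous_intros) (auto simp: less_imp_neq[symmetric] dest: sym)
  have \<psi>c: "continuous_on UNIV \<psi>" unfolding \<psi>_def[abs_def] using one by (intro continuous_intros) (auto simp: less_imp_neq[symmetric] dest: sym)
  have \<psi>\<phi>: "\<bar>\<psi> x\<bar> \<le> \<phi> x" for x
  proof -
    have "0 \<le> (\<bar>x\<bar> - 1)\<^sup>2" by simp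
    then have "2 * \<bar>x\<bar> \<le> 1 + x\<^sup>2" by (simp add: power2_diff)
    then have "2 * \<bar>x\<bar> / (1 + x\<^sup>2)\<^sup>2 \<le> (1 + x\<^sup>2) / (1 + x\<^sup>2)\<^sup>2" by (intro divide_right_mono) auto
    also have "\<dots> = \<phi> x" using one[of x] by (simp add: \<phi>_def power2_eq_square[of "1 + x\<^sup>2"])
    finally show ?thesis by (simp add: \<psi>_def abs_mult abs_divide)
  qed
  have \<phi>i: "integrable lborel \<phi>"
  proof (rule Bochner_Integration.integrable_bound)
    show "integrable lborel (\<lambda>x::real. min 1 (\<bar>x\<bar> powr (-2)))" by (rule integrable_min_powr) simp
    show "\<phi> \<in> borel_measurable lborel" by (rule continuous_measurable_lborel[OF \<phi>c])
    show "AE x in lborel. norm (\<phi> x) \<le> norm (min 1 (\<bar>x\<bar> powr (-2)))"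
      using AE_lborel_singleton[of 0]
    proof eventually_elim
      case (elim x)
      have "\<bar>x\<bar> powr (-2) = 1 / x\<^sup>2" using elim by (simp add: powr_minus_divide)
      moreover have "\<phi> x \<le> 1 / x\<^sup>2" unfolding \<phi>_def using elim by (intro divide_left_mono) (auto intro!: mult_pos_pos one)
      ultimately show ?case using \<phi>0[of x] by simp
    qed
  qed
  have bi: "integrable lborel u" if "continuous_on UNIV u" "\<And>x. \<bar>u x\<bar> \<le> \<phi> x" for u
    by (rule Bochner_Integration.integrable_bound[OF \<phi>i])
       (use that \<phi>0 borel_measurable_continuous_onI[OF that(1)] in \<open>auto simp: less_imp_le\<close>)
  have sq: "\<bar>u\<bar> \<le> v \<Longrightarrow> v \<le> 1 \<Longrightarrow> u\<^sup>2 \<le> v" for u v :: real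
  proof -
    assume uv: "\<bar>u\<bar> \<le> v" "v \<le> 1"
    then have "0 \<le> v" by linarith
    then have "v\<^sup>2 \<le> v" using mult_left_le[OF uv(2)] by (simp add: power2_eq_square)
    moreover have "u\<^sup>2 \<le> v\<^sup>2" using power_mono[OF uv(1), of 2] by simp
    ultimately show ?thesis by linarith
  qed
  have i1: "integrable lborel (\<lambda>x. (\<phi> x)\<^sup>2)" "integrable lborel (\<lambda>x. (\<psi> x)\<^sup>2)"
    by (rule bi; use \<phi>c \<psi>c sq \<psi>\<phi> \<phi>0 in \<open>auto intro!: continuous_intros simp: less_imp_le\<close>)+
  have i2: "integrable lborel (\<lambda>x. \<phi> x powr (s+2))"
  proof (rule bi)
    show "continuous_on UNIV (\<lambda>x. \<phi> x powr (s+2))" using \<phi>0 s by (intro continuous_on_powr' \<phi>c continuous_intros) (auto simp: less_imp_le)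
    show "\<bar>\<phi> x powr (s+2)\<bar> \<le> \<phi> x" for x
      using powr_mono'[of 1 "s+2" "\<phi> x"] \<phi>0[of x] s by (simp add: abs_of_pos)
  qed
  define M0 where "M0 = (LINT x|lborel. (\<phi> x)\<^sup>2)"
  define D0 where "D0 = (LINT x|lborel. (\<psi> x)\<^sup>2)"
  define P0 where "P0 = (LINT x|lborel. \<phi> x powr (s+2))"
  have M0: "M0 \<ge> 0" unfolding M0_def by (rule Bochner_Integration.integral_nonneg) simp
  have P0: "P0 > 0"
  proof -
    have half: "(\<phi> x powr ((s+2)/2))\<^sup>2 = \<phi> x powr (s+2)" for x
      unfolding power2_eq_square powr_add[symmetric] field_sum_of_halves ..
    have "0 < (LINT x|lborel. (\<phi> x powr ((s+2)/2))\<^sup>2)"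
    proof (rule integral_square_pos)
      have "(\<lambda>x. (norm (\<phi> x powr ((s+2)/2)))\<^sup>2) = (\<lambda>x. \<phi> x powr (s+2))" by (simp add: half)
      moreover have c: "continuous_on UNIV (\<lambda>x. \<phi> x powr ((s+2)/2))"
        using \<phi>0 s by (intro continuous_on_powr' \<phi>c continuous_intros) (auto simp: less_imp_le)
      have "(\<lambda>x. \<phi> x powr ((s+2)/2)) \<in> borel_measurable lborel" by (rule continuous_measurable_lborel[OF c])
      ultimately show "(\<lambda>x. \<phi> x powr ((s+2)/2)) \<in> L2" unfolding L2_def mem_Collect_eq by (simp only: i2 simp_thms)
      show "0 < \<phi> x powr ((s+2)/2)" for x using \<phi>0(1)[of x] by simp
    qed
    then show ?thesis by (simp add: half P0_def)
  qed
  \<comment> \<open>Division by M0 + 1 needs only M0 \<ge> 0; the mass becomes q * M0, which is at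
    most R.\<close>
  define q where "q = R / (M0 + 1)"
  have q: "q > 0" using R M0 by (simp add: q_def)
  \<comment> \<open>After a common factor \<epsilon>^(s/2) has been taken out, the Dirichlet part
    keeps the positive power 2 - s/2 of \<epsilon> and loses against the constant potential
    part.\<close>
  have "((\<lambda>\<epsilon>. \<epsilon> powr (2 - s/2) * D0) \<longlongrightarrow> 0 powr (2 - s/2) * D0) (at_right 0)"
    using s by (intro tendsto_intros tendsto_powr') (auto simp: eventually_at_filter)
  then have "\<forall>\<^sub>F \<epsilon> in at_right 0. \<epsilon> powr (2 - s/2) * D0 < T * q powr (s/2) * P0"
    by (rule order_tendstoD) (use s T q P0 in simp)
  moreover have "\<forall>\<^sub>F \<epsilon> in at_right (0::real). 0 < \<epsilon>" by (simp add: eventually_at_filter)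
  ultimately have "\<forall>\<^sub>F \<epsilon> in at_right (0::real). 0 < \<epsilon> \<and> \<epsilon> powr (2 - s/2) * D0 < T * q powr (s/2) * P0"
    by eventually_elim simp
  then obtain \<epsilon> where \<epsilon>: "\<epsilon> > 0" "\<epsilon> powr (2 - s/2) * D0 < T * q powr (s/2) * P0"
    using eventually_happens'[of "at_right (0::real)"] trivial_limit_at_right_real by blast
  define a where "a = sqrt (q * \<epsilon>)"
  have a: "a > 0" "a\<^sup>2 = q * \<epsilon>" using q \<epsilon> by (auto simp: a_def)
  define h where "h x = a * \<phi> (\<epsilon> * x)" for x
  define d where "d x = a * \<epsilon> * \<psi> (\<epsilon> * x)" for x
  have scale: "integrable lborel (\<lambda>x. u (\<epsilon> * x))" "(LINT x|lborel. u (\<epsilon> * x)) = (LINT x|lborel. u x) / \<epsilon>"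
    if "integrable lborel u" for u :: "real \<Rightarrow> real"
    using lborel_integrable_real_affine[OF that, of \<epsilon> 0] lborel_integral_real_affine[of \<epsilon> u 0] \<epsilon>(1) by auto
  have h2: "(\<lambda>x. (h x)\<^sup>2) = (\<lambda>x. a\<^sup>2 * (\<phi> (\<epsilon> * x))\<^sup>2)" and d2: "(\<lambda>x. (d x)\<^sup>2) = (\<lambda>x. (a\<^sup>2 * \<epsilon>\<^sup>2) * (\<psi> (\<epsilon> * x))\<^sup>2)"
    by (auto simp: h_def d_def power_mult_distrib)
  have hp: "(\<lambda>x. \<bar>h x\<bar> powr (s+2)) = (\<lambda>x. a powr (s+2) * \<phi> (\<epsilon> * x) powr (s+2))"
    using a \<phi>0 by (auto simp: h_def abs_mult powr_mult abs_of_pos)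
  have hc: "continuous_on UNIV h" unfolding h_def[abs_def]
    by (intro continuous_intros continuous_on_compose2[OF \<phi>c]) auto
  have dc: "continuous_on UNIV d" unfolding d_def[abs_def]
    by (intro continuous_intros continuous_on_compose2[OF \<psi>c]) auto
  have hd: "(h has_real_derivative d x) (at x)" for x
  proof -
    have \<phi>d: "(\<phi> has_real_derivative \<psi> y) (at y)" for y
      unfolding \<phi>_def[abs_def] \<psi>_def using one[of y]
      by (auto intro!: derivative_eq_intros simp: power2_eq_square)
    show ?thesis unfolding h_def[abs_def] d_def
      by (rule derivative_eq_intros DERIV_chain2[OF \<phi>d] refl)+ simp
  qed
  show thesis
  proof (rule that[of h d])
    show "h \<in> L2" using borel_measurable_continuous_onI[OF hc] scale(1)[OF i1(1)] by (simp add: L2_def h2)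
    show "d \<in> L2" using borel_measurable_continuous_onI[OF dc] scale(1)[OF i1(2)] by (simp add: L2_def d2)
    show "is_primitive h d"
      by (rule C1_primitive[OF _ dc]) (use hd in \<open>simp add: has_real_derivative_iff_has_vector_derivative\<close>)
    show "0 \<le> h x" for x using a \<phi>0[of "\<epsilon> * x"] by (simp add: h_def)
    have "(LINT x|lborel. (h x)\<^sup>2) = a\<^sup>2 * (M0 / \<epsilon>)"
      unfolding h2 by (simp add: scale(2)[OF i1(1)] M0_def)
    also have "\<dots> = q * M0" using \<epsilon> by (simp add: a(2))
    also have "\<dots> \<le> q * (M0 + 1)" using q by (intro mult_left_mono) auto
    also have "\<dots> = R" using M0 by (simp add: q_def)
    finally show "(LINT x|lborel. (h x)\<^sup>2) \<le> R" .
    have e1: "(LINT x|lborel. (d x)\<^sup>2) = a\<^sup>2 * \<epsilon>\<^sup>2 * (D0 / \<epsilon>)"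
      unfolding d2 by (simp add: scale(2)[OF i1(2)] D0_def)
    have e2: "(LINT x|lborel. \<bar>h x\<bar> powr (s+2)) = a powr (s+2) * (P0 / \<epsilon>)"
      unfolding hp by (simp add: scale(2)[OF i2] P0_def)
    have ap: "a powr (s+2) = a\<^sup>2 * (q powr (s/2) * \<epsilon> powr (s/2))"
    proof -
      have "a powr (s+2) = a powr s * a\<^sup>2" using a by (simp add: powr_add)
      also have "a powr s = (a\<^sup>2) powr (s/2)" using power2_powr[OF a(1), of "s/2"] by simp
      also have "(a\<^sup>2) powr (s/2) = q powr (s/2) * \<epsilon> powr (s/2)" unfolding a(2) by (rule powr_mult)
      finally show ?thesis by simp
    qed
    have \<epsilon>p: "\<epsilon>\<^sup>2 = \<epsilon> powr (s/2) * \<epsilon> powr (2 - s/2)" using \<epsilon>(1) by (simp add: powr_add[symmetric])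
    have "(LINT x|lborel. (d x)\<^sup>2) - T * (LINT x|lborel. \<bar>h x\<bar> powr (s+2))
       = (a\<^sup>2 * \<epsilon> powr (s/2) / \<epsilon>) * (\<epsilon> powr (2 - s/2) * D0 - T * q powr (s/2) * P0)"
      unfolding e1 e2 ap \<epsilon>p by (simp add: algebra_simps add_divide_distrib diff_divide_distrib)
    also have "\<dots> < 0" using \<epsilon> a q by (intro mult_pos_neg divide_pos_pos mult_pos_pos) auto
    finally show "(LINT x|lborel. (d x)\<^sup>2) - T * (LINT x|lborel. \<bar>h x\<bar> powr (s+2)) < 0" .
  qed
qed

text \<open>For scaling a component by 1 + t: the energy decreases to first order, and a slack
  constraint leaves room for the mass to grow by the factor (1 + t)^2.\<close>

lemma negative_slope_step:
  fixes F :: "real \<Rightarrow> real"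
  assumes F: "(F has_real_derivative L) (at 0)" "L < 0" and I: "I < R"
  obtains t where "t > 0" "F t < F 0" "(1 + t)\<^sup>2 * I \<le> R"
proof -
  obtain e where e: "e > 0" "\<And>h. 0 < h \<Longrightarrow> h < e \<Longrightarrow> F (0 + h) < F 0" using DERIV_neg_dec_right[OF F] by blast
  have "((\<lambda>t. (1 + t)\<^sup>2 * I) \<longlongrightarrow> (1 + 0)\<^sup>2 * I) (at_right 0)" by (intro tendsto_intros)
  then have "\<forall>\<^sub>F t in at_right 0. (1 + t)\<^sup>2 * I < R" by (rule order_tendstoD) (use I in simp)
  moreover have "\<forall>\<^sub>F t in at_right 0. 0 < t \<and> t < e" using e(1) by (auto simp: eventually_at_right)
  ultimately have "\<forall>\<^sub>F t in at_right 0. (1 + t)\<^sup>2 * I < R \<and> 0 < t \<and> t < e" by eventually_elim simp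
  then obtain t where t: "(1 + t)\<^sup>2 * I < R" "0 < t" "t < e"
    using eventually_happens'[of "at_right (0::real)"] trivial_limit_at_right_real by blast
  show thesis by (rule that[of t]) (use t e(2)[of t] in auto)
qed

section \<open>First variation at a positive solution\<close>

context nls_parameters begin

lemma stationaryD:
  assumes "stationary \<sigma>1 \<sigma>2 c f1 f2 g d1 d2 dg"
  shows "\<And>x. (f1 has_real_derivative d1 x) (at x)" "\<And>x. (f2 has_real_derivative d2 x) (at x)" "\<And>x. (g has_real_derivative dg x) (at x)"
    "\<And>x. (d1 has_real_derivative \<sigma>1 * f1 x - \<gamma>1 * \<bar>f1 x\<bar> powr q1 * f1 x - \<alpha>1 * f1 x * g x) (at x)"
    "\<And>x. (d2 has_real_derivative \<sigma>2 * f2 x - \<gamma>2 * \<bar>f2 x\<bar> powr q2 * f2 x - \<alpha>2 * f2 x * g x) (at x)"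
    "\<And>x. (dg has_real_derivative c * g x - \<beta> / (p+1) * \<bar>g x\<bar> powr p * g x - \<alpha>1 / 2 * (f1 x)\<^sup>2 - \<alpha>2 / 2 * (f2 x)\<^sup>2) (at x)"
    "f1 \<in> L2" "f2 \<in> L2" "g \<in> L2" "d1 \<in> L2" "d2 \<in> L2" "dg \<in> L2"
    "is_primitive f1 d1" "is_primitive f2 d2" "is_primitive g dg"
proof -
  show 1: "\<And>x. (f1 has_real_derivative d1 x) (at x)" "\<And>x. (f2 has_real_derivative d2 x) (at x)" "\<And>x. (g has_real_derivative dg x) (at x)"
    "\<And>x. (d1 has_real_derivative \<sigma>1 * f1 x - \<gamma>1 * \<bar>f1 x\<bar> powr q1 * f1 x - \<alpha>1 * f1 x * g x) (at x)"
    "\<And>x. (d2 has_real_derivative \<sigma>2 * f2 x - \<gamma>2 * \<bar>f2 x\<bar> powr q2 * f2 x - \<alpha>2 * f2 x * g x) (at x)"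
    "\<And>x. (dg has_real_derivative c * g x - \<beta> / (p+1) * \<bar>g x\<bar> powr p * g x - \<alpha>1 / 2 * (f1 x)\<^sup>2 - \<alpha>2 / 2 * (f2 x)\<^sup>2) (at x)"
    "f1 \<in> L2" "f2 \<in> L2" "g \<in> L2" "d1 \<in> L2" "d2 \<in> L2" "dg \<in> L2"
    using assms unfolding stationary_def by blast+
  have pr: "is_primitive f d" if "\<And>x. (f has_real_derivative d x) (at x)" "\<And>x. (d has_real_derivative D x) (at x)" for f d D :: "real \<Rightarrow> real"
  proof (rule C1_primitive)
    show "(f has_vector_derivative d x) (at x)" for x using that(1) by (simp add: has_real_derivative_iff_has_vector_derivative)
    show "continuous_on UNIV d" using that(2) by (intro continuous_at_imp_continuous_on ballI DERIV_isCont)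
  qed
  show "is_primitive f1 d1" "is_primitive f2 d2" "is_primitive g dg"
    by (rule pr[OF 1(1,4)], rule pr[OF 1(2,5)], rule pr[OF 1(3,6)])
qed

lemma energy_scaleR:
  fixes f1 f2 g d1 d2 dg :: "real \<Rightarrow> real"
  assumes 1: "f1 \<in> L2" "d1 \<in> L2" "is_primitive f1 d1" and 2: "f2 \<in> L2" "d2 \<in> L2" "is_primitive f2 d2"
    and 3: "g \<in> L2" "dg \<in> L2" "is_primitive g dg"
  shows "E (\<lambda>x. f1 x *\<^sub>R 1) (\<lambda>x. f2 x *\<^sub>R 1) g =
      (LINT x|lborel. (d1 x)\<^sup>2) - \<tau>1 * (LINT x|lborel. \<bar>f1 x\<bar> powr (q1+2)) - \<alpha>1 * (LINT x|lborel. (f1 x)\<^sup>2 * g x)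
     + ((LINT x|lborel. (d2 x)\<^sup>2) - \<tau>2 * (LINT x|lborel. \<bar>f2 x\<bar> powr (q2+2)) - \<alpha>2 * (LINT x|lborel. (f2 x)\<^sup>2 * g x))
     + (LINT x|lborel. (dg x)\<^sup>2) - \<tau> * (LINT x|lborel. odd_pow (n1 + 2*n2) n2 (g x))"
proof -
  have D: "(LINT x|lborel. (cmod (weak_deriv (\<lambda>x. f x *\<^sub>R (1::complex)) x))\<^sup>2) = (LINT x|lborel. (d x)\<^sup>2)"
    if f: "f \<in> L2" "d \<in> L2" "is_primitive f d" for f d
  proof -
    have "(LINT x|lborel. (cmod (weak_deriv (\<lambda>x. f x *\<^sub>R (1::complex)) x))\<^sup>2) = (LINT x|lborel. (norm (d x))\<^sup>2)"
    proof (rule H1_dirichlet_cong[OF H1_scaleR(1)[OF f] L2_measurable[OF f(2)]])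
      show "AE x in lborel. cmod (weak_deriv (\<lambda>x. f x *\<^sub>R (1::complex)) x) = norm (d x)"
        using H1_scaleR(2)[OF f, of "1::complex"] by eventually_elim simp
    qed
    then show ?thesis by simp
  qed
  have G: "(LINT x|lborel. (norm (weak_deriv g x))\<^sup>2) = (LINT x|lborel. (dg x)\<^sup>2)"
  proof -
    have "(LINT x|lborel. (norm (weak_deriv g x))\<^sup>2) = (LINT x|lborel. (norm (dg x))\<^sup>2)"
    proof (rule H1_dirichlet_cong[OF H1I(1)[OF 3] L2_measurable[OF 3(2)]])
      show "AE x in lborel. norm (weak_deriv g x) = norm (dg x)" using H1I(2)[OF 3] by eventually_elim simp
    qed
    then show ?thesis by simp
  qed
  show ?thesis unfolding energy_eq[OF H1_scaleR(1)[OF 1] H1_scaleR(1)[OF 2] H1I(1)[OF 3]] D[OF 1] D[OF 2] G by simp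
qed

text \<open>Weak form of the equation for one component: integrate by parts and insert the equation
  for the second derivative. As f is real, only the real part h \<bullet> 1 of the direction
  enters.\<close>

lemma component_first_variation:
  fixes f d g :: "real \<Rightarrow> real" and h :: "real \<Rightarrow> complex"
  assumes d: "\<And>x. (f has_real_derivative d x) (at x)"
    "\<And>x. (d has_real_derivative \<sigma> * f x - \<gamma> * \<bar>f x\<bar> powr q * f x - \<alpha> * f x * g x) (at x)"
    and L: "f \<in> L2" "d \<in> L2" "is_primitive f d" and pos: "\<And>x. 0 < f x" and g: "g \<in> H1" and h: "h \<in> H1" and q: "q > 0"
  shows "(LINT x|lborel. weak_deriv (\<lambda>x. f x *\<^sub>R 1) x \<bullet> weak_deriv h x) =
      - \<sigma> * (LINT x|lborel. f x * (h x \<bullet> 1)) + \<gamma> * (LINT x|lborel. f x powr (q+1) * (h x \<bullet> 1)) + \<alpha> * (LINT x|lborel. f x * (h x \<bullet> 1) * g x)"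
proof -
  have fH: "f \<in> H1" by (rule H1I(1)[OF L])
  obtain B1 where B1: "\<And>x. norm (f x) \<le> B1" using H1_bounded[OF fH] by blast
  obtain B2 where B2: "\<And>x. norm (g x) \<le> B2" using H1_bounded[OF g] by blast
  have fc: "continuous_on UNIV f" and gc: "continuous_on UNIV g" using H1_continuous[OF fH] H1_continuous[OF g] .
  have fp: "(\<lambda>x. f x powr (q+1)) \<in> L2"
  proof -
    have c: "continuous_on UNIV (\<lambda>x. f x powr q)" using pos q by (intro continuous_on_powr' fc continuous_intros) (auto simp: less_imp_le)
    have "(\<lambda>x. f x powr q * f x) \<in> L2"
    proof (rule L2_bounded_mult[OF L(1)])
      show "(\<lambda>x. f x powr q) \<in> borel_measurable lborel" by (rule continuous_measurable_lborel[OF c])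
      show "\<bar>f x powr q\<bar> \<le> B1 powr q" for x using B1[of x] pos[of x] q by (simp add: powr_mono2)
    qed
    moreover have "f x powr (q+1) = f x powr q * f x" for x using pos[of x] by (simp add: powr_add)
    ultimately show ?thesis by simp
  qed
  have fg: "(\<lambda>x. g x * f x) \<in> L2"
    by (rule L2_bounded_mult[OF L(1) L2_measurable[OF H1_L2[OF g]], of B2]) (use B2 in simp)
  have hl: "(\<lambda>x. h x \<bullet> 1) \<in> L2" by (rule L2_inner_const[OF H1_L2[OF h]])
  define D where "D x = \<sigma> * f x + (- \<gamma>) * f x powr (q+1) + (- \<alpha>) * (g x * f x)" for x
  have dD: "(d has_real_derivative D x) (at x)" for x
  proof -
    have "\<sigma> * f x - \<gamma> * \<bar>f x\<bar> powr q * f x - \<alpha> * f x * g x = D x" using pos[of x] by (simp add: D_def powr_add)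
    then show ?thesis using d(2)[of x] by simp
  qed
  have Dc: "continuous_on UNIV D" unfolding D_def[abs_def]
    using pos q by (intro continuous_on_add continuous_on_mult continuous_on_const fc gc continuous_on_powr') (auto simp: less_imp_le)
  have sm: "(\<lambda>x. k * u x) \<in> L2" if "u \<in> L2" for k and u :: "real \<Rightarrow> real"
    by (rule L2_bounded_mult[OF that, of "\<lambda>_. k" "\<bar>k\<bar>"]) auto
  have DL: "D \<in> L2"
    using L2_add_scaleR(1)[OF L2_add_scaleR(1)[OF sm[OF L(1), of \<sigma>] fp, of "-\<gamma>"] fg, of "-\<alpha>"] by (simp add: D_def[abs_def])
  have i: "integrable lborel (\<lambda>x. f x * (h x \<bullet> 1))" "integrable lborel (\<lambda>x. f x powr (q+1) * (h x \<bullet> 1))" "integrable lborel (\<lambda>x. (g x * f x) * (h x \<bullet> 1))"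
    using L2_inner_integrable[OF L(1) hl] L2_inner_integrable[OF fp hl] L2_inner_integrable[OF fg hl] by simp_all
  have "(LINT x|lborel. weak_deriv (\<lambda>x. f x *\<^sub>R 1) x \<bullet> weak_deriv h x) = (LINT x|lborel. d x * (weak_deriv h x \<bullet> 1))"
  proof (rule integral_cong_AE)
    show "(\<lambda>x. weak_deriv (\<lambda>x. f x *\<^sub>R 1) x \<bullet> weak_deriv h x) \<in> borel_measurable lborel"
      using L2_measurable[OF H1_weak_deriv(1)[OF H1_scaleR(1)[OF L, of "1::complex"]]] L2_measurable[OF H1_weak_deriv(1)[OF h]] by measurable
    show "(\<lambda>x. d x * (weak_deriv h x \<bullet> 1)) \<in> borel_measurable lborel"
      using L2_measurable[OF L(2)] L2_measurable[OF H1_weak_deriv(1)[OF h]] by measurable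
    show "AE x in lborel. weak_deriv (\<lambda>x. f x *\<^sub>R 1) x \<bullet> weak_deriv h x = d x * (weak_deriv h x \<bullet> 1)"
      using H1_scaleR(2)[OF L, of "1::complex"] by eventually_elim (simp add: inner_commute)
  qed
  also have "\<dots> = - (LINT x|lborel. D x * (h x \<bullet> 1))" by (rule H1_by_parts[OF h dD Dc L(2) DL])
  also have "(\<lambda>x. D x * (h x \<bullet> 1)) = (\<lambda>x. \<sigma> * (f x * (h x \<bullet> 1)) + (- \<gamma>) * (f x powr (q+1) * (h x \<bullet> 1)) + (- \<alpha>) * ((g x * f x) * (h x \<bullet> 1)))"
    by (simp add: D_def algebra_simps)
  also have "(LINT x|lborel. \<sigma> * (f x * (h x \<bullet> 1)) + (- \<gamma>) * (f x powr (q+1) * (h x \<bullet> 1)) + (- \<alpha>) * ((g x * f x) * (h x \<bullet> 1)))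
     = \<sigma> * (LINT x|lborel. f x * (h x \<bullet> 1)) + (- \<gamma>) * (LINT x|lborel. f x powr (q+1) * (h x \<bullet> 1)) + (- \<alpha>) * (LINT x|lborel. (g x * f x) * (h x \<bullet> 1))"
    using i by simp
  also have "(\<lambda>x. (g x * f x) * (h x \<bullet> 1)) = (\<lambda>x. f x * (h x \<bullet> 1) * g x)" by (simp add: mult_ac)
  finally show ?thesis by simp
qed

text \<open>The equations cancel all nonlinear contributions, and the multiplier terms remain. This
  one formula yields the multiplier property and also the proof that the masses are
  attained.\<close>

lemma first_variation:
  assumes st: "stationary \<sigma>1 \<sigma>2 c f1 f2 g d1 d2 dg"
    and pf: "\<And>x. 0 < f1 x" "\<And>x. 0 < f2 x" "\<And>x. 0 < g x"
    and H: "h1 \<in> H1" "h2 \<in> H1" "k \<in> H1"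
  shows "((\<lambda>t. E (\<lambda>x. f1 x *\<^sub>R 1 + t *\<^sub>R h1 x) (\<lambda>x. f2 x *\<^sub>R 1 + t *\<^sub>R h2 x) (\<lambda>x. g x + t * k x)) has_real_derivative
     - 2 * \<sigma>1 * (LINT x|lborel. f1 x * (h1 x \<bullet> 1)) - 2 * \<sigma>2 * (LINT x|lborel. f2 x * (h2 x \<bullet> 1)) - 2 * c * (LINT x|lborel. g x * k x)) (at 0)"
proof -
  note S = stationaryD[OF st]
  note \<phi>1 = H1_scaleR(1)[OF S(7,10,13), of "1::complex"] and \<phi>2 = H1_scaleR(1)[OF S(8,11,14), of "1::complex"]
  have gH: "g \<in> H1" by (rule H1I(1)[OF S(9,12,15)])
  have f1H: "f1 \<in> H1" "f2 \<in> H1" by (rule H1I(1)[OF S(7,10,13)], rule H1I(1)[OF S(8,11,14)])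
  have kk: "(\<lambda>x. g x + t * k x) \<in> H1" for t using H1_add_scaleR(1)[OF gH H(3), of t] by simp
  let ?I1 = "LINT x|lborel. f1 x * (h1 x \<bullet> 1)" and ?I2 = "LINT x|lborel. f2 x * (h2 x \<bullet> 1)" and ?Ig = "LINT x|lborel. g x * k x"
  let ?P1 = "LINT x|lborel. f1 x powr (q1+1) * (h1 x \<bullet> 1)" and ?P2 = "LINT x|lborel. f2 x powr (q2+1) * (h2 x \<bullet> 1)" and ?Pg = "LINT x|lborel. g x powr (p+1) * k x"
  let ?C1 = "LINT x|lborel. f1 x * (h1 x \<bullet> 1) * g x" and ?C2 = "LINT x|lborel. f2 x * (h2 x \<bullet> 1) * g x"
  let ?Q1 = "LINT x|lborel. (f1 x)\<^sup>2 * k x" and ?Q2 = "LINT x|lborel. (f2 x)\<^sup>2 * k x"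
  have v1: "(LINT x|lborel. weak_deriv (\<lambda>x. f1 x *\<^sub>R 1) x \<bullet> weak_deriv h1 x) = - \<sigma>1 * ?I1 + \<gamma>1 * ?P1 + \<alpha>1 * ?C1"
    by (rule component_first_variation[OF S(1,4,7,10,13) pf(1) gH H(1) q(1)])
  have v2: "(LINT x|lborel. weak_deriv (\<lambda>x. f2 x *\<^sub>R 1) x \<bullet> weak_deriv h2 x) = - \<sigma>2 * ?I2 + \<gamma>2 * ?P2 + \<alpha>2 * ?C2"
    by (rule component_first_variation[OF S(2,5,8,11,14) pf(2) gH H(2) q(3)])
  obtain B1 where B1: "\<And>x. norm (f1 x) \<le> B1" using H1_bounded[OF f1H(1)] by blast
  obtain B2 where B2: "\<And>x. norm (f2 x) \<le> B2" using H1_bounded[OF f1H(2)] by blast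
  obtain Bg where Bg: "\<And>x. norm (g x) \<le> Bg" using H1_bounded[OF gH] by blast
  obtain Bk where Bk: "\<And>x. norm (k x) \<le> Bk" using H1_bounded[OF H(3)] by blast
  have sqL: "(\<lambda>x. (f1 x)\<^sup>2) \<in> L2" "(\<lambda>x. (f2 x)\<^sup>2) \<in> L2"
    using L2_bounded_mult[OF S(7) L2_measurable[OF S(7)], of B1] L2_bounded_mult[OF S(8) L2_measurable[OF S(8)], of B2] B1 B2
    by (simp_all add: power2_eq_square)
  have cont: "continuous_on UNIV f1" "continuous_on UNIV f2" "continuous_on UNIV g"
    using H1_continuous[OF f1H(1)] H1_continuous[OF f1H(2)] H1_continuous[OF gH] .
  have gp: "(\<lambda>x. g x powr (p+1)) \<in> L2"
  proof -
    have c: "continuous_on UNIV (\<lambda>x. g x powr p)" using pf p(3) by (intro continuous_on_powr' cont continuous_intros) (auto simp: less_imp_le)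
    have "(\<lambda>x. g x powr p * g x) \<in> L2"
    proof (rule L2_bounded_mult[OF S(9)])
      show "(\<lambda>x. g x powr p) \<in> borel_measurable lborel" by (rule continuous_measurable_lborel[OF c])
      show "\<bar>g x powr p\<bar> \<le> Bg powr p" for x using Bg[of x] pf(3)[of x] p(3) by (simp add: powr_mono2)
    qed
    moreover have "g x powr (p+1) = g x powr p * g x" for x using pf(3)[of x] by (simp add: powr_add)
    ultimately show ?thesis by simp
  qed
  have vg: "(LINT x|lborel. weak_deriv g x \<bullet> weak_deriv k x) = - c * ?Ig + \<beta> / (p+1) * ?Pg + \<alpha>1 / 2 * ?Q1 + \<alpha>2 / 2 * ?Q2"
  proof -
    define D where "D x = c * g x + (- (\<beta> / (p+1))) * g x powr (p+1) + (- (\<alpha>1 / 2)) * (f1 x)\<^sup>2 + (- (\<alpha>2 / 2)) * (f2 x)\<^sup>2" for x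
    have dD: "(dg has_real_derivative D x) (at x)" for x
    proof -
      have "c * g x - \<beta> / (p+1) * \<bar>g x\<bar> powr p * g x - \<alpha>1 / 2 * (f1 x)\<^sup>2 - \<alpha>2 / 2 * (f2 x)\<^sup>2 = D x"
        using pf(3)[of x] by (simp add: D_def powr_add)
      then show ?thesis using S(6)[of x] by simp
    qed
    have Dc: "continuous_on UNIV D" unfolding D_def[abs_def]
      using pf p(3) by (intro continuous_on_add continuous_on_mult continuous_on_const cont continuous_on_powr' continuous_on_power) (auto simp: less_imp_le)
    have sm: "(\<lambda>x. t * u x) \<in> L2" if "u \<in> L2" for t and u :: "real \<Rightarrow> real"
      by (rule L2_bounded_mult[OF that, of "\<lambda>_. t" "\<bar>t\<bar>"]) auto
    have DL: "D \<in> L2"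
      using L2_add_scaleR(1)[OF L2_add_scaleR(1)[OF L2_add_scaleR(1)[OF sm[OF S(9), of c] gp, of "-(\<beta>/(p+1))"] sqL(1), of "-(\<alpha>1/2)"] sqL(2), of "-(\<alpha>2/2)"]
      by (simp add: D_def[abs_def])
    note kL = H1_L2[OF H(3)]
    have i: "integrable lborel (\<lambda>x. g x * k x)" "integrable lborel (\<lambda>x. g x powr (p+1) * k x)" "integrable lborel (\<lambda>x. (f1 x)\<^sup>2 * k x)" "integrable lborel (\<lambda>x. (f2 x)\<^sup>2 * k x)"
      using L2_inner_integrable[OF S(9) kL] L2_inner_integrable[OF gp kL] L2_inner_integrable[OF sqL(1) kL] L2_inner_integrable[OF sqL(2) kL] by simp_all
    have "(LINT x|lborel. weak_deriv g x \<bullet> weak_deriv k x) = (LINT x|lborel. dg x * (weak_deriv k x \<bullet> 1))"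
    proof (rule integral_cong_AE)
      show "(\<lambda>x. weak_deriv g x \<bullet> weak_deriv k x) \<in> borel_measurable lborel"
        using L2_measurable[OF H1_weak_deriv(1)[OF gH]] L2_measurable[OF H1_weak_deriv(1)[OF H(3)]] by measurable
      show "(\<lambda>x. dg x * (weak_deriv k x \<bullet> 1)) \<in> borel_measurable lborel"
        using L2_measurable[OF S(12)] L2_measurable[OF H1_weak_deriv(1)[OF H(3)]] by measurable
      show "AE x in lborel. weak_deriv g x \<bullet> weak_deriv k x = dg x * (weak_deriv k x \<bullet> 1)"
        using H1I(2)[OF S(9,12,15)] by eventually_elim simp
    qed
    also have "\<dots> = - (LINT x|lborel. D x * (k x \<bullet> 1))" by (rule H1_by_parts[OF H(3) dD Dc S(12) DL])
    also have "(\<lambda>x. D x * (k x \<bullet> 1)) = (\<lambda>x. c * (g x * k x) + (- (\<beta> / (p+1))) * (g x powr (p+1) * k x) + (- (\<alpha>1 / 2)) * ((f1 x)\<^sup>2 * k x) + (- (\<alpha>2 / 2)) * ((f2 x)\<^sup>2 * k x))"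
      by (simp add: D_def fun_eq_iff distrib_right left_diff_distrib mult.assoc)
    also have "(LINT x|lborel. c * (g x * k x) + (- (\<beta> / (p+1))) * (g x powr (p+1) * k x) + (- (\<alpha>1 / 2)) * ((f1 x)\<^sup>2 * k x) + (- (\<alpha>2 / 2)) * ((f2 x)\<^sup>2 * k x))
      = c * ?Ig + (- (\<beta> / (p+1))) * ?Pg + (- (\<alpha>1 / 2)) * ?Q1 + (- (\<alpha>2 / 2)) * ?Q2"
      using i by simp
    finally show ?thesis by simp
  qed
  have D1: "((\<lambda>t. LINT x|lborel. (cmod (weak_deriv (\<lambda>x. f1 x *\<^sub>R 1 + t *\<^sub>R h1 x) x))\<^sup>2) has_real_derivative 2 * (- \<sigma>1 * ?I1 + \<gamma>1 * ?P1 + \<alpha>1 * ?C1)) (at 0)"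
    using dirichlet_derivative(1)[OF \<phi>1 H(1)] unfolding v1 .
  have D2: "((\<lambda>t. LINT x|lborel. (cmod (weak_deriv (\<lambda>x. f2 x *\<^sub>R 1 + t *\<^sub>R h2 x) x))\<^sup>2) has_real_derivative 2 * (- \<sigma>2 * ?I2 + \<gamma>2 * ?P2 + \<alpha>2 * ?C2)) (at 0)"
    using dirichlet_derivative(1)[OF \<phi>2 H(2)] unfolding v2 .
  have Dg: "((\<lambda>t. LINT x|lborel. (norm (weak_deriv (\<lambda>x. g x + t * k x) x))\<^sup>2) has_real_derivative
      2 * (- c * ?Ig + \<beta> / (p+1) * ?Pg + \<alpha>1 / 2 * ?Q1 + \<alpha>2 / 2 * ?Q2)) (at 0)"
    using dirichlet_derivative(1)[OF gH H(3)] unfolding vg real_scaleR_def .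
  have R1: "((\<lambda>t. LINT x|lborel. cmod (f1 x *\<^sub>R 1 + t *\<^sub>R h1 x) powr (q1+2)) has_real_derivative (q1+2) * ?P1) (at 0)"
    using powr_integral_derivative[OF \<phi>1 pf(1) _ H(1) q(1)] by simp
  have R2: "((\<lambda>t. LINT x|lborel. cmod (f2 x *\<^sub>R 1 + t *\<^sub>R h2 x) powr (q2+2)) has_real_derivative (q2+2) * ?P2) (at 0)"
    using powr_integral_derivative[OF \<phi>2 pf(2) _ H(2) q(3)] by simp
  have Rg: "((\<lambda>t. LINT x|lborel. odd_pow (n1 + 2*n2) n2 (g x + t * k x)) has_real_derivative (p+2) * ?Pg) (at 0)"
    using odd_pow_integral_derivative[OF gH pf(3) H(3)] by simp
  have cpl: "((\<lambda>t. LINT x|lborel. (cmod (f x *\<^sub>R 1 + t *\<^sub>R h x))\<^sup>2 * (g x + t * k x)) has_real_derivative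
      2 * (LINT x|lborel. f x * (h x \<bullet> 1) * g x) + (LINT x|lborel. (f x)\<^sup>2 * k x)) (at 0)"
    if f: "(\<lambda>x. f x *\<^sub>R (1::complex)) \<in> H1" "f \<in> L2" and h: "h \<in> H1" for f :: "real \<Rightarrow> real" and h
  proof -
    have fg: "(\<lambda>x. g x * f x) \<in> L2"
      by (rule L2_bounded_mult[OF f(2) L2_measurable[OF S(9)], of Bg]) (use Bg in simp)
    have i1: "integrable lborel (\<lambda>x. f x * (h x \<bullet> 1) * g x)"
      using L2_inner_integrable[OF fg L2_inner_const[OF H1_L2[OF h], of 1]] by (simp add: mult_ac)
    have i2: "integrable lborel (\<lambda>x. (f x)\<^sup>2 * k x)"
      using H1_coupling(1)[OF f(1) H(3)] by simp
    have "(LINT x|lborel. 2 * (((f x *\<^sub>R 1) \<bullet> h x) * g x) + (cmod (f x *\<^sub>R 1))\<^sup>2 * k x)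
       = (LINT x|lborel. 2 * (f x * (h x \<bullet> 1) * g x) + (f x)\<^sup>2 * k x)"
      by (simp add: inner_commute)
    also have "\<dots> = 2 * (LINT x|lborel. f x * (h x \<bullet> 1) * g x) + (LINT x|lborel. (f x)\<^sup>2 * k x)" using i1 i2 by simp
    finally show ?thesis using coupling_integral_derivative[OF f(1) h gH H(3)] by simp
  qed
  have t: "\<tau>1 * (q1+2) = 2 * \<gamma>1" "\<tau>2 * (q2+2) = 2 * \<gamma>2" using q by (simp_all add: \<tau>1_def \<tau>2_def)
  have tg: "\<tau> * (p+2) = 2 * (\<beta> / (p+1))"
  proof -
    have "2 * \<beta> / (P * Q) * Q = 2 * (\<beta> / P)" if "Q \<noteq> 0" for P Q :: real using that by simp
    from this[of "p+2" "p+1"] show ?thesis using p(3) by (simp add: \<tau>_def)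
  qed
  \<comment> \<open>The powers cancel by \<tau>1 (q1+2) = 2 \<gamma>1 and its analogues. Of the
    coupling, the part with \<open>?C1\<close> cancels against the first equation and the part with
    \<open>?Q1\<close> against the third, whose coefficient \<alpha>1/2 is doubled by the quadratic
    derivative term.\<close>
  have "((\<lambda>t. E (\<lambda>x. f1 x *\<^sub>R 1 + t *\<^sub>R h1 x) (\<lambda>x. f2 x *\<^sub>R 1 + t *\<^sub>R h2 x) (\<lambda>x. g x + t * k x)) has_real_derivative
      2 * (- \<sigma>1 * ?I1 + \<gamma>1 * ?P1 + \<alpha>1 * ?C1) - \<tau>1 * ((q1+2) * ?P1) - \<alpha>1 * (2 * ?C1 + ?Q1)
      + (2 * (- \<sigma>2 * ?I2 + \<gamma>2 * ?P2 + \<alpha>2 * ?C2) - \<tau>2 * ((q2+2) * ?P2) - \<alpha>2 * (2 * ?C2 + ?Q2))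
      + 2 * (- c * ?Ig + \<beta> / (p+1) * ?Pg + \<alpha>1 / 2 * ?Q1 + \<alpha>2 / 2 * ?Q2) - \<tau> * ((p+2) * ?Pg)) (at 0)"
    unfolding energy_eq[OF H1_add_scaleR(1)[OF \<phi>1 H(1)] H1_add_scaleR(1)[OF \<phi>2 H(2)] kk]
    by (intro DERIV_add DERIV_diff DERIV_cmult D1 D2 Dg R1 R2 Rg cpl[OF \<phi>1 S(7) H(1)] cpl[OF \<phi>2 S(8) H(2)])
  moreover have "\<tau>1 * ((q1+2) * ?P1) = 2 * \<gamma>1 * ?P1" "\<tau>2 * ((q2+2) * ?P2) = 2 * \<gamma>2 * ?P2" "\<tau> * ((p+2) * ?Pg) = 2 * (\<beta> / (p+1)) * ?Pg"
    by (simp_all only: mult.assoc[symmetric] t tg)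
  ultimately show ?thesis by (rule_tac DERIV_cong) (assumption, simp add: algebra_simps)
qed

end

subsection \<open>The minimiser\<close>

lemma zero_L2: "(\<lambda>_. 0) \<in> L2"
  by (simp add: L2_def)

lemma zero_H1: "(\<lambda>_. 0) \<in> H1"
  by (rule H1I(1)[OF zero_L2 zero_L2]) (simp add: is_primitive_def)

lemma L2_norm_square: "(L2_norm f)\<^sup>2 = (LINT x|lborel. (norm (f x))\<^sup>2)"
  unfolding L2_norm_def by (rule real_sqrt_pow2, rule Bochner_Integration.integral_nonneg) simp

context nls_parameters begin

text \<open>Stated for a unit vector of any Euclidean space, so that it serves the complex functions
  and the real profiles alike.\<close>

lemma nls_system_scaleR:
  fixes e :: "'a::euclidean_space"
  assumes st: "stationary \<sigma>1 \<sigma>2 c f1 f2 g d1 d2 dg" and e: "norm e = 1"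
    and nn: "\<And>x. 0 \<le> f1 x" "\<And>x. 0 \<le> f2 x" "\<And>x. 0 \<le> g x"
  shows "nls_system \<gamma>1 \<gamma>2 \<beta> \<alpha>1 \<alpha>2 q1 q2 n1 n2 \<sigma>1 \<sigma>2 c (\<lambda>x. f1 x *\<^sub>R e) (\<lambda>x. f2 x *\<^sub>R e) g"
proof -
  note S = stationaryD[OF st]
  have sd: "has_second_deriv (\<lambda>x. f x *\<^sub>R e) (\<lambda>x. D x *\<^sub>R e)"
    if "\<And>x. (f has_real_derivative d x) (at x)" "\<And>x. (d has_real_derivative D x) (at x)" for f d D
    unfolding has_second_deriv_def using that
    by (intro exI[of _ "\<lambda>x. d x *\<^sub>R e"] allI conjI bounded_linear.has_vector_derivative[OF bounded_linear_scaleR_left])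
       (simp_all add: has_real_derivative_iff_has_vector_derivative)
  have sg: "has_second_deriv g (\<lambda>x. c * g x - \<beta> / (p+1) * \<bar>g x\<bar> powr p * g x - \<alpha>1 / 2 * (f1 x)\<^sup>2 - \<alpha>2 / 2 * (f2 x)\<^sup>2)"
    unfolding has_second_deriv_def using S(3,6) by (auto simp: has_real_derivative_iff_has_vector_derivative[symmetric])
  have o: "odd_pow (n1 + n2) n2 (g x) = \<bar>g x\<bar> powr p * g x" for x
    using nn(3)[of x] by (simp add: odd_pow_p1 powr_add)
  show ?thesis unfolding nls_system_def Let_def p(1)[symmetric]
  proof (intro exI conjI allI)
    show "has_second_deriv (\<lambda>x. f1 x *\<^sub>R e) (\<lambda>x. (\<sigma>1 * f1 x - \<gamma>1 * \<bar>f1 x\<bar> powr q1 * f1 x - \<alpha>1 * f1 x * g x) *\<^sub>R e)" by (rule sd[OF S(1,4)])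
    show "has_second_deriv (\<lambda>x. f2 x *\<^sub>R e) (\<lambda>x. (\<sigma>2 * f2 x - \<gamma>2 * \<bar>f2 x\<bar> powr q2 * f2 x - \<alpha>2 * f2 x * g x) *\<^sub>R e)" by (rule sd[OF S(2,5)])
    show "has_second_deriv g (\<lambda>x. c * g x - \<beta> / (p+1) * \<bar>g x\<bar> powr p * g x - \<alpha>1 / 2 * (f1 x)\<^sup>2 - \<alpha>2 / 2 * (f2 x)\<^sup>2)" by (rule sg)
    fix x
    show "- ((\<sigma>1 * f1 x - \<gamma>1 * \<bar>f1 x\<bar> powr q1 * f1 x - \<alpha>1 * f1 x * g x) *\<^sub>R e) + \<sigma>1 *\<^sub>R f1 x *\<^sub>R e =
        (\<gamma>1 * norm (f1 x *\<^sub>R e) powr q1) *\<^sub>R f1 x *\<^sub>R e + (\<alpha>1 * g x) *\<^sub>R f1 x *\<^sub>R e"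
      using e by (simp add: algebra_simps)
    show "- ((\<sigma>2 * f2 x - \<gamma>2 * \<bar>f2 x\<bar> powr q2 * f2 x - \<alpha>2 * f2 x * g x) *\<^sub>R e) + \<sigma>2 *\<^sub>R f2 x *\<^sub>R e =
        (\<gamma>2 * norm (f2 x *\<^sub>R e) powr q2) *\<^sub>R f2 x *\<^sub>R e + (\<alpha>2 * g x) *\<^sub>R f2 x *\<^sub>R e"
      using e by (simp add: algebra_simps)
    show "- (c * g x - \<beta> / (p+1) * \<bar>g x\<bar> powr p * g x - \<alpha>1 / 2 * (f1 x)\<^sup>2 - \<alpha>2 / 2 * (f2 x)\<^sup>2) + c * g x =
        \<beta> / (p+1) * odd_pow (n1 + n2) n2 (g x) + \<alpha>1 / 2 * (norm (f1 x *\<^sub>R e))\<^sup>2 + \<alpha>2 / 2 * (norm (f2 x *\<^sub>R e))\<^sup>2"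
      using e unfolding o by simp
  qed
qed

lemma positive_minimiser_exists:
  obtains \<sigma>1 \<sigma>2 c f1 f2 g d1 d2 dg where "stationary \<sigma>1 \<sigma>2 c f1 f2 g d1 d2 dg"
    "\<And>x. 0 < f1 x" "\<And>x. 0 < f2 x" "\<And>x. 0 < g x" "0 < \<sigma>1" "0 < \<sigma>2"
    "(LINT x|lborel. (f1 x)\<^sup>2) = r" "(LINT x|lborel. (f2 x)\<^sup>2) = l" "(LINT x|lborel. (g x)\<^sup>2) = m"
    "\<And>h1 h2 k. h1 \<in> H1 \<Longrightarrow> h2 \<in> H1 \<Longrightarrow> k \<in> H1 \<Longrightarrow>
       (LINT x|lborel. (cmod (h1 x))\<^sup>2) \<le> r \<Longrightarrow> (LINT x|lborel. (cmod (h2 x))\<^sup>2) \<le> l \<Longrightarrow> (LINT x|lborel. (k x)\<^sup>2) \<le> m \<Longrightarrow>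
       E (\<lambda>x. f1 x *\<^sub>R 1) (\<lambda>x. f2 x *\<^sub>R 1) g \<le> E h1 h2 k"
proof -
  obtain \<sigma>1 \<sigma>2 c f1 f2 g d1 d2 dg where st: "stationary \<sigma>1 \<sigma>2 c f1 f2 g d1 d2 dg"
    and nn: "\<And>x. 0 \<le> f1 x" "\<And>x. 0 \<le> f2 x" "\<And>x. 0 \<le> g x"
    and mass: "(LINT x|lborel. (f1 x)\<^sup>2) \<le> r" "(LINT x|lborel. (f2 x)\<^sup>2) \<le> l" "(LINT x|lborel. (g x)\<^sup>2) \<le> m"
    and min: "\<And>h1 h2 k. h1 \<in> H1 \<Longrightarrow> h2 \<in> H1 \<Longrightarrow> k \<in> H1 \<Longrightarrow>
       (LINT x|lborel. (cmod (h1 x))\<^sup>2) \<le> r \<Longrightarrow> (LINT x|lborel. (cmod (h2 x))\<^sup>2) \<le> l \<Longrightarrow> (LINT x|lborel. (k x)\<^sup>2) \<le> m \<Longrightarrow>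
       E (\<lambda>x. f1 x *\<^sub>R 1) (\<lambda>x. f2 x *\<^sub>R 1) g \<le> E h1 h2 k" by (rule relaxed_minimiser_exists) (rule that)
  note S = stationaryD[OF st]
  note \<phi>1 = H1_scaleR(1)[OF S(7,10,13), of "1::complex"] and \<phi>2 = H1_scaleR(1)[OF S(8,11,14), of "1::complex"]
  have H: "f1 \<in> H1" "f2 \<in> H1" "g \<in> H1" by (rule H1I(1)[OF S(7,10,13)], rule H1I(1)[OF S(8,11,14)], rule H1I(1)[OF S(9,12,15)])
  have zero_deriv: "d x = 0" if "\<forall>x. f x = 0" "\<And>x. (f has_real_derivative d x) (at x)" for f d :: "real \<Rightarrow> real" and x
  proof -
    have "f = (\<lambda>_. 0)" using that(1) by auto
    then have "(f has_real_derivative 0) (at x)" by simp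
    then show ?thesis using DERIV_unique that(2) by blast
  qed
  have cpl: "0 \<le> (LINT x|lborel. (u x)\<^sup>2 * w x)" if "\<And>x. 0 \<le> w x" for u w :: "real \<Rightarrow> real"
    by (rule Bochner_Integration.integral_nonneg) (use that in simp)
  \<comment> \<open>A vanishing first component contributes nothing, its coupling included. A spread
    profile in its place has negative energy of its own, and its coupling to g \<ge> 0 can only
    lower the total.\<close>
  have n1z: "\<not> (\<forall>x. f1 x = 0)"
  proof
    assume z: "\<forall>x. f1 x = 0"
    obtain h d where h: "h \<in> L2" "d \<in> L2" "is_primitive h d" "\<And>x. 0 \<le> h x" "(LINT x|lborel. (h x)\<^sup>2) \<le> r"
      "(LINT x|lborel. (d x)\<^sup>2) - \<tau>1 * (LINT x|lborel. \<bar>h x\<bar> powr (q1+2)) < 0"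
      using spread_profile_exists[OF q(1,2) \<tau>_pos(1) mass_pos(1)] by blast
    have "E (\<lambda>x. f1 x *\<^sub>R 1) (\<lambda>x. f2 x *\<^sub>R 1) g \<le> E (\<lambda>x. h x *\<^sub>R 1) (\<lambda>x. f2 x *\<^sub>R 1) g"
      by (rule min[OF H1_scaleR(1)[OF h(1,2,3)] \<phi>2 H(3)]) (use h(5) mass in simp_all)
    moreover have "0 \<le> \<alpha>1 * (LINT x|lborel. (h x)\<^sup>2 * g x)" using cpl[OF nn(3)] pos by simp
    ultimately show False using h(6) zero_deriv[OF z S(1)] z
      unfolding energy_scaleR[OF S(7,10,13) S(8,11,14) S(9,12,15)] energy_scaleR[OF h(1-3) S(8,11,14) S(9,12,15)] by simp
  qed
  have n2z: "\<not> (\<forall>x. f2 x = 0)"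
  proof
    assume z: "\<forall>x. f2 x = 0"
    obtain h d where h: "h \<in> L2" "d \<in> L2" "is_primitive h d" "\<And>x. 0 \<le> h x" "(LINT x|lborel. (h x)\<^sup>2) \<le> l"
      "(LINT x|lborel. (d x)\<^sup>2) - \<tau>2 * (LINT x|lborel. \<bar>h x\<bar> powr (q2+2)) < 0"
      using spread_profile_exists[OF q(3,4) \<tau>_pos(2) mass_pos(2)] by blast
    have "E (\<lambda>x. f1 x *\<^sub>R 1) (\<lambda>x. f2 x *\<^sub>R 1) g \<le> E (\<lambda>x. f1 x *\<^sub>R 1) (\<lambda>x. h x *\<^sub>R 1) g"
      by (rule min[OF \<phi>1 H1_scaleR(1)[OF h(1,2,3)] H(3)]) (use h(5) mass in simp_all)
    moreover have "0 \<le> \<alpha>2 * (LINT x|lborel. (h x)\<^sup>2 * g x)" using cpl[OF nn(3)] pos by simp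
    ultimately show False using h(6) zero_deriv[OF z S(2)] z
      unfolding energy_scaleR[OF S(7,10,13) S(8,11,14) S(9,12,15)] energy_scaleR[OF S(7,10,13) h(1-3) S(9,12,15)] by simp
  qed
  \<comment> \<open>With g = 0 both couplings vanish; a nonnegative profile in its place makes them
    nonnegative, which cannot spoil the gain.\<close>
  have ngz: "\<not> (\<forall>x. g x = 0)"
  proof
    assume z: "\<forall>x. g x = 0"
    obtain h d where h: "h \<in> L2" "d \<in> L2" "is_primitive h d" "\<And>x. 0 \<le> h x" "(LINT x|lborel. (h x)\<^sup>2) \<le> m"
      "(LINT x|lborel. (d x)\<^sup>2) - \<tau> * (LINT x|lborel. \<bar>h x\<bar> powr (p+2)) < 0"
      using spread_profile_exists[OF p(3,4) \<tau>_pos(3) mass_pos(3)] by blast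
    have "E (\<lambda>x. f1 x *\<^sub>R 1) (\<lambda>x. f2 x *\<^sub>R 1) g \<le> E (\<lambda>x. f1 x *\<^sub>R 1) (\<lambda>x. f2 x *\<^sub>R 1) h"
      by (rule min[OF \<phi>1 \<phi>2 H1I(1)[OF h(1,2,3)]]) (use h(5) mass in simp_all)
    moreover have "0 \<le> \<alpha>1 * (LINT x|lborel. (f1 x)\<^sup>2 * h x)" "0 \<le> \<alpha>2 * (LINT x|lborel. (f2 x)\<^sup>2 * h x)" using cpl[OF h(4)] pos by simp_all
    moreover have "(\<lambda>x. odd_pow (n1 + 2*n2) n2 (h x)) = (\<lambda>x. \<bar>h x\<bar> powr (p+2))" using h(4) by (simp add: odd_pow_p2)
    moreover have "odd_pow (n1 + 2*n2) n2 0 = 0" by (simp add: odd_pow_p2)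
    ultimately show False using h(6) zero_deriv[OF z S(3)] z
      unfolding energy_scaleR[OF S(7,10,13) S(8,11,14) S(9,12,15)] energy_scaleR[OF S(7,10,13) S(8,11,14) h(1-3)] by simp
  qed
  \<comment> \<open>Dropping the nonnegative nonlinear terms leaves f'' \<le> \<sigma> f. This
    serves twice: for the dichotomy, and as concavity in case \<sigma> \<le> 0.\<close>
  have b1: "\<sigma>1 * f1 x - \<gamma>1 * \<bar>f1 x\<bar> powr q1 * f1 x - \<alpha>1 * f1 x * g x \<le> \<sigma>1 * f1 x" for x
  proof -
    have "0 \<le> \<gamma>1 * \<bar>f1 x\<bar> powr q1 * f1 x" "0 \<le> \<alpha>1 * f1 x * g x" using pos nn[of x] by (auto intro!: mult_nonneg_nonneg)
    then show ?thesis by linarith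
  qed
  have b2: "\<sigma>2 * f2 x - \<gamma>2 * \<bar>f2 x\<bar> powr q2 * f2 x - \<alpha>2 * f2 x * g x \<le> \<sigma>2 * f2 x" for x
  proof -
    have "0 \<le> \<gamma>2 * \<bar>f2 x\<bar> powr q2 * f2 x" "0 \<le> \<alpha>2 * f2 x * g x" using pos nn[of x] by (auto intro!: mult_nonneg_nonneg)
    then show ?thesis by linarith
  qed
  have bg: "c * g x - \<beta> / (p+1) * \<bar>g x\<bar> powr p * g x - \<alpha>1 / 2 * (f1 x)\<^sup>2 - \<alpha>2 / 2 * (f2 x)\<^sup>2 \<le> c * g x" for x
  proof -
    have "0 \<le> \<beta> / (p+1) * \<bar>g x\<bar> powr p * g x" "0 \<le> \<alpha>1 / 2 * (f1 x)\<^sup>2" "0 \<le> \<alpha>2 / 2 * (f2 x)\<^sup>2"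
      using pos nn[of x] p(3) by (auto intro!: mult_nonneg_nonneg)
    then show ?thesis by linarith
  qed
  have pf: "\<And>x. 0 < f1 x" "\<And>x. 0 < f2 x" "\<And>x. 0 < g x"
    using nonneg_dichotomy[OF S(1,4) nn(1) b1] n1z nonneg_dichotomy[OF S(2,5) nn(2) b2] n2z
      nonneg_dichotomy[OF S(3,6) nn(3) bg] ngz by blast+
  have \<sigma>1: "\<sigma>1 > 0"
  proof (rule ccontr)
    assume "\<not> \<sigma>1 > 0"
    then have "\<sigma>1 * f1 x \<le> 0" for x using nn(1)[of x] by (simp add: mult_nonpos_nonneg)
    then have "f1 0 = 0" by (rule concave_vanishing[OF S(1,4) nn(1) order_trans[OF b1] H1_vanishes[OF H(1)]])
    then show False using pf(1)[of 0] by simp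
  qed
  have \<sigma>2: "\<sigma>2 > 0"
  proof (rule ccontr)
    assume "\<not> \<sigma>2 > 0"
    then have "\<sigma>2 * f2 x \<le> 0" for x using nn(2)[of x] by (simp add: mult_nonpos_nonneg)
    then have "f2 0 = 0" by (rule concave_vanishing[OF S(2,5) nn(2) order_trans[OF b2] H1_vanishes[OF H(2)]])
    then show False using pf(2)[of 0] by simp
  qed
  \<comment> \<open>The sign of the third multiplier is what later forces the mass of g up to
    m.\<close>
  have c: "c > 0"
  proof (rule ccontr)
    assume "\<not> c > 0"
    then have "c * g x \<le> 0" for x using nn(3)[of x] by (simp add: mult_nonpos_nonneg)
    then have "g 0 = 0" by (rule concave_vanishing[OF S(3,6) nn(3) order_trans[OF bg] H1_vanishes[OF H(3)]])
    then show False using pf(3)[of 0] by simp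
  qed
  note fv = first_variation[OF st pf]
  have sq: "0 < (LINT x|lborel. (f1 x)\<^sup>2)" "0 < (LINT x|lborel. (f2 x)\<^sup>2)" "0 < (LINT x|lborel. (g x)\<^sup>2)"
    by (rule integral_square_pos[OF S(7) pf(1)], rule integral_square_pos[OF S(8) pf(2)], rule integral_square_pos[OF S(9) pf(3)])
  \<comment> \<open>In the direction of f1 itself the energy has slope -2 \<sigma>1 times the mass
    of f1, so with mass to spare a slightly enlarged f1 would beat the minimiser. The other two
    masses are treated in the same way.\<close>
  have m1: "(LINT x|lborel. (f1 x)\<^sup>2) = r"
  proof (rule ccontr)
    assume "(LINT x|lborel. (f1 x)\<^sup>2) \<noteq> r"
    then have less: "(LINT x|lborel. (f1 x)\<^sup>2) < r" using mass by simp
    have "((\<lambda>t. E (\<lambda>x. f1 x *\<^sub>R 1 + t *\<^sub>R (f1 x *\<^sub>R 1)) (\<lambda>x. f2 x *\<^sub>R 1 + t *\<^sub>R 0) (\<lambda>x. g x + t * 0)) has_real_derivative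
       - 2 * \<sigma>1 * (LINT x|lborel. (f1 x)\<^sup>2)) (at 0)"
      using fv[OF \<phi>1 zero_H1 zero_H1] by (simp add: power2_eq_square)
    then obtain t where t: "t > 0" "E (\<lambda>x. f1 x *\<^sub>R 1 + t *\<^sub>R (f1 x *\<^sub>R 1)) (\<lambda>x. f2 x *\<^sub>R 1 + t *\<^sub>R 0) (\<lambda>x. g x + t * 0)
        < E (\<lambda>x. f1 x *\<^sub>R 1 + 0 *\<^sub>R (f1 x *\<^sub>R 1)) (\<lambda>x. f2 x *\<^sub>R 1 + 0 *\<^sub>R 0) (\<lambda>x. g x + 0 * 0)" "(1 + t)\<^sup>2 * (LINT x|lborel. (f1 x)\<^sup>2) \<le> r"
      by (rule negative_slope_step[OF _ _ less]) (use \<sigma>1 sq in auto)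
    have eq: "(\<lambda>x. f1 x *\<^sub>R (1::complex) + t *\<^sub>R (f1 x *\<^sub>R 1)) = (\<lambda>x. ((1 + t) * f1 x) *\<^sub>R 1)" by (simp add: fun_eq_iff algebra_simps)
    have "E (\<lambda>x. f1 x *\<^sub>R 1) (\<lambda>x. f2 x *\<^sub>R 1) g \<le> E (\<lambda>x. ((1 + t) * f1 x) *\<^sub>R 1) (\<lambda>x. f2 x *\<^sub>R 1) g"
    proof (rule min[OF _ \<phi>2 H(3)])
      show "(\<lambda>x. ((1 + t) * f1 x) *\<^sub>R (1::complex)) \<in> H1" using H1_add_scaleR(1)[OF \<phi>1 \<phi>1, of t] unfolding eq .
      show "(LINT x|lborel. (cmod (((1 + t) * f1 x) *\<^sub>R 1))\<^sup>2) \<le> r" using t(3) by (simp add: power_mult_distrib)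
    qed (use mass in simp_all)
    then show False using t(2) unfolding eq by simp
  qed
  have m2: "(LINT x|lborel. (f2 x)\<^sup>2) = l"
  proof (rule ccontr)
    assume "(LINT x|lborel. (f2 x)\<^sup>2) \<noteq> l"
    then have less: "(LINT x|lborel. (f2 x)\<^sup>2) < l" using mass by simp
    have "((\<lambda>t. E (\<lambda>x. f1 x *\<^sub>R 1 + t *\<^sub>R 0) (\<lambda>x. f2 x *\<^sub>R 1 + t *\<^sub>R (f2 x *\<^sub>R 1)) (\<lambda>x. g x + t * 0)) has_real_derivative
       - 2 * \<sigma>2 * (LINT x|lborel. (f2 x)\<^sup>2)) (at 0)"
      using fv[OF zero_H1 \<phi>2 zero_H1] by (simp add: power2_eq_square)
    then obtain t where t: "t > 0" "E (\<lambda>x. f1 x *\<^sub>R 1 + t *\<^sub>R 0) (\<lambda>x. f2 x *\<^sub>R 1 + t *\<^sub>R (f2 x *\<^sub>R 1)) (\<lambda>x. g x + t * 0)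
        < E (\<lambda>x. f1 x *\<^sub>R 1 + 0 *\<^sub>R 0) (\<lambda>x. f2 x *\<^sub>R 1 + 0 *\<^sub>R (f2 x *\<^sub>R 1)) (\<lambda>x. g x + 0 * 0)" "(1 + t)\<^sup>2 * (LINT x|lborel. (f2 x)\<^sup>2) \<le> l"
      by (rule negative_slope_step[OF _ _ less]) (use \<sigma>2 sq in auto)
    have eq: "(\<lambda>x. f2 x *\<^sub>R (1::complex) + t *\<^sub>R (f2 x *\<^sub>R 1)) = (\<lambda>x. ((1 + t) * f2 x) *\<^sub>R 1)" by (simp add: fun_eq_iff algebra_simps)
    have "E (\<lambda>x. f1 x *\<^sub>R 1) (\<lambda>x. f2 x *\<^sub>R 1) g \<le> E (\<lambda>x. f1 x *\<^sub>R 1) (\<lambda>x. ((1 + t) * f2 x) *\<^sub>R 1) g"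
    proof (rule min[OF \<phi>1 _ H(3)])
      show "(\<lambda>x. ((1 + t) * f2 x) *\<^sub>R (1::complex)) \<in> H1" using H1_add_scaleR(1)[OF \<phi>2 \<phi>2, of t] unfolding eq .
      show "(LINT x|lborel. (cmod (((1 + t) * f2 x) *\<^sub>R 1))\<^sup>2) \<le> l" using t(3) by (simp add: power_mult_distrib)
    qed (use mass in simp_all)
    then show False using t(2) unfolding eq by simp
  qed
  have mg: "(LINT x|lborel. (g x)\<^sup>2) = m"
  proof (rule ccontr)
    assume "(LINT x|lborel. (g x)\<^sup>2) \<noteq> m"
    then have less: "(LINT x|lborel. (g x)\<^sup>2) < m" using mass by simp
    have "((\<lambda>t. E (\<lambda>x. f1 x *\<^sub>R 1 + t *\<^sub>R 0) (\<lambda>x. f2 x *\<^sub>R 1 + t *\<^sub>R 0) (\<lambda>x. g x + t * g x)) has_real_derivative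
       - 2 * c * (LINT x|lborel. (g x)\<^sup>2)) (at 0)"
      using fv[OF zero_H1 zero_H1 H(3)] by (simp add: power2_eq_square)
    then obtain t where t: "t > 0" "E (\<lambda>x. f1 x *\<^sub>R 1 + t *\<^sub>R 0) (\<lambda>x. f2 x *\<^sub>R 1 + t *\<^sub>R 0) (\<lambda>x. g x + t * g x)
        < E (\<lambda>x. f1 x *\<^sub>R 1 + 0 *\<^sub>R 0) (\<lambda>x. f2 x *\<^sub>R 1 + 0 *\<^sub>R 0) (\<lambda>x. g x + 0 * g x)" "(1 + t)\<^sup>2 * (LINT x|lborel. (g x)\<^sup>2) \<le> m"
      by (rule negative_slope_step[OF _ _ less]) (use c sq in auto)
    have eq: "(\<lambda>x. g x + t * g x) = (\<lambda>x. (1 + t) * g x)" by (simp add: fun_eq_iff algebra_simps)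
    have "E (\<lambda>x. f1 x *\<^sub>R 1) (\<lambda>x. f2 x *\<^sub>R 1) g \<le> E (\<lambda>x. f1 x *\<^sub>R 1) (\<lambda>x. f2 x *\<^sub>R 1) (\<lambda>x. (1 + t) * g x)"
    proof (rule min[OF \<phi>1 \<phi>2])
      show "(\<lambda>x. (1 + t) * g x) \<in> H1" using H1_add_scaleR(1)[OF H(3) H(3), of t] unfolding real_scaleR_def eq .
      show "(LINT x|lborel. ((1 + t) * g x)\<^sup>2) \<le> m" using t(3) by (simp add: power_mult_distrib)
    qed (use mass in simp_all)
    then show False using t(2) unfolding eq by simp
  qed
  show thesis by (rule that[OF st pf \<sigma>1 \<sigma>2 m1 m2 mg min])
qed

text \<open>The derivative of the constraint terms is the negative of the derivative found in
  \<open>first_variation\<close>.\<close>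

lemma first_variation_lagrange:
  assumes st: "stationary \<sigma>1 \<sigma>2 c f1 f2 g d1 d2 dg" and pf: "\<And>x. 0 < f1 x" "\<And>x. 0 < f2 x" "\<And>x. 0 < g x"
  shows "lagrange_multipliers E (\<lambda>x. f1 x *\<^sub>R 1) (\<lambda>x. f2 x *\<^sub>R 1) g \<sigma>1 \<sigma>2 c"
  unfolding lagrange_multipliers_def Let_def L2_norm_square
proof (intro ballI)
  fix h1 h2 :: "real \<Rightarrow> complex" and k :: "real \<Rightarrow> real" assume H: "h1 \<in> H1" "h2 \<in> H1" "k \<in> H1"
  note S = stationaryD[OF st]
  note \<phi>1 = H1_scaleR(1)[OF S(7,10,13), of "1::complex"] and \<phi>2 = H1_scaleR(1)[OF S(8,11,14), of "1::complex"]
  have gH: "g \<in> H1" by (rule H1I(1)[OF S(9,12,15)])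
  have c1: "((\<lambda>t. LINT x|lborel. (cmod (f1 x *\<^sub>R 1 + t *\<^sub>R h1 x))\<^sup>2) has_real_derivative 2 * (LINT x|lborel. f1 x * (h1 x \<bullet> 1))) (at 0)"
    using dirichlet_derivative(2)[OF \<phi>1 H(1)] by (simp add: inner_commute)
  have c2: "((\<lambda>t. LINT x|lborel. (cmod (f2 x *\<^sub>R 1 + t *\<^sub>R h2 x))\<^sup>2) has_real_derivative 2 * (LINT x|lborel. f2 x * (h2 x \<bullet> 1))) (at 0)"
    using dirichlet_derivative(2)[OF \<phi>2 H(2)] by (simp add: inner_commute)
  have c3: "((\<lambda>t. LINT x|lborel. (norm (g x + t * k x))\<^sup>2) has_real_derivative 2 * (LINT x|lborel. g x * k x)) (at 0)"
    using dirichlet_derivative(2)[OF gH H(3)] by simp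
  have "((\<lambda>t. E (\<lambda>x. f1 x *\<^sub>R 1 + t *\<^sub>R h1 x) (\<lambda>x. f2 x *\<^sub>R 1 + t *\<^sub>R h2 x) (\<lambda>x. g x + t * k x)
      + \<sigma>1 * (LINT x|lborel. (cmod (f1 x *\<^sub>R 1 + t *\<^sub>R h1 x))\<^sup>2) + \<sigma>2 * (LINT x|lborel. (cmod (f2 x *\<^sub>R 1 + t *\<^sub>R h2 x))\<^sup>2)
      + c * (LINT x|lborel. (norm (g x + t * k x))\<^sup>2)) has_real_derivative
     (- 2 * \<sigma>1 * (LINT x|lborel. f1 x * (h1 x \<bullet> 1)) - 2 * \<sigma>2 * (LINT x|lborel. f2 x * (h2 x \<bullet> 1)) - 2 * c * (LINT x|lborel. g x * k x))
      + \<sigma>1 * (2 * (LINT x|lborel. f1 x * (h1 x \<bullet> 1))) + \<sigma>2 * (2 * (LINT x|lborel. f2 x * (h2 x \<bullet> 1))) + c * (2 * (LINT x|lborel. g x * k x))) (at 0)"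
    by (intro DERIV_add DERIV_cmult first_variation[OF st pf H] c1 c2 c3)
  then show "((\<lambda>t. E (\<lambda>x. f1 x *\<^sub>R 1 + t *\<^sub>R h1 x) (\<lambda>x. f2 x *\<^sub>R 1 + t *\<^sub>R h2 x) (\<lambda>x. g x + t * k x)
      + \<sigma>1 * (LINT x|lborel. (cmod (f1 x *\<^sub>R 1 + t *\<^sub>R h1 x))\<^sup>2) + \<sigma>2 * (LINT x|lborel. (cmod (f2 x *\<^sub>R 1 + t *\<^sub>R h2 x))\<^sup>2)
      + c * (LINT x|lborel. (norm (g x + t * k x))\<^sup>2)) has_real_derivative 0) (at 0)"
    by (rule DERIV_cong) simp
qed

end

theorem theorem2p5:
  fixes \<gamma>1 \<gamma>2 \<beta> \<alpha>1 \<alpha>2 q1 q2 p r l m :: real and n1 n2 :: nat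
  assumes "\<gamma>1 > 0" "\<gamma>2 > 0" "\<beta> > 0" "\<alpha>1 > 0" "\<alpha>2 > 0"
    and "0 < q1" "q1 < 4" "0 < q2" "q2 < 4"
    and "p = real n1 / real n2" "odd n2" "0 < p" "p < 4"
    and "r > 0" "l > 0" "m > 0"
  shows "\<exists>(\<sigma>1::real) (\<sigma>2::real) (c::real)
      (\<phi>1 :: real \<Rightarrow> complex) (\<phi>2 :: real \<Rightarrow> complex) (w :: real \<Rightarrow> real).
    \<sigma>1 > 0 \<and> \<sigma>2 > 0 \<and> \<phi>1 \<in> H1 \<and> \<phi>2 \<in> H1 \<and> w \<in> H1 \<and>
    nls_system \<gamma>1 \<gamma>2 \<beta> \<alpha>1 \<alpha>2 q1 q2 n1 n2 \<sigma>1 \<sigma>2 c \<phi>1 \<phi>2 w \<and>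
    (L2_norm \<phi>1)\<^sup>2 = r \<and> (L2_norm \<phi>2)\<^sup>2 = l \<and> (L2_norm w)\<^sup>2 = m \<and>
    is_constrained_minimizer (energy \<gamma>1 \<gamma>2 \<beta> \<alpha>1 \<alpha>2 q1 q2 n1 n2) r l m \<phi>1 \<phi>2 w \<and>
    lagrange_multipliers (energy \<gamma>1 \<gamma>2 \<beta> \<alpha>1 \<alpha>2 q1 q2 n1 n2) \<phi>1 \<phi>2 w \<sigma>1 \<sigma>2 c \<and>
    (\<forall>x. w x > 0) \<and>
    (\<exists>\<zeta>1 \<in> sphere 0 1. \<exists>\<zeta>2 \<in> sphere 0 1. \<exists>R1 \<in> H1_pos. \<exists>R2 \<in> H1_pos.
      (\<forall>x. \<phi>1 x = \<zeta>1 * complex_of_real (R1 x)) \<and>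
      (\<forall>x. \<phi>2 x = \<zeta>2 * complex_of_real (R2 x)) \<and>
      nls_system \<gamma>1 \<gamma>2 \<beta> \<alpha>1 \<alpha>2 q1 q2 n1 n2 \<sigma>1 \<sigma>2 c R1 R2 w)"
proof -
  interpret nls_parameters \<gamma>1 \<gamma>2 \<beta> \<alpha>1 \<alpha>2 q1 q2 p r l m n1 n2
    by (rule nls_parameters.intro) (rule assms)+
  obtain \<sigma>1 \<sigma>2 c f1 f2 g d1 d2 dg where st: "stationary \<sigma>1 \<sigma>2 c f1 f2 g d1 d2 dg"
    and pf: "\<And>x. 0 < f1 x" "\<And>x. 0 < f2 x" "\<And>x. 0 < g x" and \<sigma>: "0 < \<sigma>1" "0 < \<sigma>2"
    and mass: "(LINT x|lborel. (f1 x)\<^sup>2) = r" "(LINT x|lborel. (f2 x)\<^sup>2) = l" "(LINT x|lborel. (g x)\<^sup>2) = m"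
    and min: "\<And>h1 h2 k. h1 \<in> H1 \<Longrightarrow> h2 \<in> H1 \<Longrightarrow> k \<in> H1 \<Longrightarrow>
       (LINT x|lborel. (cmod (h1 x))\<^sup>2) \<le> r \<Longrightarrow> (LINT x|lborel. (cmod (h2 x))\<^sup>2) \<le> l \<Longrightarrow> (LINT x|lborel. (k x)\<^sup>2) \<le> m \<Longrightarrow>
       E (\<lambda>x. f1 x *\<^sub>R 1) (\<lambda>x. f2 x *\<^sub>R 1) g \<le> E h1 h2 k" by (rule positive_minimiser_exists) (rule that)
  note S = stationaryD[OF st]
  note \<phi>1 = H1_scaleR(1)[OF S(7,10,13), of "1::complex"] and \<phi>2 = H1_scaleR(1)[OF S(8,11,14), of "1::complex"]
  have nn: "0 \<le> f1 x" "0 \<le> f2 x" "0 \<le> g x" for x using pf[of x] by (simp_all add: less_imp_le)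
  have H: "f1 \<in> H1" "f2 \<in> H1" "g \<in> H1" by (rule H1I(1)[OF S(7,10,13)], rule H1I(1)[OF S(8,11,14)], rule H1I(1)[OF S(9,12,15)])
  have N: "(L2_norm (\<lambda>x. f1 x *\<^sub>R (1::complex)))\<^sup>2 = r" "(L2_norm (\<lambda>x. f2 x *\<^sub>R (1::complex)))\<^sup>2 = l" "(L2_norm g)\<^sup>2 = m"
    using mass by (simp_all add: L2_norm_square)
  \<comment> \<open>The relaxed minimum is attained at a point with exact masses, so it is also the
    minimum among triples with exact masses.\<close>
  have minimiser: "is_constrained_minimizer E r l m (\<lambda>x. f1 x *\<^sub>R 1) (\<lambda>x. f2 x *\<^sub>R 1) g"
    unfolding is_constrained_minimizer_def admissible_def using \<phi>1 \<phi>2 H(3) N min by (auto simp: L2_norm_square)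
  have sys: "nls_system \<gamma>1 \<gamma>2 \<beta> \<alpha>1 \<alpha>2 q1 q2 n1 n2 \<sigma>1 \<sigma>2 c (\<lambda>x. f1 x *\<^sub>R (1::complex)) (\<lambda>x. f2 x *\<^sub>R 1) g"
    by (rule nls_system_scaleR[OF st _ nn]) simp
  have sysR: "nls_system \<gamma>1 \<gamma>2 \<beta> \<alpha>1 \<alpha>2 q1 q2 n1 n2 \<sigma>1 \<sigma>2 c f1 f2 g"
    using nls_system_scaleR[OF st _ nn, of "1::real"] by simp
  \<comment> \<open>The minimiser is real and positive already, so both phases are 1.\<close>
  have polar: "\<exists>\<zeta>1 \<in> sphere 0 1. \<exists>\<zeta>2 \<in> sphere 0 1. \<exists>R1 \<in> H1_pos. \<exists>R2 \<in> H1_pos.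
      (\<forall>x. f1 x *\<^sub>R 1 = \<zeta>1 * complex_of_real (R1 x)) \<and> (\<forall>x. f2 x *\<^sub>R 1 = \<zeta>2 * complex_of_real (R2 x)) \<and>
      nls_system \<gamma>1 \<gamma>2 \<beta> \<alpha>1 \<alpha>2 q1 q2 n1 n2 \<sigma>1 \<sigma>2 c R1 R2 g"
    using sysR H pf
    by (intro bexI[of _ "1::complex"] bexI[of _ f1] bexI[of _ f2] conjI) (auto simp: H1_pos_def scaleR_conv_of_real)
  show ?thesis
    by (rule exI[of _ \<sigma>1], rule exI[of _ \<sigma>2], rule exI[of _ c], rule exI[of _ "\<lambda>x. f1 x *\<^sub>R 1"],
        rule exI[of _ "\<lambda>x. f2 x *\<^sub>R 1"], rule exI[of _ g])
       (intro conjI \<sigma> \<phi>1 \<phi>2 H(3) sys N minimiser first_variation_lagrange[OF st pf] allI pf(3) polar)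
qed

end
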